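(* Let $G$ be a finite group and $R$ a commutative ring with unit. Then the Mackey algebra $\mu_R(G)$ is a symmetric $R$-algebra if and only if $\big(RB(H)\big)_{H\leqslant G}$ is a stable by induction family of symmetric algebras.
   Context: Conventions: for $g\in G$ and $H\leqslant G$, ${}^gH=gHg^{-1}$ and $H^g=g^{-1}Hg$. Symmetric algebra: an $R$-algebra $A$ is symmetric if it is a finitely generated projective $R$-module and there is an $R$-bilinear form $b$ on $A$ with $b(xy,z)=b(x,yz)$ and $b(x,y)=b(y,x)$ for all $x,y,z\in A$, which is non-degenerate, i.e. $x\mapsto b(x,-)$ is an isomorphism of $R$-modules $A\to \mathrm{Hom}_R(A,R)$. Burnside algebra: $B(H)$ is the Grothendieck ring of finite $H$-sets (sum = disjoint union, product = cartesian product) and $RB(H)=R\otimes_{\mathbb Z}B(H)$. $\mathrm{Ind}_H^G$ denotes induction of $H$-sets to $G$-sets, $X\mapsto G\times_H X$, extended linearly. Mackey algebra: $\mu_R(G)$ is the unital associative $R$-algebra with generators $t^K_H$, $r^K_H$, $c_{g,H}$ for $H\leqslant K\leqslant G$, $g\in G$, and relations: $\sum_{H\leqslant G}t^H_H=1$; $t^H_H=r^H_H=c_{h,H}$ for $h\in H$; $t^L_Kt^K_H=t^L_H$ and $r^K_Hr^L_K=r^L_H$ for $H\leqslant K\leqslant L$; $c_{g',{}^gH}c_{g,H}=c_{g'g,H}$; $t^{{}^gK}_{{}^gH}c_{g,H}=c_{g,K}t^K_H$ and $r^{{}^gK}_{{}^gH}c_{g,K}=c_{g,H}r^K_H$ for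 $H\leqslant K$; $r^H_Lt^H_K=\sum_{h\in[L\backslash H/K]}t^L_{L\cap{}^hK}\,c_{h,L^h\cap K}\,r^K_{L^h\cap K}$ for $L,K\leqslant H$; all other products of generators are zero. Stable by induction: a family $\phi=(\phi_H)_{H\leqslant G}$ of $R$-linear forms $\phi_H:RB(H)\to R$ is stable by (under) induction if $\phi_G(\mathrm{Ind}_H^G(X))=\phi_H(X)$ for every $H\leqslant G$ and every finite $H$-set $X$. The family $\big(RB(H)\big)_{H\leqslant G}$ is a stable by induction family of symmetric algebras if there is a stable by induction family $\phi=(\phi_H)_{H\leqslant G}$ of linear forms such that for every $H\leqslant G$ the bilinear form $b_{\phi_H}(X,Y):=\phi_H(XY)$ on $RB(H)$ is non-degenerate. *)

theory Defs
  imports "HOL-Algebra.Group_Action" "HOL-Algebra.IntRing" "HOL-Algebra.QuotRing"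
    "HOL-Algebra.Module"
begin

section \<open>Modules and symmetric algebras\<close>

text \<open>
  The library locale \<^locale>\<open>algebra\<close> only covers commutative algebras.  Here a possibly
  noncommutative algebra over \<open>R\<close> is given by a \<open>module\<close> record, whose \<open>mult\<close> and \<open>one\<close> fields
  are its ring structure.  When a record is only meant as a module these two fields are
  \<open>undefined\<close>.
\<close>

definition linear_maps ::
  "('r, 'k) ring_scheme \<Rightarrow> ('r, 'm, 'x) module_scheme \<Rightarrow> ('r, 'n, 'y) module_scheme \<Rightarrow> ('m \<Rightarrow> 'n) set"
  where "linear_maps R M N =
    {f \<in> carrier M \<rightarrow>\<^sub>E carrier N.
      (\<forall>x\<in>carrier M. \<forall>y\<in>carrier M. f (x \<oplus>\<^bsub>M\<^esub> y) = f x \<oplus>\<^bsub>N\<^esub> f y) \<and>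
      (\<forall>a\<in>carrier R. \<forall>x\<in>carrier M. f (a \<odot>\<^bsub>M\<^esub> x) = a \<odot>\<^bsub>N\<^esub> f x)}"

definition regular_module :: "('r, 'k) ring_scheme \<Rightarrow> ('r, 'r) module"
  where "regular_module R =
    \<lparr>carrier = carrier R, monoid.mult = monoid.mult R, one = one R, zero = zero R, add = add R,
     smult = monoid.mult R\<rparr>"

definition dual_module ::
  "('r, 'k) ring_scheme \<Rightarrow> ('r, 'm, 'x) module_scheme \<Rightarrow> ('r, 'm \<Rightarrow> 'r) module"
  where "dual_module R M =
    \<lparr>carrier = linear_maps R M (regular_module R), monoid.mult = undefined, one = undefined,
     zero = (\<lambda>x\<in>carrier M. \<zero>\<^bsub>R\<^esub>),
     add = (\<lambda>f g. \<lambda>x\<in>carrier M. f x \<oplus>\<^bsub>R\<^esub> g x),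
     smult = (\<lambda>a f. \<lambda>x\<in>carrier M. a \<otimes>\<^bsub>R\<^esub> f x)\<rparr>"

text \<open>The free module on \<open>I\<close>: functions of finite support, extended by zero outside \<open>I\<close>.\<close>

definition free_module :: "('r, 'k) ring_scheme \<Rightarrow> 'i set \<Rightarrow> ('r, 'i \<Rightarrow> 'r) module"
  where "free_module R I =
    \<lparr>carrier = {f. (\<forall>i\<in>I. f i \<in> carrier R) \<and> (\<forall>i. i \<notin> I \<longrightarrow> f i = \<zero>\<^bsub>R\<^esub>) \<and>
                   finite {i. f i \<noteq> \<zero>\<^bsub>R\<^esub>}},
     monoid.mult = undefined, one = undefined,
     zero = (\<lambda>i. \<zero>\<^bsub>R\<^esub>),
     add = (\<lambda>f g i. f i \<oplus>\<^bsub>R\<^esub> g i),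
     smult = (\<lambda>a f i. a \<otimes>\<^bsub>R\<^esub> f i)\<rparr>"

definition finitely_generated_module ::
  "('r, 'k) ring_scheme \<Rightarrow> ('r, 'm, 'x) module_scheme \<Rightarrow> bool"
  where "finitely_generated_module R M \<longleftrightarrow>
    (\<exists>S. finite S \<and> S \<subseteq> carrier M \<and> (\<forall>N. submodule N R M \<and> S \<subseteq> N \<longrightarrow> N = carrier M))"

text \<open>
  Projective means isomorphic to a direct summand of a free module.  Taking the index set in the
  element type of \<open>M\<close> loses nothing: \<open>M\<close> is a quotient of the free module on \<open>carrier M\<close>, and
  hence a direct summand of it if \<open>M\<close> is projective.
\<close>

definition projective_module ::
  "('r, 'k) ring_scheme \<Rightarrow> ('r, 'm, 'x) module_scheme \<Rightarrow> bool"
  where "projective_module R M \<longleftrightarrow>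
    (\<exists>(I :: 'm set) s p. s \<in> linear_maps R M (free_module R I) \<and>
       p \<in> linear_maps R (free_module R I) M \<and> (\<forall>x\<in>carrier M. p (s x) = x))"

definition bilinear_form ::
  "('r, 'k) ring_scheme \<Rightarrow> ('r, 'm, 'x) module_scheme \<Rightarrow> ('m \<Rightarrow> 'm \<Rightarrow> 'r) \<Rightarrow> bool"
  where "bilinear_form R A b \<longleftrightarrow>
    (\<forall>x\<in>carrier A. (\<lambda>y\<in>carrier A. b x y) \<in> linear_maps R A (regular_module R)) \<and>
    (\<forall>y\<in>carrier A. (\<lambda>x\<in>carrier A. b x y) \<in> linear_maps R A (regular_module R))"

definition nondegenerate ::
  "('r, 'k) ring_scheme \<Rightarrow> ('r, 'm, 'x) module_scheme \<Rightarrow> ('m \<Rightarrow> 'm \<Rightarrow> 'r) \<Rightarrow> bool"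
  where "nondegenerate R A b \<longleftrightarrow>
    (let \<beta> = (\<lambda>x\<in>carrier A. \<lambda>y\<in>carrier A. b x y)
     in \<beta> \<in> linear_maps R A (dual_module R A) \<and>
        bij_betw \<beta> (carrier A) (carrier (dual_module R A)))"

definition symmetric_algebra ::
  "('r, 'k) ring_scheme \<Rightarrow> ('r, 'm, 'x) module_scheme \<Rightarrow> bool"
  where "symmetric_algebra R A \<longleftrightarrow>
    finitely_generated_module R A \<and> projective_module R A \<and>
    (\<exists>b. bilinear_form R A b \<and>
       (\<forall>x\<in>carrier A. \<forall>y\<in>carrier A. \<forall>z\<in>carrier A. b (x \<otimes>\<^bsub>A\<^esub> y) z = b x (y \<otimes>\<^bsub>A\<^esub> z)) \<and>
       (\<forall>x\<in>carrier A. \<forall>y\<in>carrier A. b x y = b y x) \<and>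
       nondegenerate R A b)"

section \<open>Algebras by generators and relations\<close>

definition basis_vec :: "('r, 'k) ring_scheme \<Rightarrow> 'i \<Rightarrow> 'i \<Rightarrow> 'r"
  where "basis_vec R i = (\<lambda>j. if j = i then \<one>\<^bsub>R\<^esub> else \<zero>\<^bsub>R\<^esub>)"

definition monoid_algebra ::
  "('r, 'k) ring_scheme \<Rightarrow> ('i, 'l) monoid_scheme \<Rightarrow> ('r, 'i \<Rightarrow> 'r) module"
  where "monoid_algebra R M = (free_module R (carrier M))
    \<lparr>monoid.mult := (\<lambda>f g x. \<Oplus>\<^bsub>R\<^esub>p\<in>{(y, z). y \<in> carrier M \<and> z \<in> carrier M \<and>
                 f y \<noteq> \<zero>\<^bsub>R\<^esub> \<and> g z \<noteq> \<zero>\<^bsub>R\<^esub> \<and> y \<otimes>\<^bsub>M\<^esub> z = x}. f (fst p) \<otimes>\<^bsub>R\<^esub> g (snd p)),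
     one := basis_vec R \<one>\<^bsub>M\<^esub>\<rparr>"

definition free_monoid :: "'i set \<Rightarrow> 'i list monoid"
  where "free_monoid S = \<lparr>carrier = lists S, monoid.mult = (@), one = []\<rparr>"

definition free_algebra :: "('r, 'k) ring_scheme \<Rightarrow> 'i set \<Rightarrow> ('r, 'i list \<Rightarrow> 'r) module"
  where "free_algebra R S = monoid_algebra R (free_monoid S)"

definition quotient_algebra ::
  "('r, 'm, 'x) module_scheme \<Rightarrow> 'm set \<Rightarrow> ('r, 'm set) module"
  where "quotient_algebra A I = ring.extend (A Quot I)
    (module.fields (\<lambda>a X. \<Union>x\<in>X. I +>\<^bsub>A\<^esub> (a \<odot>\<^bsub>A\<^esub> x)))"

section \<open>The Mackey algebra\<close>

definition conj_subgroup :: "('g, 'k) monoid_scheme \<Rightarrow> 'g \<Rightarrow> 'g set \<Rightarrow> 'g set"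
  where "conj_subgroup G g H = (g <#\<^bsub>G\<^esub> H) #>\<^bsub>G\<^esub> inv\<^bsub>G\<^esub> g"

definition double_coset_reps ::
  "('g, 'k) monoid_scheme \<Rightarrow> 'g set \<Rightarrow> 'g set \<Rightarrow> 'g set \<Rightarrow> 'g set \<Rightarrow> bool"
  where "double_coset_reps G L H K D \<longleftrightarrow>
    D \<subseteq> H \<and> (\<forall>x\<in>H. \<exists>!h. h \<in> D \<and> h \<in> (L #>\<^bsub>G\<^esub> x) <#>\<^bsub>G\<^esub> K)"

text \<open>
  \<open>Tr K H\<close>, \<open>Rs K H\<close> and \<open>Cj g H\<close> stand for the generators \<open>t\<^sup>K\<^sub>H\<close>, \<open>r\<^sup>K\<^sub>H\<close> and \<open>c\<^sub>g\<^sub>,\<^sub>H\<close>: in each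
  of the first two the larger subgroup comes first.  Products are written like compositions of
  maps, with \<open>t\<^sup>K\<^sub>H\<close> going from \<open>H\<close> to \<open>K\<close>, \<open>r\<^sup>K\<^sub>H\<close> from \<open>K\<close> to \<open>H\<close> and \<open>c\<^sub>g\<^sub>,\<^sub>H\<close> from \<open>H\<close> to the
  conjugate of \<open>H\<close> by \<open>g\<close>.
\<close>

datatype 'g mackey_gen = Tr "'g set" "'g set" | Rs "'g set" "'g set" | Cj 'g "'g set"

definition mackey_gens :: "('g, 'k) monoid_scheme \<Rightarrow> 'g mackey_gen set"
  where "mackey_gens G =
    {Tr K H |K H. subgroup H G \<and> subgroup K G \<and> H \<subseteq> K} \<union>
    {Rs K H |K H. subgroup H G \<and> subgroup K G \<and> H \<subseteq> K} \<union>
    {Cj g H |g H. g \<in> carrier G \<and> subgroup H G}"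

fun gen_source :: "'g mackey_gen \<Rightarrow> 'g set" where
  "gen_source (Tr K H) = H"
| "gen_source (Rs K H) = K"
| "gen_source (Cj g H) = H"

fun gen_target :: "('g, 'k) monoid_scheme \<Rightarrow> 'g mackey_gen \<Rightarrow> 'g set" where
  "gen_target G (Tr K H) = K"
| "gen_target G (Rs K H) = H"
| "gen_target G (Cj g H) = conj_subgroup G g H"

abbreviation mackey_free :: "('r, 'k) ring_scheme \<Rightarrow> ('g, 'l) monoid_scheme \<Rightarrow> _"
  where "mackey_free R G \<equiv> free_algebra R (mackey_gens G)"

text \<open>
  The defining relations \<open>u = v\<close>.  In \<open>mackey\<close> every system \<open>D\<close> of representatives is allowed;
  the other relations make the sum independent of \<open>D\<close>.  In \<open>zero\<close> the ``other'' products are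
  those of two generators that cannot be composed.  A composable product \<open>t\<^sup>K\<^sub>H r\<^sup>L\<^sub>H\<close> is not meant,
  since such products are summands on the right-hand side of \<open>mackey\<close>, with \<open>h = 1\<close>.
\<close>

inductive mackey_rel ::
  "('r, 'k) ring_scheme \<Rightarrow> ('g, 'l) monoid_scheme \<Rightarrow>
   ('g mackey_gen list \<Rightarrow> 'r) \<Rightarrow> ('g mackey_gen list \<Rightarrow> 'r) \<Rightarrow> bool"
  for R G where
  unit: "mackey_rel R G
      (\<Oplus>\<^bsub>mackey_free R G\<^esub>H\<in>{H. subgroup H G}. basis_vec R [Tr H H]) \<one>\<^bsub>mackey_free R G\<^esub>"
| idem_r: "subgroup H G \<Longrightarrow> mackey_rel R G (basis_vec R [Tr H H]) (basis_vec R [Rs H H])"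
| idem_c: "subgroup H G \<Longrightarrow> h \<in> H \<Longrightarrow>
    mackey_rel R G (basis_vec R [Tr H H]) (basis_vec R [Cj h H])"
| tt: "subgroup H G \<Longrightarrow> subgroup K G \<Longrightarrow> subgroup L G \<Longrightarrow> H \<subseteq> K \<Longrightarrow> K \<subseteq> L \<Longrightarrow>
    mackey_rel R G (basis_vec R [Tr L K, Tr K H]) (basis_vec R [Tr L H])"
| rr: "subgroup H G \<Longrightarrow> subgroup K G \<Longrightarrow> subgroup L G \<Longrightarrow> H \<subseteq> K \<Longrightarrow> K \<subseteq> L \<Longrightarrow>
    mackey_rel R G (basis_vec R [Rs K H, Rs L K]) (basis_vec R [Rs L H])"
| cc: "subgroup H G \<Longrightarrow> g \<in> carrier G \<Longrightarrow> g' \<in> carrier G \<Longrightarrow>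
    mackey_rel R G (basis_vec R [Cj g' (conj_subgroup G g H), Cj g H])
      (basis_vec R [Cj (g' \<otimes>\<^bsub>G\<^esub> g) H])"
| tc: "subgroup H G \<Longrightarrow> subgroup K G \<Longrightarrow> H \<subseteq> K \<Longrightarrow> g \<in> carrier G \<Longrightarrow>
    mackey_rel R G (basis_vec R [Tr (conj_subgroup G g K) (conj_subgroup G g H), Cj g H])
      (basis_vec R [Cj g K, Tr K H])"
| rc: "subgroup H G \<Longrightarrow> subgroup K G \<Longrightarrow> H \<subseteq> K \<Longrightarrow> g \<in> carrier G \<Longrightarrow>
    mackey_rel R G (basis_vec R [Rs (conj_subgroup G g K) (conj_subgroup G g H), Cj g K])
      (basis_vec R [Cj g H, Rs K H])"
| mackey: "subgroup H G \<Longrightarrow> subgroup L G \<Longrightarrow> subgroup K G \<Longrightarrow> L \<subseteq> H \<Longrightarrow> K \<subseteq> H \<Longrightarrow>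
    double_coset_reps G L H K D \<Longrightarrow>
    mackey_rel R G (basis_vec R [Rs H L, Tr H K])
      (\<Oplus>\<^bsub>mackey_free R G\<^esub>h\<in>D. basis_vec R
        [Tr L (L \<inter> conj_subgroup G h K),
         Cj h (conj_subgroup G (inv\<^bsub>G\<^esub> h) L \<inter> K),
         Rs K (conj_subgroup G (inv\<^bsub>G\<^esub> h) L \<inter> K)])"
| zero: "x \<in> mackey_gens G \<Longrightarrow> y \<in> mackey_gens G \<Longrightarrow> gen_source x \<noteq> gen_target G y \<Longrightarrow>
    mackey_rel R G (basis_vec R [x, y]) \<zero>\<^bsub>mackey_free R G\<^esub>"

definition mackey_algebra ::
  "('r, 'k) ring_scheme \<Rightarrow> ('g, 'l) monoid_scheme \<Rightarrow> ('r, ('g mackey_gen list \<Rightarrow> 'r) set) module"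
  where "mackey_algebra R G = quotient_algebra (mackey_free R G)
    (Idl\<^bsub>mackey_free R G\<^esub> {u \<ominus>\<^bsub>mackey_free R G\<^esub> v |u v. mackey_rel R G u v})"

section \<open>Finite sets with a group action\<close>

text \<open>
  A set with an action of \<open>K\<close> is a pair of an underlying set and an action as in
  \<^locale>\<open>group_action\<close>.  Every finite such set is isomorphic to one with underlying set in
  \<^typ>\<open>nat\<close>, so isomorphism classes are represented by their members there;
  \<open>gset_class K X\<close> makes sense for \<open>X\<close> over any type.
\<close>

type_synonym ('g, 'a) gset = "'a set \<times> ('g \<Rightarrow> 'a \<Rightarrow> 'a)"

definition finite_gset :: "('g, 'l) monoid_scheme \<Rightarrow> ('g, 'a) gset \<Rightarrow> bool"
  where "finite_gset K X \<longleftrightarrow> finite (fst X) \<and> group_action K (fst X) (snd X)"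

definition gset_iso :: "('g, 'l) monoid_scheme \<Rightarrow> ('g, 'a) gset \<Rightarrow> ('g, 'b) gset \<Rightarrow> bool"
  where "gset_iso K X Y \<longleftrightarrow>
    (\<exists>f. bij_betw f (fst X) (fst Y) \<and>
         (\<forall>g\<in>carrier K. \<forall>x\<in>fst X. f (snd X g x) = snd Y g (f x)))"

definition gset_class :: "('g, 'l) monoid_scheme \<Rightarrow> ('g, 'a) gset \<Rightarrow> ('g, nat) gset set"
  where "gset_class K X = {Y. finite_gset K Y \<and> gset_iso K X Y}"

definition gset_sum :: "('g, 'a) gset \<Rightarrow> ('g, 'b) gset \<Rightarrow> ('g, 'a + 'b) gset"
  where "gset_sum X Y =
    (Sum_Type.Plus (fst X) (fst Y),
     \<lambda>g. restrict (map_sum (snd X g) (snd Y g)) (Sum_Type.Plus (fst X) (fst Y)))"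

definition gset_prod :: "('g, 'a) gset \<Rightarrow> ('g, 'b) gset \<Rightarrow> ('g, 'a \<times> 'b) gset"
  where "gset_prod X Y =
    (fst X \<times> fst Y, \<lambda>g. restrict (map_prod (snd X g) (snd Y g)) (fst X \<times> fst Y))"

definition gset_point :: "('g, nat) gset"
  where "gset_point = ({0}, \<lambda>g. \<lambda>x\<in>{0}. x)"

text \<open>
  \<open>G \<times>\<^sub>H X\<close>: the quotient of \<open>G \<times> X\<close> identifying \<open>(g h, x)\<close> with \<open>(g, h x)\<close>, with \<open>G\<close> acting by
  left multiplication on the first component.
\<close>

definition ind_rel ::
  "('g, 'l) monoid_scheme \<Rightarrow> 'g set \<Rightarrow> ('g, 'a) gset \<Rightarrow> (('g \<times> 'a) \<times> ('g \<times> 'a)) set"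
  where "ind_rel G H X =
    {((g \<otimes>\<^bsub>G\<^esub> h, x), (g, snd X h x)) |g h x. g \<in> carrier G \<and> h \<in> H \<and> x \<in> fst X}"

definition ind_gset ::
  "('g, 'l) monoid_scheme \<Rightarrow> 'g set \<Rightarrow> ('g, 'a) gset \<Rightarrow> ('g, ('g \<times> 'a) set) gset"
  where "ind_gset G H X =
    ((carrier G \<times> fst X) // ind_rel G H X,
     \<lambda>k. \<lambda>C\<in>(carrier G \<times> fst X) // ind_rel G H X. (\<lambda>(g, x). (k \<otimes>\<^bsub>G\<^esub> g, x)) ` C)"

section \<open>The Burnside algebra\<close>

definition gset_monoid :: "('g, 'l) monoid_scheme \<Rightarrow> ('g, nat) gset set monoid"
  where "gset_monoid K =
    \<lparr>carrier = {gset_class K X |X :: ('g, nat) gset. finite_gset K X},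
     monoid.mult = (\<lambda>A B. \<Union>X\<in>A. \<Union>Y\<in>B. gset_class K (gset_prod X Y)),
     one = gset_class K gset_point\<rparr>"

text \<open>
  The Grothendieck ring: the free abelian group on isomorphism classes, multiplied by cartesian
  products, modulo \<open>[X \<squnion> Y] - ([X] + [Y])\<close>.  The additive subgroup generated by these elements is
  already an ideal.
\<close>

abbreviation burnside_free :: "('g, 'l) monoid_scheme \<Rightarrow> (int, ('g, nat) gset set \<Rightarrow> int) module"
  where "burnside_free K \<equiv> monoid_algebra \<Z> (gset_monoid K)"

definition burnside_ideal :: "('g, 'l) monoid_scheme \<Rightarrow> (('g, nat) gset set \<Rightarrow> int) set"
  where "burnside_ideal K = Idl\<^bsub>burnside_free K\<^esub>
    {basis_vec \<Z> (gset_class K (gset_sum X Y)) \<ominus>\<^bsub>burnside_free K\<^esub>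
       (basis_vec \<Z> (gset_class K X) \<oplus>\<^bsub>burnside_free K\<^esub> basis_vec \<Z> (gset_class K Y))
     |(X :: ('g, nat) gset) (Y :: ('g, nat) gset). finite_gset K X \<and> finite_gset K Y}"

definition burnside_ring :: "('g, 'l) monoid_scheme \<Rightarrow> (('g, nat) gset set \<Rightarrow> int) set ring"
  where "burnside_ring K = burnside_free K Quot burnside_ideal K"

definition burnside_elem ::
  "('g, 'l) monoid_scheme \<Rightarrow> ('g, 'a) gset \<Rightarrow> (('g, nat) gset set \<Rightarrow> int) set"
  where "burnside_elem K X =
    burnside_ideal K +>\<^bsub>burnside_free K\<^esub> basis_vec \<Z> (gset_class K X)"

text \<open>
  The tensor product over the integers of the rings \<open>R\<close> and \<open>B\<close>, as an \<open>R\<close>-algebra: the free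
  abelian group on \<open>R \<times> B\<close> with componentwise multiplication of pairs, modulo biadditivity.  The
  additive subgroup generated by the biadditivity relations is already an ideal.
\<close>

abbreviation tensor_free ::
  "('r, 'k) ring_scheme \<Rightarrow> ('b, 'l) ring_scheme \<Rightarrow> (int, 'r \<times> 'b \<Rightarrow> int) module"
  where "tensor_free R B \<equiv> monoid_algebra \<Z> (R \<times>\<times> B)"

definition tensor_ideal ::
  "('r, 'k) ring_scheme \<Rightarrow> ('b, 'l) ring_scheme \<Rightarrow> ('r \<times> 'b \<Rightarrow> int) set"
  where "tensor_ideal R B = Idl\<^bsub>tensor_free R B\<^esub>
    ({basis_vec \<Z> (r \<oplus>\<^bsub>R\<^esub> s, x) \<ominus>\<^bsub>tensor_free R B\<^esub>
        (basis_vec \<Z> (r, x) \<oplus>\<^bsub>tensor_free R B\<^esub> basis_vec \<Z> (s, x))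
      |r s x. r \<in> carrier R \<and> s \<in> carrier R \<and> x \<in> carrier B} \<union>
     {basis_vec \<Z> (r, x \<oplus>\<^bsub>B\<^esub> y) \<ominus>\<^bsub>tensor_free R B\<^esub>
        (basis_vec \<Z> (r, x) \<oplus>\<^bsub>tensor_free R B\<^esub> basis_vec \<Z> (r, y))
      |r x y. r \<in> carrier R \<and> x \<in> carrier B \<and> y \<in> carrier B})"

definition tensor_elem ::
  "('r, 'k) ring_scheme \<Rightarrow> ('b, 'l) ring_scheme \<Rightarrow> 'r \<Rightarrow> 'b \<Rightarrow> ('r \<times> 'b \<Rightarrow> int) set"
  where "tensor_elem R B r x = tensor_ideal R B +>\<^bsub>tensor_free R B\<^esub> basis_vec \<Z> (r, x)"

definition base_change ::
  "('r, 'k) ring_scheme \<Rightarrow> ('b, 'l) ring_scheme \<Rightarrow> ('r, ('r \<times> 'b \<Rightarrow> int) set) module"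
  where "base_change R B =
    (let T = tensor_free R B Quot tensor_ideal R B
     in ring.extend T (module.fields (\<lambda>r X. tensor_elem R B r \<one>\<^bsub>B\<^esub> \<otimes>\<^bsub>T\<^esub> X)))"

type_synonym ('r, 'g) burnside = "('r \<times> (('g, nat) gset set \<Rightarrow> int) set \<Rightarrow> int) set"

definition burnside_algebra ::
  "('r, 'k) ring_scheme \<Rightarrow> ('g, 'l) monoid_scheme \<Rightarrow> ('r, ('r, 'g) burnside) module"
  where "burnside_algebra R K = base_change R (burnside_ring K)"

definition burnside_class ::
  "('r, 'k) ring_scheme \<Rightarrow> ('g, 'l) monoid_scheme \<Rightarrow> ('g, 'a) gset \<Rightarrow> ('r, 'g) burnside"
  where "burnside_class R K X = tensor_elem R (burnside_ring K) \<one>\<^bsub>R\<^esub> (burnside_elem K X)"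

section \<open>Families stable by induction\<close>

definition stable_by_induction ::
  "('r, 'k) ring_scheme \<Rightarrow> ('g, 'l) monoid_scheme \<Rightarrow> ('g set \<Rightarrow> ('r, 'g) burnside \<Rightarrow> 'r) \<Rightarrow> bool"
  where "stable_by_induction R G \<phi> \<longleftrightarrow>
    (\<forall>H. subgroup H G \<longrightarrow> (\<forall>X :: ('g, nat) gset. finite_gset (G\<lparr>carrier := H\<rparr>) X \<longrightarrow>
       \<phi> (carrier G) (burnside_class R G (ind_gset G H X)) =
       \<phi> H (burnside_class R (G\<lparr>carrier := H\<rparr>) X)))"

definition stable_symmetric_burnside_family ::
  "('r, 'k) ring_scheme \<Rightarrow> ('g, 'l) monoid_scheme \<Rightarrow> bool"
  where "stable_symmetric_burnside_family R G \<longleftrightarrow>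
    (\<exists>\<phi>. (\<forall>H. subgroup H G \<longrightarrow>
            \<phi> H \<in> linear_maps R (burnside_algebra R (G\<lparr>carrier := H\<rparr>)) (regular_module R)) \<and>
         stable_by_induction R G \<phi> \<and>
         (\<forall>H. subgroup H G \<longrightarrow>
            nondegenerate R (burnside_algebra R (G\<lparr>carrier := H\<rparr>))
              (\<lambda>X Y. \<phi> H (X \<otimes>\<^bsub>burnside_algebra R (G\<lparr>carrier := H\<rparr>)\<^esub> Y))))"

end

theory Submission
  imports Defs "HOL-Library.Multiset"
begin

text \<open>
  For a function \<open>f\<close> from the conjugacy classes of subgroups of \<open>G\<close> to \<open>R\<close> and for \<open>A, B \<le> P \<le> G\<close>, let
  \<open>T\<^sub>P(A, B)\<close> be the sum of the values of \<open>f\<close> at the stabilisers of the \<open>P\<close>-orbits on \<open>P/A \<times> P/B\<close>.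
  Both conditions hold if and only if, for some \<open>f\<close>, all the matrices \<open>T\<^sub>P\<close>, indexed by the
  \<open>P\<close>-classes of subgroups of \<open>P\<close>, are invertible over \<open>R\<close>.

  For the Burnside algebras, \<open>RB(H)\<close> has the sets \<open>H/A\<close> as a basis, and a family \<open>\<phi>\<close> stable by
  induction is determined by \<open>f(A) = \<phi>\<^sub>G(G/A) = \<phi>\<^sub>H(H/A)\<close>; the Gram matrix of \<open>\<phi>\<^sub>H\<close> is then \<open>T\<^sub>H\<close>.

  The Mackey algebra has the standard words \<open>t\<^sup>H\<^sub>B\<^sub>' c\<^sub>g\<^sub>,\<^sub>B r\<^sup>K\<^sub>B\<close>, with \<open>B'\<close> the conjugate of \<open>B\<close> by \<open>g\<close>, as a
  basis once words that coincide are identified.  They span by the relations.  They are independent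
  because the generators act on functions of a left coset and a subgroup of its stabiliser,
  compatibly with all relations.  If \<open>\<tau>\<close> is the trace form of a symmetric bilinear form and
  \<open>f(A) = \<tau>(t\<^sup>G\<^sub>A r\<^sup>G\<^sub>A)\<close>, then \<open>T\<^sub>P\<close> is the block of the Gram matrix that pairs the words \<open>t\<^sup>G\<^sub>B r\<^sup>P\<^sub>B\<close> with
  the words \<open>t\<^sup>P\<^sub>C r\<^sup>G\<^sub>C\<close>.  Conversely, \<open>f\<close> defines a trace by \<open>\<tau>(t\<^sup>K\<^sub>A r\<^sup>K\<^sub>A) = f(A)\<close>, vanishing on the other
  standard words, and every block of its Gram matrix is a matrix \<open>T\<^sub>P\<close> with \<open>P\<close> the intersection of
  \<open>H\<close> with a conjugate of \<open>K\<close>.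
\<close>

text \<open>The difficulty is independence: an algebra given by generators and relations comes with
  no functionals. A pair of A \<le> L and a coset x fixed by A is read as the transitive L-set L/A
  over G/H whose base point lies over x, and the functions acted upon are additive invariants of
  such sets. On the sets, t, r and c become composition with, pullback along and transport by maps
  of coset spaces, and the Mackey relation is the decomposition of a pullback. Values are taken in
  multisets of classes, so that one verification serves every R and every functional.

  The index sets consist of all subgroups or all words, with repetitions, so that no representatives
  of conjugacy classes are chosen. This is why non-degeneracy is phrased by coefficients n that
  represent the coordinate functionals.

  The form built from f need not be the one that f came from: a symmetric form may be nonzero on
  c_{g,1} with g \<noteq> 1, where the constructed trace vanishes. Only the values at t^G_A r^G_A
  are kept.\<close>

section \<open>Linear maps between modules\<close>

definition linear_on ::
  "('r, 'k) ring_scheme \<Rightarrow> ('r, 'm, 'x) module_scheme \<Rightarrow> ('r, 'n, 'y) module_scheme \<Rightarrow> ('m \<Rightarrow> 'n) \<Rightarrow> bool"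
  where "linear_on R M N f \<longleftrightarrow> f \<in> carrier M \<rightarrow> carrier N \<and>
      (\<forall>x\<in>carrier M. \<forall>y\<in>carrier M. f (x \<oplus>\<^bsub>M\<^esub> y) = f x \<oplus>\<^bsub>N\<^esub> f y) \<and>
      (\<forall>a\<in>carrier R. \<forall>x\<in>carrier M. f (a \<odot>\<^bsub>M\<^esub> x) = a \<odot>\<^bsub>N\<^esub> f x)"

text \<open>Only the value off the carrier differs. \<open>linear_on\<close> ignores it, so that
  compositions and lambda terms are linear as they stand.\<close>

lemma linear_maps_iff: "f \<in> linear_maps R M N \<longleftrightarrow> linear_on R M N f \<and> f \<in> extensional (carrier M)"
  unfolding linear_maps_def linear_on_def PiE_def by auto

lemma linear_onD:
  assumes "linear_on R M N f"
  shows "x \<in> carrier M \<Longrightarrow> f x \<in> carrier N"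
    and "x \<in> carrier M \<Longrightarrow> y \<in> carrier M \<Longrightarrow> f (x \<oplus>\<^bsub>M\<^esub> y) = f x \<oplus>\<^bsub>N\<^esub> f y"
    and "a \<in> carrier R \<Longrightarrow> x \<in> carrier M \<Longrightarrow> f (a \<odot>\<^bsub>M\<^esub> x) = a \<odot>\<^bsub>N\<^esub> f x"
  using assms unfolding linear_on_def by auto

lemma linear_onI:
  assumes "\<And>x. x \<in> carrier M \<Longrightarrow> f x \<in> carrier N"
    and "\<And>x y. x \<in> carrier M \<Longrightarrow> y \<in> carrier M \<Longrightarrow> f (x \<oplus>\<^bsub>M\<^esub> y) = f x \<oplus>\<^bsub>N\<^esub> f y"
    and "\<And>a x. a \<in> carrier R \<Longrightarrow> x \<in> carrier M \<Longrightarrow> f (a \<odot>\<^bsub>M\<^esub> x) = a \<odot>\<^bsub>N\<^esub> f x"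
  shows "linear_on R M N f"
  using assms unfolding linear_on_def by auto

lemma linear_on_restrict:
  assumes "module R M"
  shows "linear_on R M N (restrict f (carrier M)) \<longleftrightarrow> linear_on R M N f"
proof -
  interpret module R M by fact
  show ?thesis unfolding linear_on_def by (auto simp: Pi_def)
qed

lemma linear_on_zero:
  assumes "module R M" "module R N" "linear_on R M N f"
  shows "f \<zero>\<^bsub>M\<^esub> = \<zero>\<^bsub>N\<^esub>"
proof -
  interpret M: module R M by fact
  interpret N: module R N by fact
  have "f (\<zero>\<^bsub>R\<^esub> \<odot>\<^bsub>M\<^esub> \<zero>\<^bsub>M\<^esub>) = \<zero>\<^bsub>R\<^esub> \<odot>\<^bsub>N\<^esub> f \<zero>\<^bsub>M\<^esub>"
    using linear_onD(3)[OF assms(3)] by blast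
  then show ?thesis using linear_onD(1)[OF assms(3)] by simp
qed

lemma linear_on_uminus:
  assumes "module R M" "module R N" "linear_on R M N f" "x \<in> carrier M"
  shows "f (\<ominus>\<^bsub>M\<^esub> x) = \<ominus>\<^bsub>N\<^esub> f x"
proof -
  interpret M: module R M by fact
  interpret N: module R N by fact
  have "f ((\<ominus>\<^bsub>R\<^esub> \<one>\<^bsub>R\<^esub>) \<odot>\<^bsub>M\<^esub> x) = (\<ominus>\<^bsub>R\<^esub> \<one>\<^bsub>R\<^esub>) \<odot>\<^bsub>N\<^esub> f x"
    by (rule linear_onD(3)[OF assms(3)]) (use assms(4) in auto)
  then show ?thesis using linear_onD(1)[OF assms(3,4)] assms(4)
    by (simp add: M.smult_l_minus N.smult_l_minus)
qed

lemma linear_on_minus: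
  assumes "module R M" "module R N" "linear_on R M N f" "x \<in> carrier M" "y \<in> carrier M"
  shows "f (x \<ominus>\<^bsub>M\<^esub> y) = f x \<ominus>\<^bsub>N\<^esub> f y"
proof -
  interpret M: module R M by fact
  show ?thesis
    by (simp add: a_minus_def linear_onD(2)[OF assms(3)] linear_on_uminus[OF assms(1-3)] assms)
qed

lemma linear_on_finsum:
  assumes "module R M" "module R N" "linear_on R M N f" "g \<in> A \<rightarrow> carrier M"
  shows "f (finsum M g A) = finsum N (\<lambda>i. f (g i)) A"
proof -
  interpret M: module R M by fact
  interpret N: module R N by fact
  show ?thesis
  proof (cases "finite A")
    case True
    then show ?thesis using assms(4)
    proof (induction A)
      case empty
      then show ?case by (simp add: linear_on_zero[OF assms(1-3)])
    next
      case (insert a A)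
      have "finsum M g A \<in> carrier M" using insert by (auto intro: M.finsum_closed)
      then show ?case using insert linear_onD[OF assms(3)]
        by (simp add: M.finsum_insert N.finsum_insert Pi_def)
    qed
  next
    case False
    then show ?thesis by (simp add: linear_on_zero[OF assms(1-3)])
  qed
qed

lemma linear_on_comp:
  assumes "linear_on R M N f" "linear_on R N P g"
  shows "linear_on R M P (\<lambda>x. g (f x))"
  by (rule linear_onI) (use linear_onD[OF assms(1)] linear_onD[OF assms(2)] in auto)

lemma regular_module_simps [simp]:
  "carrier (regular_module R) = carrier R" "add (regular_module R) = add R"
  "zero (regular_module R) = zero R" "smult (regular_module R) = monoid.mult R"
  "one (regular_module R) = one R" "monoid.mult (regular_module R) = monoid.mult R"
  by (simp_all add: regular_module_def)

lemma finsum_regular [simp]: "finsum (regular_module R) = finsum R"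
  by (intro ext) (simp add: finsum_def finprod_def)

lemma a_inv_regular [simp]: "a_inv (regular_module R) = a_inv R"
  by (intro ext) (simp add: a_inv_def m_inv_def)

lemma a_minus_regular [simp]: "a_minus (regular_module R) = a_minus R"
  by (intro ext) (simp add: a_minus_def)

lemma regular_module_module:
  assumes "cring R"
  shows "module R (regular_module R)"
proof -
  interpret cring R by fact
  show ?thesis
    by (rule moduleI[OF assms])
       (auto intro!: abelian_groupI add.l_inv_ex simp: a_ac l_distr r_distr m_assoc)
qed

subsection \<open>Free modules\<close>

lemma free_module_simps:
  "carrier (free_module R I) = {f. (\<forall>i\<in>I. f i \<in> carrier R) \<and> (\<forall>i. i \<notin> I \<longrightarrow> f i = \<zero>\<^bsub>R\<^esub>) \<and>
                   finite {i. f i \<noteq> \<zero>\<^bsub>R\<^esub>}}"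
  "zero (free_module R I) = (\<lambda>i. \<zero>\<^bsub>R\<^esub>)"
  "add (free_module R I) = (\<lambda>f g i. f i \<oplus>\<^bsub>R\<^esub> g i)"
  "smult (free_module R I) = (\<lambda>a f i. a \<otimes>\<^bsub>R\<^esub> f i)"
  by (simp_all add: free_module_def)

lemma free_moduleD:
  assumes "cring R" "f \<in> carrier (free_module R I)"
  shows "f i \<in> carrier R" "finite {i. f i \<noteq> \<zero>\<^bsub>R\<^esub>}" "{i. f i \<noteq> \<zero>\<^bsub>R\<^esub>} \<subseteq> I"
    "i \<notin> I \<Longrightarrow> f i = \<zero>\<^bsub>R\<^esub>"
proof -
  interpret cring R by fact
  show "f i \<in> carrier R" using assms(2) by (cases "i \<in> I") (auto simp: free_module_simps)
qed (use assms(2) in \<open>auto simp: free_module_simps\<close>)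

lemma free_moduleI:
  assumes "\<And>i. f i \<in> carrier R" "finite A" "A \<subseteq> I" "\<And>i. i \<notin> A \<Longrightarrow> f i = \<zero>\<^bsub>R\<^esub>"
  shows "f \<in> carrier (free_module R I)"
proof -
  have "finite {i. f i \<noteq> \<zero>\<^bsub>R\<^esub>}" by (rule finite_subset[OF _ assms(2)]) (use assms in auto)
  then show ?thesis using assms by (auto simp: free_module_simps)
qed

lemma free_module_module:
  assumes "cring R"
  shows "module R (free_module R I)"
proof -
  interpret cring R by fact
  note D = free_moduleD[OF assms, where I = I]
  have add: "(\<lambda>i. f i \<oplus>\<^bsub>R\<^esub> g i) \<in> carrier (free_module R I)"
    if "f \<in> carrier (free_module R I)" "g \<in> carrier (free_module R I)" for f g
    by (rule free_moduleI[of _ _ "{i. f i \<noteq> \<zero>\<^bsub>R\<^esub>} \<union> {i. g i \<noteq> \<zero>\<^bsub>R\<^esub>}"])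
       (use D[OF that(1)] D[OF that(2)] in auto)
  have sm: "(\<lambda>i. a \<otimes>\<^bsub>R\<^esub> f i) \<in> carrier (free_module R I)"
    if "f \<in> carrier (free_module R I)" "a \<in> carrier R" for f a
    by (rule free_moduleI[of _ _ "{i. f i \<noteq> \<zero>\<^bsub>R\<^esub>}"]) (use D[OF that(1)] that in auto)
  have z: "(\<lambda>i. \<zero>\<^bsub>R\<^esub>) \<in> carrier (free_module R I)"
    by (rule free_moduleI[of _ _ "{}"]) auto
  have ag: "abelian_group (free_module R I)"
  proof (rule abelian_groupI)
    fix f assume f: "f \<in> carrier (free_module R I)"
    have "(\<lambda>i. (\<ominus>\<^bsub>R\<^esub> \<one>\<^bsub>R\<^esub>) \<otimes>\<^bsub>R\<^esub> f i) \<oplus>\<^bsub>free_module R I\<^esub> f = \<zero>\<^bsub>free_module R I\<^esub>"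
      using D(1)[OF f] by (auto simp: free_module_simps l_minus l_neg)
    then show "\<exists>y\<in>carrier (free_module R I). y \<oplus>\<^bsub>free_module R I\<^esub> f = \<zero>\<^bsub>free_module R I\<^esub>"
      using sm[OF f] by (metis one_closed a_inv_closed)
  qed (use add z D(1) in \<open>auto simp: free_module_simps(2-4) a_ac\<close>)
  show ?thesis
    by (rule moduleI[OF assms ag])
       (use sm D(1) in \<open>auto simp: free_module_simps(2-4) l_distr r_distr m_assoc\<close>)
qed

lemma basis_vec_closed:
  assumes "cring R" "i \<in> I"
  shows "basis_vec R i \<in> carrier (free_module R I)"
proof -
  interpret cring R by fact
  show ?thesis by (rule free_moduleI[of _ _ "{i}"]) (use assms in \<open>auto simp: basis_vec_def\<close>)
qed

text \<open>Points are removed one at a time from a finite set that bounds the support. A bound is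
  used and not the support itself, so that the removed coordinate may be zero.\<close>

lemma free_module_induct [consumes 2, case_names zero add smult]:
  assumes "cring R" "f \<in> carrier (free_module R I)"
    and zero: "P (\<lambda>i. \<zero>\<^bsub>R\<^esub>)"
    and add: "\<And>f g. f \<in> carrier (free_module R I) \<Longrightarrow> g \<in> carrier (free_module R I) \<Longrightarrow>
      P f \<Longrightarrow> P g \<Longrightarrow> P (f \<oplus>\<^bsub>free_module R I\<^esub> g)"
    and smult: "\<And>a i. a \<in> carrier R \<Longrightarrow> i \<in> I \<Longrightarrow> P (a \<odot>\<^bsub>free_module R I\<^esub> basis_vec R i)"
  shows "P f"
proof -
  interpret cring R by fact
  note D = free_moduleD[OF assms(1), where I = I]
  have "P f" if "finite A" "A \<subseteq> I" "f \<in> carrier (free_module R I)" "\<And>i. i \<notin> A \<Longrightarrow> f i = \<zero>\<^bsub>R\<^esub>"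
    for A f
    using that
  proof (induction A arbitrary: f)
    case empty
    then have "f = (\<lambda>i. \<zero>\<^bsub>R\<^esub>)" by auto
    then show ?case using zero by simp
  next
    case (insert x A)
    let ?g = "f(x := \<zero>\<^bsub>R\<^esub>)" and ?h = "f x \<odot>\<^bsub>free_module R I\<^esub> basis_vec R x"
    have g: "?g \<in> carrier (free_module R I)"
      by (rule free_moduleI[of _ _ A]) (use insert D(1)[OF insert(5)] in auto)
    have fx: "f x \<in> carrier R" using D(1)[OF insert(5)] .
    have h: "?h \<in> carrier (free_module R I)"
      by (rule module.smult_closed[OF free_module_module[OF assms(1)] fx])
         (use basis_vec_closed[OF assms(1)] insert(4) in auto)
    have "P ?g" by (rule insert.IH[OF _ g]) (use insert in auto)
    moreover have "P ?h" using smult fx insert by auto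
    moreover have "f = ?g \<oplus>\<^bsub>free_module R I\<^esub> ?h"
      using D(1)[OF insert(5)] by (auto simp: free_module_simps basis_vec_def)
    ultimately show ?case using add[OF g h] by simp
  qed
  then show ?thesis using D[OF assms(2)] assms(2) by blast
qed

definition lin_ext :: "('r, 'k) ring_scheme \<Rightarrow> ('r, 'n, 'y) module_scheme \<Rightarrow> ('i \<Rightarrow> 'n) \<Rightarrow> ('i \<Rightarrow> 'r) \<Rightarrow> 'n"
  where "lin_ext R N \<psi> f = finsum N (\<lambda>i. f i \<odot>\<^bsub>N\<^esub> \<psi> i) {i. f i \<noteq> \<zero>\<^bsub>R\<^esub>}"

context
  fixes R :: "('r, 'k) ring_scheme" and N :: "('r, 'n, 'y) module_scheme" and I :: "'i set"
    and \<psi> :: "'i \<Rightarrow> 'n"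
  assumes N: "module R N" and \<psi>: "\<psi> \<in> I \<rightarrow> carrier N"
begin

interpretation N: module R N by (rule N)

text \<open>The defining sum runs over the support of \<open>f\<close>. Over a common finite
  superset the sums for different \<open>f\<close> can be added term by term.\<close>

lemma lin_ext_superset:
  assumes "f \<in> carrier (free_module R I)" "finite A" "{i. f i \<noteq> \<zero>\<^bsub>R\<^esub>} \<subseteq> A" "A \<subseteq> I"
  shows "lin_ext R N \<psi> f = finsum N (\<lambda>i. f i \<odot>\<^bsub>N\<^esub> \<psi> i) A"
  unfolding lin_ext_def
  by (rule N.add.finprod_mono_neutral_cong_left)
     (use assms \<psi> free_moduleD[OF N.is_cring assms(1)] in \<open>auto simp: Pi_iff subset_iff\<close>)

lemma lin_ext_basis:
  assumes "i \<in> I" shows "lin_ext R N \<psi> (basis_vec R i) = \<psi> i"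
proof -
  have "lin_ext R N \<psi> (basis_vec R i) = finsum N (\<lambda>j. basis_vec R i j \<odot>\<^bsub>N\<^esub> \<psi> j) {i}"
    by (rule lin_ext_superset[OF basis_vec_closed[OF N.is_cring assms]])
       (use assms in \<open>auto simp: basis_vec_def\<close>)
  then show ?thesis using assms \<psi> by (simp add: basis_vec_def Pi_def)
qed

lemma lin_ext_linear: "linear_on R (free_module R I) N (lin_ext R N \<psi>)"
proof (rule linear_onI)
  note D = free_moduleD[OF N.is_cring, where I = I]
  have tm: "f i \<odot>\<^bsub>N\<^esub> \<psi> i \<in> carrier N" if "f \<in> carrier (free_module R I)" "i \<in> I" for f i
    using that \<psi> D(1)[OF that(1)] by auto
  show "lin_ext R N \<psi> f \<in> carrier N" if f: "f \<in> carrier (free_module R I)" for f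
    unfolding lin_ext_def by (rule N.finsum_closed) (use tm[OF f] D[OF f] in auto)
  have FM: "module R (free_module R I)" by (rule free_module_module[OF N.is_cring])
  interpret F: module R "free_module R I" by (rule FM)
  show "lin_ext R N \<psi> (f \<oplus>\<^bsub>free_module R I\<^esub> g) = lin_ext R N \<psi> f \<oplus>\<^bsub>N\<^esub> lin_ext R N \<psi> g"
    if f: "f \<in> carrier (free_module R I)" and g: "g \<in> carrier (free_module R I)" for f g
  proof -
    let ?A = "{i. f i \<noteq> \<zero>\<^bsub>R\<^esub>} \<union> {i. g i \<noteq> \<zero>\<^bsub>R\<^esub>}"
    have A: "finite ?A" "?A \<subseteq> I" using D[OF f] D[OF g] by auto
    have s: "{i. (f \<oplus>\<^bsub>free_module R I\<^esub> g) i \<noteq> \<zero>\<^bsub>R\<^esub>} \<subseteq> ?A"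
      by (auto simp: free_module_simps)
    have "lin_ext R N \<psi> (f \<oplus>\<^bsub>free_module R I\<^esub> g)
        = finsum N (\<lambda>i. (f \<oplus>\<^bsub>free_module R I\<^esub> g) i \<odot>\<^bsub>N\<^esub> \<psi> i) ?A"
      by (rule lin_ext_superset[OF F.add.m_closed[OF f g] A(1) s A(2)])
    also have "\<dots> = finsum N (\<lambda>i. f i \<odot>\<^bsub>N\<^esub> \<psi> i \<oplus>\<^bsub>N\<^esub> g i \<odot>\<^bsub>N\<^esub> \<psi> i) ?A"
      by (rule N.finsum_cong')
         (use A tm[OF f] tm[OF g] D(1)[OF f] D(1)[OF g] \<psi> in \<open>auto simp: free_module_simps(3) N.smult_l_distr Pi_def subset_iff\<close>)
    also have "\<dots> = finsum N (\<lambda>i. f i \<odot>\<^bsub>N\<^esub> \<psi> i) ?A \<oplus>\<^bsub>N\<^esub> finsum N (\<lambda>i. g i \<odot>\<^bsub>N\<^esub> \<psi> i) ?A"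
      by (rule N.finsum_addf) (use A tm[OF f] tm[OF g] in auto)
    finally show ?thesis
      using lin_ext_superset[OF f A(1) _ A(2)] lin_ext_superset[OF g A(1) _ A(2)] by simp
  qed
  show "lin_ext R N \<psi> (a \<odot>\<^bsub>free_module R I\<^esub> f) = a \<odot>\<^bsub>N\<^esub> lin_ext R N \<psi> f"
    if a: "a \<in> carrier R" and f: "f \<in> carrier (free_module R I)" for f a
  proof -
    let ?A = "{i. f i \<noteq> \<zero>\<^bsub>R\<^esub>}"
    have A: "finite ?A" "?A \<subseteq> I" using D[OF f] by auto
    have s: "{i. (a \<odot>\<^bsub>free_module R I\<^esub> f) i \<noteq> \<zero>\<^bsub>R\<^esub>} \<subseteq> ?A"
      using a by (auto simp: free_module_simps)
    have "lin_ext R N \<psi> (a \<odot>\<^bsub>free_module R I\<^esub> f)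
        = finsum N (\<lambda>i. (a \<odot>\<^bsub>free_module R I\<^esub> f) i \<odot>\<^bsub>N\<^esub> \<psi> i) ?A"
      by (rule lin_ext_superset[OF F.smult_closed[OF a f] A(1) s A(2)])
    also have "\<dots> = finsum N (\<lambda>i. a \<odot>\<^bsub>N\<^esub> (f i \<odot>\<^bsub>N\<^esub> \<psi> i)) ?A"
      by (rule N.finsum_cong')
         (use A a tm[OF f] D(1)[OF f] \<psi> in \<open>auto simp: free_module_simps(4) N.smult_assoc1 Pi_def subset_iff\<close>)
    also have "\<dots> = a \<odot>\<^bsub>N\<^esub> lin_ext R N \<psi> f"
    proof -
      have lin: "linear_on R N N (\<lambda>x. a \<odot>\<^bsub>N\<^esub> x)"
        by (rule linear_onI) (use a in \<open>auto simp: N.smult_r_distr N.smult_assoc1[symmetric] N.m_comm\<close>)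
      show ?thesis unfolding lin_ext_def
        by (rule linear_on_finsum[OF N N lin, symmetric]) (use A tm[OF f] in auto)
    qed
    finally show ?thesis .
  qed
qed

end

subsection \<open>Monoid algebras\<close>

lemma add_monoid_simps:
  "carrier (add_monoid A) = carrier A" "one (add_monoid A) = zero A"
  "monoid.mult (add_monoid A) = add A" "m_inv (add_monoid A) = a_inv A"
  by (simp_all add: a_inv_def)

text \<open>Scalars are central. The two compatibility laws are separate because the multiplication
  of \<open>A\<close> need not commute.\<close>

locale nc_algebra = module R A + A?: ring A for R (structure) and A (structure) +
  assumes smult_mult_l: "a \<in> carrier R \<Longrightarrow> x \<in> carrier A \<Longrightarrow> y \<in> carrier A \<Longrightarrow>
      (a \<odot>\<^bsub>A\<^esub> x) \<otimes>\<^bsub>A\<^esub> y = a \<odot>\<^bsub>A\<^esub> (x \<otimes>\<^bsub>A\<^esub> y)"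
    and smult_mult_r: "a \<in> carrier R \<Longrightarrow> x \<in> carrier A \<Longrightarrow> y \<in> carrier A \<Longrightarrow>
      x \<otimes>\<^bsub>A\<^esub> (a \<odot>\<^bsub>A\<^esub> y) = a \<odot>\<^bsub>A\<^esub> (x \<otimes>\<^bsub>A\<^esub> y)"

lemma module_transfer:
  assumes "module R M" "carrier M' = carrier M" "add M' = add M" "zero M' = zero M"
    "smult M' = smult M"
  shows "module R M'"
proof -
  interpret M: module R M by fact
  show ?thesis
    by (rule moduleI[OF M.is_cring])
       (auto intro!: abelian_groupI M.add.l_inv_ex
          simp: assms(2-5) M.add.m_ac M.smult_l_distr M.smult_r_distr M.smult_assoc1)
qed

lemma monoid_algebra_simps:
  "carrier (monoid_algebra R M) = carrier (free_module R (carrier M))"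
  "zero (monoid_algebra R M) = zero (free_module R (carrier M))"
  "add (monoid_algebra R M) = add (free_module R (carrier M))"
  "smult (monoid_algebra R M) = smult (free_module R (carrier M))"
  "one (monoid_algebra R M) = basis_vec R \<one>\<^bsub>M\<^esub>"
  by (simp_all add: monoid_algebra_def)

lemma monoid_algebra_module:
  assumes "cring R" shows "module R (monoid_algebra R M)"
  by (rule module_transfer[OF free_module_module[OF assms]]) (simp_all add: monoid_algebra_simps)

context
  fixes R :: "('r, 'k) ring_scheme" and M :: "('i, 'l) monoid_scheme"
  assumes R: "cring R" and M: "monoid M"
begin

interpretation R: cring R by (rule R)
interpretation M: monoid M by (rule M)

abbreviation (input) "MA \<equiv> monoid_algebra R M"

interpretation A: module R MA by (rule monoid_algebra_module[OF R])

text \<open>In the definition the set of pairs depends on \<open>f\<close>, \<open>g\<close> and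
  \<open>x\<close>. Padding with zeros to a fixed rectangle \<open>A \<times> B\<close> makes the
  coefficient visibly additive in each factor.\<close>

lemma monoid_algebra_mult_eval:
  assumes f: "f \<in> carrier MA" and g: "g \<in> carrier MA"
    and A: "finite A" "{i. f i \<noteq> \<zero>\<^bsub>R\<^esub>} \<subseteq> A" "A \<subseteq> carrier M"
    and B: "finite B" "{i. g i \<noteq> \<zero>\<^bsub>R\<^esub>} \<subseteq> B" "B \<subseteq> carrier M"
  shows "(f \<otimes>\<^bsub>MA\<^esub> g) x = (\<Oplus>\<^bsub>R\<^esub>p\<in>A \<times> B. if fst p \<otimes>\<^bsub>M\<^esub> snd p = x then f (fst p) \<otimes>\<^bsub>R\<^esub> g (snd p) else \<zero>\<^bsub>R\<^esub>)"
proof -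
  note fc = free_moduleD(1)[OF R f[unfolded monoid_algebra_simps]] free_moduleD(1)[OF R g[unfolded monoid_algebra_simps]]
  show ?thesis unfolding monoid_algebra_def
    by simp (rule R.add.finprod_mono_neutral_cong_left, use A B fc in \<open>auto\<close>)
qed

lemma monoid_algebra_mult_closed:
  assumes f: "f \<in> carrier MA" and g: "g \<in> carrier MA"
  shows "f \<otimes>\<^bsub>MA\<^esub> g \<in> carrier MA"
proof -
  let ?A = "{i. f i \<noteq> \<zero>\<^bsub>R\<^esub>}" and ?B = "{i. g i \<noteq> \<zero>\<^bsub>R\<^esub>}"
  note Df = free_moduleD[OF R f[unfolded monoid_algebra_simps]]
  note Dg = free_moduleD[OF R g[unfolded monoid_algebra_simps]]
  have ev: "(f \<otimes>\<^bsub>MA\<^esub> g) x = (\<Oplus>\<^bsub>R\<^esub>p\<in>?A \<times> ?B. if fst p \<otimes>\<^bsub>M\<^esub> snd p = x then f (fst p) \<otimes>\<^bsub>R\<^esub> g (snd p) else \<zero>\<^bsub>R\<^esub>)" for x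
    by (rule monoid_algebra_mult_eval[OF f g]) (use Df Dg in auto)
  show ?thesis unfolding monoid_algebra_simps
  proof (rule free_moduleI[of _ _ "(\<lambda>p. fst p \<otimes>\<^bsub>M\<^esub> snd p) ` (?A \<times> ?B)"])
    show "(f \<otimes>\<^bsub>MA\<^esub> g) i \<in> carrier R" for i
      unfolding ev by (rule R.finsum_closed) (use Df Dg in auto)
    show "(f \<otimes>\<^bsub>MA\<^esub> g) i = \<zero>\<^bsub>R\<^esub>" if "i \<notin> (\<lambda>p. fst p \<otimes>\<^bsub>M\<^esub> snd p) ` (?A \<times> ?B)" for i
      unfolding ev by (rule R.add.finprod_one_eqI) (use that in auto)
    show "(\<lambda>p. fst p \<otimes>\<^bsub>M\<^esub> snd p) ` (?A \<times> ?B) \<subseteq> carrier M"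
      using subsetD[OF Df(3)] subsetD[OF Dg(3)] by auto
  qed (use Df Dg in auto)
qed

lemma monoid_algebra_basis_mult:
  assumes "y \<in> carrier M" "z \<in> carrier M"
  shows "basis_vec R y \<otimes>\<^bsub>MA\<^esub> basis_vec R z = basis_vec R (y \<otimes>\<^bsub>M\<^esub> z)"
proof
  fix x
  have b: "basis_vec R y \<in> carrier MA" "basis_vec R z \<in> carrier MA"
    by (simp_all add: monoid_algebra_simps basis_vec_closed[OF R] assms)
  have "(basis_vec R y \<otimes>\<^bsub>MA\<^esub> basis_vec R z) x = (\<Oplus>\<^bsub>R\<^esub>p\<in>{y} \<times> {z}. if fst p \<otimes>\<^bsub>M\<^esub> snd p = x
      then basis_vec R y (fst p) \<otimes>\<^bsub>R\<^esub> basis_vec R z (snd p) else \<zero>\<^bsub>R\<^esub>)"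
    by (rule monoid_algebra_mult_eval[OF b]) (use assms in \<open>auto simp: basis_vec_def\<close>)
  then show "(basis_vec R y \<otimes>\<^bsub>MA\<^esub> basis_vec R z) x = basis_vec R (y \<otimes>\<^bsub>M\<^esub> z) x"
    by (auto simp: basis_vec_def)
qed

lemma monoid_algebra_mult_linear_l:
  assumes g: "g \<in> carrier MA"
  shows "linear_on R MA MA (\<lambda>f. f \<otimes>\<^bsub>MA\<^esub> g)"
proof (rule linear_onI)
  note D = free_moduleD[OF R, where I = "carrier M", folded monoid_algebra_simps(1)[of R M]]
  let ?B = "{i. g i \<noteq> \<zero>\<^bsub>R\<^esub>}"
  note ev = monoid_algebra_mult_eval[OF _ g, where B = ?B, OF _ _ _ _ D(2)[OF g] subset_refl D(3)[OF g]]
  show "f \<otimes>\<^bsub>MA\<^esub> g \<in> carrier MA" if "f \<in> carrier MA" for f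
    using monoid_algebra_mult_closed[OF that g] .
  show "(f \<oplus>\<^bsub>MA\<^esub> f') \<otimes>\<^bsub>MA\<^esub> g = (f \<otimes>\<^bsub>MA\<^esub> g) \<oplus>\<^bsub>MA\<^esub> (f' \<otimes>\<^bsub>MA\<^esub> g)"
    if f: "f \<in> carrier MA" and f': "f' \<in> carrier MA" for f f'
  proof
    fix x
    let ?A = "{i. f i \<noteq> \<zero>\<^bsub>R\<^esub>} \<union> {i. f' i \<noteq> \<zero>\<^bsub>R\<^esub>}"
    have A: "finite ?A" "?A \<subseteq> carrier M" using D(2,3)[OF f] D(2,3)[OF f'] by auto
    have s: "{i. (f \<oplus>\<^bsub>MA\<^esub> f') i \<noteq> \<zero>\<^bsub>R\<^esub>} \<subseteq> ?A"
      by (auto simp: monoid_algebra_simps free_module_simps)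
    have cl: "(if fst p \<otimes>\<^bsub>M\<^esub> snd p = x then h (fst p) \<otimes>\<^bsub>R\<^esub> g (snd p) else \<zero>\<^bsub>R\<^esub>) \<in> carrier R"
      if "h \<in> carrier MA" for p h using D(1)[OF that] D(1)[OF g] by auto
    have "((f \<oplus>\<^bsub>MA\<^esub> f') \<otimes>\<^bsub>MA\<^esub> g) x = (\<Oplus>\<^bsub>R\<^esub>p\<in>?A \<times> ?B.
       if fst p \<otimes>\<^bsub>M\<^esub> snd p = x then (f \<oplus>\<^bsub>MA\<^esub> f') (fst p) \<otimes>\<^bsub>R\<^esub> g (snd p) else \<zero>\<^bsub>R\<^esub>)"
      by (rule ev) (use A s f f' in auto)
    also have "\<dots> = (\<Oplus>\<^bsub>R\<^esub>p\<in>?A \<times> ?B.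
       (if fst p \<otimes>\<^bsub>M\<^esub> snd p = x then f (fst p) \<otimes>\<^bsub>R\<^esub> g (snd p) else \<zero>\<^bsub>R\<^esub>) \<oplus>\<^bsub>R\<^esub>
       (if fst p \<otimes>\<^bsub>M\<^esub> snd p = x then f' (fst p) \<otimes>\<^bsub>R\<^esub> g (snd p) else \<zero>\<^bsub>R\<^esub>))"
      by (rule R.finsum_cong')
         (use D(1)[OF f] D(1)[OF f'] D(1)[OF g] in \<open>auto simp: monoid_algebra_simps free_module_simps R.l_distr\<close>)
    also have "\<dots> = (\<Oplus>\<^bsub>R\<^esub>p\<in>?A \<times> ?B. if fst p \<otimes>\<^bsub>M\<^esub> snd p = x then f (fst p) \<otimes>\<^bsub>R\<^esub> g (snd p) else \<zero>\<^bsub>R\<^esub>) \<oplus>\<^bsub>R\<^esub>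
        (\<Oplus>\<^bsub>R\<^esub>p\<in>?A \<times> ?B. if fst p \<otimes>\<^bsub>M\<^esub> snd p = x then f' (fst p) \<otimes>\<^bsub>R\<^esub> g (snd p) else \<zero>\<^bsub>R\<^esub>)"
      by (rule R.finsum_addf) (use cl[OF f] cl[OF f'] in auto)
    also have "\<dots> = (f \<otimes>\<^bsub>MA\<^esub> g) x \<oplus>\<^bsub>R\<^esub> (f' \<otimes>\<^bsub>MA\<^esub> g) x"
      using ev[OF f A(1) _ A(2), of x] ev[OF f' A(1) _ A(2), of x] by simp
    finally show "((f \<oplus>\<^bsub>MA\<^esub> f') \<otimes>\<^bsub>MA\<^esub> g) x = ((f \<otimes>\<^bsub>MA\<^esub> g) \<oplus>\<^bsub>MA\<^esub> (f' \<otimes>\<^bsub>MA\<^esub> g)) x"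
      by (simp add: monoid_algebra_simps free_module_simps)
  qed
  show "(a \<odot>\<^bsub>MA\<^esub> f) \<otimes>\<^bsub>MA\<^esub> g = a \<odot>\<^bsub>MA\<^esub> (f \<otimes>\<^bsub>MA\<^esub> g)" if a: "a \<in> carrier R" and f: "f \<in> carrier MA" for a f
  proof
    fix x
    let ?A = "{i. f i \<noteq> \<zero>\<^bsub>R\<^esub>}"
    have A: "finite ?A" "?A \<subseteq> carrier M" using D(2,3)[OF f] by auto
    have s: "{i. (a \<odot>\<^bsub>MA\<^esub> f) i \<noteq> \<zero>\<^bsub>R\<^esub>} \<subseteq> ?A"
      using a by (auto simp: monoid_algebra_simps free_module_simps)
    have "((a \<odot>\<^bsub>MA\<^esub> f) \<otimes>\<^bsub>MA\<^esub> g) x = (\<Oplus>\<^bsub>R\<^esub>p\<in>?A \<times> ?B.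
       if fst p \<otimes>\<^bsub>M\<^esub> snd p = x then (a \<odot>\<^bsub>MA\<^esub> f) (fst p) \<otimes>\<^bsub>R\<^esub> g (snd p) else \<zero>\<^bsub>R\<^esub>)"
      by (rule ev) (use A s a f in auto)
    also have "\<dots> = (\<Oplus>\<^bsub>R\<^esub>p\<in>?A \<times> ?B.
       a \<otimes>\<^bsub>R\<^esub> (if fst p \<otimes>\<^bsub>M\<^esub> snd p = x then f (fst p) \<otimes>\<^bsub>R\<^esub> g (snd p) else \<zero>\<^bsub>R\<^esub>))"
      by (rule R.finsum_cong')
         (use a D(1)[OF f] D(1)[OF g] in \<open>auto simp: monoid_algebra_simps free_module_simps R.m_assoc\<close>)
    also have "\<dots> = a \<otimes>\<^bsub>R\<^esub> (\<Oplus>\<^bsub>R\<^esub>p\<in>?A \<times> ?B. if fst p \<otimes>\<^bsub>M\<^esub> snd p = x then f (fst p) \<otimes>\<^bsub>R\<^esub> g (snd p) else \<zero>\<^bsub>R\<^esub>)"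
      by (rule R.finsum_rdistr[symmetric]) (use a A D(2)[OF g] D(1)[OF f] D(1)[OF g] in auto)
    also have "\<dots> = a \<otimes>\<^bsub>R\<^esub> (f \<otimes>\<^bsub>MA\<^esub> g) x"
      using ev[OF f A(1) _ A(2), of x] by simp
    finally show "((a \<odot>\<^bsub>MA\<^esub> f) \<otimes>\<^bsub>MA\<^esub> g) x = (a \<odot>\<^bsub>MA\<^esub> (f \<otimes>\<^bsub>MA\<^esub> g)) x"
      by (simp add: monoid_algebra_simps free_module_simps)
  qed
qed

lemma monoid_algebra_mult_linear_r:
  assumes f: "f \<in> carrier MA"
  shows "linear_on R MA MA (\<lambda>g. f \<otimes>\<^bsub>MA\<^esub> g)"
proof (rule linear_onI)
  note D = free_moduleD[OF R, where I = "carrier M", folded monoid_algebra_simps(1)[of R M]]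
  let ?A = "{i. f i \<noteq> \<zero>\<^bsub>R\<^esub>}"
  note ev = monoid_algebra_mult_eval[OF f _ D(2)[OF f] subset_refl D(3)[OF f]]
  show "f \<otimes>\<^bsub>MA\<^esub> g \<in> carrier MA" if "g \<in> carrier MA" for g
    using monoid_algebra_mult_closed[OF f that] .
  show "f \<otimes>\<^bsub>MA\<^esub> (g \<oplus>\<^bsub>MA\<^esub> g') = (f \<otimes>\<^bsub>MA\<^esub> g) \<oplus>\<^bsub>MA\<^esub> (f \<otimes>\<^bsub>MA\<^esub> g')"
    if g: "g \<in> carrier MA" and g': "g' \<in> carrier MA" for g g'
  proof
    fix x
    let ?B = "{i. g i \<noteq> \<zero>\<^bsub>R\<^esub>} \<union> {i. g' i \<noteq> \<zero>\<^bsub>R\<^esub>}"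
    have B: "finite ?B" "?B \<subseteq> carrier M" using D(2,3)[OF g] D(2,3)[OF g'] by auto
    have s: "{i. (g \<oplus>\<^bsub>MA\<^esub> g') i \<noteq> \<zero>\<^bsub>R\<^esub>} \<subseteq> ?B"
      by (auto simp: monoid_algebra_simps free_module_simps)
    have cl: "(if fst p \<otimes>\<^bsub>M\<^esub> snd p = x then f (fst p) \<otimes>\<^bsub>R\<^esub> h (snd p) else \<zero>\<^bsub>R\<^esub>) \<in> carrier R"
      if "h \<in> carrier MA" for p h using D(1)[OF that] D(1)[OF f] by auto
    have "(f \<otimes>\<^bsub>MA\<^esub> (g \<oplus>\<^bsub>MA\<^esub> g')) x = (\<Oplus>\<^bsub>R\<^esub>p\<in>?A \<times> ?B.
       if fst p \<otimes>\<^bsub>M\<^esub> snd p = x then f (fst p) \<otimes>\<^bsub>R\<^esub> (g \<oplus>\<^bsub>MA\<^esub> g') (snd p) else \<zero>\<^bsub>R\<^esub>)"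
      by (rule ev) (use B s g g' in auto)
    also have "\<dots> = (\<Oplus>\<^bsub>R\<^esub>p\<in>?A \<times> ?B.
       (if fst p \<otimes>\<^bsub>M\<^esub> snd p = x then f (fst p) \<otimes>\<^bsub>R\<^esub> g (snd p) else \<zero>\<^bsub>R\<^esub>) \<oplus>\<^bsub>R\<^esub>
       (if fst p \<otimes>\<^bsub>M\<^esub> snd p = x then f (fst p) \<otimes>\<^bsub>R\<^esub> g' (snd p) else \<zero>\<^bsub>R\<^esub>))"
      by (rule R.finsum_cong')
         (use D(1)[OF f] D(1)[OF g'] D(1)[OF g] in \<open>auto simp: monoid_algebra_simps free_module_simps R.r_distr\<close>)
    also have "\<dots> = (\<Oplus>\<^bsub>R\<^esub>p\<in>?A \<times> ?B. if fst p \<otimes>\<^bsub>M\<^esub> snd p = x then f (fst p) \<otimes>\<^bsub>R\<^esub> g (snd p) else \<zero>\<^bsub>R\<^esub>) \<oplus>\<^bsub>R\<^esub>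
        (\<Oplus>\<^bsub>R\<^esub>p\<in>?A \<times> ?B. if fst p \<otimes>\<^bsub>M\<^esub> snd p = x then f (fst p) \<otimes>\<^bsub>R\<^esub> g' (snd p) else \<zero>\<^bsub>R\<^esub>)"
      by (rule R.finsum_addf) (use cl[OF g] cl[OF g'] in auto)
    also have "\<dots> = (f \<otimes>\<^bsub>MA\<^esub> g) x \<oplus>\<^bsub>R\<^esub> (f \<otimes>\<^bsub>MA\<^esub> g') x"
      using ev[OF g B(1) _ B(2), of x] ev[OF g' B(1) _ B(2), of x] by simp
    finally show "(f \<otimes>\<^bsub>MA\<^esub> (g \<oplus>\<^bsub>MA\<^esub> g')) x = ((f \<otimes>\<^bsub>MA\<^esub> g) \<oplus>\<^bsub>MA\<^esub> (f \<otimes>\<^bsub>MA\<^esub> g')) x"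
      by (simp add: monoid_algebra_simps free_module_simps)
  qed
  show "f \<otimes>\<^bsub>MA\<^esub> (a \<odot>\<^bsub>MA\<^esub> g) = a \<odot>\<^bsub>MA\<^esub> (f \<otimes>\<^bsub>MA\<^esub> g)" if a: "a \<in> carrier R" and g: "g \<in> carrier MA" for a g
  proof
    fix x
    let ?B = "{i. g i \<noteq> \<zero>\<^bsub>R\<^esub>}"
    have B: "finite ?B" "?B \<subseteq> carrier M" using D(2,3)[OF g] by auto
    have s: "{i. (a \<odot>\<^bsub>MA\<^esub> g) i \<noteq> \<zero>\<^bsub>R\<^esub>} \<subseteq> ?B"
      using a by (auto simp: monoid_algebra_simps free_module_simps)
    have "(f \<otimes>\<^bsub>MA\<^esub> (a \<odot>\<^bsub>MA\<^esub> g)) x = (\<Oplus>\<^bsub>R\<^esub>p\<in>?A \<times> ?B.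
       if fst p \<otimes>\<^bsub>M\<^esub> snd p = x then f (fst p) \<otimes>\<^bsub>R\<^esub> (a \<odot>\<^bsub>MA\<^esub> g) (snd p) else \<zero>\<^bsub>R\<^esub>)"
      by (rule ev) (use B s a g in auto)
    also have "\<dots> = (\<Oplus>\<^bsub>R\<^esub>p\<in>?A \<times> ?B.
       a \<otimes>\<^bsub>R\<^esub> (if fst p \<otimes>\<^bsub>M\<^esub> snd p = x then f (fst p) \<otimes>\<^bsub>R\<^esub> g (snd p) else \<zero>\<^bsub>R\<^esub>))"
      by (rule R.finsum_cong')
         (use a D(1)[OF f] D(1)[OF g] in \<open>auto simp: monoid_algebra_simps free_module_simps R.m_lcomm\<close>)
    also have "\<dots> = a \<otimes>\<^bsub>R\<^esub> (\<Oplus>\<^bsub>R\<^esub>p\<in>?A \<times> ?B. if fst p \<otimes>\<^bsub>M\<^esub> snd p = x then f (fst p) \<otimes>\<^bsub>R\<^esub> g (snd p) else \<zero>\<^bsub>R\<^esub>)"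
      by (rule R.finsum_rdistr[symmetric]) (use a B D(2)[OF f] D(1)[OF f] D(1)[OF g] in auto)
    also have "\<dots> = a \<otimes>\<^bsub>R\<^esub> (f \<otimes>\<^bsub>MA\<^esub> g) x"
      using ev[OF g B(1) _ B(2), of x] by simp
    finally show "(f \<otimes>\<^bsub>MA\<^esub> (a \<odot>\<^bsub>MA\<^esub> g)) x = (a \<odot>\<^bsub>MA\<^esub> (f \<otimes>\<^bsub>MA\<^esub> g)) x"
      by (simp add: monoid_algebra_simps free_module_simps)
  qed
qed

lemma monoid_algebra_basis_closed: "w \<in> carrier M \<Longrightarrow> basis_vec R w \<in> carrier MA"
  using basis_vec_closed[OF R] by (simp add: monoid_algebra_simps)

lemma monoid_algebra_linear_eqI:
  assumes N: "module R N" and \<phi>: "linear_on R MA N \<phi>" and \<psi>: "linear_on R MA N \<psi>"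
    and eq: "\<And>w. w \<in> carrier M \<Longrightarrow> \<phi> (basis_vec R w) = \<psi> (basis_vec R w)"
    and x: "x \<in> carrier MA"
  shows "\<phi> x = \<psi> x"
  using R x[unfolded monoid_algebra_simps]
proof (induction rule: free_module_induct)
  case zero
  then show ?case
    using linear_on_zero[OF A.module_axioms N \<phi>] linear_on_zero[OF A.module_axioms N \<psi>]
    by (simp add: monoid_algebra_simps free_module_simps)
next
  case (add f g)
  then show ?case
    using linear_onD(2)[OF \<phi>, of f g] linear_onD(2)[OF \<psi>, of f g] by (simp add: monoid_algebra_simps)
next
  case (smult a i)
  then show ?case
    using linear_onD(3)[OF \<phi>, of a "basis_vec R i"] linear_onD(3)[OF \<psi>, of a "basis_vec R i"] eq
      basis_vec_closed[OF R smult(2)] by (simp add: monoid_algebra_simps)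
qed

text \<open>Associativity holds on basis vectors because \<open>M\<close> is a monoid, and is
  extended by linearity one argument at a time: first the third, then the second, then the
  first.\<close>

lemma monoid_algebra_nc_algebra: "nc_algebra R MA"
proof -
  note L = monoid_algebra_mult_linear_l and RR = monoid_algebra_mult_linear_r
    and cl = monoid_algebra_mult_closed and b = monoid_algebra_basis_closed
  note eqI = monoid_algebra_linear_eqI[OF A.module_axioms]
  have id: "linear_on R MA MA (\<lambda>f. f)" by (rule linear_onI) auto
  have one: "\<one>\<^bsub>MA\<^esub> \<in> carrier MA" using b by (simp add: monoid_algebra_simps(5))
  have assoc1: "(basis_vec R x \<otimes>\<^bsub>MA\<^esub> basis_vec R y) \<otimes>\<^bsub>MA\<^esub> h = basis_vec R x \<otimes>\<^bsub>MA\<^esub> (basis_vec R y \<otimes>\<^bsub>MA\<^esub> h)"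
    if "x \<in> carrier M" "y \<in> carrier M" "h \<in> carrier MA" for x y h
    by (rule eqI[OF RR linear_on_comp[OF RR RR] _ that(3)])
       (use that b cl in \<open>auto simp: monoid_algebra_basis_mult M.m_assoc\<close>)
  have assoc2: "(basis_vec R x \<otimes>\<^bsub>MA\<^esub> g) \<otimes>\<^bsub>MA\<^esub> h = basis_vec R x \<otimes>\<^bsub>MA\<^esub> (g \<otimes>\<^bsub>MA\<^esub> h)"
    if "x \<in> carrier M" "g \<in> carrier MA" "h \<in> carrier MA" for x g h
    by (rule eqI[OF linear_on_comp[OF RR L] linear_on_comp[OF L RR] _ that(2)])
       (use that b cl assoc1 in auto)
  have assoc: "(f \<otimes>\<^bsub>MA\<^esub> g) \<otimes>\<^bsub>MA\<^esub> h = f \<otimes>\<^bsub>MA\<^esub> (g \<otimes>\<^bsub>MA\<^esub> h)"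
    if "f \<in> carrier MA" "g \<in> carrier MA" "h \<in> carrier MA" for f g h
    by (rule eqI[OF linear_on_comp[OF L L] L _ that(1)])
       (use that b cl assoc2 in auto)
  have mon: "monoid MA"
  proof (rule monoidI)
    show "\<one>\<^bsub>MA\<^esub> \<otimes>\<^bsub>MA\<^esub> f = f" if f: "f \<in> carrier MA" for f
      by (rule eqI[OF RR[OF one] id _ f]) (auto simp: monoid_algebra_simps(5) monoid_algebra_basis_mult)
    show "f \<otimes>\<^bsub>MA\<^esub> \<one>\<^bsub>MA\<^esub> = f" if f: "f \<in> carrier MA" for f
      by (rule eqI[OF L[OF one] id _ f]) (auto simp: monoid_algebra_simps(5) monoid_algebra_basis_mult)
  qed (use cl one assoc in auto)
  have ring: "ring MA"
    by (rule ringI[OF A.abelian_group_axioms mon]) (use linear_onD(2)[OF L] linear_onD(2)[OF RR] in auto)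
  show ?thesis
    by (rule nc_algebra.intro[OF A.module_axioms ring])
       (unfold_locales, use linear_onD(3)[OF L] linear_onD(3)[OF RR] in auto)
qed

text \<open>The elements x with \<phi>(p x q) = 0 for all p and q form an ideal \<open>J\<close> in
  the kernel of \<phi>. By bilinearity in p and q, membership of \<open>S\<close> in
  \<open>J\<close> need only be tested on basis vectors, that is, on monoid elements placed on
  either side.\<close>

lemma genideal_linear_zero:
  assumes N: "module R N" and \<phi>: "linear_on R MA N \<phi>" and S: "S \<subseteq> carrier MA"
    and zero: "\<And>p q s. p \<in> carrier M \<Longrightarrow> q \<in> carrier M \<Longrightarrow> s \<in> S \<Longrightarrow>
      \<phi> (basis_vec R p \<otimes>\<^bsub>MA\<^esub> s \<otimes>\<^bsub>MA\<^esub> basis_vec R q) = \<zero>\<^bsub>N\<^esub>"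
    and x: "x \<in> Idl\<^bsub>MA\<^esub> S"
  shows "\<phi> x = \<zero>\<^bsub>N\<^esub>"
proof -
  interpret MA: nc_algebra R MA by (rule monoid_algebra_nc_algebra)
  interpret N: module R N by (rule N)
  note L = monoid_algebra_mult_linear_l and RR = monoid_algebra_mult_linear_r
    and b = monoid_algebra_basis_closed
  have z0: "linear_on R MA N (\<lambda>f. \<zero>\<^bsub>N\<^esub>)" by (rule linear_onI) auto
  note \<phi>0 = linear_on_zero[OF A.module_axioms N \<phi>]
  define J where "J = {x \<in> carrier MA. \<forall>p\<in>carrier MA. \<forall>q\<in>carrier MA. \<phi> (p \<otimes>\<^bsub>MA\<^esub> x \<otimes>\<^bsub>MA\<^esub> q) = \<zero>\<^bsub>N\<^esub>}"
  have "ideal J MA"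
  proof (rule idealI)
    show "ring MA" by unfold_locales
    show "subgroup J (add_monoid MA)"
    proof (rule group.subgroupI[OF A.a_group], unfold add_monoid_simps)
      show "\<ominus>\<^bsub>MA\<^esub> a \<in> J" if "a \<in> J" for a
        using that linear_on_uminus[OF A.module_axioms N \<phi>]
        by (auto simp: J_def MA.l_minus MA.r_minus)
      show "a \<oplus>\<^bsub>MA\<^esub> b \<in> J" if "a \<in> J" "b \<in> J" for a b
        using that linear_onD(2)[OF \<phi>] by (auto simp: J_def MA.l_distr MA.r_distr)
      have "\<zero>\<^bsub>MA\<^esub> \<in> J" using \<phi>0 by (auto simp: J_def)
      then show "J \<noteq> {}" by auto
    qed (auto simp: J_def)
    show "y \<otimes>\<^bsub>MA\<^esub> a \<in> J" if "a \<in> J" "y \<in> carrier MA" for a y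
    proof -
      have "p \<otimes>\<^bsub>MA\<^esub> (y \<otimes>\<^bsub>MA\<^esub> a) \<otimes>\<^bsub>MA\<^esub> q = p \<otimes>\<^bsub>MA\<^esub> y \<otimes>\<^bsub>MA\<^esub> a \<otimes>\<^bsub>MA\<^esub> q"
        if "p \<in> carrier MA" "q \<in> carrier MA" for p q
        using that \<open>a \<in> J\<close> \<open>y \<in> carrier MA\<close> by (simp add: J_def MA.m_assoc)
      then show ?thesis using that by (simp add: J_def)
    qed
    show "a \<otimes>\<^bsub>MA\<^esub> y \<in> J" if "a \<in> J" "y \<in> carrier MA" for a y
    proof -
      have "p \<otimes>\<^bsub>MA\<^esub> (a \<otimes>\<^bsub>MA\<^esub> y) \<otimes>\<^bsub>MA\<^esub> q = p \<otimes>\<^bsub>MA\<^esub> a \<otimes>\<^bsub>MA\<^esub> (y \<otimes>\<^bsub>MA\<^esub> q)"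
        if "p \<in> carrier MA" "q \<in> carrier MA" for p q
        using that \<open>a \<in> J\<close> \<open>y \<in> carrier MA\<close> by (simp add: J_def MA.m_assoc)
      then show ?thesis using that by (simp add: J_def)
    qed
  qed
  moreover have "S \<subseteq> J"
  proof
    fix s assume s: "s \<in> S"
    then have sc: "s \<in> carrier MA" using S by auto
    have 1: "\<phi> (basis_vec R p \<otimes>\<^bsub>MA\<^esub> s \<otimes>\<^bsub>MA\<^esub> q) = \<zero>\<^bsub>N\<^esub>" if "p \<in> carrier M" "q \<in> carrier MA" for p q
      by (rule monoid_algebra_linear_eqI[OF N linear_on_comp[OF RR \<phi>] z0 _ that(2)])
         (use that sc b zero s in auto)
    have "\<phi> (p \<otimes>\<^bsub>MA\<^esub> s \<otimes>\<^bsub>MA\<^esub> q) = \<zero>\<^bsub>N\<^esub>" if "p \<in> carrier MA" "q \<in> carrier MA" for p q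
      by (rule monoid_algebra_linear_eqI[OF N linear_on_comp[OF linear_on_comp[OF L L] \<phi>] z0 _ that(1)])
         (use that sc b 1 in auto)
    then show "s \<in> J" using sc unfolding J_def by auto
  qed
  ultimately have "x \<in> J" using MA.genideal_minimal x by blast
  then have xc: "x \<in> carrier MA" and "\<phi> (\<one>\<^bsub>MA\<^esub> \<otimes>\<^bsub>MA\<^esub> x \<otimes>\<^bsub>MA\<^esub> \<one>\<^bsub>MA\<^esub>) = \<zero>\<^bsub>N\<^esub>"
    unfolding J_def by blast+
  then show ?thesis by simp
qed

end

subsection \<open>Quotient algebras\<close>

lemma quotient_algebra_simps:
  "carrier (quotient_algebra A I) = a_rcosets\<^bsub>A\<^esub> I"
  "monoid.mult (quotient_algebra A I) = rcoset_mult A I"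
  "one (quotient_algebra A I) = I +>\<^bsub>A\<^esub> \<one>\<^bsub>A\<^esub>"
  "zero (quotient_algebra A I) = I"
  "add (quotient_algebra A I) = set_add A"
  "smult (quotient_algebra A I) = (\<lambda>a X. \<Union>x\<in>X. I +>\<^bsub>A\<^esub> (a \<odot>\<^bsub>A\<^esub> x))"
  by (simp_all add: quotient_algebra_def FactRing_def ring.extend_def module.fields_def)

lemma ring_transfer:
  assumes "ring M" "carrier M' = carrier M" "add M' = add M" "zero M' = zero M"
    "monoid.mult M' = monoid.mult M" "one M' = one M"
  shows "ring M'"
proof -
  interpret M: ring M by fact
  show ?thesis
    by (rule ringI)
       (auto intro!: abelian_groupI monoidI M.add.l_inv_ex
          simp: assms(2-6) M.add.m_ac M.l_distr M.r_distr M.m_assoc)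
qed

context nc_algebra
begin

text \<open>The scalar \<open>a\<close> acts as left multiplication by the element a 1 of the
  algebra, so an ideal of the ring is automatically a submodule.\<close>

lemma ideal_smult_closed:
  assumes "ideal I A" "a \<in> carrier R" "x \<in> I"
  shows "a \<odot>\<^bsub>A\<^esub> x \<in> I"
proof -
  interpret I: ideal I A by fact
  have x: "x \<in> carrier A" using assms(3) by (rule I.Icarr)
  have "a \<odot>\<^bsub>A\<^esub> x = (a \<odot>\<^bsub>A\<^esub> \<one>\<^bsub>A\<^esub>) \<otimes>\<^bsub>A\<^esub> x" using assms(2) x by (simp add: smult_mult_l)
  then show ?thesis using I.I_l_closed[OF assms(3)] assms(2) by simp
qed

lemma quotient_eq_iff:
  assumes "ideal I A" "x \<in> carrier A" "y \<in> carrier A"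
  shows "I +>\<^bsub>A\<^esub> x = I +>\<^bsub>A\<^esub> y \<longleftrightarrow> x \<ominus>\<^bsub>A\<^esub> y \<in> I"
  using quotient_eq_iff_same_a_r_cos[OF assms] by simp

lemma quotient_carrier:
  "carrier (quotient_algebra A I) = (\<lambda>x. I +>\<^bsub>A\<^esub> x) ` carrier A"
  unfolding quotient_algebra_simps A_RCOSETS_def' by (auto simp: a_r_coset_def')

lemma quotient_ops:
  assumes I: "ideal I A" and x: "x \<in> carrier A" and y: "y \<in> carrier A" and a: "a \<in> carrier R"
  shows "(I +>\<^bsub>A\<^esub> x) \<oplus>\<^bsub>quotient_algebra A I\<^esub> (I +>\<^bsub>A\<^esub> y) = I +>\<^bsub>A\<^esub> (x \<oplus>\<^bsub>A\<^esub> y)"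
    and "(I +>\<^bsub>A\<^esub> x) \<otimes>\<^bsub>quotient_algebra A I\<^esub> (I +>\<^bsub>A\<^esub> y) = I +>\<^bsub>A\<^esub> (x \<otimes>\<^bsub>A\<^esub> y)"
    and "a \<odot>\<^bsub>quotient_algebra A I\<^esub> (I +>\<^bsub>A\<^esub> x) = I +>\<^bsub>A\<^esub> (a \<odot>\<^bsub>A\<^esub> x)"
proof -
  interpret I: ideal I A by fact
  show "(I +>\<^bsub>A\<^esub> x) \<oplus>\<^bsub>quotient_algebra A I\<^esub> (I +>\<^bsub>A\<^esub> y) = I +>\<^bsub>A\<^esub> (x \<oplus>\<^bsub>A\<^esub> y)"
    using I.a_rcos_sum[OF x y] by (simp add: quotient_algebra_simps)
  show "(I +>\<^bsub>A\<^esub> x) \<otimes>\<^bsub>quotient_algebra A I\<^esub> (I +>\<^bsub>A\<^esub> y) = I +>\<^bsub>A\<^esub> (x \<otimes>\<^bsub>A\<^esub> y)"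
    using I.rcoset_mult_add[OF x y] by (simp add: quotient_algebra_simps)
  \<comment> \<open>The scalar multiple in \<open>quotient_algebra\<close> is a union over all
    representatives of the coset; they all yield the same coset because the ideal is closed under
    scalars.\<close>
  have "I +>\<^bsub>A\<^esub> (a \<odot>\<^bsub>A\<^esub> z) = I +>\<^bsub>A\<^esub> (a \<odot>\<^bsub>A\<^esub> x)" if z: "z \<in> I +>\<^bsub>A\<^esub> x" for z
  proof -
    obtain h where h: "h \<in> I" "z = h \<oplus>\<^bsub>A\<^esub> x" using z by (auto simp: a_r_coset_def')
    have hc: "h \<in> carrier A" using h I.Icarr by auto
    have "(a \<odot>\<^bsub>A\<^esub> z) \<ominus>\<^bsub>A\<^esub> (a \<odot>\<^bsub>A\<^esub> x) = a \<odot>\<^bsub>A\<^esub> h"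
      using hc x a by (simp add: h(2) smult_r_distr a_minus_def M.add.m_assoc M.r_neg)
    then show ?thesis
      using quotient_eq_iff[OF I, of "a \<odot>\<^bsub>A\<^esub> z" "a \<odot>\<^bsub>A\<^esub> x"] ideal_smult_closed[OF I a h(1)] h(2) hc x a
      by simp
  qed
  moreover have "x \<in> I +>\<^bsub>A\<^esub> x" using I.a_rcos_self[OF x] .
  ultimately show "a \<odot>\<^bsub>quotient_algebra A I\<^esub> (I +>\<^bsub>A\<^esub> x) = I +>\<^bsub>A\<^esub> (a \<odot>\<^bsub>A\<^esub> x)"
    unfolding quotient_algebra_simps by blast
qed

lemma quotient_nc_algebra:
  assumes I: "ideal I A"
  shows "nc_algebra R (quotient_algebra A I)"
proof -
  interpret I: ideal I A by fact
  let ?Q = "quotient_algebra A I"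
  note ops = quotient_ops[OF I]
  have ring: "ring ?Q"
    by (rule ring_transfer[OF I.quotient_is_ring]) (simp_all add: quotient_algebra_simps FactRing_def)
  interpret Q: ring ?Q by (rule ring)
  note one = R.one_closed
  have mod: "module R ?Q"
    by (rule moduleI[OF is_cring Q.abelian_group_axioms])
       (auto simp: quotient_carrier ops[OF _ _ one] ops(3)[OF _ _] ops(1)[OF _ _ one]
          smult_l_distr smult_r_distr smult_assoc1)
  show ?thesis
    by (rule nc_algebra.intro[OF mod ring], unfold_locales)
       (auto simp: quotient_carrier ops(2)[OF _ _ one] ops(3) smult_mult_l smult_mult_r)
qed

lemma quotient_linear:
  assumes I: "ideal I A" and N: "module R N" and \<phi>: "linear_on R A N \<phi>"
    and zero: "\<And>x. x \<in> I \<Longrightarrow> \<phi> x = \<zero>\<^bsub>N\<^esub>"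
  obtains \<psi> where "linear_on R (quotient_algebra A I) N \<psi>"
    "\<And>x. x \<in> carrier A \<Longrightarrow> \<psi> (I +>\<^bsub>A\<^esub> x) = \<phi> x"
proof -
  interpret I: ideal I A by fact
  interpret N: module R N by (rule N)
  define \<psi> where "\<psi> = (\<lambda>X. \<phi> (SOME x. x \<in> carrier A \<and> I +>\<^bsub>A\<^esub> x = X))"
  have \<psi>: "\<psi> (I +>\<^bsub>A\<^esub> x) = \<phi> x" if x: "x \<in> carrier A" for x
  proof -
    define y where "y = (SOME y. y \<in> carrier A \<and> I +>\<^bsub>A\<^esub> y = I +>\<^bsub>A\<^esub> x)"
    have y: "y \<in> carrier A \<and> I +>\<^bsub>A\<^esub> y = I +>\<^bsub>A\<^esub> x"
      unfolding y_def by (rule someI[of _ x]) (use x in auto)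
    then have "\<phi> (y \<ominus>\<^bsub>A\<^esub> x) = \<zero>\<^bsub>N\<^esub>" using quotient_eq_iff[OF I, of y x] x zero by auto
    then have "\<phi> y \<ominus>\<^bsub>N\<^esub> \<phi> x = \<zero>\<^bsub>N\<^esub>" using linear_on_minus[OF module_axioms N \<phi>] x y by simp
    then have "\<phi> y = \<phi> x" using linear_onD(1)[OF \<phi>] x y
      by (metis N.add.inv_closed N.minus_equality N.minus_minus a_minus_def)
    then show ?thesis by (simp add: \<psi>_def y_def)
  qed
  have "linear_on R (quotient_algebra A I) N \<psi>"
    by (rule linear_onI)
       (auto simp: quotient_carrier quotient_ops(1)[OF I _ _ R.one_closed] quotient_ops(3)[OF I]
          \<psi> linear_onD[OF \<phi>])
  then show ?thesis using that \<psi> by blast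
qed

end

subsection \<open>Spans and bases\<close>

text \<open>Only multiples of single generators are introduced, which keeps the inductions short;
  closure under arbitrary scalars, and hence under negation, is derived.\<close>

inductive_set rspan ::
  "('r, 'k) ring_scheme \<Rightarrow> ('r, 'm, 'x) module_scheme \<Rightarrow> 'm set \<Rightarrow> 'm set"
  for R :: "('r, 'k) ring_scheme" and M :: "('r, 'm, 'x) module_scheme" and S where
  zero: "\<zero>\<^bsub>M\<^esub> \<in> rspan R M S"
| add: "x \<in> rspan R M S \<Longrightarrow> y \<in> rspan R M S \<Longrightarrow> x \<oplus>\<^bsub>M\<^esub> y \<in> rspan R M S"
| smult: "a \<in> carrier R \<Longrightarrow> s \<in> S \<Longrightarrow> a \<odot>\<^bsub>M\<^esub> s \<in> rspan R M S"

lemma rspan_closed: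
  assumes "module R M" "S \<subseteq> carrier M" "x \<in> rspan R M S"
  shows "x \<in> carrier M"
proof -
  interpret module R M by fact
  show ?thesis using assms(3) by induction (use assms(2) in auto)
qed

lemma rspan_smult_closed:
  assumes "module R M" "S \<subseteq> carrier M" "x \<in> rspan R M S" "a \<in> carrier R"
  shows "a \<odot>\<^bsub>M\<^esub> x \<in> rspan R M S"
proof -
  interpret module R M by fact
  show ?thesis using assms(3)
  proof induction
    case zero
    then show ?case using assms(4) by (simp add: rspan.zero)
  next
    case (add x y)
    then show ?case
      using assms(4) rspan_closed[OF assms(1,2)] by (simp add: smult_r_distr rspan.add)
  next
    case (smult b s)
    then have "s \<in> carrier M" using assms(2) by auto
    then have "a \<odot>\<^bsub>M\<^esub> (b \<odot>\<^bsub>M\<^esub> s) = (a \<otimes>\<^bsub>R\<^esub> b) \<odot>\<^bsub>M\<^esub> s" using smult assms(4) by (simp add: smult_assoc1)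
    then show ?case using smult assms(4) by (simp add: rspan.smult)
  qed
qed

lemma rspan_base:
  assumes "module R M" "S \<subseteq> carrier M" "s \<in> S"
  shows "s \<in> rspan R M S"
proof -
  interpret module R M by fact
  have "\<one>\<^bsub>R\<^esub> \<odot>\<^bsub>M\<^esub> s = s" using assms by auto
  then show ?thesis using rspan.smult[of "\<one>\<^bsub>R\<^esub>" R s S M] assms(3) by auto
qed

lemma rspan_finsum:
  assumes "module R M" "S \<subseteq> carrier M" "\<And>i. i \<in> A \<Longrightarrow> f i \<in> rspan R M S"
  shows "finsum M f A \<in> rspan R M S"
proof -
  interpret module R M by fact
  have fc: "i \<in> A \<Longrightarrow> f i \<in> carrier M" for i using assms rspan_closed by metis
  show ?thesis
  proof (cases "finite A")
    case True
    then show ?thesis using assms(3) fc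
    proof (induction A)
      case (insert a A)
      then have "finsum M f (insert a A) = f a \<oplus>\<^bsub>M\<^esub> finsum M f A"
        by (intro M.finsum_insert) auto
      then show ?case using insert by (simp add: rspan.add)
    qed (simp add: rspan.zero)
  qed (simp add: rspan.zero)
qed

lemma linear_eq_on_rspan:
  assumes M: "module R M" and N: "module R N" and S: "S \<subseteq> carrier M"
    and f: "linear_on R M N f" and g: "linear_on R M N g"
    and eq: "\<And>s. s \<in> S \<Longrightarrow> f s = g s" and x: "x \<in> rspan R M S"
  shows "f x = g x"
  using x
proof induction
  case zero
  then show ?case using linear_on_zero[OF M N f] linear_on_zero[OF M N g] by simp
next
  case (add x y)
  then show ?case using linear_onD(2)[OF f] linear_onD(2)[OF g] rspan_closed[OF M S] by simp
next
  case (smult a s)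
  then have "s \<in> carrier M" using S by auto
  then show ?case using linear_onD(3)[OF f] linear_onD(3)[OF g] smult eq by simp
qed

lemma linear_image_rspan:
  assumes M: "module R M" and N: "module R N" and S: "S \<subseteq> carrier M" and T: "T \<subseteq> carrier N"
    and f: "linear_on R M N f"
    and im: "\<And>s. s \<in> S \<Longrightarrow> f s \<in> rspan R N T" and x: "x \<in> rspan R M S"
  shows "f x \<in> rspan R N T"
  using x
proof induction
  case zero
  then show ?case using linear_on_zero[OF M N f] by (simp add: rspan.zero)
next
  case (add x y)
  then show ?case using linear_onD(2)[OF f] rspan_closed[OF M S] by (simp add: rspan.add)
next
  case (smult a s)
  then have "s \<in> carrier M" using S by auto
  then show ?case using linear_onD(3)[OF f] smult im rspan_smult_closed[OF N T] by simp
qed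

lemma linear_on_sum:
  assumes M: "module R M" and N: "module R N" and f: "\<And>i. i \<in> A \<Longrightarrow> linear_on R M N (f i)"
  shows "linear_on R M N (\<lambda>x. finsum N (\<lambda>i. f i x) A)"
proof -
  interpret M: module R M by (rule M)
  interpret N: module R N by (rule N)
  show ?thesis
  proof (rule linear_onI)
    show "finsum N (\<lambda>i. f i x) A \<in> carrier N" if "x \<in> carrier M" for x
      by (rule N.finsum_closed) (use that linear_onD(1)[OF f] in auto)
    show "finsum N (\<lambda>i. f i (x \<oplus>\<^bsub>M\<^esub> y)) A = finsum N (\<lambda>i. f i x) A \<oplus>\<^bsub>N\<^esub> finsum N (\<lambda>i. f i y) A"
      if "x \<in> carrier M" "y \<in> carrier M" for x y
    proof -
      have "finsum N (\<lambda>i. f i (x \<oplus>\<^bsub>M\<^esub> y)) A = finsum N (\<lambda>i. f i x \<oplus>\<^bsub>N\<^esub> f i y) A"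
        by (rule N.finsum_cong') (use that linear_onD(1)[OF f] linear_onD(2)[OF f] in auto)
      also have "\<dots> = finsum N (\<lambda>i. f i x) A \<oplus>\<^bsub>N\<^esub> finsum N (\<lambda>i. f i y) A"
        by (rule N.finsum_addf) (use that linear_onD(1)[OF f] in auto)
      finally show ?thesis .
    qed
    show "finsum N (\<lambda>i. f i (a \<odot>\<^bsub>M\<^esub> x)) A = a \<odot>\<^bsub>N\<^esub> finsum N (\<lambda>i. f i x) A"
      if "a \<in> carrier R" "x \<in> carrier M" for a x
    proof -
      have lin: "linear_on R N N (\<lambda>x. a \<odot>\<^bsub>N\<^esub> x)"
        by (rule linear_onI) (use that in \<open>auto simp: N.smult_r_distr N.smult_assoc1[symmetric] M.m_comm\<close>)
      have "finsum N (\<lambda>i. f i (a \<odot>\<^bsub>M\<^esub> x)) A = finsum N (\<lambda>i. a \<odot>\<^bsub>N\<^esub> f i x) A"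
        by (rule N.finsum_cong') (use that linear_onD(1)[OF f] linear_onD(3)[OF f] in auto)
      also have "\<dots> = a \<odot>\<^bsub>N\<^esub> finsum N (\<lambda>i. f i x) A"
        by (rule linear_on_finsum[OF N N lin, symmetric]) (use that linear_onD(1)[OF f] in auto)
      finally show ?thesis .
    qed
  qed
qed

lemma linear_on_smult_fixed:
  assumes "module R M" "module R N" "linear_on R M (regular_module R) f" "v \<in> carrier N"
  shows "linear_on R M N (\<lambda>x. f x \<odot>\<^bsub>N\<^esub> v)"
proof -
  interpret N: module R N by fact
  show ?thesis
    by (rule linear_onI)
       (use linear_onD[OF assms(3)] assms(4) in \<open>auto simp: N.smult_l_distr N.smult_assoc1\<close>)
qed

lemma dual_module_simps:
  "carrier (dual_module R M) = linear_maps R M (regular_module R)"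
  "add (dual_module R M) = (\<lambda>f g. \<lambda>x\<in>carrier M. f x \<oplus>\<^bsub>R\<^esub> g x)"
  "smult (dual_module R M) = (\<lambda>a f. \<lambda>x\<in>carrier M. a \<otimes>\<^bsub>R\<^esub> f x)"
  by (simp_all add: dual_module_def)

text \<open>A finite basis that may list an element several times: two indices give the same basis
  element if \<open>cls\<close> identifies them.\<close>

locale class_basis = module R A for R :: "('r, 'k) ring_scheme" (structure)
    and A :: "('r, 'm, 'x) module_scheme" (structure) +
  fixes J :: "'j set" and e :: "'j \<Rightarrow> 'm" and cls :: "'j \<Rightarrow> 'c"
  assumes finite_J: "finite J" and e_closed: "j \<in> J \<Longrightarrow> e j \<in> carrier A"
    and e_cong: "i \<in> J \<Longrightarrow> j \<in> J \<Longrightarrow> cls i = cls j \<Longrightarrow> e i = e j"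
    and spanning: "x \<in> carrier A \<Longrightarrow> x \<in> rspan R A (e ` J)"
    and coordinate: "i \<in> J \<Longrightarrow> \<exists>\<phi>. linear_on R A (regular_module R) \<phi> \<and>
      (\<forall>j\<in>J. \<phi> (e j) = (if cls i = cls j then \<one>\<^bsub>R\<^esub> else \<zero>\<^bsub>R\<^esub>))"
begin

abbreviation "reg \<equiv> regular_module R"

lemma regm: "module R reg" by (rule regular_module_module[OF is_cring])

definition coord :: "'j \<Rightarrow> 'm \<Rightarrow> 'r" where
  "coord i = (SOME \<phi>. linear_on R A reg \<phi> \<and> (\<forall>j\<in>J. \<phi> (e j) = (if cls i = cls j then \<one>\<^bsub>R\<^esub> else \<zero>\<^bsub>R\<^esub>)))"

text \<open>One index per basis vector. Sums then run over the vectors, each counted once, whereas a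
  sum over \<open>J\<close> would count a vector as often as it is listed.\<close>

definition rep :: "'m \<Rightarrow> 'j" where "rep v = (SOME j. j \<in> J \<and> e j = v)"

lemma coord:
  assumes "i \<in> J"
  shows "linear_on R A reg (coord i)"
    and "\<And>j. j \<in> J \<Longrightarrow> coord i (e j) = (if cls i = cls j then \<one>\<^bsub>R\<^esub> else \<zero>\<^bsub>R\<^esub>)"
  using someI_ex[OF coordinate[OF assms]] unfolding coord_def by auto

lemma rep: "v \<in> e ` J \<Longrightarrow> rep v \<in> J" "v \<in> e ` J \<Longrightarrow> e (rep v) = v"
  using someI_ex[of "\<lambda>j. j \<in> J \<and> e j = v"] unfolding rep_def by auto

lemma e_image: "e ` J \<subseteq> carrier A" using e_closed by auto

lemma linear_eqI:
  assumes "module R N" "linear_on R A N f" "linear_on R A N g" "\<And>j. j \<in> J \<Longrightarrow> f (e j) = g (e j)"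
    "x \<in> carrier A"
  shows "f x = g x"
  by (rule linear_eq_on_rspan[OF module_axioms assms(1) e_image assms(2,3)])
     (use assms spanning in auto)

text \<open>The right-hand side compares vectors and not classes. Equal vectors of different classes
  are possible only if 1 = 0 in \<open>R\<close>, so the formula covers the zero ring as
  well.\<close>

lemma coord_rep_e:
  assumes "v \<in> e ` J" "j \<in> J"
  shows "coord (rep v) (e j) = (if v = e j then \<one>\<^bsub>R\<^esub> else \<zero>\<^bsub>R\<^esub>)"
proof (cases "v = e j")
  case True
  have "coord (rep v) (e (rep v)) = \<one>\<^bsub>R\<^esub>" using coord(2)[OF rep(1) rep(1), OF assms(1) assms(1)] by simp
  then show ?thesis using True rep(2)[OF assms(1)] by simp
next
  case False
  then have "cls (rep v) \<noteq> cls j" using e_cong[OF rep(1)[OF assms(1)] assms(2)] rep(2)[OF assms(1)] by auto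
  then show ?thesis using False coord(2)[OF rep(1)[OF assms(1)] assms(2)] by simp
qed

lemma linear_on_id: "linear_on R A A (\<lambda>x. x)" by (rule linear_onI) auto

lemma sum_e_delta:
  assumes N: "module R N" and w: "\<And>v. v \<in> e ` J \<Longrightarrow> w v \<in> carrier N" and j: "j \<in> J"
  shows "finsum N (\<lambda>v. coord (rep v) (e j) \<odot>\<^bsub>N\<^esub> w v) (e ` J) = w (e j)"
proof -
  interpret N: module R N by (rule N)
  have "finsum N (\<lambda>v. coord (rep v) (e j) \<odot>\<^bsub>N\<^esub> w v) (e ` J)
      = finsum N (\<lambda>v. if e j = v then w v else \<zero>\<^bsub>N\<^esub>) (e ` J)"
    by (rule N.finsum_cong') (use coord_rep_e[OF _ j] w in auto)
  also have "\<dots> = w (e j)"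
    by (rule N.add.finprod_singleton) (use j w finite_J in auto)
  finally show ?thesis .
qed

lemma expansion:
  assumes "x \<in> carrier A"
  shows "finsum A (\<lambda>v. coord (rep v) x \<odot>\<^bsub>A\<^esub> v) (e ` J) = x"
proof (rule linear_eqI[OF module_axioms _ linear_on_id _ assms])
  show "linear_on R A A (\<lambda>x. finsum A (\<lambda>v. coord (rep v) x \<odot>\<^bsub>A\<^esub> v) (e ` J))"
    by (rule linear_on_sum[OF module_axioms module_axioms],
        rule linear_on_smult_fixed[OF module_axioms module_axioms coord(1)])
       (use rep e_image in auto)
  show "finsum A (\<lambda>v. coord (rep v) (e j) \<odot>\<^bsub>A\<^esub> v) (e ` J) = e j" if "j \<in> J" for j
    using sum_e_delta[OF module_axioms _ that, of "\<lambda>v. v"] e_image by auto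
qed

lemma coord_closed: "i \<in> J \<Longrightarrow> x \<in> carrier A \<Longrightarrow> coord i x \<in> carrier R"
  using linear_onD(1)[OF coord(1)] by auto

lemma finitely_generated: "finitely_generated_module R A"
  unfolding finitely_generated_module_def
proof (intro exI[of _ "e ` J"] conjI allI impI)
  show "finite (e ` J)" "e ` J \<subseteq> carrier A" using finite_J e_image by auto
  fix N assume N: "submodule N R A \<and> e ` J \<subseteq> N"
  then have sg: "subgroup N (add_monoid A)"
    and sm: "a \<in> carrier R \<Longrightarrow> x \<in> N \<Longrightarrow> a \<odot>\<^bsub>A\<^esub> x \<in> N" for a x
    unfolding submodule_def submodule_axioms_def by auto
  have "x \<in> N" if "x \<in> rspan R A (e ` J)" for x
    using that
  proof induction
    case zero
    then show ?case using subgroup.one_closed[OF sg] by simp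
  next
    case (add x y)
    then show ?case using subgroup.m_closed[OF sg] by simp
  next
    case (smult a s)
    then show ?case using sm N by auto
  qed
  then show "N = carrier A" using spanning subgroup.subset[OF sg] by auto
qed

lemma projective: "projective_module R A"
proof -
  \<comment> \<open>\<open>projective_module\<close> wants an index set in the element type of the
    module, so the basis vectors index themselves.\<close>
  let ?I = "e ` J"
  define s where "s = (\<lambda>x\<in>carrier A. \<lambda>v. if v \<in> ?I then coord (rep v) x else \<zero>\<^bsub>R\<^esub>)"
  define p where "p = restrict (lin_ext R A (\<lambda>v. v)) (carrier (free_module R ?I))"
  note FM = free_module_module[OF is_cring, of ?I]
  have I: "finite ?I" using finite_J by auto
  have sc: "(\<lambda>v. if v \<in> ?I then coord (rep v) x else \<zero>\<^bsub>R\<^esub>) \<in> carrier (free_module R ?I)" if "x \<in> carrier A" for x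
    by (rule free_moduleI[OF _ I subset_refl]) (use that coord_closed rep(1) in auto)
  have "linear_on R A (free_module R ?I) (\<lambda>x v. if v \<in> ?I then coord (rep v) x else \<zero>\<^bsub>R\<^esub>)"
    by (rule linear_onI)
       (use sc linear_onD(2,3)[OF coord(1)[OF rep(1)]] in \<open>auto simp: free_module_simps(3,4) fun_eq_iff\<close>)
  then have s: "s \<in> linear_maps R A (free_module R ?I)"
    unfolding linear_maps_iff s_def by (simp add: linear_on_restrict[OF module_axioms])
  have "linear_on R (free_module R ?I) A (lin_ext R A (\<lambda>v. v))"
    by (rule lin_ext_linear[OF module_axioms]) (use e_image in auto)
  then have p: "p \<in> linear_maps R (free_module R ?I) A"
    unfolding linear_maps_iff p_def by (simp add: linear_on_restrict[OF FM])
  have "p (s x) = x" if x: "x \<in> carrier A" for x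
  proof -
    have "p (s x) = lin_ext R A (\<lambda>v. v) (\<lambda>v. if v \<in> ?I then coord (rep v) x else \<zero>\<^bsub>R\<^esub>)"
      using x sc by (simp add: p_def s_def)
    also have "\<dots> = finsum A (\<lambda>v. (if v \<in> ?I then coord (rep v) x else \<zero>\<^bsub>R\<^esub>) \<odot>\<^bsub>A\<^esub> v) ?I"
      by (rule lin_ext_superset[OF module_axioms _ sc[OF x] I]) (use e_image in auto)
    also have "\<dots> = finsum A (\<lambda>v. coord (rep v) x \<odot>\<^bsub>A\<^esub> v) ?I"
      by (rule M.finsum_cong') (use coord_closed rep(1) x e_image in auto)
    finally show ?thesis using expansion[OF x] by simp
  qed
  then show ?thesis unfolding projective_module_def using s p by blast
qed

context
  fixes b :: "'m \<Rightarrow> 'm \<Rightarrow> 'r"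
  assumes b1: "\<And>x. x \<in> carrier A \<Longrightarrow> linear_on R A reg (b x)"
    and b2: "\<And>y. y \<in> carrier A \<Longrightarrow> linear_on R A reg (\<lambda>x. b x y)"
begin

lemma symmetric_if_on_basis:
  assumes "\<And>i j. i \<in> J \<Longrightarrow> j \<in> J \<Longrightarrow> b (e i) (e j) = b (e j) (e i)"
    and "x \<in> carrier A" "y \<in> carrier A"
  shows "b x y = b y x"
proof -
  have 1: "b (e i) y = b y (e i)" if "i \<in> J" for i
    by (rule linear_eqI[OF regm b1 b2 _ assms(3)]) (use that e_closed assms in auto)
  show ?thesis
    by (rule linear_eqI[OF regm b2 b1 _ assms(2)]) (use 1 e_closed assms in auto)
qed

lemma b_closed: "x \<in> carrier A \<Longrightarrow> y \<in> carrier A \<Longrightarrow> b x y \<in> carrier R"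
  using linear_onD(1)[OF b1] by auto

text \<open>The form is non-degenerate if and only if every coordinate functional has the form b(d,
  -): the vectors d form a dual basis, and a symmetric form with a dual basis is injective and
  surjective onto the dual. The coefficients n of d may be spread over several indices of one
  vector, so n is not unique.\<close>

lemma nondegenerate_iff:
  assumes sym: "\<And>i j. i \<in> J \<Longrightarrow> j \<in> J \<Longrightarrow> b (e i) (e j) = b (e j) (e i)"
  shows "nondegenerate R A b \<longleftrightarrow> (\<forall>i\<in>J. \<exists>n\<in>J \<rightarrow> carrier R. \<forall>k\<in>J.
     (\<Oplus>\<^bsub>R\<^esub>j\<in>J. n j \<otimes>\<^bsub>R\<^esub> b (e j) (e k)) = (if cls i = cls k then \<one>\<^bsub>R\<^esub> else \<zero>\<^bsub>R\<^esub>))"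
proof -
  define \<beta> where "\<beta> = (\<lambda>x\<in>carrier A. \<lambda>y\<in>carrier A. b x y)"
  have bs: "b x y = b y x" if "x \<in> carrier A" "y \<in> carrier A" for x y
    using symmetric_if_on_basis sym that by blast
  have \<beta>c: "\<beta> x \<in> carrier (dual_module R A)" if "x \<in> carrier A" for x
    using that b1 by (simp add: \<beta>_def dual_module_simps linear_maps_iff linear_on_restrict[OF module_axioms])
  have "linear_on R A (dual_module R A) \<beta>"
  proof (rule linear_onI)
    show "\<beta> (x \<oplus>\<^bsub>A\<^esub> y) = \<beta> x \<oplus>\<^bsub>dual_module R A\<^esub> \<beta> y" if "x \<in> carrier A" "y \<in> carrier A" for x y
      using that linear_onD(2)[OF b2] by (auto simp: \<beta>_def dual_module_simps fun_eq_iff)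
    show "\<beta> (a \<odot>\<^bsub>A\<^esub> x) = a \<odot>\<^bsub>dual_module R A\<^esub> \<beta> x" if "a \<in> carrier R" "x \<in> carrier A" for a x
      using that linear_onD(3)[OF b2] by (auto simp: \<beta>_def dual_module_simps fun_eq_iff)
  qed (rule \<beta>c)
  then have nd: "nondegenerate R A b \<longleftrightarrow> bij_betw \<beta> (carrier A) (carrier (dual_module R A))"
    unfolding nondegenerate_def Let_def \<beta>_def[symmetric] linear_maps_iff by (simp add: \<beta>_def)
  have bsum: "b (finsum A (\<lambda>j. n j \<odot>\<^bsub>A\<^esub> f j) K) y = (\<Oplus>\<^bsub>R\<^esub>j\<in>K. n j \<otimes>\<^bsub>R\<^esub> b (f j) y)"
    if "n \<in> K \<rightarrow> carrier R" "f \<in> K \<rightarrow> carrier A" "y \<in> carrier A" for n f y and K :: "'z set"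
  proof -
    have "b (finsum A (\<lambda>j. n j \<odot>\<^bsub>A\<^esub> f j) K) y = (\<Oplus>\<^bsub>R\<^esub>j\<in>K. b (n j \<odot>\<^bsub>A\<^esub> f j) y)"
      using linear_on_finsum[OF module_axioms regm b2[OF that(3)], of "\<lambda>j. n j \<odot>\<^bsub>A\<^esub> f j" K] that
      by (simp add: Pi_iff)
    also have "\<dots> = (\<Oplus>\<^bsub>R\<^esub>j\<in>K. n j \<otimes>\<^bsub>R\<^esub> b (f j) y)"
      by (rule R.finsum_cong')
         (use that b_closed linear_onD(3)[OF b2[OF that(3)]] in \<open>auto simp: Pi_iff\<close>)
    finally show ?thesis .
  qed
  show ?thesis unfolding nd
  proof
    assume bij: "bij_betw \<beta> (carrier A) (carrier (dual_module R A))"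
    show "\<forall>i\<in>J. \<exists>n\<in>J \<rightarrow> carrier R. \<forall>k\<in>J.
       (\<Oplus>\<^bsub>R\<^esub>j\<in>J. n j \<otimes>\<^bsub>R\<^esub> b (e j) (e k)) = (if cls i = cls k then \<one>\<^bsub>R\<^esub> else \<zero>\<^bsub>R\<^esub>)"
    proof
      fix i assume i: "i \<in> J"
      have "restrict (coord i) (carrier A) \<in> carrier (dual_module R A)"
        using coord(1)[OF i] by (simp add: dual_module_simps linear_maps_iff linear_on_restrict[OF module_axioms])
      then obtain d where d: "d \<in> carrier A" "\<beta> d = restrict (coord i) (carrier A)"
        using bij by (metis bij_betw_imp_surj_on imageE)
      have bd: "b d y = coord i y" if "y \<in> carrier A" for y
        using fun_cong[OF d(2), of y] that d(1) by (simp add: \<beta>_def)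
      \<comment> \<open>The whole coefficient of a vector is put on its chosen index, and zero on
        the other indices of the same vector.\<close>
      define n where "n j = (if j = rep (e j) then coord j d else \<zero>\<^bsub>R\<^esub>)" for j
      have n: "n \<in> J \<rightarrow> carrier R" using coord_closed d by (auto simp: n_def)
      have inj: "inj_on rep (e ` J)" by (rule inj_on_inverseI[of _ e]) (use rep(2) in auto)
      have "finsum A (\<lambda>j. n j \<odot>\<^bsub>A\<^esub> e j) (rep ` e ` J) = finsum A (\<lambda>j. n j \<odot>\<^bsub>A\<^esub> e j) J"
        by (rule M.add.finprod_mono_neutral_cong_left)
           (use finite_J rep(1) n e_closed in \<open>auto simp: n_def image_iff Pi_iff\<close>)
      moreover have "finsum A (\<lambda>j. n j \<odot>\<^bsub>A\<^esub> e j) (rep ` e ` J) = finsum A (\<lambda>v. n (rep v) \<odot>\<^bsub>A\<^esub> e (rep v)) (e ` J)"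
        by (rule M.add.finprod_reindex) (use inj rep n e_closed in \<open>auto simp: Pi_iff\<close>)
      moreover have "finsum A (\<lambda>v. n (rep v) \<odot>\<^bsub>A\<^esub> e (rep v)) (e ` J) = finsum A (\<lambda>v. coord (rep v) d \<odot>\<^bsub>A\<^esub> v) (e ` J)"
        by (rule M.finsum_cong') (use rep coord_closed d e_image in \<open>auto simp: n_def\<close>)
      ultimately have dd: "finsum A (\<lambda>j. n j \<odot>\<^bsub>A\<^esub> e j) J = d" using expansion[OF d(1)] by simp
      have "(\<Oplus>\<^bsub>R\<^esub>j\<in>J. n j \<otimes>\<^bsub>R\<^esub> b (e j) (e k)) = (if cls i = cls k then \<one>\<^bsub>R\<^esub> else \<zero>\<^bsub>R\<^esub>)" if "k \<in> J" for k
        using bsum[OF n _ e_closed[OF that], of e] dd bd[OF e_closed[OF that]] coord(2)[OF i that] e_closed by auto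
      then show "\<exists>n\<in>J \<rightarrow> carrier R. \<forall>k\<in>J.
       (\<Oplus>\<^bsub>R\<^esub>j\<in>J. n j \<otimes>\<^bsub>R\<^esub> b (e j) (e k)) = (if cls i = cls k then \<one>\<^bsub>R\<^esub> else \<zero>\<^bsub>R\<^esub>)" using n by blast
    qed
  next
    assume "\<forall>i\<in>J. \<exists>n\<in>J \<rightarrow> carrier R. \<forall>k\<in>J.
       (\<Oplus>\<^bsub>R\<^esub>j\<in>J. n j \<otimes>\<^bsub>R\<^esub> b (e j) (e k)) = (if cls i = cls k then \<one>\<^bsub>R\<^esub> else \<zero>\<^bsub>R\<^esub>)"
    then obtain n where n: "\<And>i. i \<in> J \<Longrightarrow> n i \<in> J \<rightarrow> carrier R"
      "\<And>i k. i \<in> J \<Longrightarrow> k \<in> J \<Longrightarrow>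
        (\<Oplus>\<^bsub>R\<^esub>j\<in>J. n i j \<otimes>\<^bsub>R\<^esub> b (e j) (e k)) = (if cls i = cls k then \<one>\<^bsub>R\<^esub> else \<zero>\<^bsub>R\<^esub>)"
      by metis
    define d where "d i = finsum A (\<lambda>j. n i j \<odot>\<^bsub>A\<^esub> e j) J" for i
    have dc: "d i \<in> carrier A" if "i \<in> J" for i
      unfolding d_def by (rule M.finsum_closed) (use n(1)[OF that] e_closed in \<open>auto simp: Pi_iff\<close>)
    have bd: "b (d i) x = coord i x" if "i \<in> J" "x \<in> carrier A" for i x
    proof (rule linear_eqI[OF regm b1[OF dc[OF that(1)]] coord(1)[OF that(1)] _ that(2)])
      fix k assume k: "k \<in> J"
      show "b (d i) (e k) = coord i (e k)"
        using bsum[OF n(1)[OF that(1)] _ e_closed[OF k], of e] n(2)[OF that(1) k] coord(2)[OF that(1) k] e_closed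
        unfolding d_def by auto
    qed
    show "bij_betw \<beta> (carrier A) (carrier (dual_module R A))"
      unfolding bij_betw_def
    proof
      show "inj_on \<beta> (carrier A)"
      proof (rule inj_onI)
        fix x y assume x: "x \<in> carrier A" and y: "y \<in> carrier A" and eq: "\<beta> x = \<beta> y"
        \<comment> \<open>By symmetry the coordinates of x are its pairings with the vectors
          \<open>d i\<close>, so \<beta> x determines x.\<close>
        have "coord i x = coord i y" if "i \<in> J" for i
        proof -
          have "b x (d i) = b y (d i)" using fun_cong[OF eq, of "d i"] x y dc[OF that] by (simp add: \<beta>_def)
          then show ?thesis using bd[OF that] bs[OF dc[OF that]] x y by metis
        qed
        then have "finsum A (\<lambda>v. coord (rep v) x \<odot>\<^bsub>A\<^esub> v) (e ` J) = finsum A (\<lambda>v. coord (rep v) y \<odot>\<^bsub>A\<^esub> v) (e ` J)"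
          by (intro M.finsum_cong') (use rep(1) coord_closed y e_image in auto)
        then show "x = y" using expansion x y by simp
      qed
      show "\<beta> ` carrier A = carrier (dual_module R A)"
      proof (intro equalityI subsetI)
        fix \<psi> assume "\<psi> \<in> carrier (dual_module R A)"
        then have \<psi>: "linear_on R A reg \<psi>" "\<psi> \<in> extensional (carrier A)"
          by (simp_all add: dual_module_simps linear_maps_iff)
        \<comment> \<open>A functional is the combination of the coordinate functionals with its own
          values on the basis as coefficients; replacing each coordinate functional by the vector
          \<open>d\<close> that represents it gives x.\<close>
        define x where "x = finsum A (\<lambda>v. \<psi> v \<odot>\<^bsub>A\<^esub> d (rep v)) (e ` J)"
        have \<psi>c: "\<psi> v \<in> carrier R" if "v \<in> carrier A" for v using linear_onD(1)[OF \<psi>(1) that] by simp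
        have x: "x \<in> carrier A" unfolding x_def
          by (rule M.finsum_closed) (use \<psi>c e_image dc rep(1) in auto)
        have "b x y = \<psi> y" if "y \<in> carrier A" for y
        proof (rule linear_eqI[OF regm b1[OF x] \<psi>(1) _ that])
          fix k assume k: "k \<in> J"
          have "b x (e k) = (\<Oplus>\<^bsub>R\<^esub>v\<in>e ` J. \<psi> v \<otimes>\<^bsub>R\<^esub> b (d (rep v)) (e k))"
            unfolding x_def
            by (rule bsum) (use \<psi>c e_image dc rep(1) e_closed k in auto)
          also have "\<dots> = (\<Oplus>\<^bsub>R\<^esub>v\<in>e ` J. coord (rep v) (e k) \<otimes>\<^bsub>R\<^esub> \<psi> v)"
            by (rule R.finsum_cong')
               (use \<psi>c e_image dc rep(1) e_closed k bd coord_closed in \<open>auto simp: R.m_comm\<close>)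
          also have "\<dots> = \<psi> (e k)"
            using sum_e_delta[OF regm, of \<psi> k] \<psi>c e_closed k by auto
          finally show "b x (e k) = \<psi> (e k)" .
        qed
        then have "\<beta> x = \<psi>" using \<psi>(2) x by (auto simp: \<beta>_def fun_eq_iff extensional_def)
        then show "\<psi> \<in> \<beta> ` carrier A" using x by auto
      qed (use \<beta>c in auto)
    qed
  qed
qed

end

end

text \<open>The multiset notation would make the one for left cosets ambiguous.\<close>

no_notation (ASCII) subset_mset (infix "<#" 50)

subsection \<open>Sums over orbits\<close>

definition acts :: "('g, 'l) monoid_scheme \<Rightarrow> 'g set \<Rightarrow> ('g \<Rightarrow> 'a \<Rightarrow> 'a) \<Rightarrow> 'a set \<Rightarrow> bool"
  where "acts G A act X \<longleftrightarrow> subgroup A G \<and> (\<forall>a\<in>A. \<forall>x\<in>X. act a x \<in> X) \<and>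
    (\<forall>x\<in>X. act \<one>\<^bsub>G\<^esub> x = x) \<and> (\<forall>a\<in>A. \<forall>b\<in>A. \<forall>x\<in>X. act (a \<otimes>\<^bsub>G\<^esub> b) x = act a (act b x))"

definition orb :: "'g set \<Rightarrow> ('g \<Rightarrow> 'a \<Rightarrow> 'a) \<Rightarrow> 'a \<Rightarrow> 'a set"
  where "orb A act x = (\<lambda>a. act a x) ` A"

text \<open>Each orbit contributes the value of \<open>h\<close> at a chosen point, which is
  harmless for functions constant on orbits. The values lie in a commutative monoid, in practice
  multisets, and not only in a ring.\<close>

definition osum :: "'g set \<Rightarrow> ('g \<Rightarrow> 'a \<Rightarrow> 'a) \<Rightarrow> 'a set \<Rightarrow> ('a \<Rightarrow> 'm) \<Rightarrow> 'm :: comm_monoid_add"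
  where "osum A act X h = (\<Sum>Q\<in>orb A act ` X. h (SOME x. x \<in> Q))"

definition invariant :: "'g set \<Rightarrow> ('g \<Rightarrow> 'a \<Rightarrow> 'a) \<Rightarrow> 'a set \<Rightarrow> ('a \<Rightarrow> 'm) \<Rightarrow> bool"
  where "invariant A act X h \<longleftrightarrow> (\<forall>a\<in>A. \<forall>x\<in>X. h (act a x) = h x)"

context group
begin

lemma acts_subset: "acts G A act X \<Longrightarrow> Y \<subseteq> X \<Longrightarrow> (\<And>a x. a \<in> A \<Longrightarrow> x \<in> Y \<Longrightarrow> act a x \<in> Y) \<Longrightarrow> acts G A act Y"
  unfolding acts_def by blast

lemma acts_subgroup: "acts G A act X \<Longrightarrow> subgroup B G \<Longrightarrow> B \<subseteq> A \<Longrightarrow> acts G B act X"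
  unfolding acts_def by blast

lemma orb_self: "acts G A act X \<Longrightarrow> x \<in> X \<Longrightarrow> x \<in> orb A act x"
  unfolding acts_def orb_def using subgroup.one_closed by (metis image_eqI)

lemma orb_eq_iff:
  assumes X: "acts G A act X" and x: "x \<in> X" and y: "y \<in> X"
  shows "orb A act x = orb A act y \<longleftrightarrow> (\<exists>a\<in>A. y = act a x)"
proof
  assume "orb A act x = orb A act y"
  then have "y \<in> orb A act x" using orb_self[OF X y] by simp
  then show "\<exists>a\<in>A. y = act a x" unfolding orb_def by auto
next
  assume "\<exists>a\<in>A. y = act a x"
  then obtain a where a: "a \<in> A" "y = act a x" by auto
  have A: "subgroup A G" and m: "\<And>b c. b \<in> A \<Longrightarrow> c \<in> A \<Longrightarrow> act (b \<otimes> c) x = act b (act c x)"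
    and m': "\<And>b c. b \<in> A \<Longrightarrow> c \<in> A \<Longrightarrow> act (b \<otimes> c) y = act b (act c y)" and o: "act \<one> x = x"
    using X x y unfolding acts_def by auto
  have "inv a \<otimes> a = \<one>" using a(1) subgroup.mem_carrier[OF A] by auto
  then have "act (inv a) y = x" using m[of "inv a" a] a subgroup.m_inv_closed[OF A a(1)] o by simp
  then have "act b x \<in> orb A act y" if "b \<in> A" for b
    using m'[OF that subgroup.m_inv_closed[OF A a(1)]] subgroup.m_closed[OF A that subgroup.m_inv_closed[OF A a(1)]]
    unfolding orb_def by (metis image_eqI)
  moreover have "act b y \<in> orb A act x" if "b \<in> A" for b
    using m[OF that a(1)] subgroup.m_closed[OF A that a(1)] a(2) unfolding orb_def by (metis image_eqI)
  ultimately show "orb A act x = orb A act y" unfolding orb_def by blast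
qed

lemma orb_subset: "acts G A act X \<Longrightarrow> x \<in> X \<Longrightarrow> orb A act x \<subseteq> X"
  unfolding acts_def orb_def by auto

lemma orb_rep:
  assumes X: "acts G A act X" and x: "x \<in> X" and h: "invariant A act X h"
  shows "h (SOME y. y \<in> orb A act x) = h x"
proof -
  have "(SOME y. y \<in> orb A act x) \<in> orb A act x"
    by (rule someI[of "\<lambda>y. y \<in> orb A act x"], rule orb_self[OF X x])
  then obtain a where "a \<in> A" "(SOME y. y \<in> orb A act x) = act a x" unfolding orb_def by blast
  then show ?thesis using h x unfolding invariant_def by simp
qed

lemma osum_cong:
  assumes X: "acts G A act X" and eq: "\<And>x. x \<in> X \<Longrightarrow> h x = k x"
  shows "osum A act X h = osum A act X k"
  unfolding osum_def
proof (rule sum.cong)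
  fix Q assume "Q \<in> orb A act ` X"
  then obtain x where x: "x \<in> X" "Q = orb A act x" by auto
  have "(SOME x. x \<in> Q) \<in> Q" by (rule someI[of _ x]) (use x orb_self[OF X] in auto)
  then show "h (SOME x. x \<in> Q) = k (SOME x. x \<in> Q)" using x orb_subset[OF X] eq by blast
qed simp

text \<open>The map \<open>f\<close> induces a bijection of orbit sets although the acting group
  changes: \<open>fwd\<close> makes the induced map well defined, \<open>bwd\<close> injective and
  \<open>surj\<close> surjective. \<open>f\<close> itself need be neither injective nor
  equivariant.\<close>

lemma osum_transfer:
  assumes X: "acts G A act X" and Y: "acts G B act' Y"
    and h: "invariant A act X h" and k: "invariant B act' Y k"
    and f: "\<And>x. x \<in> X \<Longrightarrow> f x \<in> Y" and hk: "\<And>x. x \<in> X \<Longrightarrow> h x = k (f x)"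
    and fwd: "\<And>a x. a \<in> A \<Longrightarrow> x \<in> X \<Longrightarrow> \<exists>b\<in>B. f (act a x) = act' b (f x)"
    and bwd: "\<And>b x x'. b \<in> B \<Longrightarrow> x \<in> X \<Longrightarrow> x' \<in> X \<Longrightarrow> f x' = act' b (f x) \<Longrightarrow> \<exists>a\<in>A. x' = act a x"
    and surj: "\<And>y. y \<in> Y \<Longrightarrow> \<exists>x\<in>X. \<exists>b\<in>B. y = act' b (f x)"
  shows "osum A act X h = osum B act' Y k"
proof -
  have eq: "orb A act x = orb A act x' \<longleftrightarrow> orb B act' (f x) = orb B act' (f x')"
    if "x \<in> X" "x' \<in> X" for x x'
    using orb_eq_iff[OF X that] orb_eq_iff[OF Y f f, OF that] fwd bwd that by metis
  define F where "F Q = orb B act' (f (SOME x. x \<in> Q))" for Q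
  have F: "F (orb A act x) = orb B act' (f x)" if x: "x \<in> X" for x
  proof -
    let ?y = "SOME y. y \<in> orb A act x"
    have "?y \<in> orb A act x" by (rule someI[of "\<lambda>y. y \<in> orb A act x"], rule orb_self[OF X x])
    then have y: "?y \<in> X" using orb_subset[OF X x] by auto
    have "\<exists>a\<in>A. ?y = act a x" using \<open>?y \<in> orb A act x\<close> unfolding orb_def by blast
    then have y: "?y \<in> X" "orb A act x = orb A act ?y" using y orb_eq_iff[OF X x y] by auto
    then show ?thesis unfolding F_def using eq[OF x y(1)] by simp
  qed
  have "bij_betw F (orb A act ` X) (orb B act' ` Y)"
    unfolding bij_betw_def
  proof
    show "inj_on F (orb A act ` X)" by (rule inj_onI) (elim imageE, use F eq in metis)
    show "F ` (orb A act ` X) = orb B act' ` Y"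
    proof (intro equalityI subsetI)
      fix Q assume "Q \<in> orb B act' ` Y"
      then obtain y where y: "y \<in> Y" "Q = orb B act' y" by auto
      obtain x b where xb: "x \<in> X" "b \<in> B" "y = act' b (f x)" using surj[OF y(1)] by auto
      then have "Q = orb B act' (f x)" using orb_eq_iff[OF Y f[OF xb(1)] y(1)] y by auto
      then show "Q \<in> F ` (orb A act ` X)" using F xb by auto
    qed (use F f in auto)
  qed
  then have "osum B act' Y k = (\<Sum>Q\<in>orb A act ` X. k (SOME x. x \<in> F Q))"
    unfolding osum_def by (rule sum.reindex_bij_betw[symmetric])
  also have "\<dots> = osum A act X h"
    unfolding osum_def by (rule sum.cong) (use F orb_rep[OF X _ h] orb_rep[OF Y f k] hk in auto)
  finally show ?thesis by simp
qed

lemma osum_bij: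
  assumes X: "acts G A act X" and Y: "acts G A act' Y"
    and h: "invariant A act X h"
    and f: "bij_betw f X Y" and hk: "\<And>x. x \<in> X \<Longrightarrow> h x = k (f x)"
    and eqv: "\<And>a x. a \<in> A \<Longrightarrow> x \<in> X \<Longrightarrow> f (act a x) = act' a (f x)"
  shows "osum A act X h = osum A act' Y k"
proof (rule osum_transfer[OF X Y h, of k f])
  have fX: "f x \<in> Y" if "x \<in> X" for x using f that by (auto simp: bij_betw_def)
  have cl: "act a x \<in> X" if "a \<in> A" "x \<in> X" for a x using X that unfolding acts_def by auto
  show "invariant A act' Y k"
    unfolding invariant_def
  proof (intro ballI)
    fix a y assume a: "a \<in> A" and y: "y \<in> Y"
    then obtain x where x: "x \<in> X" "y = f x" using f by (auto simp: bij_betw_def)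
    show "k (act' a y) = k y"
      using eqv[OF a x(1)] hk[OF x(1)] hk[OF cl[OF a x(1)]] h a x unfolding invariant_def by metis
  qed
  show "f x \<in> Y" "h x = k (f x)" if "x \<in> X" for x using fX hk that by auto
  show "\<exists>b\<in>A. f (act a x) = act' b (f x)" if "a \<in> A" "x \<in> X" for a x using eqv that by auto
  show "\<exists>a\<in>A. x' = act a x" if "b \<in> A" "x \<in> X" "x' \<in> X" "f x' = act' b (f x)" for b x x'
    using eqv[OF that(1,2)] that f cl[OF that(1,2)] unfolding bij_betw_def inj_on_def by metis
  show "\<exists>x\<in>X. \<exists>b\<in>A. y = act' b (f x)" if y: "y \<in> Y" for y
  proof -
    obtain x where x: "x \<in> X" "y = f x" using f y by (auto simp: bij_betw_def)
    have "\<one> \<in> A" "act' \<one> y = y" using X Y y subgroup.one_closed unfolding acts_def by auto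
    then show ?thesis using x by metis
  qed
qed

lemma osum_UN:
  assumes X: "\<And>i. i \<in> I \<Longrightarrow> acts G A act (X i)" and I: "finite I" and fin: "\<And>i. i \<in> I \<Longrightarrow> finite (X i)"
    and disj: "\<And>i j. i \<in> I \<Longrightarrow> j \<in> I \<Longrightarrow> i \<noteq> j \<Longrightarrow> X i \<inter> X j = {}"
  shows "osum A act (\<Union>i\<in>I. X i) h = (\<Sum>i\<in>I. osum A act (X i) h)"
proof -
  have "orb A act ` (X i) \<inter> orb A act ` (X j) = {}" if "i \<in> I" "j \<in> I" "i \<noteq> j" for i j
  proof (rule ccontr)
    assume "orb A act ` (X i) \<inter> orb A act ` (X j) \<noteq> {}"
    then obtain x y where "x \<in> X i" "y \<in> X j" "orb A act x = orb A act y" by auto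
    then have "x \<in> orb A act y" "orb A act y \<subseteq> X j" using orb_self[OF X] orb_subset[OF X] that by auto
    then show False using disj that \<open>x \<in> X i\<close> by auto
  qed
  then show ?thesis unfolding osum_def image_UN
    by (intro sum.UNION_disjoint) (use I fin in auto)
qed

lemma osum_single:
  assumes X: "acts G A act X" and x: "x \<in> X" and h: "invariant A act X h"
    and tr: "\<And>y. y \<in> X \<Longrightarrow> \<exists>a\<in>A. y = act a x"
  shows "osum A act X h = h x"
proof -
  have "orb A act ` X = {orb A act x}" using orb_eq_iff[OF X x] tr x by blast
  then show ?thesis unfolding osum_def using orb_rep[OF X x h] by simp
qed

text \<open>Orbits of \<open>X\<close> over the orbit of \<open>y\<close> correspond to orbits of the stabiliser of \<open>y\<close> on the
  fibre over \<open>y\<close>.\<close>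

lemma osum_fibration:
  assumes X: "acts G A act X" and Y: "acts G A act' Y" and fin: "finite X" "finite Y"
    and h: "invariant A act X h" and p: "\<And>x. x \<in> X \<Longrightarrow> p x \<in> Y"
    and eqv: "\<And>a x. a \<in> A \<Longrightarrow> x \<in> X \<Longrightarrow> p (act a x) = act' a (p x)"
  shows "osum A act X h = osum A act' Y (\<lambda>y. osum {a\<in>A. act' a y = y} act {x\<in>X. p x = y} h)"
proof -
  have A: "subgroup A G" and cl: "\<And>a x. a \<in> A \<Longrightarrow> x \<in> X \<Longrightarrow> act a x \<in> X"
    and cl': "\<And>a x. a \<in> A \<Longrightarrow> x \<in> Y \<Longrightarrow> act' a x \<in> Y"
    and o: "\<And>x. x \<in> X \<Longrightarrow> act \<one> x = x" and o': "\<And>x. x \<in> Y \<Longrightarrow> act' \<one> x = x"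
    and m: "\<And>a b x. a \<in> A \<Longrightarrow> b \<in> A \<Longrightarrow> x \<in> X \<Longrightarrow> act (a \<otimes> b) x = act a (act b x)"
    and m': "\<And>a b x. a \<in> A \<Longrightarrow> b \<in> A \<Longrightarrow> x \<in> Y \<Longrightarrow> act' (a \<otimes> b) x = act' a (act' b x)"
    using X Y unfolding acts_def by auto
  interpret A: subgroup A G by (rule A)
  have sub: "subgroup {a\<in>A. act' a y = y} G" if y: "y \<in> Y" for y
  proof (rule subgroupI)
    show "{a\<in>A. act' a y = y} \<noteq> {}" using o'[OF y] A.one_closed by blast
    show "inv a \<in> {a\<in>A. act' a y = y}" if "a \<in> {a\<in>A. act' a y = y}" for a
      using that m'[of "inv a" a y] o'[OF y] y A.mem_carrier by auto
    show "a \<otimes> b \<in> {a\<in>A. act' a y = y}"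
      if "a \<in> {a\<in>A. act' a y = y}" "b \<in> {a\<in>A. act' a y = y}" for a b
      using that m'[of a b y] y by auto
  qed (use A.mem_carrier in auto)
  define q where "q Q = orb A act' (p (SOME x. x \<in> Q))" for Q
  have q: "q (orb A act x) = orb A act' (p x)" if x: "x \<in> X" for x
  proof -
    let ?y = "SOME y. y \<in> orb A act x"
    have "?y \<in> orb A act x" by (rule someI[of "\<lambda>y. y \<in> orb A act x"], rule orb_self[OF X x])
    then obtain a where a: "a \<in> A" "?y = act a x" unfolding orb_def by auto
    then show ?thesis unfolding q_def
      using orb_eq_iff[OF Y p[OF x], of "p ?y"] eqv[OF a(1) x] p[OF cl[OF a(1) x]] by auto
  qed
  have fib: "(\<Sum>Q\<in>{Q \<in> orb A act ` X. q Q = orb A act' y}. h (SOME x. x \<in> Q))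
     = osum {a\<in>A. act' a y = y} act {x\<in>X. p x = y} h" if y: "y \<in> Y" for y
  proof -
    let ?X = "{x \<in> X. orb A act' (p x) = orb A act' y}"
    have X': "acts G A act ?X"
    proof (rule acts_subset[OF X])
      fix a x assume a: "a \<in> A" and x: "x \<in> ?X"
      then have "orb A act' (p x) = orb A act' (p (act a x))"
        using orb_eq_iff[OF Y p p, of x "act a x"] eqv cl by blast
      then show "act a x \<in> ?X" using a x cl by simp
    qed simp
    have Xy: "acts G {a\<in>A. act' a y = y} act {x\<in>X. p x = y}"
      by (rule acts_subset[OF acts_subgroup[OF X sub[OF y]]]) (use cl eqv in auto)
    have "{Q \<in> orb A act ` X. q Q = orb A act' y} = orb A act ` ?X"
      using q by (auto simp: image_iff)
    then have "(\<Sum>Q\<in>{Q \<in> orb A act ` X. q Q = orb A act' y}. h (SOME x. x \<in> Q)) = osum A act ?X h"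
      unfolding osum_def by simp
    \<comment> \<open>The inclusion of the fibre over \<open>y\<close> into the part of
      \<open>X\<close> over the orbit of \<open>y\<close>: every point can be moved into the fibre,
      and an element that carries a point of the fibre to another one fixes
      \<open>y\<close>.\<close>
    also have "\<dots> = osum {a\<in>A. act' a y = y} act {x\<in>X. p x = y} h"
    proof (rule osum_transfer[OF Xy X', of h h "\<lambda>x. x", symmetric])
      show "\<exists>a\<in>{a \<in> A. act' a y = y}. x' = act a x"
        if "b \<in> A" "x \<in> {x \<in> X. p x = y}" "x' \<in> {x \<in> X. p x = y}" "x' = act b x" for b x x'
        using that eqv[of b x] by auto
      show "\<exists>x\<in>{x \<in> X. p x = y}. \<exists>b\<in>A. x' = act b x" if x': "x' \<in> ?X" for x'
      proof -
        have "orb A act' (p x') = orb A act' y" using x' by simp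
        then obtain a where a: "a \<in> A" "y = act' a (p x')" using orb_eq_iff[OF Y p y, of x'] x' by auto
        then have "p (act a x') = y" "act (inv a) (act a x') = x'"
          using x' eqv m[of "inv a" a x'] o[of x'] A.mem_carrier by auto
        then show ?thesis using a x' cl by (metis (mono_tags, lifting) A.m_inv_closed mem_Collect_eq)
      qed
    qed (use h in \<open>auto simp: invariant_def\<close>)
    finally show ?thesis .
  qed
  have "osum A act X h = (\<Sum>P\<in>orb A act' ` Y. \<Sum>Q\<in>{Q \<in> orb A act ` X. q Q = P}. h (SOME x. x \<in> Q))"
    unfolding osum_def by (rule sum.group[symmetric]) (use fin q p in auto)
  also have "\<dots> = osum A act' Y (\<lambda>y. osum {a\<in>A. act' a y = y} act {x\<in>X. p x = y} h)"
    unfolding osum_def[of A act' Y]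
  proof (rule sum.cong)
    fix P assume "P \<in> orb A act' ` Y"
    then obtain y where y: "y \<in> Y" "P = orb A act' y" by auto
    let ?z = "SOME x. x \<in> P"
    have "?z \<in> P" by (rule someI[of _ y]) (use y orb_self[OF Y] in auto)
    then have z: "?z \<in> Y" "\<exists>a\<in>A. ?z = act' a y"
      using orb_subset[OF Y y(1)] y(2) unfolding orb_def by auto
    then have z: "?z \<in> Y" "P = orb A act' ?z" using orb_eq_iff[OF Y y(1) z(1)] y(2) by auto
    show "(\<Sum>Q\<in>{Q \<in> orb A act ` X. q Q = P}. h (SOME x. x \<in> Q))
        = osum {a\<in>A. act' a ?z = ?z} act {x\<in>X. p x = ?z} h"
      using fib[OF z(1)] z(2) by simp
  qed simp
  finally show ?thesis .
qed

end

subsection \<open>Left cosets and their stabilisers\<close>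

definition cosets :: "('g, 'l) monoid_scheme \<Rightarrow> 'g set \<Rightarrow> 'g set set"
  where "cosets G H = (\<lambda>u. u <#\<^bsub>G\<^esub> H) ` carrier G"

definition cstab :: "('g, 'l) monoid_scheme \<Rightarrow> 'g set \<Rightarrow> 'g set"
  where "cstab G x = {g \<in> carrier G. g <#\<^bsub>G\<^esub> x = x}"

definition subconj :: "('g, 'l) monoid_scheme \<Rightarrow> 'g set \<Rightarrow> 'g set \<Rightarrow> 'g set set"
  where "subconj G P A = (\<lambda>g. conj_subgroup G g A) ` P"

abbreviation (input) lmult :: "('g, 'l) monoid_scheme \<Rightarrow> 'g \<Rightarrow> 'g set \<Rightarrow> 'g set"
  where "lmult G \<equiv> (\<lambda>a z. a <#\<^bsub>G\<^esub> z)"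

context group
begin

lemma cancel_simps [simp]:
  "x \<in> carrier G \<Longrightarrow> y \<in> carrier G \<Longrightarrow> x \<otimes> (inv x \<otimes> y) = y"
  "x \<in> carrier G \<Longrightarrow> y \<in> carrier G \<Longrightarrow> inv x \<otimes> (x \<otimes> y) = y"
  by (simp_all add: m_assoc[symmetric])

lemmas group_norm = m_assoc inv_mult_group

lemma lcos_mem: "u \<in> carrier G \<Longrightarrow> H \<subseteq> carrier G \<Longrightarrow> a \<in> u <# H \<longleftrightarrow> a \<in> carrier G \<and> inv u \<otimes> a \<in> H"
  unfolding l_coset_def by (auto simp: subset_iff intro!: bexI[of _ "inv u \<otimes> a"])

lemma rcos_mem: "u \<in> carrier G \<Longrightarrow> H \<subseteq> carrier G \<Longrightarrow> a \<in> H #> u \<longleftrightarrow> a \<in> carrier G \<and> a \<otimes> inv u \<in> H"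
  unfolding r_coset_def by (auto simp: m_assoc subset_iff intro!: bexI[of _ "a \<otimes> inv u"])

lemma lcos_closed: "u \<in> carrier G \<Longrightarrow> H \<subseteq> carrier G \<Longrightarrow> u <# H \<subseteq> carrier G"
  by (auto simp: lcos_mem)

lemma conj_mem: "u \<in> carrier G \<Longrightarrow> H \<subseteq> carrier G \<Longrightarrow>
    a \<in> conj_subgroup G u H \<longleftrightarrow> a \<in> carrier G \<and> inv u \<otimes> (a \<otimes> u) \<in> H"
  unfolding conj_subgroup_def by (auto simp: rcos_mem lcos_mem lcos_closed)

lemma conj_closed: "u \<in> carrier G \<Longrightarrow> H \<subseteq> carrier G \<Longrightarrow> conj_subgroup G u H \<subseteq> carrier G"
  by (auto simp: conj_mem)

lemma lcos_comp: "g \<in> carrier G \<Longrightarrow> h \<in> carrier G \<Longrightarrow> x \<subseteq> carrier G \<Longrightarrow> g <# (h <# x) = (g \<otimes> h) <# x"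
  by (rule lcos_m_assoc)

lemma lcos_one: "x \<subseteq> carrier G \<Longrightarrow> \<one> <# x = x"
  by (rule lcos_mult_one)

lemma lcos_inv_cancel: "g \<in> carrier G \<Longrightarrow> x \<subseteq> carrier G \<Longrightarrow> inv g <# (g <# x) = x"
  by (simp add: lcos_comp lcos_one)

lemma conj_comp: "g \<in> carrier G \<Longrightarrow> h \<in> carrier G \<Longrightarrow> H \<subseteq> carrier G \<Longrightarrow>
    conj_subgroup G g (conj_subgroup G h H) = conj_subgroup G (g \<otimes> h) H"
  by (auto simp: conj_mem conj_closed group_norm)

lemma conj_one: "H \<subseteq> carrier G \<Longrightarrow> conj_subgroup G \<one> H = H"
  by (rule Set.set_eqI) (auto simp: conj_mem subset_iff)

lemma conj_mono: "u \<in> carrier G \<Longrightarrow> H \<subseteq> K \<Longrightarrow> K \<subseteq> carrier G \<Longrightarrow> conj_subgroup G u H \<subseteq> conj_subgroup G u K"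
  by (auto simp: conj_mem)

lemma conj_Int: "u \<in> carrier G \<Longrightarrow> H \<subseteq> carrier G \<Longrightarrow> K \<subseteq> carrier G \<Longrightarrow>
    conj_subgroup G u (H \<inter> K) = conj_subgroup G u H \<inter> conj_subgroup G u K"
  by (auto simp: conj_mem le_infI1)

lemma conj_subgroup_subgroup:
  assumes H: "subgroup H G" and u: "u \<in> carrier G"
  shows "subgroup (conj_subgroup G u H) G"
proof -
  interpret H: subgroup H G by (rule H)
  show ?thesis
  proof (rule subgroupI)
    have "\<one> \<in> conj_subgroup G u H" using u by (simp add: conj_mem H.subset)
    then show "conj_subgroup G u H \<noteq> {}" by blast
    show "inv a \<in> conj_subgroup G u H" if "a \<in> conj_subgroup G u H" for a
      using that u H.m_inv_closed[of "inv u \<otimes> (a \<otimes> u)"] by (auto simp: conj_mem H.subset group_norm)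
    show "a \<otimes> b \<in> conj_subgroup G u H" if "a \<in> conj_subgroup G u H" "b \<in> conj_subgroup G u H" for a b
      using that u H.m_closed[of "inv u \<otimes> (a \<otimes> u)" "inv u \<otimes> (b \<otimes> u)"] by (auto simp: conj_mem H.subset group_norm)
  qed (use u in \<open>auto simp: conj_mem H.subset\<close>)
qed

lemma conj_self: "subgroup H G \<Longrightarrow> h \<in> H \<Longrightarrow> conj_subgroup G h H = H"
proof -
  assume H: "subgroup H G" and h: "h \<in> H"
  interpret H: subgroup H G by (rule H)
  have 1: "inv h \<otimes> (a \<otimes> h) \<in> H \<longleftrightarrow> a \<in> H" if a: "a \<in> carrier G" for a
  proof
    assume *: "inv h \<otimes> (a \<otimes> h) \<in> H"
    have "h \<otimes> (inv h \<otimes> (a \<otimes> h)) \<otimes> inv h \<in> H"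
      by (rule H.m_closed[OF H.m_closed[OF h *] H.m_inv_closed[OF h]])
    then show "a \<in> H" using a H.mem_carrier[OF h] by (simp add: m_assoc)
  next
    assume "a \<in> H"
    then show "inv h \<otimes> (a \<otimes> h) \<in> H" by (intro H.m_closed H.m_inv_closed h)
  qed
  show ?thesis
  proof (intro Set.set_eqI)
    fix a show "a \<in> conj_subgroup G h H \<longleftrightarrow> a \<in> H"
      using 1[of a] H.mem_carrier[of a] conj_mem[OF H.mem_carrier[OF h] H.subset, of a] by blast
  qed
qed

lemma lcos_eq_iff:
  assumes H: "subgroup H G" and u: "u \<in> carrier G" and v: "v \<in> carrier G"
  shows "u <# H = v <# H \<longleftrightarrow> inv u \<otimes> v \<in> H"
proof -
  interpret H: subgroup H G by (rule H)
  show ?thesis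
  proof
    assume "u <# H = v <# H"
    moreover have "v \<in> v <# H" using v by (simp add: lcos_mem H.subset)
    ultimately show "inv u \<otimes> v \<in> H" using u by (metis lcos_mem H.subset)
  next
    assume *: "inv u \<otimes> v \<in> H"
    have 1: "inv u \<otimes> a \<in> H \<longleftrightarrow> inv v \<otimes> a \<in> H" if a: "a \<in> carrier G" for a
    proof
      assume **: "inv u \<otimes> a \<in> H"
      have "inv (inv u \<otimes> v) \<otimes> (inv u \<otimes> a) \<in> H" by (rule H.m_closed[OF H.m_inv_closed[OF *] **])
      then show "inv v \<otimes> a \<in> H" using a u v by (simp add: group_norm)
    next
      assume **: "inv v \<otimes> a \<in> H"
      have "(inv u \<otimes> v) \<otimes> (inv v \<otimes> a) \<in> H" by (rule H.m_closed[OF * **])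
      then show "inv u \<otimes> a \<in> H" using a u v by (simp add: group_norm)
    qed
    then show "u <# H = v <# H" using u v by (auto simp: lcos_mem H.subset)
  qed
qed

lemma lcos_eq_mem: "subgroup H G \<Longrightarrow> u \<in> carrier G \<Longrightarrow> v \<in> u <# H \<Longrightarrow> u <# H = v <# H"
  by (simp add: lcos_eq_iff lcos_mem subgroup.subset)

lemma lcos_self: "subgroup H G \<Longrightarrow> u \<in> carrier G \<Longrightarrow> u \<in> u <# H"
  by (simp add: lcos_mem subgroup.subset subgroup.one_closed)

lemma cosetsI: "u \<in> carrier G \<Longrightarrow> u <# H \<in> cosets G H"
  unfolding cosets_def by auto

lemma cosetsE:
  assumes "x \<in> cosets G H" obtains u where "u \<in> carrier G" "x = u <# H"
  using assms unfolding cosets_def by auto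

lemma cosets_mem: "subgroup H G \<Longrightarrow> x \<in> cosets G H \<Longrightarrow> u \<in> x \<Longrightarrow> u \<in> carrier G \<and> x = u <# H"
proof -
  assume H: "subgroup H G" and x: "x \<in> cosets G H" and u: "u \<in> x"
  obtain v where v: "v \<in> carrier G" "x = v <# H" using cosetsE[OF x] .
  show "u \<in> carrier G \<and> x = u <# H"
    using lcos_eq_mem[OF H v(1), of u] lcos_mem[OF v(1) subgroup.subset[OF H], of u] u v by simp
qed

lemma cosets_nonempty: "subgroup H G \<Longrightarrow> x \<in> cosets G H \<Longrightarrow> \<exists>u. u \<in> x"
  using lcos_self by (auto elim!: cosetsE)

lemma cosets_subset: "subgroup H G \<Longrightarrow> x \<in> cosets G H \<Longrightarrow> x \<subseteq> carrier G"
  using cosets_mem by auto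

lemma coset_self: "subgroup H G \<Longrightarrow> H \<in> cosets G H"
  using cosetsI[of \<one> H] lcos_one[of H] subgroup.subset[of H G] by simp

lemma lcos_in_cosets: "subgroup H G \<Longrightarrow> x \<in> cosets G H \<Longrightarrow> g \<in> carrier G \<Longrightarrow> g <# x \<in> cosets G H"
  by (auto elim!: cosetsE simp: lcos_comp subgroup.subset intro!: cosetsI)

lemma finite_cosets: "finite (carrier G) \<Longrightarrow> finite (cosets G H)"
  unfolding cosets_def by auto

text \<open>For u in x the subgroup is recovered as the translate of x by the inverse of u. Hence a
  coset knows its own subgroup, states need not carry it along, and the source of a generator can be
  tested on the coset alone.\<close>

lemma coset_type_unique:
  assumes H: "subgroup H G" and K: "subgroup K G" and x: "x \<in> cosets G H" "x \<in> cosets G K"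
  shows "H = K"
proof -
  obtain u where u: "u \<in> x" using cosets_nonempty[OF H x(1)] by auto
  have eq: "u \<in> carrier G" "x = u <# H" "x = u <# K" using cosets_mem[OF H x(1) u] cosets_mem[OF K x(2) u] by auto
  have "inv u <# x = H" "inv u <# x = K" using eq lcos_inv_cancel subgroup.subset[OF H] subgroup.subset[OF K] by metis+
  then show ?thesis by simp
qed

lemma set_mult_lcos: "u \<in> carrier G \<Longrightarrow> H \<subseteq> carrier G \<Longrightarrow> K \<subseteq> carrier G \<Longrightarrow> (u <# H) <#> K = u <# (H <#> K)"
  unfolding set_mult_def l_coset_def by (auto simp: m_assoc subset_iff)

lemma set_mult_subgroup: "subgroup H G \<Longrightarrow> subgroup K G \<Longrightarrow> H \<subseteq> K \<Longrightarrow> H <#> K = K"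
proof -
  assume H: "subgroup H G" and K: "subgroup K G" and HK: "H \<subseteq> K"
  have "k \<in> H <#> K" if "k \<in> K" for k
    unfolding set_mult_def using subgroup.one_closed[OF H] that subgroup.mem_carrier[OF K that]
    by (simp, intro bexI[of _ \<one>] bexI[of _ k]) auto
  moreover have "H <#> K \<subseteq> K" unfolding set_mult_def using HK subgroup.m_closed[OF K] by auto
  ultimately show ?thesis by auto
qed

lemma lcos_up: "subgroup H G \<Longrightarrow> subgroup K G \<Longrightarrow> H \<subseteq> K \<Longrightarrow> u \<in> carrier G \<Longrightarrow> (u <# H) <#> K = u <# K"
  by (simp add: set_mult_lcos subgroup.subset set_mult_subgroup)

lemma up_in_cosets: "subgroup H G \<Longrightarrow> subgroup K G \<Longrightarrow> H \<subseteq> K \<Longrightarrow> x \<in> cosets G H \<Longrightarrow> x <#> K \<in> cosets G K"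
  by (auto elim!: cosetsE simp: lcos_up intro: cosetsI)

lemma up_subset: "subgroup H G \<Longrightarrow> subgroup K G \<Longrightarrow> H \<subseteq> K \<Longrightarrow> x \<in> cosets G H \<Longrightarrow> x \<subseteq> x <#> K"
  by (auto elim!: cosetsE simp: lcos_up lcos_mem subgroup.subset)

lemma up_eq_iff: "subgroup H G \<Longrightarrow> subgroup K G \<Longrightarrow> H \<subseteq> K \<Longrightarrow> x \<in> cosets G H \<Longrightarrow> y \<in> cosets G K \<Longrightarrow>
    x <#> K = y \<longleftrightarrow> x \<subseteq> y"
proof
  assume a: "subgroup H G" "subgroup K G" "H \<subseteq> K" "x \<in> cosets G H" "y \<in> cosets G K" and "x \<subseteq> y"
  obtain u where u: "u \<in> x" using cosets_nonempty a by metis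
  then have "x = u <# H" "u \<in> carrier G" "y = u <# K" using cosets_mem[OF a(1,4)] cosets_mem[OF a(2,5)] \<open>x \<subseteq> y\<close> by auto
  then show "x <#> K = y" using lcos_up[OF a(1-3)] by simp
qed (use up_subset in blast)

lemma lcos_up_comm: "subgroup K G \<Longrightarrow> x \<subseteq> carrier G \<Longrightarrow> g \<in> carrier G \<Longrightarrow> g <# (x <#> K) = (g <# x) <#> K"
  by (simp add: set_mult_lcos subgroup.subset)

lemma lcos_rcos_comm: "x \<subseteq> carrier G \<Longrightarrow> g \<in> carrier G \<Longrightarrow> k \<in> carrier G \<Longrightarrow> g <# (x #> k) = (g <# x) #> k"
  unfolding l_coset_def r_coset_def by (auto simp: m_assoc subset_iff)

lemma lcos_rcos_inv: "g \<in> carrier G \<Longrightarrow> u \<in> carrier G \<Longrightarrow> B \<subseteq> carrier G \<Longrightarrow>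
   (u <# B) #> inv g = (u \<otimes> inv g) <# conj_subgroup G g B"
  by (auto simp: rcos_mem lcos_mem conj_mem lcos_closed conj_closed group_norm)

lemma rcos_in_cosets: "g \<in> carrier G \<Longrightarrow> subgroup B G \<Longrightarrow> x \<in> cosets G B \<Longrightarrow> x #> inv g \<in> cosets G (conj_subgroup G g B)"
  by (auto elim!: cosetsE simp: lcos_rcos_inv subgroup.subset intro!: cosetsI)

lemma cstab_subgroup: "x \<subseteq> carrier G \<Longrightarrow> subgroup (cstab G x) G"
proof (rule subgroupI)
  assume x: "x \<subseteq> carrier G"
  show "cstab G x \<noteq> {}" using x lcos_one[OF x] unfolding cstab_def by blast
  show "inv a \<in> cstab G x" if "a \<in> cstab G x" for a
    using that lcos_inv_cancel[of a x] x unfolding cstab_def by auto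
  show "a \<otimes> b \<in> cstab G x" if "a \<in> cstab G x" "b \<in> cstab G x" for a b
    using that x by (auto simp: cstab_def lcos_comp[symmetric])
qed (auto simp: cstab_def)

lemma cstab_lcos: "subgroup H G \<Longrightarrow> u \<in> carrier G \<Longrightarrow> cstab G (u <# H) = conj_subgroup G u H"
proof (intro Set.set_eqI iffI)
  assume H: "subgroup H G" and u: "u \<in> carrier G"
  note s = subgroup.subset[OF H]
  fix a
  show "a \<in> conj_subgroup G u H" if "a \<in> cstab G (u <# H)"
  proof -
    have a: "a \<in> carrier G" "(a \<otimes> u) <# H = u <# H" using that u s by (auto simp: cstab_def lcos_comp)
    then have "inv u \<otimes> (a \<otimes> u) \<in> H" using lcos_eq_iff[OF H u, of "a \<otimes> u"] u by simp
    then show ?thesis using a u s by (simp add: conj_mem)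
  qed
  show "a \<in> cstab G (u <# H)" if "a \<in> conj_subgroup G u H"
  proof -
    have a: "a \<in> carrier G" "inv u \<otimes> (a \<otimes> u) \<in> H" using that u s by (auto simp: conj_mem)
    then have "(a \<otimes> u) <# H = u <# H" using lcos_eq_iff[OF H u, of "a \<otimes> u"] u by simp
    then show ?thesis using a u s by (simp add: cstab_def lcos_comp)
  qed
qed

lemma cstab_self: "subgroup H G \<Longrightarrow> cstab G H = H"
  using cstab_lcos[of H \<one>] conj_one[of H] subgroup.subset[of H G] lcos_one[of H] by simp

lemma cstab_translate: "x \<subseteq> carrier G \<Longrightarrow> g \<in> carrier G \<Longrightarrow> cstab G (g <# x) = conj_subgroup G g (cstab G x)"
proof (intro Set.set_eqI iffI)
  assume x: "x \<subseteq> carrier G" and g: "g \<in> carrier G"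
  have s: "cstab G x \<subseteq> carrier G" by (auto simp: cstab_def)
  fix a
  have *: "a <# (g <# x) = g <# x \<longleftrightarrow> (inv g \<otimes> (a \<otimes> g)) <# x = x" if a: "a \<in> carrier G"
  proof -
    have "(inv g \<otimes> (a \<otimes> g)) <# x = inv g <# (a <# (g <# x))" using a g x by (simp add: lcos_comp lcos_closed)
    moreover have "g <# (inv g <# (a <# (g <# x))) = a <# (g <# x)" using a g x by (simp add: lcos_comp lcos_closed)
    ultimately show ?thesis using lcos_inv_cancel[OF g x] by metis
  qed
  show "a \<in> conj_subgroup G g (cstab G x)" if "a \<in> cstab G (g <# x)"
    using that * g s by (auto simp: conj_mem) (auto simp: cstab_def)
  show "a \<in> cstab G (g <# x)" if "a \<in> conj_subgroup G g (cstab G x)"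
    using that * g s by (auto simp: conj_mem) (auto simp: cstab_def)
qed

lemma cstab_closed: "cstab G x \<subseteq> carrier G" by (auto simp: cstab_def)

lemma cstab_up: "subgroup K G \<Longrightarrow> x \<subseteq> carrier G \<Longrightarrow> cstab G x \<subseteq> cstab G (x <#> K)"
  by (auto simp: cstab_def lcos_up_comm)

lemma cstab_mono: "subgroup H G \<Longrightarrow> subgroup K G \<Longrightarrow> H \<subseteq> K \<Longrightarrow> x \<in> cosets G H \<Longrightarrow> y \<in> cosets G K \<Longrightarrow>
   x \<subseteq> y \<Longrightarrow> cstab G x \<subseteq> cstab G y"
  using cstab_up[of K x] up_eq_iff[of H K x y] cosets_subset[of H x] by auto

lemma lcos_mono: "x \<subseteq> y \<Longrightarrow> a <# x \<subseteq> a <# y"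
  unfolding l_coset_def by auto

lemma acts_children:
  assumes A: "subgroup A G" and H: "subgroup H G" and y: "A \<subseteq> cstab G y"
  shows "acts G A (lmult G) {z \<in> cosets G H. z \<subseteq> y}"
  unfolding acts_def
proof (intro conjI ballI)
  have Ac: "a \<in> carrier G" if "a \<in> A" for a using subgroup.mem_carrier[OF A that] .
  show "a <# z \<in> {z \<in> cosets G H. z \<subseteq> y}" if "a \<in> A" "z \<in> {z \<in> cosets G H. z \<subseteq> y}" for a z
  proof -
    have "a <# y = y" using y that by (auto simp: cstab_def)
    then have "a <# z \<subseteq> y" using lcos_mono[of z y a] that by auto
    then show ?thesis using that lcos_in_cosets[OF H] Ac by auto
  qed
qed (use A cosets_subset[OF H] subgroup.mem_carrier[OF A] in \<open>auto simp: lcos_one lcos_comp\<close>)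

lemma subgroup_Int: "subgroup H G \<Longrightarrow> subgroup K G \<Longrightarrow> subgroup (H \<inter> K) G"
  using subgroups_Inter_pair by blast

lemma subconj_eq_iff:
  assumes P: "subgroup P G" and A: "A \<subseteq> carrier G" and B: "B \<subseteq> carrier G"
  shows "subconj G P A = subconj G P B \<longleftrightarrow> (\<exists>p\<in>P. B = conj_subgroup G p A)"
proof -
  interpret P: subgroup P G by (rule P)
  have 1: "subconj G P (conj_subgroup G p A) \<subseteq> subconj G P A" if "p \<in> P" "A \<subseteq> carrier G" for p A
    using that P.mem_carrier P.m_closed unfolding subconj_def by (auto simp: conj_comp)
  have 2: "subconj G P A = subconj G P (conj_subgroup G p A)" if p: "p \<in> P" for p
    using 1[OF p A] 1[of "inv p" "conj_subgroup G p A"] p A P.mem_carrier[OF p]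
    by (auto simp: conj_comp conj_closed conj_one)
  have "B \<in> subconj G P B"
    unfolding subconj_def by (rule image_eqI[of _ _ \<one>]) (simp_all add: conj_one[OF B])
  then show ?thesis using 2 unfolding subconj_def[of _ _ A] by (metis imageE)
qed

lemma subconj_conj: "subgroup P G \<Longrightarrow> A \<subseteq> carrier G \<Longrightarrow> p \<in> P \<Longrightarrow> subconj G P (conj_subgroup G p A) = subconj G P A"
  using subconj_eq_iff[of P A "conj_subgroup G p A"] conj_closed subgroup.mem_carrier by metis

end

subsection \<open>The generators as operators on functions of pairs (subgroup, coset)\<close>

text \<open>For H \<le> K and x in G/K this is the fibre over x of G/H \<rightarrow> G/K; for x = P
  with H \<le> P it is P/H.\<close>

definition kids :: "('g, 'l) monoid_scheme \<Rightarrow> 'g set \<Rightarrow> 'g set \<Rightarrow> 'g set set"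
  where "kids G H x = {z \<in> cosets G H. z \<subseteq> x}"

text \<open>\<open>h\<close> is an additive invariant of L-sets over coset spaces, given by its
  values at the transitive sets L/A over G/H with base point over \<open>x\<close>.
  \<open>Tr\<close> composes with G/H \<rightarrow> G/K, and \<open>Cj\<close> with right
  multiplication by the inverse of \<open>g\<close>. \<open>Rs\<close> pulls back along G/H
  \<rightarrow> G/K; the pullback splits into one piece for each A-orbit on the fibre over
  \<open>x\<close>, with stabiliser \<open>A \<inter> cstab G z\<close>. Off the source the value is
  zero.\<close>

fun gact :: "('g, 'l) monoid_scheme \<Rightarrow> 'g mackey_gen \<Rightarrow> ('g set \<Rightarrow> 'g set \<Rightarrow> 'm) \<Rightarrow>
    'g set \<Rightarrow> 'g set \<Rightarrow> 'm :: comm_monoid_add" where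
  "gact G (Tr K H) h A x = (if x \<in> cosets G H then h A (x <#>\<^bsub>G\<^esub> K) else 0)"
| "gact G (Rs K H) h A x = (if x \<in> cosets G K
     then osum A (lmult G) (kids G H x) (\<lambda>z. h (A \<inter> cstab G z) z) else 0)"
| "gact G (Cj g H) h A x = (if x \<in> cosets G H then h A (x #>\<^bsub>G\<^esub> inv\<^bsub>G\<^esub> g) else 0)"

text \<open>Functions are pulled back, so the leftmost letter is applied to \<open>h\<close> first
  and the rightmost letter is the one that meets the state at which the result is evaluated. This
  matches products read as compositions.\<close>

abbreviation wact :: "('g, 'l) monoid_scheme \<Rightarrow> 'g mackey_gen list \<Rightarrow> ('g set \<Rightarrow> 'g set \<Rightarrow> 'm) \<Rightarrow>
    'g set \<Rightarrow> 'g set \<Rightarrow> 'm :: comm_monoid_add"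
  where "wact G w h \<equiv> fold (gact G) w h"

definition valid_state :: "('g, 'l) monoid_scheme \<Rightarrow> 'g set \<Rightarrow> 'g set \<Rightarrow> 'g set \<Rightarrow> bool"
  where "valid_state G L A x \<longleftrightarrow> subgroup A G \<and> A \<subseteq> L \<and> A \<subseteq> cstab G x \<and> (\<exists>H. subgroup H G \<and> x \<in> cosets G H)"

text \<open>Moving the base point of L/A by k changes the stabiliser to its conjugate and the coset
  below to its translate. The value must not depend on the base point.\<close>

definition inv_state :: "('g, 'l) monoid_scheme \<Rightarrow> 'g set \<Rightarrow> ('g set \<Rightarrow> 'g set \<Rightarrow> 'm) \<Rightarrow> bool"
  where "inv_state G L h \<longleftrightarrow> (\<forall>A x k. valid_state G L A x \<longrightarrow> k \<in> L \<longrightarrow>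
     h (conj_subgroup G k A) (k <#\<^bsub>G\<^esub> x) = h A x)"

locale fin_group = group G for G (structure) +
  assumes finite_carrier: "finite (carrier G)"
begin

lemma valid_stateD:
  assumes "valid_state G L A x"
  shows "subgroup A G" "A \<subseteq> L" "A \<subseteq> cstab G x" "x \<subseteq> carrier G" "A \<subseteq> carrier G"
  using assms subgroup.subset cosets_subset unfolding valid_state_def by metis+

lemma valid_stateI:
  "subgroup A G \<Longrightarrow> A \<subseteq> L \<Longrightarrow> A \<subseteq> cstab G x \<Longrightarrow> subgroup H G \<Longrightarrow> x \<in> cosets G H \<Longrightarrow> valid_state G L A x"
  unfolding valid_state_def by blast

lemma finite_kids: "finite (kids G H x)"
  unfolding kids_def using finite_cosets[OF finite_carrier] by auto

lemma kids_cosets: "z \<in> kids G H x \<Longrightarrow> z \<in> cosets G H" by (simp add: kids_def)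

lemma acts_kids: "subgroup A G \<Longrightarrow> subgroup H G \<Longrightarrow> A \<subseteq> cstab G x \<Longrightarrow> acts G A (lmult G) (kids G H x)"
  unfolding kids_def by (rule acts_children)

lemma conj_Int_cstab:
  assumes A: "subgroup A G" and a: "a \<in> A" and z: "z \<subseteq> carrier G"
  shows "A \<inter> cstab G (a <# z) = conj_subgroup G a (A \<inter> cstab G z)"
  using conj_Int[of a A "cstab G z"] conj_self[OF A a] cstab_translate[OF z] subgroup.mem_carrier[OF A a]
    subgroup.subset[OF A] cstab_closed by metis

lemma valid_kid:
  assumes "valid_state G L A x" "subgroup H G" "z \<in> cosets G H"
  shows "valid_state G L (A \<inter> cstab G z) z"
  using assms valid_stateD[OF assms(1)] cstab_subgroup[OF cosets_subset[OF assms(2,3)]]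
  by (intro valid_stateI[OF subgroup_Int _ _ assms(2,3)]) auto

text \<open>This is what makes the orbit sum in \<open>gact\<close> for \<open>Rs\<close>
  independent of representatives: A \<le> L, and \<open>h\<close> is invariant under L.\<close>

lemma kids_invariant:
  assumes h: "inv_state G L h" and v: "valid_state G L A x" and H: "subgroup H G"
  shows "invariant A (lmult G) (kids G H x) (\<lambda>z. h (A \<inter> cstab G z) z)"
  unfolding invariant_def
proof (intro ballI)
  fix a z assume a: "a \<in> A" and z: "z \<in> kids G H x"
  note zc = cosets_subset[OF H kids_cosets[OF z]]
  show "h (A \<inter> cstab G (a <# z)) (a <# z) = h (A \<inter> cstab G z) z"
    unfolding conj_Int_cstab[OF valid_stateD(1)[OF v] a zc]
    using h valid_kid[OF v H kids_cosets[OF z]] a valid_stateD(2)[OF v] unfolding inv_state_def by blast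
qed

lemma valid_up:
  assumes "valid_state G L A x" "subgroup H G" "subgroup K G" "H \<subseteq> K" "x \<in> cosets G H"
  shows "valid_state G L A (x <#> K)"
  using valid_stateD[OF assms(1)] cstab_up[OF assms(3), of x]
  by (intro valid_stateI[OF _ _ _ assms(3) up_in_cosets[OF assms(2-5)]]) auto

lemma valid_rcos:
  assumes v: "valid_state G L A x" and H: "subgroup H G" "x \<in> cosets G H" and g: "g \<in> carrier G"
  shows "valid_state G L A (x #> inv g)"
proof -
  have "A \<subseteq> cstab G (x #> inv g)"
    using valid_stateD[OF v] lcos_rcos_comm[OF valid_stateD(4)[OF v], of _ "inv g"] g
    by (auto simp: cstab_def subset_iff)
  then show ?thesis
    using valid_stateD[OF v] by (intro valid_stateI[OF _ _ _ conj_subgroup_subgroup[OF H(1) g] rcos_in_cosets[OF g H]]) auto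
qed

lemma valid_translate:
  assumes v: "valid_state G L A x" and L: "subgroup L G" and k: "k \<in> L"
  shows "valid_state G L (conj_subgroup G k A) (k <# x)"
proof -
  obtain H where H: "subgroup H G" "x \<in> cosets G H" using v unfolding valid_state_def by auto
  have kc: "k \<in> carrier G" using subgroup.mem_carrier[OF L k] .
  have "conj_subgroup G k A \<subseteq> L"
    using conj_mono[OF kc valid_stateD(2)[OF v] subgroup.subset[OF L]] conj_self[OF L k] by simp
  moreover have "conj_subgroup G k A \<subseteq> cstab G (k <# x)"
    using conj_mono[OF kc valid_stateD(3)[OF v] cstab_closed] cstab_translate[OF valid_stateD(4)[OF v] kc] by simp
  ultimately show ?thesis
    using conj_subgroup_subgroup[OF valid_stateD(1)[OF v] kc] lcos_in_cosets[OF H kc]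
    by (intro valid_stateI[OF _ _ _ H(1)]) auto
qed

lemma lcos_cosets_iff: "subgroup H G \<Longrightarrow> x \<subseteq> carrier G \<Longrightarrow> g \<in> carrier G \<Longrightarrow> g <# x \<in> cosets G H \<longleftrightarrow> x \<in> cosets G H"
  using lcos_in_cosets[of H x g] lcos_in_cosets[of H "g <# x" "inv g"] lcos_inv_cancel[of g x] by auto

lemma gens_subgroups:
  "Tr K H \<in> mackey_gens G \<longleftrightarrow> subgroup H G \<and> subgroup K G \<and> H \<subseteq> K"
  "Rs K H \<in> mackey_gens G \<longleftrightarrow> subgroup H G \<and> subgroup K G \<and> H \<subseteq> K"
  "Cj g H \<in> mackey_gens G \<longleftrightarrow> subgroup H G \<and> g \<in> carrier G"
  by (auto simp: mackey_gens_def)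

text \<open>Every state at which \<open>gact\<close> evaluates its argument is again valid. Hence
  identities proved at valid states only may be used inside longer words.\<close>

lemma gact_cong:
  assumes g: "g \<in> mackey_gens G" and v: "valid_state G L A x"
    and eq: "\<And>A x. valid_state G L A x \<Longrightarrow> h A x = h' A x"
  shows "gact G g h A x = gact G g h' A x"
proof (cases g)
  case (Tr K H)
  then show ?thesis using eq valid_up[OF v, of H K] g by (simp add: gens_subgroups)
next
  case (Rs K H)
  then have "osum A (lmult G) (kids G H x) (\<lambda>z. h (A \<inter> cstab G z) z) = osum A (lmult G) (kids G H x) (\<lambda>z. h' (A \<inter> cstab G z) z)"
    using g eq valid_kid[OF v] kids_cosets valid_stateD[OF v]
    by (intro osum_cong[OF acts_kids]) (auto simp: gens_subgroups)
  then show ?thesis using Rs by simp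
next
  case (Cj k H)
  then show ?thesis using eq valid_rcos[OF v, of H k] g by (simp add: gens_subgroups)
qed

lemma kids_translate: "subgroup H G \<Longrightarrow> x \<subseteq> carrier G \<Longrightarrow> k \<in> carrier G \<Longrightarrow> z \<in> kids G H x \<Longrightarrow> k <# z \<in> kids G H (k <# x)"
  unfolding kids_def using lcos_in_cosets lcos_mono by auto

text \<open>Only \<open>Rs\<close> needs an argument: left translation by k carries the A-orbits on
  the fibre over x to the orbits of the conjugate of A on the fibre over kx, and conjugates the
  stabilisers accordingly.\<close>

lemma gact_inv:
  assumes g: "g \<in> mackey_gens G" and L: "subgroup L G" and h: "inv_state G L h"
  shows "inv_state G L (gact G g h)"
  unfolding inv_state_def
proof (intro allI impI)
  fix A x k assume v: "valid_state G L A x" and k: "k \<in> L"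
  note D = valid_stateD[OF v]
  have kc: "k \<in> carrier G" using subgroup.mem_carrier[OF L k] .
  note vt = valid_translate[OF v L k]
  have hh: "h (conj_subgroup G k B) (k <# y) = h B y" if "valid_state G L B y" for B y
    using h that k unfolding inv_state_def by blast
  show "gact G g h (conj_subgroup G k A) (k <# x) = gact G g h A x"
  proof (cases g)
    case (Tr K H)
    then show ?thesis using g hh[OF valid_up[OF v, of H K]] D kc
      by (simp add: gens_subgroups lcos_cosets_iff lcos_up_comm[symmetric])
  next
    case (Rs K H)
    then have HK: "subgroup H G" "subgroup K G" using g by (auto simp: gens_subgroups)
    have "osum A (lmult G) (kids G H x) (\<lambda>z. h (A \<inter> cstab G z) z)
      = osum (conj_subgroup G k A) (lmult G) (kids G H (k <# x)) (\<lambda>z. h (conj_subgroup G k A \<inter> cstab G z) z)"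
    proof (rule osum_transfer[where f = "\<lambda>z. k <# z"])
      show "acts G A (lmult G) (kids G H x)" by (rule acts_kids[OF D(1) HK(1) D(3)])
      show "acts G (conj_subgroup G k A) (lmult G) (kids G H (k <# x))"
        by (rule acts_kids[OF valid_stateD(1)[OF vt] HK(1) valid_stateD(3)[OF vt]])
      show "invariant A (lmult G) (kids G H x) (\<lambda>z. h (A \<inter> cstab G z) z)"
        by (rule kids_invariant[OF h v HK(1)])
      show "invariant (conj_subgroup G k A) (lmult G) (kids G H (k <# x)) (\<lambda>z. h (conj_subgroup G k A \<inter> cstab G z) z)"
        by (rule kids_invariant[OF h vt HK(1)])
      fix z assume z: "z \<in> kids G H x"
      note zc = cosets_subset[OF HK(1) kids_cosets[OF z]]
      show "k <# z \<in> kids G H (k <# x)" using kids_translate[OF HK(1) D(4) kc z] .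
      show "h (A \<inter> cstab G z) z = h (conj_subgroup G k A \<inter> cstab G (k <# z)) (k <# z)"
        using hh[OF valid_kid[OF v HK(1) kids_cosets[OF z]]] conj_Int[OF kc D(5) cstab_closed, of z]
          cstab_translate[OF zc kc] by simp
      show "\<exists>b\<in>conj_subgroup G k A. k <# (a <# z) = b <# (k <# z)" if a: "a \<in> A" for a
      proof -
        have ac: "a \<in> carrier G" using a D(5) by auto
        show ?thesis
          by (rule bexI[of _ "k \<otimes> a \<otimes> inv k"])
             (use ac kc zc a D(5) in \<open>auto simp: lcos_comp conj_mem group_norm\<close>)
      qed
      show "\<exists>a\<in>A. z' = a <# z" if b: "b \<in> conj_subgroup G k A" and z': "z' \<in> kids G H x" and eq: "k <# z' = b <# (k <# z)" for b z'
      proof -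
        have bc: "b \<in> carrier G" "inv k \<otimes> (b \<otimes> k) \<in> A" using b D(5) kc by (auto simp: conj_mem)
        have "z' = inv k <# (k <# z')" using lcos_inv_cancel[OF kc cosets_subset[OF HK(1) kids_cosets[OF z']]] by simp
        also have "\<dots> = (inv k \<otimes> (b \<otimes> k)) <# z" using bc kc zc by (simp add: eq lcos_comp lcos_closed)
        finally show ?thesis using bc by auto
      qed
    next
      fix y assume y: "y \<in> kids G H (k <# x)"
      note yc = cosets_subset[OF HK(1) kids_cosets[OF y]]
      have "inv k <# y \<in> kids G H (inv k <# (k <# x))"
        by (rule kids_translate[OF HK(1) _ _ y]) (use kc D(4) lcos_closed in auto)
      then have "inv k <# y \<in> kids G H x" using lcos_inv_cancel[OF kc D(4)] by simp
      moreover have "\<one> \<in> conj_subgroup G k A" using subgroup.one_closed[OF valid_stateD(1)[OF vt]] .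
      moreover have "y = \<one> <# (k <# (inv k <# y))" using kc yc by (simp add: lcos_comp lcos_one)
      ultimately show "\<exists>z\<in>kids G H x. \<exists>b\<in>conj_subgroup G k A. y = b <# (k <# z)" by blast
    qed
    then show ?thesis using Rs lcos_cosets_iff[OF HK(2) D(4) kc] by simp
  next
    case (Cj c H)
    then show ?thesis using g hh[OF valid_rcos[OF v, of H c]] D kc
      by (simp add: gens_subgroups lcos_cosets_iff lcos_rcos_comm[symmetric])
  qed
qed

lemma wact_inv:
  assumes "set w \<subseteq> mackey_gens G" "subgroup L G" "inv_state G L h"
  shows "inv_state G L (wact G w h)"
  using assms(1,3) by (induction w arbitrary: h) (auto intro: gact_inv[OF _ assms(2)])

lemma wact_cong:
  assumes "set w \<subseteq> mackey_gens G" "valid_state G L A x" "\<And>A x. valid_state G L A x \<Longrightarrow> h A x = h' A x"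
  shows "wact G w h A x = wact G w h' A x"
  using assms
proof (induction w arbitrary: h h' A x)
  case (Cons g w)
  have "gact G g h B y = gact G g h' B y" if "valid_state G L B y" for B y
    by (rule gact_cong[OF _ that Cons.prems(3)]) (use Cons in auto)
  then show ?case using Cons.IH[of A x "gact G g h" "gact G g h'"] Cons.prems by simp
qed simp

lemma gact_sum:
  assumes "finite I"
  shows "gact G g (\<lambda>A x. \<Sum>i\<in>I. h i A x) = (\<lambda>A x. \<Sum>i\<in>I. gact G g (h i) A x)"
proof (intro ext, cases g)
  fix A x
  case (Rs K H)
  then show "gact G g (\<lambda>A x. \<Sum>i\<in>I. h i A x) A x = (\<Sum>i\<in>I. gact G g (h i) A x)"
    by (simp add: osum_def) (rule impI, rule sum.swap)
qed auto

lemma wact_sum: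
  assumes "finite I"
  shows "wact G w (\<lambda>A x. \<Sum>i\<in>I. h i A x) = (\<lambda>A x. \<Sum>i\<in>I. wact G w (h i) A x)"
  by (induction w arbitrary: h) (simp_all add: gact_sum[OF assms])

end

lemma acts_closed: "acts G A act X \<Longrightarrow> a \<in> A \<Longrightarrow> x \<in> X \<Longrightarrow> act a x \<in> X"
  unfolding acts_def by blast

section \<open>The defining relations hold for the operators\<close>

context fin_group
begin

lemma cstab_rcos: "x \<subseteq> carrier G \<Longrightarrow> g \<in> carrier G \<Longrightarrow> cstab G (x #> inv g) = cstab G x"
proof -
  have 1: "cstab G x \<subseteq> cstab G (x #> g)" if "x \<subseteq> carrier G" "g \<in> carrier G" for x g
    using that by (auto simp: cstab_def lcos_rcos_comm)
  assume x: "x \<subseteq> carrier G" and g: "g \<in> carrier G"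
  have "(x #> inv g) #> g = x" using x g by (simp add: coset_mult_assoc)
  then show ?thesis using 1[OF x, of "inv g"] 1[of "x #> inv g" g] x g r_coset_subset_G[OF x, of "inv g"] by auto
qed

lemma rcos_cancel: "x \<subseteq> carrier G \<Longrightarrow> g \<in> carrier G \<Longrightarrow> (x #> inv g) #> g = x" "x \<subseteq> carrier G \<Longrightarrow> g \<in> carrier G \<Longrightarrow> (x #> g) #> inv g = x"
  by (simp_all add: coset_mult_assoc)

lemma coset_up_self: "subgroup H G \<Longrightarrow> x \<in> cosets G H \<Longrightarrow> x <#> H = x"
  using up_eq_iff[of H H x x] by auto

lemma kids_self: "subgroup H G \<Longrightarrow> x \<in> cosets G H \<Longrightarrow> kids G H x = {x}"
proof -
  assume H: "subgroup H G" and x: "x \<in> cosets G H"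
  have "z = x" if "z \<in> kids G H x" for z
    using that up_eq_iff[OF H H subset_refl _ x, of z] coset_up_self[OF H] by (auto simp: kids_def)
  then show ?thesis using x by (auto simp: kids_def)
qed

context
  fixes L A x and h :: "'a set \<Rightarrow> 'a set \<Rightarrow> 'm :: comm_monoid_add"
  assumes h: "inv_state G L h" and v: "valid_state G L A x"
begin

text \<open>The coset x has exactly one type H, so one summand survives, and that summand does not
  move x.\<close>

lemma rel_unit: "(\<Sum>H\<in>{H. subgroup H G}. gact G (Tr H H) h A x) = h A x"
proof -
  obtain H0 where H0: "subgroup H0 G" "x \<in> cosets G H0" using v unfolding valid_state_def by auto
  have fin: "finite {H. subgroup H G}"
    by (rule finite_subset[of _ "Pow (carrier G)"]) (use subgroup.subset finite_carrier in auto)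
  have "(\<Sum>H\<in>{H. subgroup H G}. gact G (Tr H H) h A x) = (\<Sum>H\<in>{H. subgroup H G}. if H = H0 then h A x else 0)"
    using H0 coset_type_unique[OF _ H0(1)] coset_up_self by (intro sum.cong) auto
  then show ?thesis using H0 fin by simp
qed

lemma rel_idem_r: "subgroup H G \<Longrightarrow> gact G (Tr H H) h A x = gact G (Rs H H) h A x"
proof (cases "x \<in> cosets G H")
  case True
  assume H: "subgroup H G"
  have "osum A (lmult G) (kids G H x) (\<lambda>z. h (A \<inter> cstab G z) z) = h (A \<inter> cstab G x) x"
    by (rule osum_single[OF acts_kids[OF valid_stateD(1)[OF v] H valid_stateD(3)[OF v]] _ kids_invariant[OF h v H]])
       (use kids_self[OF H True] lcos_one[OF valid_stateD(4)[OF v]] subgroup.one_closed[OF valid_stateD(1)[OF v]] in force)+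
  moreover have "A \<inter> cstab G x = A" using valid_stateD(3)[OF v] by auto
  ultimately show ?thesis using True coset_up_self[OF H True] by simp
qed simp

lemma rel_idem_c: "subgroup H G \<Longrightarrow> k \<in> H \<Longrightarrow> gact G (Tr H H) h A x = gact G (Cj k H) h A x"
proof (cases "x \<in> cosets G H")
  case True
  assume H: "subgroup H G" and k: "k \<in> H"
  obtain u where u: "u \<in> carrier G" "x = u <# H" using True by (rule cosetsE)
  have kc: "k \<in> carrier G" using subgroup.mem_carrier[OF H k] .
  have "x #> inv k = (u \<otimes> inv k) <# H"
    using lcos_rcos_inv[OF kc u(1) subgroup.subset[OF H]] conj_self[OF H k] u by simp
  also have "\<dots> = x" using lcos_eq_iff[OF H u(1), of "u \<otimes> inv k"] u kc subgroup.m_inv_closed[OF H k] by simp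
  finally show ?thesis using True coset_up_self[OF H True] by simp
qed simp

lemma rel_tt: "subgroup H G \<Longrightarrow> subgroup K G \<Longrightarrow> subgroup M G \<Longrightarrow> H \<subseteq> K \<Longrightarrow> K \<subseteq> M \<Longrightarrow>
    wact G [Tr M K, Tr K H] h A x = gact G (Tr M H) h A x"
proof -
  assume a: "subgroup H G" "subgroup K G" "subgroup M G" "H \<subseteq> K" "K \<subseteq> M"
  then have HM: "H \<subseteq> M" by auto
  have "x <#> K <#> M = x <#> M" "x <#> K \<in> cosets G K" if x: "x \<in> cosets G H"
  proof -
    obtain u where u: "u \<in> carrier G" "x = u <# H" using x by (rule cosetsE)
    show "x <#> K <#> M = x <#> M"
      using u lcos_up[OF a(1,2,4)] lcos_up[OF a(2,3,5)] lcos_up[OF a(1,3) HM] by simp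
    show "x <#> K \<in> cosets G K" using up_in_cosets[OF a(1,2,4) x] .
  qed
  then show ?thesis by auto
qed

text \<open>Pullback in two steps: the fibre over x in G/H maps to the fibre over x in G/K, and
  orbits upstairs are counted by \<open>osum_fibration\<close>. The stabiliser of y in A is
  \<open>A \<inter> cstab G y\<close>, and intersecting with it first changes nothing, since a coset
  z inside y has its stabiliser inside that of y.\<close>

lemma rel_rr: "subgroup H G \<Longrightarrow> subgroup K G \<Longrightarrow> subgroup M G \<Longrightarrow> H \<subseteq> K \<Longrightarrow> K \<subseteq> M \<Longrightarrow>
    wact G [Rs K H, Rs M K] h A x = gact G (Rs M H) h A x"
proof (cases "x \<in> cosets G M")
  case True
  assume a: "subgroup H G" "subgroup K G" "subgroup M G" "H \<subseteq> K" "K \<subseteq> M"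
  note D = valid_stateD[OF v]
  have XH: "acts G A (lmult G) (kids G H x)" by (rule acts_kids[OF D(1) a(1) D(3)])
  have XK: "acts G A (lmult G) (kids G K x)" by (rule acts_kids[OF D(1) a(2) D(3)])
  have fib: "osum A (lmult G) (kids G H x) (\<lambda>z. h (A \<inter> cstab G z) z) =
    osum A (lmult G) (kids G K x) (\<lambda>y. osum {a \<in> A. a <# y = y} (lmult G) {z \<in> kids G H x. z <#> K = y} (\<lambda>z. h (A \<inter> cstab G z) z))"
  proof (rule osum_fibration[OF XH XK finite_kids finite_kids kids_invariant[OF h v a(1)]])
    show "z <#> K \<in> kids G K x" if z: "z \<in> kids G H x" for z
    proof -
      have "z <#> M = x" using up_eq_iff[OF a(1,3) _ _ True, of z] z a by (auto simp: kids_def)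
      moreover have "z <#> K <#> M = z <#> M"
      proof -
        obtain u where u: "u \<in> carrier G" "z = u <# H" using z cosetsE[of z H] by (auto simp: kids_def)
        show ?thesis using u a lcos_up[of H K u] lcos_up[of K M u] lcos_up[of H M u] by auto
      qed
      ultimately show ?thesis
        using up_in_cosets[OF a(1,2,4) kids_cosets[OF z]] up_eq_iff[OF a(2,3,5) _ True] by (simp add: kids_def)
    qed
    show "(b <# z) <#> K = b <# (z <#> K)" if "b \<in> A" "z \<in> kids G H x" for b z
      using lcos_up_comm[OF a(2) cosets_subset[OF a(1) kids_cosets[OF that(2)]]] D(5) that by auto
  qed
  have "osum {a \<in> A. a <# y = y} (lmult G) {z \<in> kids G H x. z <#> K = y} (\<lambda>z. h (A \<inter> cstab G z) z)
      = gact G (Rs K H) h (A \<inter> cstab G y) y" if y: "y \<in> kids G K x" for y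
  proof -
    note yc = kids_cosets[OF y]
    note vy = valid_kid[OF v a(2) yc]
    have 1: "{a \<in> A. a <# y = y} = A \<inter> cstab G y" using D(5) by (auto simp: cstab_def)
    have 2: "{z \<in> kids G H x. z <#> K = y} = kids G H y"
      using y up_eq_iff[OF a(1,2,4) _ yc] by (auto simp: kids_def)
    have "osum (A \<inter> cstab G y) (lmult G) (kids G H y) (\<lambda>z. h (A \<inter> cstab G z) z)
      = osum (A \<inter> cstab G y) (lmult G) (kids G H y) (\<lambda>z. h (A \<inter> cstab G y \<inter> cstab G z) z)"
    proof (rule osum_cong[OF acts_kids[OF valid_stateD(1)[OF vy] a(1) valid_stateD(3)[OF vy]]])
      fix z assume z: "z \<in> kids G H y"
      have "cstab G z \<subseteq> cstab G y" using cstab_mono[OF a(1,2,4) kids_cosets[OF z] yc] z by (simp add: kids_def)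
      then have "A \<inter> cstab G y \<inter> cstab G z = A \<inter> cstab G z" by auto
      then show "h (A \<inter> cstab G z) z = h (A \<inter> cstab G y \<inter> cstab G z) z" by simp
    qed
    then show ?thesis using yc 1 2 by simp
  qed
  then have "osum A (lmult G) (kids G H x) (\<lambda>z. h (A \<inter> cstab G z) z) =
     osum A (lmult G) (kids G K x) (\<lambda>y. gact G (Rs K H) h (A \<inter> cstab G y) y)"
    unfolding fib by (rule osum_cong[OF XK])
  then show ?thesis using True by simp
qed simp

lemma rel_cc: "subgroup H G \<Longrightarrow> g \<in> carrier G \<Longrightarrow> g' \<in> carrier G \<Longrightarrow>
    wact G [Cj g' (conj_subgroup G g H), Cj g H] h A x = gact G (Cj (g' \<otimes> g) H) h A x"
  using rcos_in_cosets[of g H x] valid_stateD(4)[OF v]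
  by (auto simp: coset_mult_assoc inv_mult_group)

lemma rel_tc: "subgroup H G \<Longrightarrow> subgroup K G \<Longrightarrow> H \<subseteq> K \<Longrightarrow> g \<in> carrier G \<Longrightarrow>
    wact G [Tr (conj_subgroup G g K) (conj_subgroup G g H), Cj g H] h A x = wact G [Cj g K, Tr K H] h A x"
proof (cases "x \<in> cosets G H")
  case True
  assume a: "subgroup H G" "subgroup K G" "H \<subseteq> K" "g \<in> carrier G"
  obtain u where u: "u \<in> carrier G" "x = u <# H" using True by (rule cosetsE)
  note s = subgroup.subset[OF a(1)] subgroup.subset[OF a(2)]
  have "(x #> inv g) <#> conj_subgroup G g K = (x <#> K) #> inv g"
    using u a s lcos_rcos_inv[of g u H] lcos_rcos_inv[of g u K] lcos_up[OF a(1-3) u(1)]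
      lcos_up[OF conj_subgroup_subgroup[OF a(1,4)] conj_subgroup_subgroup[OF a(2,4)] conj_mono[OF a(4,3) s(2)], of "u \<otimes> inv g"]
    by simp
  then show ?thesis using True rcos_in_cosets[OF a(4,1) True] up_in_cosets[OF a(1-3) True] by simp
qed simp

text \<open>Right multiplication by g identifies the two fibres. It commutes with left translation
  and so preserves orbits and left stabilisers.\<close>

lemma rel_rc: "subgroup H G \<Longrightarrow> subgroup K G \<Longrightarrow> H \<subseteq> K \<Longrightarrow> g \<in> carrier G \<Longrightarrow>
    wact G [Rs (conj_subgroup G g K) (conj_subgroup G g H), Cj g K] h A x = wact G [Cj g H, Rs K H] h A x"
proof (cases "x \<in> cosets G K")
  case True
  assume a: "subgroup H G" "subgroup K G" "H \<subseteq> K" "g \<in> carrier G"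
  note D = valid_stateD[OF v]
  note gH = conj_subgroup_subgroup[OF a(1,4)]
  note vx = valid_rcos[OF v a(2) True a(4)]
  note X = acts_kids[OF D(1) a(1) D(3)]
  note gK = conj_subgroup_subgroup[OF a(2,4)]
  have "osum A (lmult G) (kids G (conj_subgroup G g H) (x #> inv g)) (\<lambda>z. h (A \<inter> cstab G z) z) =
     osum A (lmult G) (kids G H x) (\<lambda>z. h (A \<inter> cstab G z) (z #> inv g))"
  proof (rule osum_bij[OF acts_kids[OF D(1) gH valid_stateD(3)[OF vx]] X kids_invariant[OF h vx gH], of "\<lambda>z. z #> g"])
    note zc = cosets_subset[OF gH kids_cosets]
    show "bij_betw (\<lambda>z. z #> g) (kids G (conj_subgroup G g H) (x #> inv g)) (kids G H x)"
    proof (rule bij_betwI[where g = "\<lambda>z. z #> inv g"])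
      have "z #> g \<in> kids G H x" if z: "z \<in> kids G (conj_subgroup G g H) (x #> inv g)" for z
      proof -
        have "z #> inv (inv g) \<in> cosets G (conj_subgroup G (inv g) (conj_subgroup G g H))"
          by (rule rcos_in_cosets[OF _ gH kids_cosets[OF z]]) (use a in auto)
        moreover have "z #> g \<subseteq> (x #> inv g) #> g" using z by (auto simp: kids_def r_coset_def)
        ultimately show ?thesis
          using a subgroup.subset[OF a(1)] rcos_cancel(1)[OF D(4) a(4)]
          by (simp add: kids_def conj_comp conj_one)
      qed
      then show "(\<lambda>z. z #> g) \<in> kids G (conj_subgroup G g H) (x #> inv g) \<rightarrow> kids G H x" by auto
      show "(\<lambda>z. z #> inv g) \<in> kids G H x \<rightarrow> kids G (conj_subgroup G g H) (x #> inv g)"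
        using rcos_in_cosets[OF a(4,1)] by (auto simp: kids_def r_coset_def)
    qed (use zc cosets_subset[OF a(1) kids_cosets] rcos_cancel a(4) in auto)
    fix z assume z: "z \<in> kids G (conj_subgroup G g H) (x #> inv g)"
    show "h (A \<inter> cstab G z) z = h (A \<inter> cstab G (z #> g)) (z #> g #> inv g)"
      using rcos_cancel(2)[OF zc[OF z] a(4)] cstab_rcos[OF zc[OF z], of "inv g"] a(4) by simp
    show "(b <# z) #> g = b <# (z #> g)" if "b \<in> A" for b
      using lcos_rcos_comm[OF zc[OF z], of b g] that D(5) a(4) by auto
  qed
  also have "\<dots> = osum A (lmult G) (kids G H x) (\<lambda>z. gact G (Cj g H) h (A \<inter> cstab G z) z)"
    by (rule osum_cong[OF X]) (auto simp: kids_def)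
  finally show ?thesis using True rcos_in_cosets[OF a(4,2) True] by simp
qed simp

text \<open>For x in G/K the left-hand side sums over the M-cosets inside xH. These are sorted by
  the double cosets of M and K in H: the part belonging to d is in bijection with the cosets of
  \<open>N d\<close> inside x, and the bijection is left equivariant, so orbits and stabilisers can
  be compared.\<close>

lemma rel_mackey:
  assumes H: "subgroup H G" and M: "subgroup M G" and K: "subgroup K G" and MH: "M \<subseteq> H" and KH: "K \<subseteq> H"
    and D: "double_coset_reps G M H K D"
  shows "wact G [Rs H M, Tr H K] h A x = (\<Sum>d\<in>D. wact G
        [Tr M (M \<inter> conj_subgroup G d K),
         Cj d (conj_subgroup G (inv d) M \<inter> K),
         Rs K (conj_subgroup G (inv d) M \<inter> K)] h A x)"
proof (cases "x \<in> cosets G K")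
  case True
  note VD = valid_stateD[OF v]
  note sub = subgroup.subset[OF H] subgroup.subset[OF M] subgroup.subset[OF K]
  have DH: "D \<subseteq> H" and uniq: "\<And>y. y \<in> H \<Longrightarrow> \<exists>!d. d \<in> D \<and> d \<in> (M #> y) <#> K"
    using D unfolding double_coset_reps_def by auto
  have finD: "finite D" using DH sub(1) finite_carrier finite_subset by metis
  have Dc: "d \<in> carrier G" if "d \<in> D" for d using DH sub(1) that by auto
  have dc: "e \<in> (M #> y) <#> K \<longleftrightarrow> (\<exists>l\<in>M. \<exists>k\<in>K. e = l \<otimes> y \<otimes> k)" for e y
    unfolding set_mult_def r_coset_def by auto
  define N where "N d = conj_subgroup G (inv d) M \<inter> K" for d
  \<comment> \<open>In terms of elements, the coset w \<open>N d\<close> is sent to w d^{-1} M. This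
    is well defined because conjugation by d takes \<open>N d\<close> into M.\<close>
  define f where "f d z = (z #> inv d) <#> M" for d z
  have N: "subgroup (N d) G" "N d \<subseteq> K" "N d \<subseteq> carrier G" if "d \<in> D" for d
    using subgroup_Int[OF conj_subgroup_subgroup[OF M] K] Dc[OF that] sub unfolding N_def by auto
  have dN: "conj_subgroup G d (N d) = M \<inter> conj_subgroup G d K" if "d \<in> D" for d
    unfolding N_def using Dc[OF that] sub by (simp add: conj_Int conj_closed conj_comp conj_one)
  have dNs: "subgroup (conj_subgroup G d (N d)) G" "conj_subgroup G d (N d) \<subseteq> M" if "d \<in> D" for d
    using conj_subgroup_subgroup[OF N(1)[OF that] Dc[OF that]] dN[OF that] by auto
  have xw: "w \<in> carrier G" "x = w <# K" if "w \<in> x" for w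
    using cosets_mem[OF K True that] by auto
  have zw: "w \<in> carrier G" "z = w <# N d" "w \<in> x" "f d z = (w \<otimes> inv d) <# M"
    if "d \<in> D" "z \<in> kids G (N d) x" "w \<in> z" for d z w
  proof -
    show 1: "w \<in> carrier G" "z = w <# N d" using cosets_mem[OF N(1)[OF that(1)] kids_cosets[OF that(2)] that(3)] by auto
    show "w \<in> x" using that by (auto simp: kids_def)
    show "f d z = (w \<otimes> inv d) <# M"
      unfolding f_def using 1 lcos_rcos_inv[OF Dc[OF that(1)] 1(1) N(3)[OF that(1)]]
        lcos_up[OF dNs(1)[OF that(1)] M dNs(2)[OF that(1)], of "w \<otimes> inv d"] Dc[OF that(1)] by simp
  qed
  have zne: "\<exists>w. w \<in> z" if "d \<in> D" "z \<in> kids G (N d) x" for d z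
    using cosets_nonempty[OF N(1)[OF that(1)] kids_cosets[OF that(2)]] .
  have fk: "f d z \<in> kids G M (x <#> H)" if d: "d \<in> D" and z: "z \<in> kids G (N d) x" for d z
  proof -
    obtain w where w: "w \<in> z" using zne[OF d z] by auto
    note W = zw[OF d z w]
    have wd: "w \<otimes> inv d \<in> carrier G" using W Dc[OF d] by auto
    have xH: "x <#> H = w <# H" using xw[OF W(3)] lcos_up[OF K H KH] W(1) by simp
    have "f d z <#> H = (w \<otimes> inv d) <# H" using W(4) lcos_up[OF M H MH wd] by simp
    also have "\<dots> = w <# H"
      using lcos_eq_iff[OF H wd W(1)] W(1) Dc[OF d] DH d by (auto simp: group_norm)
    finally have "f d z <#> H = x <#> H" using xH by simp
    moreover have "f d z \<in> cosets G M" using W(4) wd by (simp add: cosetsI)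
    ultimately show ?thesis
      using up_eq_iff[OF M H MH, of "f d z" "x <#> H"] up_in_cosets[OF K H KH True] by (simp add: kids_def)
  qed
  \<comment> \<open>Write l for the first element and k for the second. If d = d', both together put
    k into \<open>N d\<close>, which gives injectivity; in general d = l d' k^{-1}, so d and d' lie
    in the same double coset and agree.\<close>
  have key: "d \<otimes> (inv w \<otimes> (w' \<otimes> inv d')) \<in> M" "inv w \<otimes> w' \<in> K"
    if "d \<in> D" "z \<in> kids G (N d) x" "w \<in> z" "d' \<in> D" "z' \<in> kids G (N d') x" "w' \<in> z'" "f d z = f d' z'" for d z w d' z' w'
  proof -
    note W = zw[OF that(1-3)] and W' = zw[OF that(4-6)]
    have "(w \<otimes> inv d) <# M = (w' \<otimes> inv d') <# M" using W(4) W'(4) that(7) by simp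
    then show "d \<otimes> (inv w \<otimes> (w' \<otimes> inv d')) \<in> M"
      using lcos_eq_iff[OF M, of "w \<otimes> inv d" "w' \<otimes> inv d'"] W(1) W'(1) Dc[OF that(1)] Dc[OF that(4)]
      by (simp add: group_norm)
    show "inv w \<otimes> w' \<in> K" using lcos_eq_iff[OF K W(1) W'(1)] xw[OF W(3)] xw[OF W'(3)] by simp
  qed
  have finj: "inj_on (f d) (kids G (N d) x)" if d: "d \<in> D" for d
  proof (rule inj_onI)
    fix z z' assume z: "z \<in> kids G (N d) x" and z': "z' \<in> kids G (N d) x" and eq: "f d z = f d z'"
    obtain w where w: "w \<in> z" using zne[OF d z] by auto
    obtain w' where w': "w' \<in> z'" using zne[OF d z'] by auto
    note W = zw[OF d z w] and W' = zw[OF d z' w'] and k = key[OF d z w d z' w' eq]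
    have "inv w \<otimes> w' \<in> N d"
      unfolding N_def using k W(1) W'(1) Dc[OF d] sub by (simp add: conj_mem m_assoc)
    then show "z = z'" using lcos_eq_iff[OF N(1)[OF d] W(1) W'(1)] W(2) W'(2) by simp
  qed
  have fdisj: "d = d'" if d: "d \<in> D" and d': "d' \<in> D" and z: "z \<in> kids G (N d) x" and z': "z' \<in> kids G (N d') x"
    and eq: "f d z = f d' z'" for d d' z z'
  proof -
    obtain w where w: "w \<in> z" using zne[OF d z] by auto
    obtain w' where w': "w' \<in> z'" using zne[OF d' z'] by auto
    note W = zw[OF d z w] and W' = zw[OF d' z' w'] and k = key[OF d z w d' z' w' eq]
    let ?l = "d \<otimes> (inv w \<otimes> (w' \<otimes> inv d'))" and ?k = "inv w \<otimes> w'"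
    have "d = ?l \<otimes> d' \<otimes> inv ?k" using W(1) W'(1) Dc[OF d] Dc[OF d'] by (simp add: group_norm)
    then have 1: "d \<in> (M #> d') <#> K" unfolding dc using k subgroup.m_inv_closed[OF K k(2)] by blast
    have "d' = \<one> \<otimes> d' \<otimes> \<one>" using Dc[OF d'] by simp
    then have 2: "d' \<in> (M #> d') <#> K" unfolding dc using subgroup.one_closed[OF M] subgroup.one_closed[OF K] by blast
    show ?thesis using uniq[of d'] 1 2 d d' DH by blast
  qed
  \<comment> \<open>For y = wM and u in x the inverse of u^{-1} w lies in H, and its representative
    d equals l (u^{-1} w)^{-1} k; the coset of uk modulo \<open>N d\<close> is then sent to
    y.\<close>
  have fsurj: "\<exists>d\<in>D. \<exists>z\<in>kids G (N d) x. y = f d z" if y: "y \<in> kids G M (x <#> H)" for y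
  proof -
    obtain u where u: "u \<in> x" using cosets_nonempty[OF K True] by auto
    note U = xw[OF u]
    obtain w where w: "w \<in> y" using cosets_nonempty[OF M kids_cosets[OF y]] by auto
    have W: "w \<in> carrier G" "y = w <# M" using cosets_mem[OF M kids_cosets[OF y] w] by auto
    have "w \<in> u <# H" using y w U lcos_up[OF K H KH U(1)] by (auto simp: kids_def)
    then have "inv u \<otimes> w \<in> H" using lcos_mem[OF U(1) sub(1)] by simp
    then have "inv (inv u \<otimes> w) \<in> H" by (rule subgroup.m_inv_closed[OF H])
    then obtain d where d: "d \<in> D" "d \<in> (M #> inv (inv u \<otimes> w)) <#> K" using uniq by blast
    then obtain l k where lk: "l \<in> M" "k \<in> K" "d = l \<otimes> inv (inv u \<otimes> w) \<otimes> k" unfolding dc by blast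
    have c: "l \<in> carrier G" "k \<in> carrier G" using lk sub by auto
    define z where "z = (u \<otimes> k) <# N d"
    have uk: "u \<otimes> k \<in> carrier G" using U c by auto
    have "z <#> K = (u \<otimes> k) <# K" unfolding z_def by (rule lcos_up[OF N(1)[OF d(1)] K N(2)[OF d(1)] uk])
    also have "\<dots> = x" using lcos_eq_iff[OF K U(1) uk] U lk c by simp
    finally have z: "z \<in> kids G (N d) x"
      using up_eq_iff[OF N(1)[OF d(1)] K N(2)[OF d(1)] _ True, of z] cosetsI[OF uk, of "N d"]
      unfolding kids_def z_def by auto
    have "u \<otimes> k \<in> z" unfolding z_def by (rule lcos_self[OF N(1)[OF d(1)] uk])
    then have "f d z = (u \<otimes> k \<otimes> inv d) <# M" using zw[OF d(1) z] by simp
    also have "\<dots> = w <# M"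
      using lcos_eq_iff[OF M, of "u \<otimes> k \<otimes> inv d" w] U W c lk(1) by (simp add: lk(3) group_norm)
    finally show ?thesis using W d(1) z by auto
  qed
  \<comment> \<open>The stabiliser of z is that of \<open>f d z\<close> intersected with that of x,
    and A already lies in the latter.\<close>
  have stab: "A \<inter> cstab G z = A \<inter> cstab G (f d z)" if d: "d \<in> D" and z: "z \<in> kids G (N d) x" for d z
  proof -
    obtain w where w: "w \<in> z" using zne[OF d z] by auto
    note W = zw[OF d z w]
    have "cstab G z = conj_subgroup G w (conj_subgroup G (inv d) M) \<inter> conj_subgroup G w K"
      using W(1,2) cstab_lcos[OF N(1)[OF d] W(1)] conj_Int[OF W(1) conj_closed sub(3)] Dc[OF d] sub
      by (simp add: N_def)
    moreover have "cstab G x = conj_subgroup G w K" using xw[OF W(3)] cstab_lcos[OF K W(1)] by simp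
    moreover have "cstab G (f d z) = conj_subgroup G w (conj_subgroup G (inv d) M)"
      using W(1,4) cstab_lcos[OF M, of "w \<otimes> inv d"] Dc[OF d] sub by (simp add: conj_comp)
    ultimately show ?thesis using VD(3) by auto
  qed
  let ?k = "\<lambda>z. h (A \<inter> cstab G z) z"
  have vH: "valid_state G L A (x <#> H)" by (rule valid_up[OF v K H KH True])
  note X' = acts_kids[OF VD(1) M valid_stateD(3)[OF vH]]
  have img: "kids G M (x <#> H) = (\<Union>d\<in>D. f d ` kids G (N d) x)"
  proof (intro equalityI subsetI)
    fix y assume "y \<in> kids G M (x <#> H)"
    then obtain d z where "d \<in> D" "z \<in> kids G (N d) x" "y = f d z" using fsurj by metis
    then show "y \<in> (\<Union>d\<in>D. f d ` kids G (N d) x)" by blast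
  next
    fix y assume "y \<in> (\<Union>d\<in>D. f d ` kids G (N d) x)"
    then obtain d z where "d \<in> D" "z \<in> kids G (N d) x" "y = f d z" by blast
    then show "y \<in> kids G M (x <#> H)" using fk by simp
  qed
  have eqv: "f d (a <# z) = a <# f d z" if "d \<in> D" "z \<in> kids G (N d) x" "a \<in> A" for d z a
  proof -
    have zs: "z \<subseteq> carrier G" by (rule cosets_subset[OF N(1)[OF that(1)] kids_cosets[OF that(2)]])
    have ac: "a \<in> carrier G" using that(3) VD(5) by auto
    have zds: "z #> inv d \<subseteq> carrier G" using r_coset_subset_G[OF zs] Dc[OF that(1)] by simp
    show ?thesis unfolding f_def using lcos_rcos_comm[OF zs ac, of "inv d"] lcos_up_comm[OF M zds ac] Dc[OF that(1)] by simp
  qed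
  have Z: "acts G A (lmult G) (kids G (N d) x)" if "d \<in> D" for d by (rule acts_kids[OF VD(1) N(1)[OF that] VD(3)])
  have fZ: "acts G A (lmult G) (f d ` kids G (N d) x)" if d: "d \<in> D" for d
  proof (rule acts_subset[OF X'])
    show "f d ` kids G (N d) x \<subseteq> kids G M (x <#> H)" using fk[OF d] by auto
    fix a y assume a: "a \<in> A" and y: "y \<in> f d ` kids G (N d) x"
    obtain z where z: "z \<in> kids G (N d) x" "y = f d z" using y by (elim imageE) simp
    have "a <# z \<in> kids G (N d) x" by (rule acts_closed[OF Z[OF d] a z(1)])
    moreover have "a <# y = f d (a <# z)" using eqv[OF d z(1) a] z(2) by simp
    ultimately show "a <# y \<in> f d ` kids G (N d) x" by (metis image_eqI)
  qed
  have "osum A (lmult G) (kids G M (x <#> H)) ?k = (\<Sum>d\<in>D. osum A (lmult G) (f d ` kids G (N d) x) ?k)"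
    unfolding img
  proof (rule osum_UN[OF fZ finD])
    show "finite (f d ` kids G (N d) x)" for d by (rule finite_imageI[OF finite_kids])
    fix d d' assume dd: "d \<in> D" "d' \<in> D" "d \<noteq> d'"
    show "f d ` kids G (N d) x \<inter> f d' ` kids G (N d') x = {}"
    proof (rule ccontr)
      assume "f d ` kids G (N d) x \<inter> f d' ` kids G (N d') x \<noteq> {}"
      then obtain z z' where "z \<in> kids G (N d) x" "z' \<in> kids G (N d') x" "f d z = f d' z'" by force
      then show False using fdisj[OF dd(1,2)] dd(3) by metis
    qed
  qed
  also have "\<dots> = (\<Sum>d\<in>D. wact G [Tr M (M \<inter> conj_subgroup G d K), Cj d (N d), Rs K (N d)] h A x)"
  proof (rule sum.cong[OF refl])
    fix d assume d: "d \<in> D"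
    have inv: "invariant A (lmult G) (kids G (N d) x) (\<lambda>z. ?k (f d z))"
      unfolding invariant_def
    proof (intro ballI)
      fix a z assume a: "a \<in> A" and z: "z \<in> kids G (N d) x"
      show "?k (f d (a <# z)) = ?k (f d z)"
        using eqv[OF d z a] kids_invariant[OF h vH M] fk[OF d z] a by (simp add: invariant_def)
    qed
    have "osum A (lmult G) (f d ` kids G (N d) x) ?k = osum A (lmult G) (kids G (N d) x) (\<lambda>z. ?k (f d z))"
      by (rule osum_bij[OF Z[OF d] fZ[OF d] inv inj_on_imp_bij_betw[OF finj[OF d]], symmetric])
         (simp_all add: eqv[OF d])
    also have "\<dots> = osum A (lmult G) (kids G (N d) x)
        (\<lambda>z. gact G (Cj d (N d)) (gact G (Tr M (M \<inter> conj_subgroup G d K)) h) (A \<inter> cstab G z) z)"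
    proof (rule osum_cong[OF Z[OF d]])
      fix z assume z: "z \<in> kids G (N d) x"
      show "?k (f d z) = gact G (Cj d (N d)) (gact G (Tr M (M \<inter> conj_subgroup G d K)) h) (A \<inter> cstab G z) z"
        using kids_cosets[OF z] rcos_in_cosets[OF Dc[OF d] N(1)[OF d] kids_cosets[OF z]] stab[OF d z]
        by (simp add: dN[OF d]) (simp add: f_def)
    qed
    finally show "osum A (lmult G) (f d ` kids G (N d) x) ?k =
        wact G [Tr M (M \<inter> conj_subgroup G d K), Cj d (N d), Rs K (N d)] h A x" using True by simp
  qed
  finally have *: "osum A (lmult G) (kids G M (x <#> H)) ?k =
    (\<Sum>d\<in>D. wact G [Tr M (M \<inter> conj_subgroup G d K), Cj d (N d), Rs K (N d)] h A x)" .
  have "wact G [Rs H M, Tr H K] h A x = osum A (lmult G) (kids G M (x <#> H)) ?k"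
    using True up_in_cosets[OF K H KH True] by simp
  then show ?thesis using * unfolding N_def by (rule trans)
next
  case False
  have 1: "wact G [Rs H M, Tr H K] h A x = 0" using False by simp
  have 2: "wact G [a, b, Rs K N] h A x = 0" for a b N using False by simp
  show ?thesis unfolding 1 2 by simp
qed

end

lemma gact_off_source: "x \<notin> cosets G (gen_source g) \<Longrightarrow> gact G g h A x = 0"
  by (cases g) auto

lemma gact_zero:
  assumes g: "g \<in> mackey_gens G" and v: "valid_state G L A x"
    and z: "\<And>A x. x \<in> cosets G (gen_target G g) \<Longrightarrow> h A x = 0"
  shows "gact G g h A x = 0"
proof (cases g)
  case (Tr K H)
  then show ?thesis using z g up_in_cosets[of H K x] by (simp add: gens_subgroups)
next
  case (Rs K H)
  have "osum A (lmult G) (kids G H x) (\<lambda>z. h (A \<inter> cstab G z) z) = osum A (lmult G) (kids G H x) (\<lambda>z. 0)"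
    by (rule osum_cong[OF acts_kids[OF valid_stateD(1)[OF v] _ valid_stateD(3)[OF v]]])
       (use Rs g z kids_cosets in \<open>auto simp: gens_subgroups\<close>)
  then show ?thesis using Rs by (simp add: osum_def)
next
  case (Cj k H)
  then show ?thesis using z g rcos_in_cosets[of k H x] by (simp add: gens_subgroups)
qed

lemma gen_subgroups:
  assumes "g \<in> mackey_gens G"
  shows "subgroup (gen_source g) G" "subgroup (gen_target G g) G"
  using assms conj_subgroup_subgroup by (cases g; auto simp: gens_subgroups)+

text \<open>A function produced by \<open>g\<close> vanishes off the cosets of the source of
  \<open>g\<close>, while \<open>g'\<close> evaluates it only at cosets of its own target. Distinct
  subgroups have no coset in common.\<close>

lemma rel_zero:
  assumes "g \<in> mackey_gens G" "g' \<in> mackey_gens G" "gen_source g \<noteq> gen_target G g'" "valid_state G L A x"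
  shows "wact G [g, g'] h A x = 0"
proof -
  have *: "gact G g h B y = 0" if "y \<in> cosets G (gen_target G g')" for B y
    by (rule gact_off_source)
       (use coset_type_unique[OF gen_subgroups(1)[OF assms(1)] gen_subgroups(2)[OF assms(2)] _ that] assms(3) in blast)
  have "gact G g' (gact G g h) A x = 0" by (rule gact_zero[OF assms(2,4)]) (rule *)
  then show ?thesis by simp
qed

end

subsection \<open>The table of double cosets\<close>

text \<open>One term for each \<open>P\<close>-orbit on \<open>P/A \<times> P/B\<close>, written as an \<open>A\<close>-orbit on \<open>P/B\<close>.\<close>

definition dtable :: "('g, 'l) monoid_scheme \<Rightarrow> 'g set \<Rightarrow> 'g set \<Rightarrow> 'g set \<Rightarrow> 'g set set multiset"
  where "dtable G P A B = osum A (lmult G) (kids G B P) (\<lambda>z. {#subconj G (carrier G) (A \<inter> cstab G z)#})"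

context fin_group
begin

lemma subgroup_cstab_self: "subgroup A G \<Longrightarrow> A \<subseteq> P \<Longrightarrow> subgroup P G \<Longrightarrow> A \<subseteq> cstab G P"
  by (simp add: cstab_self)

lemma subconj_carrier_conj:
  "A \<subseteq> carrier G \<Longrightarrow> g \<in> carrier G \<Longrightarrow> subconj G (carrier G) (conj_subgroup G g A) = subconj G (carrier G) A"
  using subconj_conj[OF subgroup_self] by simp

text \<open>Every P-orbit on P/A \<times> P/B meets the fibre over the base point A, in a single
  A-orbit on P/B. The product form is the one in which A and B play symmetric parts.\<close>

lemma dtable_product:
  assumes P: "subgroup P G" and A: "subgroup A G" "A \<subseteq> P" and B: "subgroup B G" "B \<subseteq> P"
  shows "acts G P (\<lambda>p (y, z). (p <# y, p <# z)) (kids G A P \<times> kids G B P)"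
    and "invariant P (\<lambda>p (y, z). (p <# y, p <# z)) (kids G A P \<times> kids G B P)
           (\<lambda>(y, z). {#subconj G (carrier G) (P \<inter> cstab G y \<inter> cstab G z)#})"
    and "dtable G P A B = osum P (\<lambda>p (y, z). (p <# y, p <# z)) (kids G A P \<times> kids G B P)
           (\<lambda>(y, z). {#subconj G (carrier G) (P \<inter> cstab G y \<inter> cstab G z)#})"
proof -
  note Ps = subgroup.subset[OF P]
  let ?act = "\<lambda>p (y, z). (p <# y, p <# z)" and ?X = "kids G A P \<times> kids G B P"
  let ?h = "\<lambda>(y, z). {#subconj G (carrier G) (P \<inter> cstab G y \<inter> cstab G z)#}"
  note kA = acts_kids[OF P A(1) subgroup_cstab_self[OF P subset_refl P]]
  note kB = acts_kids[OF P B(1) subgroup_cstab_self[OF P subset_refl P]]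
  show X: "acts G P ?act ?X" using kA kB unfolding acts_def by auto
  have ys: "y \<subseteq> carrier G" if "y \<in> kids G A P" for y using cosets_subset[OF A(1) kids_cosets[OF that]] .
  have zs: "z \<subseteq> carrier G" if "z \<in> kids G B P" for z using cosets_subset[OF B(1) kids_cosets[OF that]] .
  show h: "invariant P ?act ?X ?h"
    unfolding invariant_def
  proof (intro ballI)
    fix p q assume p: "p \<in> P" and "q \<in> ?X"
    then obtain y z where q: "q = (y, z)" and y: "y \<in> kids G A P" and z: "z \<in> kids G B P" by auto
    have pc: "p \<in> carrier G" using p Ps by auto
    have "P \<inter> cstab G (p <# y) \<inter> cstab G (p <# z) = conj_subgroup G p (P \<inter> cstab G y \<inter> cstab G z)"
      using conj_self[OF P p] cstab_translate[OF ys[OF y] pc] cstab_translate[OF zs[OF z] pc] Ps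
      by (simp add: conj_Int[OF pc] cstab_closed le_infI1)
    moreover have "P \<inter> cstab G y \<inter> cstab G z \<subseteq> carrier G" using Ps by auto
    ultimately show "?h (?act p q) = ?h q" using subconj_carrier_conj[OF _ pc] q by simp
  qed
  note AX = acts_kids[OF A(1) B(1) subgroup_cstab_self[OF A P]]
  have pA: "A \<in> kids G A P" using A coset_self[OF A(1)] by (simp add: kids_def)
  have stA: "P \<inter> cstab G A = A" using A cstab_self[OF A(1)] by auto
  have hz: "{#subconj G (carrier G) (A \<inter> cstab G z)#} = ?h (A, z)" for z by (simp add: stA)
  show "dtable G P A B = osum P ?act ?X ?h"
    unfolding dtable_def
  proof (rule osum_transfer[OF AX X _ h, of _ "\<lambda>z. (A, z)"])
    show "invariant A (lmult G) (kids G B P) (\<lambda>z. {#subconj G (carrier G) (A \<inter> cstab G z)#})"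
      unfolding invariant_def
    proof (intro ballI)
      fix a z assume a: "a \<in> A" and z: "z \<in> kids G B P"
      show "{#subconj G (carrier G) (A \<inter> cstab G (a <# z))#} = {#subconj G (carrier G) (A \<inter> cstab G z)#}"
        using conj_Int_cstab[OF A(1) a zs[OF z]] subconj_carrier_conj[of "A \<inter> cstab G z" a] a A Ps by auto
    qed
    fix z assume z: "z \<in> kids G B P"
    show "(A, z) \<in> ?X" using z pA by simp
    show "{#subconj G (carrier G) (A \<inter> cstab G z)#} = ?h (A, z)" by (rule hz)
    show "\<exists>p\<in>P. (A, a <# z) = ?act p (A, z)" if "a \<in> A" for a
      using that A cstab_self[OF A(1)] by (intro bexI[of _ a]) (auto simp: cstab_def)
    show "\<exists>a\<in>A. z' = a <# z" if "p \<in> P" "z' \<in> kids G B P" "(A, z') = ?act p (A, z)" for p z'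
    proof -
      have "p \<in> cstab G A" using that Ps by (auto simp: cstab_def)
      then show ?thesis using that cstab_self[OF A(1)] by auto
    qed
  next
    fix q assume q: "q \<in> ?X"
    obtain y z where yz: "q = (y, z)" "y \<in> kids G A P" "z \<in> kids G B P" using q by auto
    obtain u where u: "u \<in> y" using cosets_nonempty[OF A(1) kids_cosets[OF yz(2)]] by auto
    have U: "u \<in> carrier G" "y = u <# A" "u \<in> P"
      using cosets_mem[OF A(1) kids_cosets[OF yz(2)] u] u yz(2) by (auto simp: kids_def)
    have iu: "inv u \<in> P" using subgroup.m_inv_closed[OF P U(3)] .
    have 1: "inv u <# z \<in> kids G B P" by (rule acts_closed[OF kB iu yz(3)])
    have "u <# (inv u <# z) = z" using U zs[OF yz(3)] by (simp add: lcos_comp lcos_one)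
    then have "q = ?act u (A, inv u <# z)" using yz U by simp
    then show "\<exists>z\<in>kids G B P. \<exists>p\<in>P. q = ?act p (A, z)" using 1 U(3) by blast
  qed
qed

lemma dtable_sym:
  assumes P: "subgroup P G" and A: "subgroup A G" "A \<subseteq> P" and B: "subgroup B G" "B \<subseteq> P"
  shows "dtable G P A B = dtable G P B A"
  unfolding dtable_product(3)[OF assms] dtable_product(3)[OF P B A]
  by (rule osum_bij[OF dtable_product(1)[OF assms] dtable_product(1)[OF P B A] dtable_product(2)[OF assms], of prod.swap])
     (auto simp: bij_betw_def inj_on_def image_iff Int_ac)

lemma rcos_translate_cosets:
  assumes "subgroup B G" "z \<in> cosets G B" "g \<in> carrier G" "h \<in> carrier G"
  shows "(h <# z) #> inv g \<in> cosets G (conj_subgroup G g B)"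
    and "cstab G ((h <# z) #> inv g) = conj_subgroup G h (cstab G z)"
    and "(h <# z) #> inv g \<subseteq> carrier G"
proof -
  show 1: "(h <# z) #> inv g \<in> cosets G (conj_subgroup G g B)"
    by (rule rcos_in_cosets[OF assms(3,1) lcos_in_cosets[OF assms(1,2,4)]])
  note zs = cosets_subset[OF assms(1,2)]
  show "cstab G ((h <# z) #> inv g) = conj_subgroup G h (cstab G z)"
    using cstab_rcos[OF lcos_closed[OF assms(4) zs] assms(3)] cstab_translate[OF zs assms(4)] by simp
  show "(h <# z) #> inv g \<subseteq> carrier G"
    by (rule cosets_subset[OF conj_subgroup_subgroup[OF assms(1,3)] 1])
qed

text \<open>Transport along \<open>z \<mapsto> h z g\<inverse>\<close>; the domain is a union of orbits of left cosets of \<open>B\<close>.\<close>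

lemma dtable_transport:
  assumes P: "subgroup P G" and B: "subgroup B G" and C: "subgroup C G"
    and g: "g \<in> carrier G" and h: "h \<in> carrier G"
    and gB: "conj_subgroup G g B \<subseteq> P" and hC: "conj_subgroup G h C \<subseteq> P"
    and Z: "\<And>z. z \<in> Z \<longleftrightarrow> z \<in> cosets G B \<and> (h <# z) #> inv g \<subseteq> P"
  shows "acts G C (lmult G) Z"
    and "osum C (lmult G) Z (\<lambda>z. {#subconj G (carrier G) (C \<inter> cstab G z)#}) = dtable G P (conj_subgroup G h C) (conj_subgroup G g B)"
proof -
  let ?C = "conj_subgroup G h C" and ?B = "conj_subgroup G g B"
  let ?f = "\<lambda>z. (h <# z) #> inv g"
  have Cc: "c \<in> carrier G" if "c \<in> C" for c using subgroup.mem_carrier[OF C that] .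
  note Cs = subgroup.subset[OF C]
  note sC = conj_subgroup_subgroup[OF C h] and sB = conj_subgroup_subgroup[OF B g]
  note tr = rcos_translate_cosets[OF B _ g h]
  have zs: "z \<subseteq> carrier G" if "z \<in> cosets G B" for z using cosets_subset[OF B that] .
  \<comment> \<open>Translation by c becomes translation by its conjugate under h; the right factor
    commutes with left translations.\<close>
  have fc: "?f (c <# z) = (h \<otimes> c \<otimes> inv h) <# ?f z" if c: "c \<in> C" and z: "z \<in> cosets G B" for c z
  proof -
    have "(h \<otimes> c \<otimes> inv h) <# ?f z = ((h \<otimes> c \<otimes> inv h) <# (h <# z)) #> inv g"
      using lcos_rcos_comm[OF lcos_closed[OF h zs[OF z]], of "h \<otimes> c \<otimes> inv h" "inv g"] g h Cc[OF c] by simp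
    also have "(h \<otimes> c \<otimes> inv h) <# (h <# z) = h <# (c <# z)"
      using h Cc[OF c] zs[OF z] by (simp add: lcos_comp group_norm)
    finally show ?thesis by simp
  qed
  have hch: "h \<otimes> c \<otimes> inv h \<in> ?C" if "c \<in> C" for c
    using that h Cc[OF that] Cs by (simp add: conj_mem group_norm)
  have kB: "acts G ?C (lmult G) (kids G ?B P)" by (rule acts_kids[OF sC sB subgroup_cstab_self[OF sC hC P]])
  have fZ: "?f z \<in> kids G ?B P" if "z \<in> Z" for z using that Z[of z] tr(1)[of z] by (simp add: kids_def)
  show aZ: "acts G C (lmult G) Z"
    unfolding acts_def
  proof (intro conjI ballI)
    fix c z assume c: "c \<in> C" and z: "z \<in> Z"
    have zc: "z \<in> cosets G B" using Z z by simp
    have "(h \<otimes> c \<otimes> inv h) <# ?f z \<in> kids G ?B P" by (rule acts_closed[OF kB hch[OF c] fZ[OF z]])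
    then have "?f (c <# z) \<subseteq> P" using fc[OF c zc] by (simp add: kids_def)
    then show "c <# z \<in> Z" using Z[of "c <# z"] lcos_in_cosets[OF B zc Cc[OF c]] by simp
  next
    fix z assume z: "z \<in> Z"
    have zc: "z \<in> cosets G B" using Z z by simp
    show "\<one> <# z = z" using lcos_one[OF zs[OF zc]] .
    show "(a \<otimes> b) <# z = a <# (b <# z)" if "a \<in> C" "b \<in> C" for a b
      using lcos_comp[OF Cc[OF that(1)] Cc[OF that(2)] zs[OF zc]] by simp
  qed (rule C)
  have st: "?C \<inter> cstab G (?f z) = conj_subgroup G h (C \<inter> cstab G z)" if "z \<in> cosets G B" for z
    using tr(2)[OF that] conj_Int[OF h Cs cstab_closed] by simp
  have invC: "invariant C' (lmult G) X (\<lambda>z. {#subconj G (carrier G) (C' \<inter> cstab G z)#})"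
    if C': "subgroup C' G" and X: "\<And>z. z \<in> X \<Longrightarrow> z \<subseteq> carrier G" for C' X
    unfolding invariant_def
  proof (intro ballI)
    fix c z assume c: "c \<in> C'" and z: "z \<in> X"
    have cc: "c \<in> carrier G" using subgroup.mem_carrier[OF C' c] .
    have "C' \<inter> cstab G z \<subseteq> carrier G" using subgroup.subset[OF C'] by auto
    then show "{#subconj G (carrier G) (C' \<inter> cstab G (c <# z))#} = {#subconj G (carrier G) (C' \<inter> cstab G z)#}"
      using conj_Int_cstab[OF C' c X[OF z]] subconj_carrier_conj[OF _ cc] by simp
  qed
  show "osum C (lmult G) Z (\<lambda>z. {#subconj G (carrier G) (C \<inter> cstab G z)#}) = dtable G P ?C ?B"
    unfolding dtable_def
  proof (rule osum_transfer[OF aZ kB, of _ _ ?f])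
    show "invariant C (lmult G) Z (\<lambda>z. {#subconj G (carrier G) (C \<inter> cstab G z)#})"
      by (rule invC[OF C]) (use Z zs in simp)
    show "invariant ?C (lmult G) (kids G ?B P) (\<lambda>z. {#subconj G (carrier G) (?C \<inter> cstab G z)#})"
      by (rule invC[OF sC]) (rule cosets_subset[OF sB kids_cosets])
    fix z assume z: "z \<in> Z"
    have zc: "z \<in> cosets G B" using Z z by simp
    show "?f z \<in> kids G ?B P" by (rule fZ[OF z])
    have "C \<inter> cstab G z \<subseteq> carrier G" using Cs by auto
    then show "{#subconj G (carrier G) (C \<inter> cstab G z)#} = {#subconj G (carrier G) (?C \<inter> cstab G (?f z))#}"
      using st[OF zc] subconj_carrier_conj[OF _ h] by simp
    show "\<exists>b\<in>?C. ?f (c <# z) = b <# ?f z" if "c \<in> C" for c using fc[OF that zc] hch[OF that] by blast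
    show "\<exists>c\<in>C. z' = c <# z" if b: "b \<in> ?C" and z': "z' \<in> Z" and eq: "?f z' = b <# ?f z" for b z'
    proof -
      have zc': "z' \<in> cosets G B" using Z z' by simp
      define c where "c = inv h \<otimes> (b \<otimes> h)"
      have bc: "b \<in> carrier G" and c: "c \<in> C" using b h Cs by (auto simp: conj_mem c_def)
      have "b = h \<otimes> c \<otimes> inv h" using bc h by (simp add: c_def group_norm)
      then have "?f z' = ?f (c <# z)" using eq fc[OF c zc] by simp
      then have "(?f z') #> g = (?f (c <# z)) #> g" by simp
      then have "h <# z' = h <# (c <# z)"
        using rcos_cancel(1)[OF lcos_closed[OF h zs[OF zc']] g]
          rcos_cancel(1)[OF lcos_closed[OF h lcos_closed[OF Cc[OF c] zs[OF zc]]] g] by simp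
      then have "inv h <# (h <# z') = inv h <# (h <# (c <# z))" by simp
      then have "z' = c <# z"
        using lcos_inv_cancel[OF h zs[OF zc']] lcos_inv_cancel[OF h lcos_closed[OF Cc[OF c] zs[OF zc]]] by simp
      then show ?thesis using c by blast
    qed
  next
    fix y assume y: "y \<in> kids G ?B P"
    note yc = cosets_subset[OF sB kids_cosets[OF y]]
    \<comment> \<open>The inverse of z \<mapsto> h z g^{-1}.\<close>
    define z where "z = (inv h <# y) #> g"
    have "z \<in> cosets G (conj_subgroup G (inv g) ?B)"
      using rcos_in_cosets[OF _ sB lcos_in_cosets[OF sB kids_cosets[OF y]], of "inv g" "inv h"] g h
      by (simp add: z_def)
    then have zc: "z \<in> cosets G B" using g subgroup.subset[OF B] by (simp add: conj_comp conj_one)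
    have "h <# z = (h <# (inv h <# y)) #> g"
      unfolding z_def using lcos_rcos_comm[OF lcos_closed[OF _ yc], of "inv h" h g] g h by simp
    also have "h <# (inv h <# y) = y" using h yc by (simp add: lcos_comp lcos_one)
    finally have fy: "?f z = y" using rcos_cancel(2)[OF yc g] by simp
    have "z \<in> Z" using Z[of z] zc fy y by (simp add: kids_def)
    moreover have "y = \<one> <# ?f z" using fy lcos_one[OF yc] by simp
    moreover have "\<one> \<in> ?C" by (rule subgroup.one_closed[OF sC])
    ultimately show "\<exists>z\<in>Z. \<exists>b\<in>?C. y = b <# ?f z" by blast
  qed
qed

text \<open>The case \<open>h = g\<close> of the transport: z \<mapsto> g z g^{-1} takes the cosets
  of B inside P to those of the conjugate of B inside the conjugate of P.\<close>

lemma dtable_conj: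
  assumes P: "subgroup P G" and A: "subgroup A G" "A \<subseteq> P" and B: "subgroup B G" "B \<subseteq> P" and g: "g \<in> carrier G"
  shows "dtable G (conj_subgroup G g P) (conj_subgroup G g A) (conj_subgroup G g B) = dtable G P A B"
proof -
  note Ps = subgroup.subset[OF P]
  have iff: "z \<in> kids G B P \<longleftrightarrow> z \<in> cosets G B \<and> (g <# z) #> inv g \<subseteq> conj_subgroup G g P" for z
  proof (cases "z \<in> cosets G B")
    case True
    have zs: "z \<subseteq> carrier G" by (rule cosets_subset[OF B(1) True])
    have "(g <# z) #> inv g \<subseteq> conj_subgroup G g P \<longleftrightarrow> z \<subseteq> P"
    proof
      assume "z \<subseteq> P" then show "(g <# z) #> inv g \<subseteq> conj_subgroup G g P"
        unfolding conj_subgroup_def by (auto simp: r_coset_def l_coset_def)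
    next
      assume *: "(g <# z) #> inv g \<subseteq> conj_subgroup G g P"
      show "z \<subseteq> P"
      proof
        fix a assume a: "a \<in> z"
        have ac: "a \<in> carrier G" using a zs by auto
        have "g \<otimes> a \<otimes> inv g \<in> (g <# z) #> inv g" using a by (auto simp: r_coset_def l_coset_def)
        then have "g \<otimes> a \<otimes> inv g \<in> conj_subgroup G g P" using * by auto
        then show "a \<in> P" using conj_mem[OF g Ps] ac g by (simp add: group_norm)
      qed
    qed
    then show ?thesis using True by (simp add: kids_def)
  qed (simp add: kids_def)
  show ?thesis
    using dtable_transport(2)[OF conj_subgroup_subgroup[OF P g] B(1) A(1) g g
        conj_mono[OF g B(2) Ps] conj_mono[OF g A(2) Ps] iff]
    by (simp add: dtable_def[of G P A B])
qed

end

subsection \<open>Standard words and their coefficients\<close>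

type_synonym 'g mindex = "'g set \<times> 'g set \<times> 'g \<times> 'g set"
type_synonym 'g mclass = "'g set \<times> ('g set \<times> 'g set) set"

text \<open>
  The index \<open>(H, K, g, B)\<close> stands for \<open>t\<^sup>H\<^sub>B\<^sub>' c\<^sub>g\<^sub>,\<^sub>B r\<^sup>K\<^sub>B\<close>, with \<open>B'\<close> the conjugate of \<open>B\<close> by \<open>g\<close>.  It is determined in
  the Mackey algebra by \<open>K\<close> and the \<open>K\<close>-orbit of the pair of \<open>B\<close> and the coset \<open>g\<inverse>H\<close>, which also
  knows \<open>H\<close>.
\<close>

definition state_class :: "('g, 'l) monoid_scheme \<Rightarrow> 'g set \<Rightarrow> 'g set \<Rightarrow> 'g set \<Rightarrow> 'g mclass"
  where "state_class G L A x = (L, (\<lambda>k. (conj_subgroup G k A, k <#\<^bsub>G\<^esub> x)) ` L)"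

fun mword :: "('g, 'l) monoid_scheme \<Rightarrow> 'g mindex \<Rightarrow> 'g mackey_gen list" where
  "mword G (H, K, g, B) = [Tr H (conj_subgroup G g B), Cj g B, Rs K B]"

definition mindex :: "('g, 'l) monoid_scheme \<Rightarrow> 'g mindex set"
  where "mindex G = {(H, K, g, B). subgroup H G \<and> subgroup K G \<and> g \<in> carrier G \<and> subgroup B G \<and>
    B \<subseteq> K \<and> conj_subgroup G g B \<subseteq> H}"

fun mcls :: "('g, 'l) monoid_scheme \<Rightarrow> 'g mindex \<Rightarrow> 'g mclass" where
  "mcls G (H, K, g, B) = state_class G K B (inv\<^bsub>G\<^esub> g <#\<^bsub>G\<^esub> H)"

text \<open>The expansion of the word in standard words. \<open>state_class\<close> is the invariant
  that merely records the isomorphism class of a set over a coset space, and the state (L, L), a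
  single point over the coset L, detects the part of the word that starts at t^L_L. The sum over L
  reflects that these elements add up to 1. Multiplicities are natural numbers, hence a
  multiset.\<close>

definition coef :: "('g, 'l) monoid_scheme \<Rightarrow> 'g mackey_gen list \<Rightarrow> 'g mclass multiset"
  where "coef G w = (\<Sum>L\<in>{L. subgroup L G}. wact G w (\<lambda>A x. {#state_class G L A x#}) L L)"

text \<open>The contribution of the standard words \<open>j\<close> and \<open>k\<close> to the trace of their product.\<close>

fun tvalue :: "('g, 'l) monoid_scheme \<Rightarrow> 'g mindex \<Rightarrow> 'g mindex \<Rightarrow> 'g set set multiset" where
  "tvalue G (H, K, g, B) (H', K', g', C) = (if inv\<^bsub>G\<^esub> g' <#\<^bsub>G\<^esub> H' \<in> cosets G K then
     osum C (lmult G) (kids G B (inv\<^bsub>G\<^esub> g' <#\<^bsub>G\<^esub> H')) (\<lambda>z.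
       if (z #>\<^bsub>G\<^esub> inv\<^bsub>G\<^esub> g) <#>\<^bsub>G\<^esub> H = K' then {#subconj G (carrier G) (C \<inter> cstab G z)#} else {#}) else {#})"

context fin_group
begin

lemma finite_subgroups: "finite {L. subgroup L G}"
  by (rule finite_subset[of _ "Pow (carrier G)"]) (use subgroup.subset finite_carrier in auto)

lemma mindexD:
  assumes "(H, K, g, B) \<in> mindex G"
  shows "subgroup H G" "subgroup K G" "g \<in> carrier G" "subgroup B G" "B \<subseteq> K" "conj_subgroup G g B \<subseteq> H"
    "subgroup (conj_subgroup G g B) G"
  using assms conj_subgroup_subgroup unfolding mindex_def by auto

lemma finite_mindex: "finite (mindex G)"
proof (rule finite_subset)
  show "mindex G \<subseteq> {L. subgroup L G} \<times> {L. subgroup L G} \<times> carrier G \<times> {L. subgroup L G}"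
    unfolding mindex_def by auto
qed (use finite_subgroups finite_carrier in simp)

lemma mword_gens: "j \<in> mindex G \<Longrightarrow> set (mword G j) \<subseteq> mackey_gens G"
  using mindexD by (cases j) (simp add: gens_subgroups)

lemma state_class_eq_iff:
  assumes L: "subgroup L G" and A: "A \<subseteq> carrier G" "A' \<subseteq> carrier G" and x: "x \<subseteq> carrier G" "x' \<subseteq> carrier G"
  shows "state_class G L A x = state_class G L' A' x' \<longleftrightarrow>
    L = L' \<and> (\<exists>k\<in>L. A' = conj_subgroup G k A \<and> x' = k <# x)"
proof -
  let ?act = "\<lambda>k (A, x). (conj_subgroup G k A, k <# x)"
  have Lc: "k \<in> carrier G" if "k \<in> L" for k using subgroup.mem_carrier[OF L that] .
  have act: "acts G L ?act {(A, x). A \<subseteq> carrier G \<and> x \<subseteq> carrier G}"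
    unfolding acts_def using L Lc conj_closed lcos_closed by (auto simp: conj_comp lcos_comp conj_one lcos_one)
  have "state_class G L A x = (L, orb L ?act (A, x))" for A x
    unfolding state_class_def orb_def by simp
  moreover have "orb L ?act (A, x) = orb L ?act (A', x') \<longleftrightarrow> (\<exists>k\<in>L. (A', x') = ?act k (A, x))"
    by (rule orb_eq_iff[OF act]) (use A x in auto)
  ultimately show ?thesis by (auto simp: state_class_def)
qed

lemma inv_state_class:
  assumes L: "subgroup L G"
  shows "inv_state G L (\<lambda>A x. {#state_class G L A x#})"
  unfolding inv_state_def
proof (intro allI impI)
  fix A x k assume v: "valid_state G L A x" and k: "k \<in> L"
  have kc: "k \<in> carrier G" using subgroup.mem_carrier[OF L k] .
  note D = valid_stateD[OF v]
  have "state_class G L A x = state_class G L (conj_subgroup G k A) (k <# x)"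
    using state_class_eq_iff[OF L D(5) conj_closed[OF kc D(5)] D(4) lcos_closed[OF kc D(4)]] k by blast
  then show "{#state_class G L (conj_subgroup G k A) (k <# x)#} = {#state_class G L A x#}" by simp
qed

lemma valid_self: "subgroup L G \<Longrightarrow> valid_state G L L L"
  by (rule valid_stateI[where H = L]) (simp_all add: cstab_self coset_self)

text \<open>The letters of \<open>p\<close> act first and turn the universal invariant into another
  invariant \<open>h\<close>; there the hypothesis applies at all valid states, and the letters of
  \<open>q\<close> preserve equality at valid states.\<close>

lemma coef_relation:
  assumes p: "set p \<subseteq> mackey_gens G" and q: "set q \<subseteq> mackey_gens G" and I: "finite I" and I': "finite I'"
    and rel: "\<And>L A x (h :: 'a set \<Rightarrow> 'a set \<Rightarrow> 'a mclass multiset). subgroup L G \<Longrightarrow> inv_state G L h \<Longrightarrow>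
      valid_state G L A x \<Longrightarrow> (\<Sum>i\<in>I. wact G (a i) h A x) = (\<Sum>i\<in>I'. wact G (b i) h A x)"
  shows "(\<Sum>i\<in>I. coef G (p @ a i @ q)) = (\<Sum>i\<in>I'. coef G (p @ b i @ q))"
proof -
  have swap: "(\<Sum>i\<in>I. coef G (p @ a i @ q)) =
     (\<Sum>L\<in>{L. subgroup L G}. wact G q (\<lambda>A x. \<Sum>i\<in>I. wact G (a i) (wact G p (\<lambda>A x. {#state_class G L A x#})) A x) L L)"
    if "finite I" for I and a :: "'z \<Rightarrow> 'a mackey_gen list"
    unfolding coef_def wact_sum[OF that] by (subst sum.swap) simp
  show ?thesis unfolding swap[OF I] swap[OF I']
  proof (rule sum.cong[OF refl])
    fix L assume "L \<in> {L. subgroup L G}"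
    then have L: "subgroup L G" by simp
    show "wact G q (\<lambda>A x. \<Sum>i\<in>I. wact G (a i) (wact G p (\<lambda>A x. {#state_class G L A x#})) A x) L L =
      wact G q (\<lambda>A x. \<Sum>i\<in>I'. wact G (b i) (wact G p (\<lambda>A x. {#state_class G L A x#})) A x) L L"
      by (rule wact_cong[OF q valid_self[OF L]], rule rel[OF L wact_inv[OF p L inv_state_class[OF L]]])
  qed
qed

text \<open>From (L, L) the letter r^K_B forces L = K, and K is transitive on K/B, so only the state
  (B, B) remains. The letter c moves its coset to B g^{-1}, the translate by g^{-1} of the conjugate
  of B, and t enlarges this to g^{-1} H.\<close>

lemma mword_eval_start:
  assumes j: "(H, K, g, B) \<in> mindex G" and L: "subgroup L G" and h: "inv_state G L h"
  shows "wact G (mword G (H, K, g, B)) h L L = (if L = K then h B (inv g <# H) else 0)"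
proof (cases "L = K")
  case True
  note D = mindexD[OF j]
  let ?h = "wact G [Tr H (conj_subgroup G g B), Cj g B] h"
  have inv: "inv_state G L ?h" by (rule wact_inv[OF _ L h]) (use D in \<open>simp add: gens_subgroups\<close>)
  note v = valid_self[OF L]
  have B: "B \<in> kids G B L" using D coset_self True by (simp add: kids_def)
  have "osum L (lmult G) (kids G B L) (\<lambda>z. ?h (L \<inter> cstab G z) z) = ?h (L \<inter> cstab G B) B"
  proof (rule osum_single[OF acts_kids[OF L D(4) valid_stateD(3)[OF v]] B kids_invariant[OF inv v D(4)]])
    fix y assume y: "y \<in> kids G B L"
    obtain u where u: "u \<in> y" using cosets_nonempty[OF D(4) kids_cosets[OF y]] by auto
    then have "u \<in> L" "y = u <# B" using cosets_mem[OF D(4) kids_cosets[OF y] u] y by (auto simp: kids_def)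
    then show "\<exists>a\<in>L. y = a <# B" by blast
  qed
  also have "L \<inter> cstab G B = B" using D True cstab_self[OF D(4)] by auto
  also have "?h B B = h B (inv g <# H)"
  proof -
    have "B #> inv g = (\<one> <# B) #> inv g" using lcos_one[OF subgroup.subset[OF D(4)]] by simp
    also have "\<dots> = inv g <# conj_subgroup G g B"
      using lcos_rcos_inv[OF D(3) one_closed subgroup.subset[OF D(4)]] D(3) by simp
    finally have 1: "B #> inv g = inv g <# conj_subgroup G g B" .
    then have "B #> inv g \<in> cosets G (conj_subgroup G g B)" using D(3) by (simp add: cosetsI)
    moreover have "(B #> inv g) <#> H = inv g <# H"
      unfolding 1 using lcos_up[OF D(7,1,6)] D(3) by simp
    ultimately show ?thesis using coset_self[OF D(4)] by simp
  qed
  finally show ?thesis using True coset_self[OF L] by simp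
next
  case False
  then have "L \<notin> cosets G K"
    using coset_type_unique[OF L mindexD(2)[OF j] coset_self[OF L]] by auto
  then show ?thesis using False by simp
qed

text \<open>A standard word leads from its starting point to a single state, so whatever is written
  to its left simply continues from there.\<close>

lemma coef_append_mword:
  assumes j: "(H, K, g, B) \<in> mindex G" and u: "set u \<subseteq> mackey_gens G"
  shows "coef G (u @ mword G (H, K, g, B)) = wact G u (\<lambda>A x. {#state_class G K A x#}) B (inv g <# H)"
proof -
  have "coef G (u @ mword G (H, K, g, B)) = (\<Sum>L\<in>{L. subgroup L G}.
     if L = K then wact G u (\<lambda>A x. {#state_class G K A x#}) B (inv g <# H) else 0)"
    unfolding coef_def
  proof (rule sum.cong[OF refl])
    fix L assume "L \<in> {L. subgroup L G}"
    then have L: "subgroup L G" by simp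
    show "wact G (u @ mword G (H, K, g, B)) (\<lambda>A x. {#state_class G L A x#}) L L =
      (if L = K then wact G u (\<lambda>A x. {#state_class G K A x#}) B (inv g <# H) else 0)"
      using mword_eval_start[OF j L wact_inv[OF u L inv_state_class[OF L]]] by (simp del: mword.simps)
  qed
  then show ?thesis using mindexD[OF j] finite_subgroups by simp
qed

text \<open>The core of independence: each standard word has its own class as its only coefficient,
  so words of different classes are separated.\<close>

lemma coef_mword: "j \<in> mindex G \<Longrightarrow> coef G (mword G j) = {#mcls G j#}"
  using coef_append_mword[of _ _ _ _ "[]"] by (cases j) simp

lemma mstate_valid:
  assumes "(H, K, g, B) \<in> mindex G"
  shows "valid_state G K B (inv g <# H)"
proof -
  note D = mindexD[OF assms]
  have ig: "inv g \<in> carrier G" using D by simp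
  have "conj_subgroup G (inv g) (conj_subgroup G g B) \<subseteq> conj_subgroup G (inv g) H"
    by (rule conj_mono[OF ig D(6) subgroup.subset[OF D(1)]])
  then have "B \<subseteq> conj_subgroup G (inv g) H" using D(3) subgroup.subset[OF D(4)] by (simp add: conj_comp conj_one)
  then show ?thesis
    by (intro valid_stateI[OF D(4,5) _ D(1) cosetsI[OF ig]]) (simp add: cstab_lcos[OF D(1) ig])
qed

text \<open>The right word leads to the state (C, g'^{-1} H'). The restriction in the left word then
  splits it into the C-orbits on the fibre, provided that it lies over G/K.\<close>

lemma coef_pair:
  assumes j: "(H, K, g, B) \<in> mindex G" and k: "(H', K', g', C) \<in> mindex G"
  shows "coef G (mword G (H, K, g, B) @ mword G (H', K', g', C)) = (if inv g' <# H' \<in> cosets G K then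
     osum C (lmult G) (kids G B (inv g' <# H')) (\<lambda>z. {#state_class G K' (C \<inter> cstab G z) ((z #> inv g) <#> H)#}) else 0)"
proof -
  note D = mindexD[OF j] and v = mstate_valid[OF k]
  let ?h = "\<lambda>A x. {#state_class G K' A x#}"
  have "osum C (lmult G) (kids G B (inv g' <# H')) (\<lambda>z. wact G [Tr H (conj_subgroup G g B), Cj g B] ?h (C \<inter> cstab G z) z)
    = osum C (lmult G) (kids G B (inv g' <# H')) (\<lambda>z. ?h (C \<inter> cstab G z) ((z #> inv g) <#> H))"
    by (rule osum_cong[OF acts_kids[OF valid_stateD(1)[OF v] D(4) valid_stateD(3)[OF v]]])
       (use rcos_in_cosets[OF D(3,4)] in \<open>simp add: kids_def\<close>)
  then show ?thesis unfolding coef_append_mword[OF k mword_gens[OF j]] by simp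
qed

lemma osum_restrict:
  assumes X: "acts G A act X" and fin: "finite X" and p: "\<And>a x. a \<in> A \<Longrightarrow> x \<in> X \<Longrightarrow> p (act a x) = p x"
    and z: "\<And>x. x \<in> X \<Longrightarrow> \<not> p x \<Longrightarrow> h x = 0"
  shows "osum A act X h = osum A act {x\<in>X. p x} h"
proof -
  have cl: "act a x \<in> X" if "a \<in> A" "x \<in> X" for a x by (rule acts_closed[OF X that])
  have 1: "acts G A act {x\<in>X. p x = b}" for b by (rule acts_subset[OF X]) (use cl p in auto)
  have "osum A act (\<Union>b\<in>UNIV. {x\<in>X. p x = b}) h = (\<Sum>b\<in>UNIV. osum A act {x\<in>X. p x = b} h)"
    by (rule osum_UN[OF 1]) (use fin in auto)
  moreover have "(\<Union>b\<in>UNIV. {x\<in>X. p x = b}) = X" by auto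
  moreover have "osum A act {x\<in>X. p x = False} h = osum A act {x\<in>X. p x = False} (\<lambda>x. 0)"
    by (rule osum_cong[OF 1]) (use z in auto)
  ultimately show ?thesis by (simp add: UNIV_bool osum_def)
qed

text \<open>The condition for two words to pair nontrivially: their endpoints are exchanged, and the
  inverse of g' lies in the double coset H g K. The element h is a witness for the latter; the
  fourth components do not enter.\<close>

definition linked :: "'a mindex \<Rightarrow> 'a mindex \<Rightarrow> 'a \<Rightarrow> bool" where
  "linked j k h = (case j of (H, K, g, B) \<Rightarrow> case k of (H', K', g', C) \<Rightarrow>
     H = K' \<and> K = H' \<and> h \<in> H \<and> inv g' <# H' = (h \<otimes> g) <# K)"

text \<open>The map z \<mapsto> h^{-1} z g^{-1} carries the cosets that contribute to the trace onto
  the cosets of the conjugate of B by g inside P, the intersection of H with the conjugate of K by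
  g. It turns the action of C into that of a conjugate of C lying in P.\<close>

lemma tvalue_linked:
  assumes j: "(H, K, g, B) \<in> mindex G" and k: "(H', K', g', C) \<in> mindex G"
    and l: "linked (H, K, g, B) (H', K', g', C) h"
  shows "tvalue G (H, K, g, B) (H', K', g', C) =
     dtable G (H \<inter> conj_subgroup G g K) (conj_subgroup G (inv h) C) (conj_subgroup G g B)"
    and "conj_subgroup G (inv h) C \<subseteq> H \<inter> conj_subgroup G g K"
proof -
  note D = mindexD[OF j] and D' = mindexD[OF k] and v = mstate_valid[OF k]
  let ?y = "inv g' <# H'" and ?P = "H \<inter> conj_subgroup G g K"
  have E: "H = K'" "K = H'" and h: "h \<in> H" and y: "?y = (h \<otimes> g) <# K" using l by (auto simp: linked_def)
  have hc: "h \<in> carrier G" using subgroup.mem_carrier[OF D(1) h] .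
  have ih: "inv h \<in> carrier G" "inv h \<in> H" using hc subgroup.m_inv_closed[OF D(1) h] by auto
  have hg: "h \<otimes> g \<in> carrier G" using hc D(3) by simp
  note s = subgroup.subset[OF D(1)] subgroup.subset[OF D(2)] subgroup.subset[OF D(4)] subgroup.subset[OF D'(4)]
  have P: "subgroup ?P G" by (rule subgroup_Int[OF D(1) conj_subgroup_subgroup[OF D(2,3)]])
  have "conj_subgroup G (inv h) C \<subseteq> H"
    using conj_mono[OF ih(1) D'(5) subgroup.subset[OF D'(2)]] conj_self[OF D(1) ih(2)] E by simp
  moreover have "conj_subgroup G (inv h) C \<subseteq> conj_subgroup G (inv h) (conj_subgroup G (h \<otimes> g) K)"
    using conj_mono[OF ih(1) valid_stateD(3)[OF v] cstab_closed] cstab_lcos[OF D(2) hg] y by simp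
  ultimately show CP: "conj_subgroup G (inv h) C \<subseteq> ?P"
    using hc D(3) s by (simp add: conj_comp)
  have gBP: "conj_subgroup G g B \<subseteq> ?P" using D(6) conj_mono[OF D(3,5) s(2)] by auto
  define Z where "Z = {z \<in> kids G B ?y. (z #> inv g) <#> H = K'}"
  \<comment> \<open>For z = wB, each of the two conditions on z says that h^{-1} w g^{-1} lies in
    one of the two factors of P.\<close>
  have Z: "z \<in> Z \<longleftrightarrow> z \<in> cosets G B \<and> (inv h <# z) #> inv g \<subseteq> ?P" for z
  proof (cases "z \<in> cosets G B")
    case True
    obtain w where w: "w \<in> carrier G" "z = w <# B" using True by (rule cosetsE)
    have wg: "w \<otimes> inv g \<in> carrier G" and hwg: "inv h \<otimes> (w \<otimes> inv g) \<in> carrier G" using w D(3) hc by auto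
    have f: "(inv h <# z) #> inv g = (inv h \<otimes> (w \<otimes> inv g)) <# conj_subgroup G g B"
      using w hc D(3) s lcos_rcos_inv[OF D(3), of "inv h \<otimes> w" B] by (simp add: lcos_comp m_assoc)
    have zg: "z #> inv g = (w \<otimes> inv g) <# conj_subgroup G g B" using lcos_rcos_inv[OF D(3) w(1) s(3)] w(2) by simp
    have sub: "u <# conj_subgroup G g B \<subseteq> Q \<longleftrightarrow> u \<in> Q" if "subgroup Q G" "conj_subgroup G g B \<subseteq> Q" "u \<in> carrier G" for u Q
    proof
      assume "u <# conj_subgroup G g B \<subseteq> Q" then show "u \<in> Q" using lcos_self[OF D(7) that(3)] by auto
    next
      assume u: "u \<in> Q"
      show "u <# conj_subgroup G g B \<subseteq> Q" unfolding l_coset_def using subgroup.m_closed[OF that(1) u] that(2) by auto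
    qed
    have 1: "z \<subseteq> ?y \<longleftrightarrow> w \<in> ?y"
    proof
      assume "z \<subseteq> ?y" then show "w \<in> ?y" using w lcos_self[OF D(4) w(1)] by auto
    next
      assume "w \<in> ?y"
      then have "?y = w <# K" using lcos_eq_mem[OF D(2) hg] y by simp
      moreover have "w <# B \<subseteq> w <# K" by (rule lcos_mono[OF D(5)])
      ultimately show "z \<subseteq> ?y" using w by simp
    qed
    have 2: "w \<in> ?y \<longleftrightarrow> inv h \<otimes> (w \<otimes> inv g) \<in> conj_subgroup G g K"
      unfolding y using w hc D(3) s lcos_mem[OF hg s(2)] by (simp add: conj_mem group_norm)
    have 3: "(z #> inv g) <#> H = K' \<longleftrightarrow> w \<otimes> inv g \<in> H"
      using lcos_up[OF D(7,1,6) wg] zg E lcos_eq_iff[OF D(1) one_closed wg] lcos_one[OF s(1)] wg by auto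
    have 4: "w \<otimes> inv g \<in> H \<longleftrightarrow> inv h \<otimes> (w \<otimes> inv g) \<in> H"
    proof
      assume "w \<otimes> inv g \<in> H" then show "inv h \<otimes> (w \<otimes> inv g) \<in> H" by (rule subgroup.m_closed[OF D(1) ih(2)])
    next
      assume "inv h \<otimes> (w \<otimes> inv g) \<in> H"
      then have "h \<otimes> (inv h \<otimes> (w \<otimes> inv g)) \<in> H" by (rule subgroup.m_closed[OF D(1) h])
      then show "w \<otimes> inv g \<in> H" using hc wg by simp
    qed
    have "(inv h <# z) #> inv g \<subseteq> ?P \<longleftrightarrow> inv h \<otimes> (w \<otimes> inv g) \<in> ?P" unfolding f by (rule sub[OF P gBP hwg])
    then show ?thesis unfolding Z_def kids_def using True 1 2 3 4 by blast
  qed (simp add: Z_def kids_def)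
  have X: "acts G C (lmult G) (kids G B ?y)" by (rule acts_kids[OF D'(4) D(4) valid_stateD(3)[OF v]])
  have Cc: "a \<in> carrier G" if "a \<in> C" for a using that s by auto
  have zs: "z \<subseteq> carrier G" if "z \<in> kids G B ?y" for z by (rule cosets_subset[OF D(4) kids_cosets[OF that]])
  have pinv: "((a <# z) #> inv g) <#> H = K' \<longleftrightarrow> (z #> inv g) <#> H = K'" if a: "a \<in> C" and z: "z \<in> kids G B ?y" for a z
  proof -
    have aH: "a \<in> H" using a D'(5) E by auto
    have zg: "z #> inv g \<subseteq> carrier G" using r_coset_subset_G[OF zs[OF z]] D(3) by simp
    have e: "((a <# z) #> inv g) <#> H = a <# ((z #> inv g) <#> H)"
      using lcos_rcos_comm[OF zs[OF z] Cc[OF a], of "inv g"] lcos_up_comm[OF D(1) zg Cc[OF a]] D(3) by simp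
    have aHH: "a <# H = H" using aH cstab_self[OF D(1)] by (auto simp: cstab_def)
    have zgH: "(z #> inv g) <#> H \<subseteq> carrier G" by (rule set_mult_closed[OF zg s(1)])
    show ?thesis
    proof
      assume "((a <# z) #> inv g) <#> H = K'"
      then have "inv a <# (a <# ((z #> inv g) <#> H)) = inv a <# (a <# H)" using e aHH E by simp
      then show "(z #> inv g) <#> H = K'"
        using lcos_inv_cancel[OF Cc[OF a] zgH] lcos_inv_cancel[OF Cc[OF a] s(1)] E by simp
    qed (use e aHH E in simp)
  qed
  have "?y \<in> cosets G K" using y hg by (simp add: cosetsI)
  then have "tvalue G (H, K, g, B) (H', K', g', C) = osum C (lmult G) (kids G B ?y)
     (\<lambda>z. if (z #> inv g) <#> H = K' then {#subconj G (carrier G) (C \<inter> cstab G z)#} else {#})" by simp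
  also have "\<dots> = osum C (lmult G) Z
     (\<lambda>z. if (z #> inv g) <#> H = K' then {#subconj G (carrier G) (C \<inter> cstab G z)#} else {#})"
    unfolding Z_def by (rule osum_restrict[OF X finite_kids]) (simp_all add: pinv)
  also have "\<dots> = osum C (lmult G) Z (\<lambda>z. {#subconj G (carrier G) (C \<inter> cstab G z)#})"
    by (rule osum_cong[OF dtable_transport(1)[OF P D(4) D'(4) D(3) ih(1) gBP CP Z]]) (simp add: Z_def)
  also have "\<dots> = dtable G ?P (conj_subgroup G (inv h) C) (conj_subgroup G g B)"
    by (rule dtable_transport(2)[OF P D(4) D'(4) D(3) ih(1) gBP CP Z])
  finally show "tvalue G (H, K, g, B) (H', K', g', C) = dtable G ?P (conj_subgroup G (inv h) C) (conj_subgroup G g B)" .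
qed

text \<open>A contributing coset z would produce a link: for w in z the element w g^{-1} is a
  witness.\<close>

lemma tvalue_not_linked:
  assumes j: "(H, K, g, B) \<in> mindex G" and k: "(H', K', g', C) \<in> mindex G"
    and l: "\<And>h. \<not> linked (H, K, g, B) (H', K', g', C) h"
  shows "tvalue G (H, K, g, B) (H', K', g', C) = {#}"
proof (cases "inv g' <# H' \<in> cosets G K")
  case True
  note D = mindexD[OF j] and D' = mindexD[OF k] and v = mstate_valid[OF k]
  let ?y = "inv g' <# H'"
  have ig: "inv g' \<in> carrier G" using D'(3) by simp
  have KH: "K = H'" by (rule coset_type_unique[OF D(2) D'(1) True cosetsI[OF ig]])
  have "(z #> inv g) <#> H \<noteq> K'" if z: "z \<in> kids G B ?y" for z
  proof
    assume eq: "(z #> inv g) <#> H = K'"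
    obtain w where wz: "w \<in> z" using cosets_nonempty[OF D(4) kids_cosets[OF z]] by auto
    have w: "w \<in> carrier G" "z = w <# B" using cosets_mem[OF D(4) kids_cosets[OF z] wz] by auto
    have wg: "w \<otimes> inv g \<in> carrier G" using w D(3) by simp
    have 1: "(w \<otimes> inv g) <# H = K'"
      using eq w lcos_rcos_inv[OF D(3) w(1) subgroup.subset[OF D(4)]] lcos_up[OF D(7,1,6) wg] by simp
    have HK: "H = K'" by (rule coset_type_unique[OF D(1) D'(2) _ coset_self[OF D'(2)]]) (use 1 wg cosetsI in metis)
    have "w \<otimes> inv g \<in> H" using lcos_self[OF D(1) wg] 1 HK by simp
    moreover have "w \<in> ?y" using wz z by (auto simp: kids_def)
    then have "?y = w <# K" using cosets_mem[OF D(2) True] by simp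
    then have "?y = (w \<otimes> inv g \<otimes> g) <# K" using w D(3) by (simp add: m_assoc)
    ultimately have "linked (H, K, g, B) (H', K', g', C) (w \<otimes> inv g)" using HK KH by (simp add: linked_def)
    then show False using l by simp
  qed
  then have "osum C (lmult G) (kids G B ?y) (\<lambda>z. if (z #> inv g) <#> H = K' then {#subconj G (carrier G) (C \<inter> cstab G z)#} else {#})
     = osum C (lmult G) (kids G B ?y) (\<lambda>z. {#})"
    by (intro osum_cong[OF acts_kids[OF D'(4) D(4) valid_stateD(3)[OF v]]]) simp
  then show ?thesis by (simp add: osum_def)
qed simp

text \<open>Linking is symmetric, with witness the inverse of g' h g in the other direction. The two
  values are then tables over P and P' with the arguments in opposite order; these groups are
  conjugate, and tables are symmetric and invariant under conjugation.\<close>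

lemma tvalue_sym:
  assumes j: "j \<in> mindex G" and k: "k \<in> mindex G"
  shows "tvalue G j k = tvalue G k j"
proof -
  obtain H K g B where j': "j = (H, K, g, B)" by (cases j)
  obtain H' K' g' C where k': "k = (H', K', g', C)" by (cases k)
  note J = j[unfolded j'] and K = k[unfolded k']
  note D = mindexD[OF J] and D' = mindexD[OF K]
  have link: "\<exists>h'. linked (H', K', g', C) (H, K, g, B) h' \<and> h' = inv (g' \<otimes> (h \<otimes> g))"
    if l: "linked (H, K, g, B) (H', K', g', C) h" and D: "subgroup H G" "subgroup K G" "g \<in> carrier G" "g' \<in> carrier G"
    for h H K g B H' K' g' C
  proof -
    have E: "H = K'" "K = H'" and h: "h \<in> H" and y: "inv g' <# K = (h \<otimes> g) <# K" using l by (auto simp: linked_def)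
    have hc: "h \<in> carrier G" using subgroup.mem_carrier[OF D(1) h] .
    have t: "g' \<otimes> (h \<otimes> g) \<in> K" using lcos_eq_iff[OF D(2), of "inv g'" "h \<otimes> g"] y hc D by simp
    have it: "inv (g' \<otimes> (h \<otimes> g)) \<in> K" by (rule subgroup.m_inv_closed[OF D(2) t])
    have "inv g <# H = (inv (g' \<otimes> (h \<otimes> g)) \<otimes> g') <# H"
      using lcos_eq_iff[OF D(1), of "inv g" "inv (g' \<otimes> (h \<otimes> g)) \<otimes> g'"] hc D subgroup.m_inv_closed[OF D(1) h]
      by (simp add: group_norm)
    then show ?thesis using it E by (simp add: linked_def)
  qed
  show ?thesis
  proof (cases "\<exists>h. linked (H, K, g, B) (H', K', g', C) h")
    case True
    then obtain h where l: "linked (H, K, g, B) (H', K', g', C) h" by auto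
    define t where "t = g' \<otimes> (h \<otimes> g)"
    have l': "linked (H', K', g', C) (H, K, g, B) (inv t)" using link[OF l D(1-3) D'(3)] by (auto simp: t_def)
    have E: "H = K'" "K = H'" and h: "h \<in> H" using l by (auto simp: linked_def)
    have hc: "h \<in> carrier G" using subgroup.mem_carrier[OF D(1) h] .
    have tc: "t \<in> carrier G" using hc D D' by (simp add: t_def)
    have itK: "inv t \<in> K" using l' E by (auto simp: linked_def)
    have tK: "t \<in> K" using subgroup.m_inv_closed[OF D(2) itK] tc by simp
    note s = subgroup.subset[OF D(1)] subgroup.subset[OF D(2)] subgroup.subset[OF D(4)] subgroup.subset[OF D'(4)]
    define P where "P = H \<inter> conj_subgroup G g K"
    define P' where "P' = K \<inter> conj_subgroup G g' H"
    \<comment> \<open>Chosen so that c t = g and c g' = h^{-1}: conjugation by c then takes P' to P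
      and both subgroups of P' to their counterparts in P at the same time.\<close>
    define c where "c = inv h \<otimes> inv g'"
    have cc: "c \<in> carrier G" using hc D' by (simp add: c_def)
    have P': "subgroup P' G" unfolding P'_def by (rule subgroup_Int[OF D(2) conj_subgroup_subgroup[OF D(1) D'(3)]])
    have P: "subgroup P G" unfolding P_def by (rule subgroup_Int[OF D(1) conj_subgroup_subgroup[OF D(2) D(3)]])
    have ct: "c \<otimes> t = g" using hc D(3) D'(3) by (simp add: c_def t_def group_norm)
    have cg: "c \<otimes> g' = inv h" using hc D'(3) by (simp add: c_def group_norm)
    have cPK: "conj_subgroup G c K = conj_subgroup G g K"
      using conj_comp[OF cc tc s(2)] conj_self[OF D(2) tK] ct by simp
    have ih: "inv h \<in> H" by (rule subgroup.m_inv_closed[OF D(1) h])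
    have cPH: "conj_subgroup G c (conj_subgroup G g' H) = H"
      using conj_comp[OF cc D'(3) s(1)] conj_self[OF D(1) ih] cg by simp
    have cP: "conj_subgroup G c P' = P"
      unfolding P_def P'_def using conj_Int[OF cc s(2) conj_closed[OF D'(3) s(1)]] cPK cPH by auto
    have 1: "tvalue G (H, K, g, B) (H', K', g', C) = dtable G P (conj_subgroup G (inv h) C) (conj_subgroup G g B)"
      using tvalue_linked(1)[OF J K l] by (simp add: P_def)
    have 2: "tvalue G (H', K', g', C) (H, K, g, B) = dtable G P' (conj_subgroup G t B) (conj_subgroup G g' C)"
      using tvalue_linked(1)[OF K J l'] E tc by (simp add: P'_def)
    have sB: "conj_subgroup G t B \<subseteq> P'" using tvalue_linked(2)[OF K J l'] E tc by (simp add: P'_def)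
    have sC: "conj_subgroup G g' C \<subseteq> P'" using D'(6) E conj_mono[OF D'(3,5) subgroup.subset[OF D'(2)]] by (auto simp: P'_def)
    have sgB: "subgroup (conj_subgroup G t B) G" by (rule conj_subgroup_subgroup[OF D(4) tc])
    have "dtable G P' (conj_subgroup G t B) (conj_subgroup G g' C) =
       dtable G (conj_subgroup G c P') (conj_subgroup G c (conj_subgroup G t B)) (conj_subgroup G c (conj_subgroup G g' C))"
      by (rule dtable_conj[OF P' sgB sB D'(7) sC cc, symmetric])
    also have "\<dots> = dtable G P (conj_subgroup G g B) (conj_subgroup G (inv h) C)"
      using cP conj_comp[OF cc tc s(3)] conj_comp[OF cc D'(3) s(4)] ct cg by simp
    also have "\<dots> = dtable G P (conj_subgroup G (inv h) C) (conj_subgroup G g B)"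
      by (rule dtable_sym[OF P D(7) _ conj_subgroup_subgroup[OF D'(4)]])
         (use hc tvalue_linked(2)[OF J K l] D(6) conj_mono[OF D(3,5) s(2)] in \<open>auto simp: P_def\<close>)
    finally show ?thesis using 1 2 j' k' by simp
  next
    case False
    then have "\<not> linked (H', K', g', C) (H, K, g, B) h" for h using link[OF _ D'(1-3) D(3)] by blast
    then show ?thesis using False tvalue_not_linked[OF J K] tvalue_not_linked[OF K J] j' k' by simp
  qed
qed

end

subsection \<open>Sums over multisets in a ring\<close>

definition msum :: "('r, 'k) ring_scheme \<Rightarrow> ('c \<Rightarrow> 'r) \<Rightarrow> 'c multiset \<Rightarrow> 'r"
  where "msum R F M = finsum R (\<lambda>c. add_pow R (count M c) (F c)) (set_mset M)"

context cring
begin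

lemma msum_superset:
  assumes F: "\<And>c. F c \<in> carrier R" and S: "finite S" "set_mset M \<subseteq> S"
  shows "msum R F M = finsum R (\<lambda>c. add_pow R (count M c) (F c)) S"
  unfolding msum_def
  by (rule add.finprod_mono_neutral_cong_left) (use F S in \<open>auto simp: not_in_iff\<close>)

lemma msum_closed: "(\<And>c. F c \<in> carrier R) \<Longrightarrow> msum R F M \<in> carrier R"
  unfolding msum_def by (rule finsum_closed) auto

lemma msum_empty [simp]: "msum R F {#} = \<zero>"
  by (simp add: msum_def)

lemma msum_single: "F c \<in> carrier R \<Longrightarrow> msum R F {#c#} = F c"
  by (simp add: msum_def)

lemma msum_add:
  assumes F: "\<And>c. F c \<in> carrier R"
  shows "msum R F (M + N) = msum R F M \<oplus> msum R F N"
proof -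
  let ?S = "set_mset M \<union> set_mset N"
  have "msum R F (M + N) = finsum R (\<lambda>c. add_pow R (count M c) (F c) \<oplus> add_pow R (count N c) (F c)) ?S"
    using msum_superset[of F, OF F, of ?S "M + N"] F by (simp add: add.nat_pow_mult)
  also have "\<dots> = finsum R (\<lambda>c. add_pow R (count M c) (F c)) ?S \<oplus> finsum R (\<lambda>c. add_pow R (count N c) (F c)) ?S"
    by (rule finsum_addf) (use F in auto)
  finally show ?thesis using msum_superset[of F, OF F, of ?S M] msum_superset[of F, OF F, of ?S N] by simp
qed

lemma msum_sum:
  assumes F: "\<And>c. F c \<in> carrier R"
  shows "msum R F (\<Sum>i\<in>I. M i) = finsum R (\<lambda>i. msum R F (M i)) I"
proof (cases "finite I")
  case True
  then show ?thesis
    by induction (use F in \<open>simp_all add: msum_add msum_closed\<close>)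
qed simp

end

text \<open>Both sums evaluate at the same chosen points of the same orbits, so \<open>h\<close> and
  \<open>k\<close> need not be invariant.\<close>

lemma (in group) msum_osum_cong:
  assumes R: "cring R" and F: "\<And>c. F c \<in> carrier R" "\<And>c. F' c \<in> carrier R"
    and X: "acts G A act X" and eq: "\<And>x. x \<in> X \<Longrightarrow> msum R F (h x) = msum R F' (k x)"
  shows "msum R F (osum A act X h) = msum R F' (osum A act X k)"
proof -
  interpret R: cring R by (rule R)
  have rep: "(SOME x. x \<in> Q) \<in> X" if Q: "Q \<in> orb A act ` X" for Q
  proof -
    obtain x where x: "x \<in> X" "Q = orb A act x" using Q by auto
    have "(SOME x. x \<in> Q) \<in> Q" by (rule someI[of _ x]) (use x orb_self[OF X] in auto)
    then show ?thesis using x orb_subset[OF X] by auto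
  qed
  show ?thesis unfolding osum_def R.msum_sum[of F, OF F(1)] R.msum_sum[of F', OF F(2)]
    by (rule R.finsum_cong') (use eq rep R.msum_closed[of F', OF F(2)] in auto)
qed

subsection \<open>The Mackey algebra\<close>

lemma free_monoid_monoid: "monoid (free_monoid S)"
  by (rule monoidI) (auto simp: free_monoid_def)

lemma free_monoid_simps [simp]:
  "carrier (free_monoid S) = lists S" "monoid.mult (free_monoid S) = (@)" "one (free_monoid S) = []"
  by (simp_all add: free_monoid_def)

locale mackey_setup =
  fixes R :: "('r, 'k) ring_scheme" and G :: "('g, 'l) monoid_scheme"
  assumes cring_R: "cring R" and fin_group_G: "fin_group G"
begin

sublocale R: cring R by (rule cring_R)
sublocale G: fin_group G by (rule fin_group_G)

abbreviation "FA \<equiv> mackey_free R G"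
abbreviation "Wd \<equiv> lists (mackey_gens G)"

sublocale F: nc_algebra R FA
  unfolding free_algebra_def by (rule monoid_algebra_nc_algebra[OF cring_R free_monoid_monoid])

abbreviation "bv \<equiv> basis_vec R"

lemma bv_closed: "w \<in> Wd \<Longrightarrow> bv w \<in> carrier FA"
  unfolding free_algebra_def using monoid_algebra_basis_closed[OF cring_R free_monoid_monoid] by simp

lemma bv_mult: "w \<in> Wd \<Longrightarrow> w' \<in> Wd \<Longrightarrow> bv w \<otimes>\<^bsub>FA\<^esub> bv w' = bv (w @ w')"
  unfolding free_algebra_def using monoid_algebra_basis_mult[OF cring_R free_monoid_monoid, of w _ w'] by simp

lemma one_bv: "\<one>\<^bsub>FA\<^esub> = bv []"
  by (simp add: free_algebra_def monoid_algebra_simps)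

lemma mult_linear_l: "y \<in> carrier FA \<Longrightarrow> linear_on R FA FA (\<lambda>x. x \<otimes>\<^bsub>FA\<^esub> y)"
  by (rule linear_onI) (auto simp: F.l_distr F.smult_mult_l)

lemma mult_linear_r: "y \<in> carrier FA \<Longrightarrow> linear_on R FA FA (\<lambda>x. y \<otimes>\<^bsub>FA\<^esub> x)"
  by (rule linear_onI) (auto simp: F.r_distr F.smult_mult_r)

definition wfun :: "('g mclass \<Rightarrow> 'r) \<Rightarrow> ('g mackey_gen list \<Rightarrow> 'r) \<Rightarrow> 'r"
  where "wfun f = lin_ext R (regular_module R) (\<lambda>w. msum R f (coef G w))"

lemma regular: "module R (regular_module R)" by (rule regular_module_module[OF cring_R])

context
  fixes f :: "'g mclass \<Rightarrow> 'r"
  assumes f: "\<And>c. f c \<in> carrier R"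
begin

lemma wfun_linear: "linear_on R FA (regular_module R) (wfun f)"
proof -
  have "linear_on R (free_module R Wd) (regular_module R) (wfun f)"
    unfolding wfun_def by (rule lin_ext_linear[OF regular]) (use R.msum_closed[of f, OF f] in auto)
  then show ?thesis unfolding linear_on_def free_algebra_def monoid_algebra_simps by simp
qed

lemma wfun_bv: "w \<in> Wd \<Longrightarrow> wfun f (bv w) = msum R f (coef G w)"
  unfolding wfun_def by (rule lin_ext_basis[OF regular]) (use R.msum_closed[of f, OF f] in auto)

lemma wfun_context_sum:
  assumes p: "p \<in> Wd" and q: "q \<in> Wd" and a: "\<And>i. i \<in> I \<Longrightarrow> a i \<in> Wd"
  shows "wfun f (bv p \<otimes>\<^bsub>FA\<^esub> (\<Oplus>\<^bsub>FA\<^esub>i\<in>I. bv (a i)) \<otimes>\<^bsub>FA\<^esub> bv q) = msum R f (\<Sum>i\<in>I. coef G (p @ a i @ q))"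
proof -
  have lin: "linear_on R FA (regular_module R) (\<lambda>x. wfun f (bv p \<otimes>\<^bsub>FA\<^esub> x \<otimes>\<^bsub>FA\<^esub> bv q))"
    by (rule linear_on_comp[OF linear_on_comp[OF mult_linear_r mult_linear_l] wfun_linear])
       (use p q bv_closed in auto)
  have "wfun f (bv p \<otimes>\<^bsub>FA\<^esub> (\<Oplus>\<^bsub>FA\<^esub>i\<in>I. bv (a i)) \<otimes>\<^bsub>FA\<^esub> bv q) =
    (\<Oplus>\<^bsub>R\<^esub>i\<in>I. wfun f (bv p \<otimes>\<^bsub>FA\<^esub> bv (a i) \<otimes>\<^bsub>FA\<^esub> bv q))"
    using linear_on_finsum[OF F.module_axioms regular lin, of "\<lambda>i. bv (a i)" I] bv_closed a by auto
  also have "\<dots> = (\<Oplus>\<^bsub>R\<^esub>i\<in>I. msum R f (coef G (p @ a i @ q)))"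
  proof (rule R.finsum_cong')
    fix i assume i: "i \<in> I"
    have "p @ a i @ q \<in> Wd" "p @ a i \<in> Wd" using p q a[OF i] by auto
    then show "wfun f (bv p \<otimes>\<^bsub>FA\<^esub> bv (a i) \<otimes>\<^bsub>FA\<^esub> bv q) = msum R f (coef G (p @ a i @ q))"
      using bv_mult[OF p a[OF i]] bv_mult[of "p @ a i" q] wfun_bv[of "p @ a i @ q"] q by simp
  qed (use R.msum_closed[of f, OF f] in auto)
  finally show ?thesis by (simp add: R.msum_sum[of f, OF f])
qed

lemma wfun_context:
  assumes p: "p \<in> Wd" and q: "q \<in> Wd" and a: "a \<in> Wd"
  shows "wfun f (bv p \<otimes>\<^bsub>FA\<^esub> bv a \<otimes>\<^bsub>FA\<^esub> bv q) = msum R f (coef G (p @ a @ q))"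
  using wfun_context_sum[OF p q, of "{()}" "\<lambda>_. a"] a bv_closed by simp

end

lemma words_simps: "[] \<in> Wd" "x # w \<in> Wd \<longleftrightarrow> x \<in> mackey_gens G \<and> w \<in> Wd"
  by auto

lemma mackey_words:
  assumes "subgroup H G" "subgroup L G" "subgroup K G" "L \<subseteq> H" "K \<subseteq> H" "d \<in> H"
  shows "[Tr L (L \<inter> conj_subgroup G d K), Cj d (conj_subgroup G (inv\<^bsub>G\<^esub> d) L \<inter> K), Rs K (conj_subgroup G (inv\<^bsub>G\<^esub> d) L \<inter> K)] \<in> Wd"
  using assms G.subgroup_Int G.conj_subgroup_subgroup subgroup.mem_carrier[OF assms(1,6)]
  by (simp add: words_simps G.gens_subgroups)

lemma relation_closed:
  assumes "mackey_rel R G u v"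
  shows "u \<in> carrier FA" "v \<in> carrier FA"
proof -
  have "u \<in> carrier FA \<and> v \<in> carrier FA" using assms
  proof cases
    case unit
    have "(\<Oplus>\<^bsub>FA\<^esub>H\<in>{H. subgroup H G}. bv [Tr H H]) \<in> carrier FA"
      by (rule F.M.finsum_closed) (auto simp: G.gens_subgroups intro!: bv_closed)
    then show ?thesis using unit by simp
  next
    case (mackey H L K D)
    have "(\<Oplus>\<^bsub>FA\<^esub>h\<in>D. bv [Tr L (L \<inter> conj_subgroup G h K), Cj h (conj_subgroup G (inv\<^bsub>G\<^esub> h) L \<inter> K),
         Rs K (conj_subgroup G (inv\<^bsub>G\<^esub> h) L \<inter> K)]) \<in> carrier FA"
    proof (rule F.M.finsum_closed, rule Pi_I, rule bv_closed)
      fix d assume "d \<in> D"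
      then have "d \<in> H" using mackey(8) unfolding double_coset_reps_def by blast
      then show "[Tr L (L \<inter> conj_subgroup G d K), Cj d (conj_subgroup G (inv\<^bsub>G\<^esub> d) L \<inter> K),
         Rs K (conj_subgroup G (inv\<^bsub>G\<^esub> d) L \<inter> K)] \<in> Wd" by (rule mackey_words[OF mackey(3-7)])
    qed
    then show ?thesis using mackey by (auto simp: words_simps G.gens_subgroups intro!: bv_closed)
  qed (auto simp: words_simps G.gens_subgroups G.conj_subgroup_subgroup G.conj_mono subgroup.subset subgroup.mem_carrier intro!: bv_closed)
  then show "u \<in> carrier FA" "v \<in> carrier FA" by auto
qed

text \<open>Each relation is an identity between the operators of its two sides at valid states, so
  \<open>coef_relation\<close> permits any words to its left and right.\<close>

lemma relation_wfun:
  assumes rel: "mackey_rel R G u v" and f: "\<And>c. f c \<in> carrier R" and p: "p \<in> Wd" and q: "q \<in> Wd"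
  shows "wfun f (bv p \<otimes>\<^bsub>FA\<^esub> u \<otimes>\<^bsub>FA\<^esub> bv q) = wfun f (bv p \<otimes>\<^bsub>FA\<^esub> v \<otimes>\<^bsub>FA\<^esub> bv q)"
proof -
  have pq: "set p \<subseteq> mackey_gens G" "set q \<subseteq> mackey_gens G" using p q by auto
  note cr = G.coef_relation[OF pq]
  note ctx = wfun_context[OF f p q]
  have single: "wfun f (bv p \<otimes>\<^bsub>FA\<^esub> bv a \<otimes>\<^bsub>FA\<^esub> bv q) = wfun f (bv p \<otimes>\<^bsub>FA\<^esub> bv b \<otimes>\<^bsub>FA\<^esub> bv q)"
    if "a \<in> Wd" "b \<in> Wd" "\<And>L A x (h :: 'g set \<Rightarrow> 'g set \<Rightarrow> 'g mclass multiset). subgroup L G \<Longrightarrow> inv_state G L h \<Longrightarrow>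
      valid_state G L A x \<Longrightarrow> wact G a h A x = wact G b h A x" for a b
    using cr[of "{()}" "{()}" "\<lambda>_. a" "\<lambda>_. b"] that ctx by simp
  show ?thesis using rel
  proof cases
    case unit
    have "(\<Sum>H\<in>{H. subgroup H G}. coef G (p @ [Tr H H] @ q)) = (\<Sum>i\<in>{()}. coef G (p @ [] @ q))"
      by (rule cr) (use G.rel_unit G.finite_subgroups in auto)
    moreover have "wfun f (bv p \<otimes>\<^bsub>FA\<^esub> u \<otimes>\<^bsub>FA\<^esub> bv q) = msum R f (\<Sum>H\<in>{H. subgroup H G}. coef G (p @ [Tr H H] @ q))"
      unfolding unit by (rule wfun_context_sum[OF f p q]) (auto simp: G.gens_subgroups)
    moreover have "wfun f (bv p \<otimes>\<^bsub>FA\<^esub> v \<otimes>\<^bsub>FA\<^esub> bv q) = msum R f (coef G (p @ [] @ q))"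
      unfolding unit one_bv by (rule ctx) simp
    ultimately show ?thesis by simp
  next
    case (idem_r H)
    show ?thesis unfolding idem_r(1,2)
    proof (rule single)
      fix M A x and h :: "'g set \<Rightarrow> 'g set \<Rightarrow> 'g mclass multiset"
      assume h: "inv_state G M h" and v: "valid_state G M A x"
      show "wact G [Tr H H] h A x = wact G [Rs H H] h A x"
        using G.rel_idem_r[OF h v idem_r(3)] by (simp only: fold_simps)
    qed (use idem_r in \<open>auto simp: words_simps G.gens_subgroups G.conj_subgroup_subgroup G.conj_mono subgroup.subset subgroup.mem_carrier\<close>)
  next
    case (idem_c H k)
    show ?thesis unfolding idem_c(1,2)
    proof (rule single)
      fix M A x and h :: "'g set \<Rightarrow> 'g set \<Rightarrow> 'g mclass multiset"
      assume h: "inv_state G M h" and v: "valid_state G M A x"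
      show "wact G [Tr H H] h A x = wact G [Cj k H] h A x"
        using G.rel_idem_c[OF h v idem_c(3,4)] by (simp only: fold_simps)
    qed (use idem_c in \<open>auto simp: words_simps G.gens_subgroups G.conj_subgroup_subgroup G.conj_mono subgroup.subset subgroup.mem_carrier\<close>)
  next
    case (tt H K L)
    show ?thesis unfolding tt(1,2)
    proof (rule single)
      fix M A x and h :: "'g set \<Rightarrow> 'g set \<Rightarrow> 'g mclass multiset"
      assume h: "inv_state G M h" and v: "valid_state G M A x"
      show "wact G [Tr L K, Tr K H] h A x = wact G [Tr L H] h A x"
        using G.rel_tt[OF h v tt(3-7)] by (simp only: fold_simps)
    qed (use tt in \<open>auto simp: words_simps G.gens_subgroups G.conj_subgroup_subgroup G.conj_mono subgroup.subset subgroup.mem_carrier\<close>)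
  next
    case (rr H K L)
    show ?thesis unfolding rr(1,2)
    proof (rule single)
      fix M A x and h :: "'g set \<Rightarrow> 'g set \<Rightarrow> 'g mclass multiset"
      assume h: "inv_state G M h" and v: "valid_state G M A x"
      show "wact G [Rs K H, Rs L K] h A x = wact G [Rs L H] h A x"
        using G.rel_rr[OF h v rr(3-7)] by (simp only: fold_simps)
    qed (use rr in \<open>auto simp: words_simps G.gens_subgroups G.conj_subgroup_subgroup G.conj_mono subgroup.subset subgroup.mem_carrier\<close>)
  next
    case (cc H g g')
    show ?thesis unfolding cc(1,2)
    proof (rule single)
      fix M A x and h :: "'g set \<Rightarrow> 'g set \<Rightarrow> 'g mclass multiset"
      assume h: "inv_state G M h" and v: "valid_state G M A x"
      show "wact G [Cj g' (conj_subgroup G g H), Cj g H] h A x = wact G [Cj (g' \<otimes>\<^bsub>G\<^esub> g) H] h A x"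
        using G.rel_cc[OF h v cc(3-5)] by (simp only: fold_simps)
    qed (use cc in \<open>auto simp: words_simps G.gens_subgroups G.conj_subgroup_subgroup G.conj_mono subgroup.subset subgroup.mem_carrier\<close>)
  next
    case (tc H K g)
    show ?thesis unfolding tc(1,2)
    proof (rule single)
      fix M A x and h :: "'g set \<Rightarrow> 'g set \<Rightarrow> 'g mclass multiset"
      assume h: "inv_state G M h" and v: "valid_state G M A x"
      show "wact G [Tr (conj_subgroup G g K) (conj_subgroup G g H), Cj g H] h A x = wact G [Cj g K, Tr K H] h A x"
        using G.rel_tc[OF h v tc(3-6)] by (simp only: fold_simps)
    qed (use tc in \<open>auto simp: words_simps G.gens_subgroups G.conj_subgroup_subgroup G.conj_mono subgroup.subset subgroup.mem_carrier\<close>)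
  next
    case (rc H K g)
    show ?thesis unfolding rc(1,2)
    proof (rule single)
      fix M A x and h :: "'g set \<Rightarrow> 'g set \<Rightarrow> 'g mclass multiset"
      assume h: "inv_state G M h" and v: "valid_state G M A x"
      show "wact G [Rs (conj_subgroup G g K) (conj_subgroup G g H), Cj g K] h A x = wact G [Cj g H, Rs K H] h A x"
        using G.rel_rc[OF h v rc(3-6)] by (simp only: fold_simps)
    qed (use rc in \<open>auto simp: words_simps G.gens_subgroups G.conj_subgroup_subgroup G.conj_mono subgroup.subset subgroup.mem_carrier\<close>)
  next
    case (mackey H L K D)
    let ?w = "\<lambda>h. [Tr L (L \<inter> conj_subgroup G h K), Cj h (conj_subgroup G (inv\<^bsub>G\<^esub> h) L \<inter> K),
         Rs K (conj_subgroup G (inv\<^bsub>G\<^esub> h) L \<inter> K)]"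
    have DH: "D \<subseteq> H" using mackey(8) unfolding double_coset_reps_def by blast
    have fD: "finite D" using DH subgroup.subset[OF mackey(3)] G.finite_carrier finite_subset by metis
    have w: "[Rs H L, Tr H K] \<in> Wd" using mackey by (simp add: words_simps G.gens_subgroups)
    have "(\<Sum>i\<in>{()}. coef G (p @ [Rs H L, Tr H K] @ q)) = (\<Sum>h\<in>D. coef G (p @ ?w h @ q))"
    proof (rule cr[OF _ fD])
      fix M A x and h :: "'g set \<Rightarrow> 'g set \<Rightarrow> 'g mclass multiset"
      assume "subgroup M G" and h: "inv_state G M h" and v: "valid_state G M A x"
      have "wact G [Rs H L, Tr H K] h A x = (\<Sum>d\<in>D. wact G (?w d) h A x)"
        by (rule G.rel_mackey[OF h v mackey(3-8)])
      then show "(\<Sum>i\<in>{()}. wact G [Rs H L, Tr H K] h A x) = (\<Sum>d\<in>D. wact G (?w d) h A x)" by simp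
    qed simp
    moreover have "wfun f (bv p \<otimes>\<^bsub>FA\<^esub> v \<otimes>\<^bsub>FA\<^esub> bv q) = msum R f (\<Sum>h\<in>D. coef G (p @ ?w h @ q))"
      unfolding mackey(2) by (rule wfun_context_sum[OF f p q]) (use mackey_words[OF mackey(3-7)] DH in auto)
    ultimately show ?thesis unfolding mackey(1) ctx[OF w] by simp
  next
    case (zero x y)
    have w: "[x, y] \<in> Wd" using zero by (simp add: words_simps)
    have "(\<Sum>i\<in>{()}. coef G (p @ [x, y] @ q)) = (\<Sum>i\<in>{}. coef G (p @ [x, y] @ q))"
    proof (rule cr)
      fix M A z and h :: "'g set \<Rightarrow> 'g set \<Rightarrow> 'g mclass multiset"
      assume v: "valid_state G M A z"
      have "wact G [x, y] h A z = 0" by (rule G.rel_zero[OF zero(3-5) v])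
      then show "(\<Sum>i\<in>{()}. wact G [x, y] h A z) = (\<Sum>i\<in>{}. wact G [x, y] h A z)" by simp
    qed auto
    moreover have "wfun f (bv p \<otimes>\<^bsub>FA\<^esub> \<zero>\<^bsub>FA\<^esub> \<otimes>\<^bsub>FA\<^esub> bv q) = \<zero>\<^bsub>R\<^esub>"
      using bv_closed[OF p] bv_closed[OF q] linear_on_zero[OF F.module_axioms regular wfun_linear[OF f]] by simp
    ultimately show ?thesis unfolding zero(1,2) ctx[OF w] by simp
  qed
qed

abbreviation "MI \<equiv> Idl\<^bsub>FA\<^esub> {u \<ominus>\<^bsub>FA\<^esub> v |u v. mackey_rel R G u v}"
abbreviation "MA' \<equiv> mackey_algebra R G"

lemma rels_closed: "{u \<ominus>\<^bsub>FA\<^esub> v |u v. mackey_rel R G u v} \<subseteq> carrier FA"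
  using relation_closed by auto

lemma MI_ideal: "ideal MI FA"
  by (rule F.genideal_ideal[OF rels_closed])

lemma MA_alt: "MA' = quotient_algebra FA MI"
  by (simp add: mackey_algebra_def)

sublocale Q: nc_algebra R MA'
  unfolding MA_alt by (rule F.quotient_nc_algebra[OF MI_ideal])

lemma wfun_MI:
  assumes f: "\<And>c. f c \<in> carrier R" and x: "x \<in> MI"
  shows "wfun f x = \<zero>\<^bsub>R\<^esub>"
proof -
  let ?S = "{u \<ominus>\<^bsub>FA\<^esub> v |u v. mackey_rel R G u v}"
  have "wfun f x = \<zero>\<^bsub>regular_module R\<^esub>"
  proof (rule genideal_linear_zero[OF cring_R free_monoid_monoid regular, of "mackey_gens G" "wfun f" ?S, folded free_algebra_def])
    show "linear_on R FA (regular_module R) (wfun f)" by (rule wfun_linear[OF f])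
    show "?S \<subseteq> carrier FA" by (rule rels_closed)
    show "x \<in> MI" by (rule x)
    fix p q s assume pq: "p \<in> carrier (free_monoid (mackey_gens G))" "q \<in> carrier (free_monoid (mackey_gens G))" and s: "s \<in> ?S"
    then have p: "p \<in> Wd" and q: "q \<in> Wd" by auto
    obtain u v where uv: "s = u \<ominus>\<^bsub>FA\<^esub> v" "mackey_rel R G u v" using s by auto
    note c = relation_closed[OF uv(2)]
    have lin: "linear_on R FA (regular_module R) (\<lambda>x. wfun f (bv p \<otimes>\<^bsub>FA\<^esub> x \<otimes>\<^bsub>FA\<^esub> bv q))"
      by (rule linear_on_comp[OF linear_on_comp[OF mult_linear_r mult_linear_l] wfun_linear[OF f]])
         (use p q bv_closed in auto)
    have "wfun f (bv p \<otimes>\<^bsub>FA\<^esub> s \<otimes>\<^bsub>FA\<^esub> bv q) =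
       wfun f (bv p \<otimes>\<^bsub>FA\<^esub> u \<otimes>\<^bsub>FA\<^esub> bv q) \<ominus>\<^bsub>R\<^esub> wfun f (bv p \<otimes>\<^bsub>FA\<^esub> v \<otimes>\<^bsub>FA\<^esub> bv q)"
      using linear_on_minus[OF F.module_axioms regular lin c] uv(1) by simp
    also have "\<dots> = \<zero>\<^bsub>R\<^esub>"
      using relation_wfun[OF uv(2) f p q] linear_onD(1)[OF lin c(2)] by (simp add: R.r_neg a_minus_def)
    finally show "wfun f (bv p \<otimes>\<^bsub>FA\<^esub> s \<otimes>\<^bsub>FA\<^esub> bv q) = \<zero>\<^bsub>regular_module R\<^esub>" by simp
  qed
  then show ?thesis by simp
qed

definition cl :: "'g mackey_gen list \<Rightarrow> ('g mackey_gen list \<Rightarrow> 'r) set"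
  where "cl w = MI +>\<^bsub>FA\<^esub> bv w"

text \<open>Any assignment of ring elements to classes defines a functional on the Mackey algebra
  whose values on words are computed through \<open>coef\<close>. It yields the coordinate
  functionals as well as the trace.\<close>

lemma class_functional:
  assumes f: "\<And>c. f c \<in> carrier R"
  obtains \<psi> where "linear_on R MA' (regular_module R) \<psi>" "\<And>w. w \<in> Wd \<Longrightarrow> \<psi> (cl w) = msum R f (coef G w)"
proof -
  have z: "wfun f x = \<zero>\<^bsub>regular_module R\<^esub>" if "x \<in> MI" for x using wfun_MI[OF f that] by simp
  show ?thesis
  proof (rule F.quotient_linear[OF MI_ideal regular wfun_linear[of f, OF f] z])
    fix \<psi> assume \<psi>: "linear_on R (quotient_algebra FA MI) (regular_module R) \<psi>"
      and e: "\<And>x. x \<in> carrier FA \<Longrightarrow> \<psi> (MI +>\<^bsub>FA\<^esub> x) = wfun f x"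
    show thesis
    proof (rule that)
      show "linear_on R MA' (regular_module R) \<psi>" using \<psi> unfolding MA_alt .
      fix w assume w: "w \<in> Wd"
      show "\<psi> (cl w) = msum R f (coef G w)" unfolding cl_def e[OF bv_closed[OF w]] by (rule wfun_bv[OF f w])
    qed
  qed
qed

end

text \<open>The Mackey relation can be used for rewriting only when some system of representatives
  is at hand.\<close>

lemma (in group) double_coset_reps_exist:
  assumes L: "subgroup L G" and K: "subgroup K G" and H: "subgroup H G" and LH: "L \<subseteq> H" and KH: "K \<subseteq> H"
  shows "\<exists>D. double_coset_reps G L H K D"
proof -
  define Q where "Q x = (L #> x) <#> K" for x
  have Qm: "e \<in> Q y \<longleftrightarrow> (\<exists>l\<in>L. \<exists>k\<in>K. e = l \<otimes> y \<otimes> k)" for e y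
    unfolding Q_def set_mult_def r_coset_def by auto
  have c: "x \<in> carrier G" if "x \<in> L \<or> x \<in> K \<or> x \<in> H" for x
    using that subgroup.mem_carrier[OF L] subgroup.mem_carrier[OF K] subgroup.mem_carrier[OF H] by auto
  have self: "x \<in> Q x" if "x \<in> H" for x
  proof -
    have "x = \<one> \<otimes> x \<otimes> \<one>" using c that by simp
    then show ?thesis unfolding Qm using subgroup.one_closed[OF L] subgroup.one_closed[OF K] by metis
  qed
  have sub: "Q x \<subseteq> H" if "x \<in> H" for x
    using that LH KH subgroup.m_closed[OF H] unfolding subset_iff Qm by metis
  have mono: "Q y \<subseteq> Q x" if x: "x \<in> H" and y: "y \<in> Q x" for x y
  proof
    fix z assume "z \<in> Q y"
    then obtain l k where lk: "l \<in> L" "k \<in> K" "z = l \<otimes> y \<otimes> k" unfolding Qm by blast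
    obtain l' k' where lk': "l' \<in> L" "k' \<in> K" "y = l' \<otimes> x \<otimes> k'" using y unfolding Qm by blast
    have "z = (l \<otimes> l') \<otimes> x \<otimes> (k' \<otimes> k)" using lk lk' c x by (simp add: m_assoc)
    then show "z \<in> Q x" unfolding Qm
      using subgroup.m_closed[OF L lk(1) lk'(1)] subgroup.m_closed[OF K lk'(2) lk(2)] by metis
  qed
  have symQ: "x \<in> Q y" if x: "x \<in> H" and y: "y \<in> Q x" for x y
  proof -
    obtain l k where lk: "l \<in> L" "k \<in> K" "y = l \<otimes> x \<otimes> k" using y unfolding Qm by blast
    have "x = inv l \<otimes> y \<otimes> inv k" using lk c x by (simp add: m_assoc)
    then show ?thesis unfolding Qm using subgroup.m_inv_closed[OF L lk(1)] subgroup.m_inv_closed[OF K lk(2)] by metis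
  qed
  have eqQ: "Q y = Q x" if "x \<in> H" "y \<in> Q x" for x y
    using mono[OF that] mono[of y x] symQ[OF that] sub[OF that(1)] that(2) by auto
  define s where "s X = (SOME h. h \<in> X)" for X :: "'a set"
  have s: "s (Q x) \<in> Q x" if "x \<in> H" for x unfolding s_def by (rule someI[of _ x]) (rule self[OF that])
  have "double_coset_reps G L H K ((\<lambda>x. s (Q x)) ` H)"
    unfolding double_coset_reps_def Q_def[symmetric]
  proof (intro conjI ballI)
    show "(\<lambda>x. s (Q x)) ` H \<subseteq> H" using s sub by blast
    fix x assume x: "x \<in> H"
    show "\<exists>!h. h \<in> (\<lambda>x. s (Q x)) ` H \<and> h \<in> Q x"
    proof (rule ex1I[of _ "s (Q x)"])
      show "s (Q x) \<in> (\<lambda>x. s (Q x)) ` H \<and> s (Q x) \<in> Q x" using x s by auto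
      fix h assume "h \<in> (\<lambda>x. s (Q x)) ` H \<and> h \<in> Q x"
      then obtain y where y: "y \<in> H" "h = s (Q y)" "h \<in> Q x" by auto
      have "Q h = Q y" by (rule eqQ[OF y(1)]) (use y s in simp)
      moreover have "Q h = Q x" by (rule eqQ[OF x y(3)])
      ultimately show "h = s (Q x)" using y by simp
    qed
  qed
  then show ?thesis by blast
qed

section \<open>Rewriting in the Mackey algebra: standard words span\<close>

context mackey_setup
begin

lemma cl_closed: "w \<in> Wd \<Longrightarrow> cl w \<in> carrier MA'"
  unfolding cl_def MA_alt F.quotient_carrier using bv_closed by auto

lemma cl_mult: "w \<in> Wd \<Longrightarrow> w' \<in> Wd \<Longrightarrow> cl w \<otimes>\<^bsub>MA'\<^esub> cl w' = cl (w @ w')"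
  using F.quotient_ops(2)[OF MI_ideal bv_closed bv_closed R.one_closed] bv_mult
  unfolding cl_def MA_alt by simp

lemma quotient_map_linear: "linear_on R FA MA' (\<lambda>x. MI +>\<^bsub>FA\<^esub> x)"
  unfolding MA_alt
  by (rule linear_onI)
     (use F.quotient_ops(1)[OF MI_ideal _ _ R.one_closed] F.quotient_ops(3)[OF MI_ideal] F.quotient_carrier in auto)

lemma relation_class: "mackey_rel R G u v \<Longrightarrow> MI +>\<^bsub>FA\<^esub> u = MI +>\<^bsub>FA\<^esub> v"
proof -
  assume r: "mackey_rel R G u v"
  have "u \<ominus>\<^bsub>FA\<^esub> v \<in> {u \<ominus>\<^bsub>FA\<^esub> v |u v. mackey_rel R G u v}" using r by blast
  then have "u \<ominus>\<^bsub>FA\<^esub> v \<in> MI" using F.genideal_self[OF rels_closed] by blast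
  then show ?thesis using F.quotient_eq_iff[OF MI_ideal] relation_closed[OF r] by simp
qed

lemma cl_eq: "mackey_rel R G (bv a) (bv b) \<Longrightarrow> cl a = cl b"
  unfolding cl_def by (rule relation_class)

lemma class_sum:
  assumes "\<And>i. i \<in> I \<Longrightarrow> a i \<in> Wd"
  shows "MI +>\<^bsub>FA\<^esub> (\<Oplus>\<^bsub>FA\<^esub>i\<in>I. bv (a i)) = (\<Oplus>\<^bsub>MA'\<^esub>i\<in>I. cl (a i))"
  using linear_on_finsum[OF F.module_axioms Q.module_axioms quotient_map_linear, of "\<lambda>i. bv (a i)" I]
    assms bv_closed unfolding cl_def by auto

abbreviation "gt K H \<equiv> cl [Tr K H]"
abbreviation "gr K H \<equiv> cl [Rs K H]"
abbreviation "gc g H \<equiv> cl [Cj g H]"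
abbreviation mul (infixl \<open>\<cdot>\<close> 70) where "x \<cdot> y \<equiv> x \<otimes>\<^bsub>MA'\<^esub> y"

definition mel :: "'g mindex \<Rightarrow> ('g mackey_gen list \<Rightarrow> 'r) set" where "mel j = cl (mword G j)"

lemma gens_closed:
  "subgroup H G \<Longrightarrow> subgroup K G \<Longrightarrow> H \<subseteq> K \<Longrightarrow> gt K H \<in> carrier MA'"
  "subgroup H G \<Longrightarrow> subgroup K G \<Longrightarrow> H \<subseteq> K \<Longrightarrow> gr K H \<in> carrier MA'"
  "subgroup H G \<Longrightarrow> g \<in> carrier G \<Longrightarrow> gc g H \<in> carrier MA'"
  by (auto intro!: cl_closed simp: G.gens_subgroups)

lemma cl_Cons: "x \<in> mackey_gens G \<Longrightarrow> w \<in> Wd \<Longrightarrow> cl (x # w) = cl [x] \<cdot> cl w"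
  using cl_mult[of "[x]" w] by simp

lemma cl_pair:
  "x \<in> mackey_gens G \<Longrightarrow> y \<in> mackey_gens G \<Longrightarrow> cl [x, y] = cl [x] \<cdot> cl [y]"
  "x \<in> mackey_gens G \<Longrightarrow> y \<in> mackey_gens G \<Longrightarrow> z \<in> mackey_gens G \<Longrightarrow>
    cl [x, y, z] = cl [x] \<cdot> (cl [y] \<cdot> cl [z])"
  using cl_Cons[of x "[y]"] cl_Cons[of x "[y, z]"] cl_Cons[of y "[z]"] by auto

lemma gen_relations:
  "subgroup H G \<Longrightarrow> gr H H = gt H H"
  "subgroup H G \<Longrightarrow> h \<in> H \<Longrightarrow> gc h H = gt H H"
  "subgroup H G \<Longrightarrow> subgroup K G \<Longrightarrow> subgroup L G \<Longrightarrow> H \<subseteq> K \<Longrightarrow> K \<subseteq> L \<Longrightarrow> gt L K \<cdot> gt K H = gt L H"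
  "subgroup H G \<Longrightarrow> subgroup K G \<Longrightarrow> subgroup L G \<Longrightarrow> H \<subseteq> K \<Longrightarrow> K \<subseteq> L \<Longrightarrow> gr K H \<cdot> gr L K = gr L H"
  "subgroup H G \<Longrightarrow> g \<in> carrier G \<Longrightarrow> g' \<in> carrier G \<Longrightarrow>
     gc g' (conj_subgroup G g H) \<cdot> gc g H = gc (g' \<otimes>\<^bsub>G\<^esub> g) H"
  "subgroup H G \<Longrightarrow> subgroup K G \<Longrightarrow> H \<subseteq> K \<Longrightarrow> g \<in> carrier G \<Longrightarrow>
     gt (conj_subgroup G g K) (conj_subgroup G g H) \<cdot> gc g H = gc g K \<cdot> gt K H"
  "subgroup H G \<Longrightarrow> subgroup K G \<Longrightarrow> H \<subseteq> K \<Longrightarrow> g \<in> carrier G \<Longrightarrow>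
     gr (conj_subgroup G g K) (conj_subgroup G g H) \<cdot> gc g K = gc g H \<cdot> gr K H"
proof -
  note s = words_simps G.gens_subgroups G.conj_subgroup_subgroup G.conj_mono subgroup.subset
  show "subgroup H G \<Longrightarrow> gr H H = gt H H" by (rule cl_eq[symmetric], rule mackey_rel.idem_r)
  show "subgroup H G \<Longrightarrow> h \<in> H \<Longrightarrow> gc h H = gt H H" by (rule cl_eq[symmetric], rule mackey_rel.idem_c)
  show "gt L K \<cdot> gt K H = gt L H" if "subgroup H G" "subgroup K G" "subgroup L G" "H \<subseteq> K" "K \<subseteq> L"
    using cl_eq[OF mackey_rel.tt[OF that]] that by (simp add: cl_pair s)
  show "gr K H \<cdot> gr L K = gr L H" if "subgroup H G" "subgroup K G" "subgroup L G" "H \<subseteq> K" "K \<subseteq> L"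
    using cl_eq[OF mackey_rel.rr[OF that]] that by (simp add: cl_pair s)
  show "gc g' (conj_subgroup G g H) \<cdot> gc g H = gc (g' \<otimes>\<^bsub>G\<^esub> g) H"
    if "subgroup H G" "g \<in> carrier G" "g' \<in> carrier G"
    using cl_eq[OF mackey_rel.cc[OF that]] that by (simp add: cl_pair s)
  show "gt (conj_subgroup G g K) (conj_subgroup G g H) \<cdot> gc g H = gc g K \<cdot> gt K H"
    if "subgroup H G" "subgroup K G" "H \<subseteq> K" "g \<in> carrier G"
    using cl_eq[OF mackey_rel.tc[OF that]] that by (simp add: cl_pair s)
  show "gr (conj_subgroup G g K) (conj_subgroup G g H) \<cdot> gc g K = gc g H \<cdot> gr K H"
    if "subgroup H G" "subgroup K G" "H \<subseteq> K" "g \<in> carrier G"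
    using cl_eq[OF mackey_rel.rc[OF that]] that by (simp add: cl_pair s)
qed

lemma gen_zero:
  assumes "x \<in> mackey_gens G" "y \<in> mackey_gens G" "gen_source x \<noteq> gen_target G y"
  shows "cl [x] \<cdot> cl [y] = \<zero>\<^bsub>MA'\<^esub>"
proof -
  have "cl [x, y] = MI +>\<^bsub>FA\<^esub> \<zero>\<^bsub>FA\<^esub>" unfolding cl_def by (rule relation_class[OF mackey_rel.zero[OF assms]])
  also have "\<dots> = \<zero>\<^bsub>MA'\<^esub>" by (rule linear_on_zero[OF F.module_axioms Q.module_axioms quotient_map_linear])
  finally show ?thesis using cl_Cons[of x "[y]"] assms by simp
qed

lemma mel_alt:
  assumes "(H, K, g, B) \<in> mindex G"
  shows "mel (H, K, g, B) = gt H (conj_subgroup G g B) \<cdot> (gc g B \<cdot> gr K B)"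
  unfolding mel_def using G.mindexD[OF assms]
  by (simp add: cl_pair words_simps G.gens_subgroups)

lemma mword_Wd: "j \<in> mindex G \<Longrightarrow> mword G j \<in> Wd"
  unfolding lists_eq_set using G.mword_gens by blast

lemma mel_closed: "j \<in> mindex G \<Longrightarrow> mel j \<in> carrier MA'"
  unfolding mel_def by (rule cl_closed[OF mword_Wd])

lemma mel_image: "mel ` mindex G \<subseteq> carrier MA'" using mel_closed by blast

lemma mel_span_base: "j \<in> mindex G \<Longrightarrow> mel j \<in> rspan R MA' (mel ` mindex G)"
  by (rule rspan_base[OF Q.module_axioms mel_image imageI])

lemma mindexI: "subgroup H G \<Longrightarrow> subgroup K G \<Longrightarrow> g \<in> carrier G \<Longrightarrow> subgroup B G \<Longrightarrow> B \<subseteq> K \<Longrightarrow>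
   conj_subgroup G g B \<subseteq> H \<Longrightarrow> (H, K, g, B) \<in> mindex G"
  by (simp add: mindex_def)

lemma gt_mel:
  assumes j: "(H, K, g, B) \<in> mindex G" and M: "subgroup M G" "H \<subseteq> M"
  shows "gt M H \<cdot> mel (H, K, g, B) = mel (M, K, g, B)" and "(M, K, g, B) \<in> mindex G"
proof -
  note D = G.mindexD[OF j]
  show j': "(M, K, g, B) \<in> mindex G" by (rule mindexI) (use D M in auto)
  show "gt M H \<cdot> mel (H, K, g, B) = mel (M, K, g, B)"
    unfolding mel_alt[OF j] mel_alt[OF j']
    using gen_relations(3)[OF D(7) D(1) M(1) D(6) M(2)] D M
      Q.m_assoc[of "gt M H" "gt H (conj_subgroup G g B)" "gc g B \<cdot> gr K B"]
    by (simp add: gens_closed)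
qed

lemma gc_mel:
  assumes j: "(H, K, g, B) \<in> mindex G" and d: "d \<in> carrier G"
  shows "gc d H \<cdot> mel (H, K, g, B) = mel (conj_subgroup G d H, K, d \<otimes>\<^bsub>G\<^esub> g, B)"
    and "(conj_subgroup G d H, K, d \<otimes>\<^bsub>G\<^esub> g, B) \<in> mindex G"
proof -
  note D = G.mindexD[OF j]
  let ?dH = "conj_subgroup G d H" and ?dB = "conj_subgroup G d (conj_subgroup G g B)"
  have dg: "conj_subgroup G (d \<otimes>\<^bsub>G\<^esub> g) B = ?dB" using G.conj_comp[OF d D(3) subgroup.subset[OF D(4)]] by simp
  have dH: "subgroup ?dH G" and dB: "subgroup ?dB G" using G.conj_subgroup_subgroup D d by auto
  have le: "?dB \<subseteq> ?dH" by (rule G.conj_mono[OF d D(6) subgroup.subset[OF D(1)]])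
  show j': "(?dH, K, d \<otimes>\<^bsub>G\<^esub> g, B) \<in> mindex G" by (rule mindexI) (use D d dH le dg in auto)
  have "gc d H \<cdot> mel (H, K, g, B) = (gc d H \<cdot> gt H (conj_subgroup G g B)) \<cdot> (gc g B \<cdot> gr K B)"
    unfolding mel_alt[OF j] using D d by (simp add: gens_closed Q.m_assoc)
  also have "gc d H \<cdot> gt H (conj_subgroup G g B) = gt ?dH ?dB \<cdot> gc d (conj_subgroup G g B)"
    using gen_relations(6)[OF D(7,1,6) d] by simp
  also have "\<dots> \<cdot> (gc g B \<cdot> gr K B) = gt ?dH ?dB \<cdot> ((gc d (conj_subgroup G g B) \<cdot> gc g B) \<cdot> gr K B)"
    using D d dH dB le by (simp add: gens_closed Q.m_assoc)
  also have "\<dots> = mel (?dH, K, d \<otimes>\<^bsub>G\<^esub> g, B)"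
    unfolding mel_alt[OF j'] dg using gen_relations(5)[OF D(4,3) d] by simp
  finally show "gc d H \<cdot> mel (H, K, g, B) = mel (?dH, K, d \<otimes>\<^bsub>G\<^esub> g, B)" .
qed

text \<open>The Mackey relation moves the restriction past the leftmost t. In each summand the
  restriction is then moved past c_{g,B} to the right, the two c and the two r merge, and a standard
  word remains.\<close>

lemma gr_mel:
  assumes j: "(H, K, g, B) \<in> mindex G" and M: "subgroup M G" "M \<subseteq> H"
  shows "gr H M \<cdot> mel (H, K, g, B) \<in> rspan R MA' (mel ` mindex G)"
proof -
  note D = G.mindexD[OF j]
  let ?gB = "conj_subgroup G g B"
  obtain T where T: "double_coset_reps G M H ?gB T"
    using G.double_coset_reps_exist[OF M(1) D(7) D(1) M(2) D(6)] by blast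
  have TH: "T \<subseteq> H" using T unfolding double_coset_reps_def by blast
  have Tc: "d \<in> carrier G" if "d \<in> T" for d using that TH subgroup.mem_carrier[OF D(1)] by auto
  define N where "N d = conj_subgroup G (inv\<^bsub>G\<^esub> d) M \<inter> ?gB" for d
  \<comment> \<open>The conjugate of \<open>N d\<close> back into B, so that r from the conjugate of
    B to \<open>N d\<close>, followed on the right by c_{g,B}, becomes c_{g,N0} times r from B to
    \<open>N0 d\<close>.\<close>
  define N0 where "N0 d = conj_subgroup G (inv\<^bsub>G\<^esub> g) (N d)" for d
  let ?w = "\<lambda>d. [Tr M (M \<inter> conj_subgroup G d ?gB), Cj d (N d), Rs ?gB (N d)]"
  have w: "?w d \<in> Wd" if "d \<in> T" for d
    using mackey_words[OF D(1) M(1) D(7) M(2) D(6)] TH that unfolding N_def by auto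
  note e = relation_class[OF mackey_rel.mackey[OF D(1) M(1) D(7) M(2) D(6) T], folded N_def]
  have "gr H M \<cdot> gt H ?gB = cl [Rs H M, Tr H ?gB]"
    using cl_Cons[of "Rs H M" "[Tr H ?gB]"] D M by (simp add: words_simps G.gens_subgroups)
  also have "\<dots> = (\<Oplus>\<^bsub>MA'\<^esub>d\<in>T. cl (?w d))"
    unfolding cl_def[of "[_, _]"] e by (rule class_sum[OF w])
  finally have 1: "gr H M \<cdot> gt H ?gB = (\<Oplus>\<^bsub>MA'\<^esub>d\<in>T. cl (?w d))" .
  let ?x = "gc g B \<cdot> gr K B"
  have xc: "?x \<in> carrier MA'" using D by (simp add: gens_closed)
  have "gr H M \<cdot> mel (H, K, g, B) = (gr H M \<cdot> gt H ?gB) \<cdot> ?x"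
    unfolding mel_alt[OF j] using D M by (simp add: gens_closed Q.m_assoc)
  also have "\<dots> = (\<Oplus>\<^bsub>MA'\<^esub>d\<in>T. cl (?w d)) \<cdot> ?x" unfolding 1 ..
  also have "\<dots> = (\<Oplus>\<^bsub>MA'\<^esub>d\<in>T. cl (?w d) \<cdot> ?x)"
    by (rule Q.finsum_ldistr)
       (use xc w cl_closed finite_subset[OF TH] finite_subset[OF subgroup.subset[OF D(1)] G.finite_carrier] in auto)
  also have "\<dots> \<in> rspan R MA' (mel ` mindex G)"
  proof (rule rspan_finsum[OF Q.module_axioms])
    show "mel ` mindex G \<subseteq> carrier MA'" by (rule mel_image)
    fix d assume d: "d \<in> T"
    note dc = Tc[OF d]
    note s = subgroup.subset[OF D(4)] subgroup.subset[OF M(1)] subgroup.subset[OF D(7)]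
    have ig: "inv\<^bsub>G\<^esub> g \<in> carrier G" using D by simp
    have Nd: "subgroup (N d) G" "N d \<subseteq> ?gB" unfolding N_def
      using G.subgroup_Int[OF G.conj_subgroup_subgroup[OF M(1)] D(7)] dc by auto
    have N0: "subgroup (N0 d) G" unfolding N0_def by (rule G.conj_subgroup_subgroup[OF Nd(1) ig])
    have gN0: "conj_subgroup G g (N0 d) = N d"
      unfolding N0_def using D(3) subgroup.subset[OF Nd(1)] by (simp add: G.conj_comp G.conj_one)
    have "N0 d \<subseteq> conj_subgroup G (inv\<^bsub>G\<^esub> g) ?gB" unfolding N0_def by (rule G.conj_mono[OF ig Nd(2) s(3)])
    then have N0B: "N0 d \<subseteq> B" using D(3) s by (simp add: G.conj_comp G.conj_one)
    then have N0K: "N0 d \<subseteq> K" using D(5) by auto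
    have dN: "conj_subgroup G d (N d) = M \<inter> conj_subgroup G d ?gB"
      unfolding N_def using dc s by (simp add: G.conj_Int G.conj_closed G.conj_comp G.conj_one)
    have dN0: "conj_subgroup G (d \<otimes>\<^bsub>G\<^esub> g) (N0 d) = M \<inter> conj_subgroup G d ?gB"
      using G.conj_comp[OF dc D(3) subgroup.subset[OF N0]] gN0 dN by simp
    have j': "(M, K, d \<otimes>\<^bsub>G\<^esub> g, N0 d) \<in> mindex G"
      by (rule mindexI) (use M D dc N0 N0K dN0 in auto)
    let ?t = "gt M (M \<inter> conj_subgroup G d ?gB)"
    have tc: "?t \<in> carrier MA'"
      using dN G.conj_subgroup_subgroup[OF Nd(1) dc] M by (intro gens_closed) auto
    have wd: "cl (?w d) = ?t \<cdot> (gc d (N d) \<cdot> gr ?gB (N d))"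
      using w[OF d] by (simp add: cl_pair words_simps)
    have rc: "gr ?gB (N d) \<cdot> gc g B = gc g (N0 d) \<cdot> gr B (N0 d)"
      using gen_relations(7)[OF N0 D(4) N0B D(3)] gN0 by simp
    have cc: "gc d (N d) \<cdot> gc g (N0 d) = gc (d \<otimes>\<^bsub>G\<^esub> g) (N0 d)"
      using gen_relations(5)[OF N0 D(3) dc] gN0 by simp
    have rr: "gr B (N0 d) \<cdot> gr K B = gr K (N0 d)" by (rule gen_relations(4)[OF N0 D(4,2) N0B D(5)])
    note cls = gens_closed(3)[OF Nd(1) dc] gens_closed(2)[OF Nd(1) D(7) Nd(2)] gens_closed(3)[OF D(4,3)]
      gens_closed(2)[OF D(4,2,5)] gens_closed(3)[OF N0 D(3)] gens_closed(2)[OF N0 D(4) N0B] tc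
    have "cl (?w d) \<cdot> ?x = ?t \<cdot> (gc d (N d) \<cdot> ((gr ?gB (N d) \<cdot> gc g B) \<cdot> gr K B))"
      unfolding wd using cls by (simp add: Q.m_assoc)
    also have "\<dots> = ?t \<cdot> ((gc d (N d) \<cdot> gc g (N0 d)) \<cdot> (gr B (N0 d) \<cdot> gr K B))"
      unfolding rc using cls by (simp add: Q.m_assoc)
    also have "\<dots> = mel (M, K, d \<otimes>\<^bsub>G\<^esub> g, N0 d)" unfolding cc rr mel_alt[OF j'] dN0 ..
    finally have "cl (?w d) \<cdot> ?x = mel (M, K, d \<otimes>\<^bsub>G\<^esub> g, N0 d)" .
    then show "cl (?w d) \<cdot> ?x \<in> rspan R MA' (mel ` mindex G)"
      using mel_span_base[OF j'] by simp
  qed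
  finally show ?thesis .
qed

lemma gen_mel:
  assumes x: "x \<in> mackey_gens G" and j: "j \<in> mindex G"
  shows "cl [x] \<cdot> mel j \<in> rspan R MA' (mel ` mindex G)"
proof -
  obtain H K g B where j': "j = (H, K, g, B)" by (cases j)
  note J = j[unfolded j']
  note D = G.mindexD[OF J]
  show ?thesis
  proof (cases "gen_source x = H")
    case False
    have "cl [x] \<cdot> mel j = (cl [x] \<cdot> gt H (conj_subgroup G g B)) \<cdot> (gc g B \<cdot> gr K B)"
      unfolding j' mel_alt[OF J] using D x cl_closed[of "[x]"] by (simp add: gens_closed Q.m_assoc)
    also have "cl [x] \<cdot> gt H (conj_subgroup G g B) = \<zero>\<^bsub>MA'\<^esub>"
      by (rule gen_zero[OF x]) (use False D in \<open>auto simp: G.gens_subgroups\<close>)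
    finally have "cl [x] \<cdot> mel j = \<zero>\<^bsub>MA'\<^esub>" using D by (simp add: gens_closed)
    then show ?thesis by (simp add: rspan.zero)
  next
    case True
    show ?thesis
    proof (cases x)
      case (Tr M H')
      then have "H' = H" "subgroup M G" "H \<subseteq> M" using True x by (auto simp: G.gens_subgroups)
      then show ?thesis using gt_mel[OF J] Tr j' mel_span_base by simp
    next
      case (Rs H' M)
      then have "H' = H" "subgroup M G" "M \<subseteq> H" using True x by (auto simp: G.gens_subgroups)
      then show ?thesis using gr_mel[OF J] Rs j' by simp
    next
      case (Cj d H')
      then have "H' = H" "d \<in> carrier G" using True x by (auto simp: G.gens_subgroups)
      then show ?thesis using gc_mel[OF J] Cj j' mel_span_base by simp
    qed
  qed
qed

lemma word_mel:
  assumes "w \<in> Wd" "j \<in> mindex G"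
  shows "cl w \<cdot> mel j \<in> rspan R MA' (mel ` mindex G)"
  using assms(1)
proof (induction w)
  case Nil
  have "cl [] = \<one>\<^bsub>MA'\<^esub>" unfolding cl_def MA_alt quotient_algebra_simps one_bv ..
  then show ?case using mel_span_base[OF assms(2)] mel_closed[OF assms(2)] by simp
next
  case (Cons x w)
  then have x: "x \<in> mackey_gens G" and w: "w \<in> Wd" by auto
  have xc: "cl [x] \<in> carrier MA'" using x cl_closed[of "[x]"] by simp
  have lin: "linear_on R MA' MA' (\<lambda>y. cl [x] \<cdot> y)"
    by (rule linear_onI) (use xc in \<open>auto simp: Q.r_distr Q.smult_mult_r\<close>)
  have "cl (x # w) \<cdot> mel j = cl [x] \<cdot> (cl w \<cdot> mel j)"
    using cl_Cons[OF x w] xc cl_closed[OF w] mel_closed[OF assms(2)] by (simp add: Q.m_assoc)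
  moreover have "\<dots> \<in> rspan R MA' (mel ` mindex G)"
    by (rule linear_image_rspan[OF Q.module_axioms Q.module_axioms mel_image mel_image lin _ Cons.IH])
       (use gen_mel[OF x] in auto)
  ultimately show ?case by simp
qed

text \<open>With g = 1 and B = H all three letters equal t^H_H, which is idempotent.\<close>

lemma mel_unit: "subgroup H G \<Longrightarrow> mel (H, H, \<one>\<^bsub>G\<^esub>, H) = gt H H" "subgroup H G \<Longrightarrow> (H, H, \<one>\<^bsub>G\<^esub>, H) \<in> mindex G"
proof -
  assume H: "subgroup H G"
  note s = subgroup.subset[OF H]
  show j: "(H, H, \<one>\<^bsub>G\<^esub>, H) \<in> mindex G" by (rule mindexI) (use H G.conj_one[OF s] in auto)
  have t: "gt H H \<cdot> gt H H = gt H H" by (rule gen_relations(3)) (use H in auto)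
  show "mel (H, H, \<one>\<^bsub>G\<^esub>, H) = gt H H"
    unfolding mel_alt[OF j] G.conj_one[OF s] gen_relations(1)[OF H] gen_relations(2)[OF H subgroup.one_closed[OF H]] t ..
qed

text \<open>The unit is a sum of standard words t^H_H, and the span of the standard words is closed
  under left multiplication by generators; hence it contains every word w = w 1.\<close>

lemma mel_spanning:
  assumes x: "x \<in> carrier MA'"
  shows "x \<in> rspan R MA' (mel ` mindex G)"
proof -
  let ?S = "{H. subgroup H G}"
  have one: "\<one>\<^bsub>MA'\<^esub> = (\<Oplus>\<^bsub>MA'\<^esub>H\<in>?S. mel (H, H, \<one>\<^bsub>G\<^esub>, H))"
  proof -
    have "\<one>\<^bsub>MA'\<^esub> = MI +>\<^bsub>FA\<^esub> \<one>\<^bsub>FA\<^esub>" unfolding MA_alt quotient_algebra_simps ..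
    also have "\<dots> = (\<Oplus>\<^bsub>MA'\<^esub>H\<in>?S. cl [Tr H H])"
      using relation_class[OF mackey_rel.unit] class_sum[of ?S "\<lambda>H. [Tr H H]"] by (simp add: G.gens_subgroups)
    also have "\<dots> = (\<Oplus>\<^bsub>MA'\<^esub>H\<in>?S. mel (H, H, \<one>\<^bsub>G\<^esub>, H))"
      by (rule Q.finsum_cong') (auto simp: mel_unit(1) gens_closed)
    finally show ?thesis .
  qed
  have w: "cl w \<in> rspan R MA' (mel ` mindex G)" if w: "w \<in> Wd" for w
  proof -
    have "cl w = cl w \<cdot> (\<Oplus>\<^bsub>MA'\<^esub>H\<in>?S. mel (H, H, \<one>\<^bsub>G\<^esub>, H))"
      unfolding one[symmetric] using cl_closed[OF w] by simp
    also have "\<dots> = (\<Oplus>\<^bsub>MA'\<^esub>H\<in>?S. cl w \<cdot> mel (H, H, \<one>\<^bsub>G\<^esub>, H))"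
      by (rule Q.finsum_rdistr) (auto simp: cl_closed[OF w] G.finite_subgroups intro!: mel_closed mel_unit(2))
    also have "\<dots> \<in> rspan R MA' (mel ` mindex G)"
      by (rule rspan_finsum[OF Q.module_axioms mel_image]) (auto intro!: word_mel[OF w] mel_unit(2))
    finally show ?thesis .
  qed
  obtain f where f: "f \<in> carrier FA" "x = MI +>\<^bsub>FA\<^esub> f" using x unfolding MA_alt F.quotient_carrier by auto
  have f': "f \<in> carrier (free_module R Wd)" using f(1) unfolding free_algebra_def monoid_algebra_simps by simp
  have "f \<in> rspan R FA (bv ` Wd)"
    using cring_R f'
  proof (induction rule: free_module_induct)
    case zero
    have "(\<lambda>i. \<zero>\<^bsub>R\<^esub>) = \<zero>\<^bsub>FA\<^esub>" by (simp add: free_algebra_def monoid_algebra_simps free_module_simps)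
    then show ?case using rspan.zero by metis
  next
    case (add f g)
    have "f \<oplus>\<^bsub>free_module R Wd\<^esub> g = f \<oplus>\<^bsub>FA\<^esub> g" by (simp add: free_algebra_def monoid_algebra_simps)
    then show ?case using rspan.add[OF add(3,4)] by simp
  next
    case (smult a i)
    have "a \<odot>\<^bsub>free_module R Wd\<^esub> bv i = a \<odot>\<^bsub>FA\<^esub> bv i" by (simp add: free_algebra_def monoid_algebra_simps)
    then show ?case using rspan.smult[OF smult(1) imageI[OF smult(2)], of FA bv] by simp
  qed
  then show ?thesis unfolding f(2)
    by (rule linear_image_rspan[OF F.module_axioms Q.module_axioms _ mel_image quotient_map_linear, rotated 2])
       (use bv_closed w in \<open>auto simp: cl_def\<close>)
qed

section \<open>Coinciding standard words and the basis\<close>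

text \<open>For k in K the letter c_{k,K} is r^K_K. Inserting it and moving r past it shows that
  restriction to the conjugate of B by k is c_{k,B} r^K_B, and the two c letters merge to
  c_{g,B}.\<close>

lemma mel_shift_right:
  assumes j: "(H, K, g, B) \<in> mindex G" and k: "k \<in> K"
  shows "mel (H, K, g \<otimes>\<^bsub>G\<^esub> inv\<^bsub>G\<^esub> k, conj_subgroup G k B) = mel (H, K, g, B)"
proof -
  note D = G.mindexD[OF j]
  have kc: "k \<in> carrier G" using subgroup.mem_carrier[OF D(2) k] .
  let ?kB = "conj_subgroup G k B" and ?gk = "g \<otimes>\<^bsub>G\<^esub> inv\<^bsub>G\<^esub> k"
  have gk: "?gk \<in> carrier G" using D kc by simp
  have kB: "subgroup ?kB G" by (rule G.conj_subgroup_subgroup[OF D(4) kc])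
  have kK: "conj_subgroup G k K = K" by (rule G.conj_self[OF D(2) k])
  have kBK: "?kB \<subseteq> K" using G.conj_mono[OF kc D(5) subgroup.subset[OF D(2)]] kK by simp
  have e: "conj_subgroup G ?gk ?kB = conj_subgroup G g B"
    using G.conj_comp[OF gk kc subgroup.subset[OF D(4)]] D(3) kc by (simp add: G.m_assoc)
  have j': "(H, K, ?gk, ?kB) \<in> mindex G" by (rule mindexI) (use D gk kB kBK e in auto)
  have "gr K ?kB = gr K ?kB \<cdot> gr K K" using gen_relations(4)[OF kB D(2,2) kBK] by simp
  also have "\<dots> = gr K ?kB \<cdot> gc k K" using gen_relations(1)[OF D(2)] gen_relations(2)[OF D(2) k] by simp
  also have "\<dots> = gc k B \<cdot> gr K B" using gen_relations(7)[OF D(4,2,5) kc] kK by simp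
  finally have r: "gr K ?kB = gc k B \<cdot> gr K B" .
  have "gc ?gk ?kB \<cdot> gr K ?kB = (gc ?gk ?kB \<cdot> gc k B) \<cdot> gr K B"
    unfolding r using gens_closed(3)[OF kB gk] gens_closed(3)[OF D(4) kc] gens_closed(2)[OF D(4,2,5)] by (simp add: Q.m_assoc)
  also have "gc ?gk ?kB \<cdot> gc k B = gc g B" using gen_relations(5)[OF D(4) kc gk] D(3) kc by (simp add: G.m_assoc)
  finally show ?thesis unfolding mel_alt[OF j] mel_alt[OF j'] e by simp
qed

lemma mel_shift_left:
  assumes j: "(H, K, g, B) \<in> mindex G" and h: "h \<in> H"
  shows "mel (H, K, h \<otimes>\<^bsub>G\<^esub> g, B) = mel (H, K, g, B)"
proof -
  note D = G.mindexD[OF j]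
  have hc: "h \<in> carrier G" using subgroup.mem_carrier[OF D(1) h] .
  have "mel (H, K, h \<otimes>\<^bsub>G\<^esub> g, B) = gc h H \<cdot> mel (H, K, g, B)" using gc_mel[OF j hc] G.conj_self[OF D(1) h] by simp
  also have "\<dots> = gt H H \<cdot> mel (H, K, g, B)" using gen_relations(2)[OF D(1) h] by simp
  also have "\<dots> = mel (H, K, g, B)" by (rule gt_mel(1)[OF j D(1)]) simp
  finally show ?thesis .
qed

lemma mcls_eq_iff:
  assumes j: "(H, K, g, B) \<in> mindex G" and k: "(H', K', g', B') \<in> mindex G"
  shows "mcls G (H, K, g, B) = mcls G (H', K', g', B') \<longleftrightarrow>
    K = K' \<and> (\<exists>k\<in>K. B' = conj_subgroup G k B \<and> inv\<^bsub>G\<^esub> g' <#\<^bsub>G\<^esub> H' = k <#\<^bsub>G\<^esub> (inv\<^bsub>G\<^esub> g <#\<^bsub>G\<^esub> H))"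
proof -
  note D = G.mindexD[OF j] and D' = G.mindexD[OF k]
  have "inv\<^bsub>G\<^esub> g \<in> carrier G" "inv\<^bsub>G\<^esub> g' \<in> carrier G" using D D' by auto
  then show ?thesis
    unfolding mcls.simps
    by (intro G.state_class_eq_iff[OF D(2) subgroup.subset[OF D(4)] subgroup.subset[OF D'(4)]]
        G.lcos_closed subgroup.subset[OF D(1)] subgroup.subset[OF D'(1)])
qed

text \<open>Equal classes mean that B' is the conjugate of B by some u in K and g'^{-1} H' = u
  g^{-1} H. Then H' = H, and g' differs from g u^{-1} by a left factor from H; a shift on the right
  and one on the left undo this.\<close>

lemma mel_cong:
  assumes j: "j \<in> mindex G" and k: "k \<in> mindex G" and eq: "mcls G j = mcls G k"
  shows "mel j = mel k"
proof -
  obtain H K g B where j': "j = (H, K, g, B)" by (cases j)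
  obtain H' K' g' B' where k': "k = (H', K', g', B')" by (cases k)
  note J = j[unfolded j'] and L = k[unfolded k']
  note D = G.mindexD[OF J] and D' = G.mindexD[OF L]
  obtain u where u: "K = K'" "u \<in> K" "B' = conj_subgroup G u B"
    "inv\<^bsub>G\<^esub> g' <#\<^bsub>G\<^esub> H' = u <#\<^bsub>G\<^esub> (inv\<^bsub>G\<^esub> g <#\<^bsub>G\<^esub> H)"
    using eq mcls_eq_iff[OF J L] j' k' by auto
  have uc: "u \<in> carrier G" using subgroup.mem_carrier[OF D(2) u(2)] .
  have ig: "inv\<^bsub>G\<^esub> g \<in> carrier G" "inv\<^bsub>G\<^esub> g' \<in> carrier G" and ug: "u \<otimes>\<^bsub>G\<^esub> inv\<^bsub>G\<^esub> g \<in> carrier G" using D D' uc by auto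
  have e: "inv\<^bsub>G\<^esub> g' <#\<^bsub>G\<^esub> H' = (u \<otimes>\<^bsub>G\<^esub> inv\<^bsub>G\<^esub> g) <#\<^bsub>G\<^esub> H"
    using u(4) G.lcos_comp[OF uc ig(1) subgroup.subset[OF D(1)]] by simp
  have HH: "H' = H"
    by (rule G.coset_type_unique[OF D'(1) D(1) G.cosetsI[OF ig(2)]]) (use e G.cosetsI[OF ug] in simp)
  \<comment> \<open>The element by which the two representatives of the coset u g^{-1} H = g'^{-1} H
    differ; its inverse is the left factor from H.\<close>
  define h where "h = inv\<^bsub>G\<^esub> (u \<otimes>\<^bsub>G\<^esub> inv\<^bsub>G\<^esub> g) \<otimes>\<^bsub>G\<^esub> inv\<^bsub>G\<^esub> g'"
  have h: "h \<in> H" using G.lcos_eq_iff[OF D(1) ug ig(2)] e HH by (simp add: h_def)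
  have ih: "inv\<^bsub>G\<^esub> h \<in> H" by (rule subgroup.m_inv_closed[OF D(1) h])
  have g': "g' = inv\<^bsub>G\<^esub> h \<otimes>\<^bsub>G\<^esub> (g \<otimes>\<^bsub>G\<^esub> inv\<^bsub>G\<^esub> u)"
    using D(3) D'(3) uc by (simp add: h_def G.group_norm)
  let ?j = "(H, K, g \<otimes>\<^bsub>G\<^esub> inv\<^bsub>G\<^esub> u, conj_subgroup G u B)"
  have j2: "?j \<in> mindex G"
  proof (rule mindexI)
    have "conj_subgroup G (g \<otimes>\<^bsub>G\<^esub> inv\<^bsub>G\<^esub> u) (conj_subgroup G u B) = conj_subgroup G g B"
      using G.conj_comp[OF _ uc subgroup.subset[OF D(4)], of "g \<otimes>\<^bsub>G\<^esub> inv\<^bsub>G\<^esub> u"] D(3) uc by (simp add: G.m_assoc)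
    then show "conj_subgroup G (g \<otimes>\<^bsub>G\<^esub> inv\<^bsub>G\<^esub> u) (conj_subgroup G u B) \<subseteq> H" using D(6) by simp
  qed (use D D' u uc in auto)
  have "mel k = mel ?j" unfolding k' HH g' u(3) u(1)[symmetric] by (rule mel_shift_left[OF j2 ih])
  then show ?thesis using mel_shift_right[OF J u(2)] j' by simp
qed

sublocale MB: class_basis R MA' "mindex G" mel "mcls G"
proof
  show "finite (mindex G)" by (rule G.finite_mindex)
  show "mel j \<in> carrier MA'" if "j \<in> mindex G" for j by (rule mel_closed[OF that])
  show "mel i = mel j" if "i \<in> mindex G" "j \<in> mindex G" "mcls G i = mcls G j" for i j
    by (rule mel_cong[OF that])
  show "x \<in> rspan R MA' (mel ` mindex G)" if "x \<in> carrier MA'" for x by (rule mel_spanning[OF that])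
  show "\<exists>\<phi>. linear_on R MA' (regular_module R) \<phi> \<and>
      (\<forall>j\<in>mindex G. \<phi> (mel j) = (if mcls G i = mcls G j then \<one>\<^bsub>R\<^esub> else \<zero>\<^bsub>R\<^esub>))" if i: "i \<in> mindex G" for i
  proof -
    \<comment> \<open>The functional that reads off the multiplicity of the class of i; by
      \<open>coef_mword\<close> it is a coordinate functional.\<close>
    let ?f = "\<lambda>c. if mcls G i = c then \<one>\<^bsub>R\<^esub> else \<zero>\<^bsub>R\<^esub>"
    have f: "?f c \<in> carrier R" for c by simp
    obtain \<psi> where \<psi>: "linear_on R MA' (regular_module R) \<psi>" "\<And>w. w \<in> Wd \<Longrightarrow> \<psi> (cl w) = msum R ?f (coef G w)"
      using class_functional[of ?f, OF f] by blast
    have "\<psi> (mel j) = (if mcls G i = mcls G j then \<one>\<^bsub>R\<^esub> else \<zero>\<^bsub>R\<^esub>)" if j: "j \<in> mindex G" for j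
    proof -
      have "\<psi> (mel j) = msum R ?f (coef G (mword G j))" unfolding mel_def by (rule \<psi>(2)[OF mword_Wd[OF j]])
      also have "\<dots> = ?f (mcls G j)" unfolding G.coef_mword[OF j] by (rule R.msum_single[of ?f]) simp
      finally show ?thesis .
    qed
    then show ?thesis using \<psi>(1) by blast
  qed
qed

end

subsection \<open>Symmetry in terms of the tables of double cosets\<close>

definition subs :: "('g, 'l) monoid_scheme \<Rightarrow> 'g set \<Rightarrow> 'g set set"
  where "subs G P = {B. subgroup B G \<and> B \<subseteq> P}"

text \<open>Invertibility as matrices indexed by \<open>P\<close>-classes of subgroups; a class may contribute several
  coefficients \<open>n B\<close>, since \<open>B\<close> runs over the subgroups themselves.\<close>

definition invertible_tables :: "('r, 'k) ring_scheme \<Rightarrow> ('g, 'l) monoid_scheme \<Rightarrow> ('g set set \<Rightarrow> 'r) \<Rightarrow> bool"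
  where "invertible_tables R G f \<longleftrightarrow> (\<forall>P. subgroup P G \<longrightarrow> (\<forall>A\<in>subs G P.
    \<exists>n\<in>subs G P \<rightarrow> carrier R. \<forall>C\<in>subs G P.
      (\<Oplus>\<^bsub>R\<^esub>B\<in>subs G P. n B \<otimes>\<^bsub>R\<^esub> msum R f (dtable G P C B)) =
      (if \<exists>p\<in>P. C = conj_subgroup G p A then \<one>\<^bsub>R\<^esub> else \<zero>\<^bsub>R\<^esub>)))"

lemma invertible_tablesE:
  assumes "invertible_tables R G f" "subgroup P G" "A \<in> subs G P"
  obtains n where "n \<in> subs G P \<rightarrow> carrier R" "\<And>C. C \<in> subs G P \<Longrightarrow>
      (\<Oplus>\<^bsub>R\<^esub>B\<in>subs G P. n B \<otimes>\<^bsub>R\<^esub> msum R f (dtable G P C B)) =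
      (if \<exists>p\<in>P. C = conj_subgroup G p A then \<one>\<^bsub>R\<^esub> else \<zero>\<^bsub>R\<^esub>)"
proof -
  have "\<exists>n\<in>subs G P \<rightarrow> carrier R. \<forall>C\<in>subs G P.
      (\<Oplus>\<^bsub>R\<^esub>B\<in>subs G P. n B \<otimes>\<^bsub>R\<^esub> msum R f (dtable G P C B)) =
      (if \<exists>p\<in>P. C = conj_subgroup G p A then \<one>\<^bsub>R\<^esub> else \<zero>\<^bsub>R\<^esub>)"
    by (rule bspec[OF mp[OF spec[OF assms(1)[unfolded invertible_tables_def], of P] assms(2)] assms(3)])
  then show thesis by (elim bexE) (use that in simp)
qed

context mackey_setup
begin

lemma finite_subs: "finite (subs G P)"
  unfolding subs_def by (rule finite_subset[OF _ G.finite_subgroups]) auto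

text \<open>The first component of a class is L and the second an L-orbit of pairs. It contains a
  pair (A, L) exactly if the coset is L itself, that is, for the words that equal some t^L_A r^L_A;
  these get the value f(A), all others zero. The chosen A is determined up to conjugation in
  L.\<close>

definition trace_weight :: "('g set set \<Rightarrow> 'r) \<Rightarrow> 'g mclass \<Rightarrow> 'r" where
  "trace_weight f c = (if \<exists>A. (A, fst c) \<in> snd c
     then f (subconj G (carrier G) (SOME A. (A, fst c) \<in> snd c)) else \<zero>\<^bsub>R\<^esub>)"

lemma trace_weight:
  assumes L: "subgroup L G" and A: "A \<subseteq> carrier G" and x: "x \<subseteq> carrier G"
  shows "trace_weight f (state_class G L A x) = (if x = L then f (subconj G (carrier G) A) else \<zero>\<^bsub>R\<^esub>)"
proof -
  let ?c = "state_class G L A x"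
  have mem: "(A', fst ?c) \<in> snd ?c \<longleftrightarrow> x = L \<and> (\<exists>k\<in>L. A' = conj_subgroup G k A)" for A'
  proof
    assume "(A', fst ?c) \<in> snd ?c"
    then obtain k where k: "k \<in> L" "A' = conj_subgroup G k A" "L = k <#\<^bsub>G\<^esub> x" by (auto simp: state_class_def)
    have kc: "k \<in> carrier G" and ik: "inv\<^bsub>G\<^esub> k \<in> L"
      using subgroup.mem_carrier[OF L k(1)] subgroup.m_inv_closed[OF L k(1)] by auto
    have "x = inv\<^bsub>G\<^esub> k <#\<^bsub>G\<^esub> L" using k(3) G.lcos_inv_cancel[OF kc x] by simp
    also have "\<dots> = L" using ik G.cstab_self[OF L] by (auto simp: cstab_def)
    finally show "x = L \<and> (\<exists>k\<in>L. A' = conj_subgroup G k A)" using k by blast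
  next
    assume a: "x = L \<and> (\<exists>k\<in>L. A' = conj_subgroup G k A)"
    then obtain k where k: "k \<in> L" "A' = conj_subgroup G k A" by auto
    have "k <#\<^bsub>G\<^esub> x = L" using a k G.cstab_self[OF L] by (auto simp: cstab_def)
    then show "(A', fst ?c) \<in> snd ?c" using k unfolding state_class_def by (auto intro!: image_eqI[of _ _ k])
  qed
  show ?thesis
  proof (cases "x = L")
    case True
    have "\<exists>A. (A, fst ?c) \<in> snd ?c" using mem True subgroup.one_closed[OF L] by blast
    then have e: "(SOME A. (A, fst ?c) \<in> snd ?c, fst ?c) \<in> snd ?c" by (rule someI_ex)
    then obtain k where k: "k \<in> L" "(SOME A. (A, fst ?c) \<in> snd ?c) = conj_subgroup G k A" using mem by blast
    have "subconj G (carrier G) (SOME A. (A, fst ?c) \<in> snd ?c) = subconj G (carrier G) A"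
      unfolding k(2) by (rule G.subconj_carrier_conj[OF A subgroup.mem_carrier[OF L k(1)]])
    then show ?thesis unfolding trace_weight_def using e True by auto
  next
    case False
    then show ?thesis unfolding trace_weight_def using mem by simp
  qed
qed

lemma msum_coef_pair:
  assumes f: "\<And>c. f c \<in> carrier R" and j: "j \<in> mindex G" and k: "k \<in> mindex G"
  shows "msum R (trace_weight f) (coef G (mword G j @ mword G k)) = msum R f (tvalue G j k)"
proof -
  obtain H K g B where j': "j = (H, K, g, B)" by (cases j)
  obtain H' K' g' C where k': "k = (H', K', g', C)" by (cases k)
  note J = j[unfolded j'] and L = k[unfolded k']
  note D = G.mindexD[OF J] and D' = G.mindexD[OF L] and v = G.mstate_valid[OF L]
  let ?y = "inv\<^bsub>G\<^esub> g' <#\<^bsub>G\<^esub> H'"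
  have tw: "trace_weight f c \<in> carrier R" for c unfolding trace_weight_def using f by simp
  have "msum R (trace_weight f) (osum C (lmult G) (kids G B ?y) (\<lambda>z. {#state_class G K' (C \<inter> cstab G z) ((z #>\<^bsub>G\<^esub> inv\<^bsub>G\<^esub> g) <#>\<^bsub>G\<^esub> H)#})) =
    msum R f (osum C (lmult G) (kids G B ?y) (\<lambda>z. if (z #>\<^bsub>G\<^esub> inv\<^bsub>G\<^esub> g) <#>\<^bsub>G\<^esub> H = K' then {#subconj G (carrier G) (C \<inter> cstab G z)#} else {#}))"
  proof (rule G.msum_osum_cong[OF cring_R tw f G.acts_kids[OF D'(4) D(4) G.valid_stateD(3)[OF v]]])
    fix z assume z: "z \<in> kids G B ?y"
    have "(z #>\<^bsub>G\<^esub> inv\<^bsub>G\<^esub> g) <#>\<^bsub>G\<^esub> H \<subseteq> carrier G"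
      using G.cosets_subset[OF D(1) G.up_in_cosets[OF D(7,1,6) G.rcos_in_cosets[OF D(3,4) G.kids_cosets[OF z]]]] .
    moreover have "C \<inter> cstab G z \<subseteq> carrier G" using subgroup.subset[OF D'(4)] by auto
    ultimately show "msum R (trace_weight f) {#state_class G K' (C \<inter> cstab G z) ((z #>\<^bsub>G\<^esub> inv\<^bsub>G\<^esub> g) <#>\<^bsub>G\<^esub> H)#} =
      msum R f (if (z #>\<^bsub>G\<^esub> inv\<^bsub>G\<^esub> g) <#>\<^bsub>G\<^esub> H = K' then {#subconj G (carrier G) (C \<inter> cstab G z)#} else {#})"
      using trace_weight[OF D'(2)] tw f by (simp add: R.msum_single)
  qed
  then show ?thesis unfolding j' k' G.coef_pair[OF J L] by simp
qed

text \<open>The coordinate functional of i = (H, K, g, A) is sought within the block of words linked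
  to i. That block of the Gram matrix is a table over P, so coefficients for the table, extended by
  zero, represent the functional. Symmetry comes from \<open>tvalue_sym\<close>, associativity from
  that of the algebra.\<close>

lemma symmetric_if_invertible:
  assumes f: "\<And>c. f c \<in> carrier R" and inv: "invertible_tables R G f"
  shows "symmetric_algebra R MA'"
proof -
  have tw: "trace_weight f c \<in> carrier R" for c unfolding trace_weight_def using f by simp
  obtain \<tau> where \<tau>: "linear_on R MA' (regular_module R) \<tau>"
    "\<And>w. w \<in> Wd \<Longrightarrow> \<tau> (cl w) = msum R (trace_weight f) (coef G w)"
    using class_functional[of "trace_weight f", OF tw] by blast
  define b where "b x y = \<tau> (x \<cdot> y)" for x y
  have b1: "linear_on R MA' (regular_module R) (b x)" if "x \<in> carrier MA'" for x
    unfolding b_def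
    by (rule linear_on_comp[OF _ \<tau>(1), of _ "\<lambda>y. x \<cdot> y"], rule linear_onI)
       (use that in \<open>auto simp: Q.r_distr Q.smult_mult_r\<close>)
  have b2: "linear_on R MA' (regular_module R) (\<lambda>x. b x y)" if "y \<in> carrier MA'" for y
    unfolding b_def
    by (rule linear_on_comp[OF _ \<tau>(1), of _ "\<lambda>x. x \<cdot> y"], rule linear_onI)
       (use that in \<open>auto simp: Q.l_distr Q.smult_mult_l\<close>)
  have val: "b (mel j) (mel k) = msum R f (tvalue G j k)" if j: "j \<in> mindex G" and k: "k \<in> mindex G" for j k
  proof -
    have "mel j \<cdot> mel k = cl (mword G j @ mword G k)"
      unfolding mel_def by (rule cl_mult[OF mword_Wd[OF j] mword_Wd[OF k]])
    moreover have "mword G j @ mword G k \<in> Wd" using mword_Wd[OF j] mword_Wd[OF k] by simp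
    ultimately show ?thesis unfolding b_def using \<tau>(2) msum_coef_pair[OF f j k] by simp
  qed
  have sym: "b (mel j) (mel k) = b (mel k) (mel j)" if "j \<in> mindex G" "k \<in> mindex G" for j k
    using val[OF that] val[OF that(2,1)] G.tvalue_sym[OF that] by simp
  have "nondegenerate R MA' b"
    unfolding MB.nondegenerate_iff[OF b1 b2 sym, simplified]
  proof
    fix i assume i: "i \<in> mindex G"
    obtain H K g A where i': "i = (H, K, g, A)" by (cases i)
    note I = i[unfolded i']
    note D = G.mindexD[OF I] and v = G.mstate_valid[OF I]
    let ?ig = "inv\<^bsub>G\<^esub> g"
    have ig: "?ig \<in> carrier G" using D by simp
    define P where "P = K \<inter> conj_subgroup G ?ig H"
    have P: "subgroup P G" unfolding P_def by (rule G.subgroup_Int[OF D(2) G.conj_subgroup_subgroup[OF D(1) ig]])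
    note Ps = subgroup.subset[OF P]
    have st: "cstab G (?ig <#\<^bsub>G\<^esub> H) = conj_subgroup G ?ig H" by (rule G.cstab_lcos[OF D(1) ig])
    have A: "A \<in> subs G P" unfolding subs_def P_def using D G.valid_stateD(3)[OF v] st by auto
    obtain n0 where n0: "n0 \<in> subs G P \<rightarrow> carrier R"
      "\<And>C. C \<in> subs G P \<Longrightarrow> (\<Oplus>\<^bsub>R\<^esub>B\<in>subs G P. n0 B \<otimes>\<^bsub>R\<^esub> msum R f (dtable G P C B)) =
      (if \<exists>p\<in>P. C = conj_subgroup G p A then \<one>\<^bsub>R\<^esub> else \<zero>\<^bsub>R\<^esub>)"
      by (rule invertible_tablesE[OF inv P A], rule that)
    \<comment> \<open>Words from H to K with group element g^{-1}: the ones that pair nontrivially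
      with words in the double coset of i. Conjugating B by g makes the table have B itself as its
      column.\<close>
    define q where "q B = (K, H, ?ig, conj_subgroup G g B)" for B
    have q: "q B \<in> mindex G" if B: "B \<in> subs G P" for B
    proof -
      have B': "subgroup B G" "B \<subseteq> K" "B \<subseteq> conj_subgroup G ?ig H" "B \<subseteq> carrier G"
        using B Ps by (auto simp: subs_def P_def)
      have "conj_subgroup G g B \<subseteq> conj_subgroup G g (conj_subgroup G ?ig H)"
        by (rule G.conj_mono[OF D(3) B'(3) G.conj_closed[OF ig subgroup.subset[OF D(1)]]])
      then have 1: "conj_subgroup G g B \<subseteq> H" using D(3) subgroup.subset[OF D(1)] by (simp add: G.conj_comp G.conj_one)
      have 2: "conj_subgroup G ?ig (conj_subgroup G g B) = B" using D(3) B'(4) by (simp add: G.conj_comp G.conj_one)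
      show ?thesis unfolding q_def by (rule mindexI) (use D ig B' 1 2 G.conj_subgroup_subgroup in auto)
    qed
    have qinv: "conj_subgroup G ?ig (conj_subgroup G g B) = B" if "B \<in> subs G P" for B
    proof -
      have "B \<subseteq> carrier G" using that subgroup.subset by (auto simp: subs_def)
      then show ?thesis using D(3) by (simp add: G.conj_comp G.conj_one)
    qed
    have qinj: "inj_on q (subs G P)"
      by (rule inj_onI) (use qinv in \<open>metis Pair_inject q_def\<close>)
    \<comment> \<open>Coefficients live on the words \<open>q B\<close> only; the subgroup B is
      recovered from the fourth component by conjugating back.\<close>
    define n where "n j = (if j \<in> q ` subs G P then n0 (conj_subgroup G ?ig (snd (snd (snd j)))) else \<zero>\<^bsub>R\<^esub>)" for j
    have nq: "n (q B) = n0 B" if "B \<in> subs G P" for B using that qinv unfolding n_def by (simp add: q_def)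
    have n0c: "n0 B \<in> carrier R" if "B \<in> subs G P" for B using n0(1) that by auto
    have nc: "n \<in> mindex G \<rightarrow> carrier R"
    proof (rule Pi_I)
      fix j show "n j \<in> carrier R"
      proof (cases "j \<in> q ` subs G P")
        case True
        then obtain B where "B \<in> subs G P" "j = q B" by blast
        then show ?thesis using nq n0c by simp
      qed (simp add: n_def)
    qed
    have bc: "b (mel j) (mel k) \<in> carrier R" if "j \<in> mindex G" "k \<in> mindex G" for j k
      using linear_onD(1)[OF b1[OF mel_closed[OF that(1)]] mel_closed[OF that(2)]] by simp
    have "(\<Oplus>\<^bsub>R\<^esub>j\<in>mindex G. n j \<otimes>\<^bsub>R\<^esub> b (mel j) (mel k)) = (if mcls G i = mcls G k then \<one>\<^bsub>R\<^esub> else \<zero>\<^bsub>R\<^esub>)"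
      if k: "k \<in> mindex G" for k
    proof -
      obtain H' K' g' C where k': "k = (H', K', g', C)" by (cases k)
      note L = k[unfolded k']
      note D' = G.mindexD[OF L]
      have ig': "inv\<^bsub>G\<^esub> g' \<in> carrier G" using D' by simp
      have "(\<Oplus>\<^bsub>R\<^esub>j\<in>mindex G. n j \<otimes>\<^bsub>R\<^esub> b (mel j) (mel k)) = (\<Oplus>\<^bsub>R\<^esub>j\<in>q ` subs G P. n j \<otimes>\<^bsub>R\<^esub> b (mel j) (mel k))"
      proof (rule R.add.finprod_mono_neutral_cong_right[OF G.finite_mindex])
        show "q ` subs G P \<subseteq> mindex G" using q by blast
        show "n j \<otimes>\<^bsub>R\<^esub> b (mel j) (mel k) = \<zero>\<^bsub>R\<^esub>" if "j \<in> mindex G - q ` subs G P" for j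
          using that bc[OF _ k, of j] by (simp add: n_def)
        show "(\<lambda>j. n j \<otimes>\<^bsub>R\<^esub> b (mel j) (mel k)) \<in> mindex G \<rightarrow> carrier R"
          using nc bc[OF _ k] by (simp add: Pi_iff)
      qed simp
      also have "\<dots> = (\<Oplus>\<^bsub>R\<^esub>B\<in>subs G P. n (q B) \<otimes>\<^bsub>R\<^esub> b (mel (q B)) (mel k))"
        by (rule R.add.finprod_reindex[OF _ qinj]) (use q nc bc[OF _ k] in \<open>simp add: Pi_iff\<close>)
      also have "\<dots> = (\<Oplus>\<^bsub>R\<^esub>B\<in>subs G P. n0 B \<otimes>\<^bsub>R\<^esub> msum R f (tvalue G (q B) k))"
        by (rule R.finsum_cong') (use nq val[OF q k] n0(1) R.msum_closed[of f, OF f] in \<open>auto simp: Pi_iff\<close>)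
      \<comment> \<open>Linking does not see the fourth component, so whether k is linked to
        \<open>q B\<close> is the same for all B, and A may stand in for it.\<close>
      also have "\<dots> = (if mcls G i = mcls G k then \<one>\<^bsub>R\<^esub> else \<zero>\<^bsub>R\<^esub>)"
      proof (cases "\<exists>h. G.linked (K, H, ?ig, A) (H', K', g', C) h")
        case True
        then obtain h where h: "K = K'" "H = H'" "h \<in> K" "inv\<^bsub>G\<^esub> g' <#\<^bsub>G\<^esub> H' = (h \<otimes>\<^bsub>G\<^esub> ?ig) <#\<^bsub>G\<^esub> H"
          unfolding G.linked_def by auto
        have hc: "h \<in> carrier G" using subgroup.mem_carrier[OF D(2) h(3)] .
        let ?C = "conj_subgroup G (inv\<^bsub>G\<^esub> h) C"
        have lk: "G.linked (K, H, ?ig, conj_subgroup G g B) (H', K', g', C) h" for B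
          unfolding G.linked_def using h by simp
        have tv: "tvalue G (q B) k = dtable G P ?C B" and CP: "?C \<subseteq> P" if B: "B \<in> subs G P" for B
          using G.tvalue_linked[OF q[OF B, unfolded q_def] L lk] qinv[OF B] unfolding q_def k' P_def by auto
        have C: "?C \<in> subs G P"
          unfolding subs_def using CP[OF A] G.conj_subgroup_subgroup[OF D'(4)] hc by simp
        have "(\<Oplus>\<^bsub>R\<^esub>B\<in>subs G P. n0 B \<otimes>\<^bsub>R\<^esub> msum R f (tvalue G (q B) k)) =
          (\<Oplus>\<^bsub>R\<^esub>B\<in>subs G P. n0 B \<otimes>\<^bsub>R\<^esub> msum R f (dtable G P ?C B))"
          by (rule R.finsum_cong') (use tv n0(1) R.msum_closed[of f, OF f] in \<open>auto simp: Pi_iff\<close>)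
        also have "\<dots> = (if \<exists>p\<in>P. ?C = conj_subgroup G p A then \<one>\<^bsub>R\<^esub> else \<zero>\<^bsub>R\<^esub>)" by (rule n0(2)[OF C])
        also have "(\<exists>p\<in>P. ?C = conj_subgroup G p A) \<longleftrightarrow> mcls G i = mcls G k"
        proof
          assume "\<exists>p\<in>P. ?C = conj_subgroup G p A"
          then obtain p where p: "p \<in> P" "?C = conj_subgroup G p A" by blast
          have pc: "p \<in> carrier G" "p \<in> K" using p Ps by (auto simp: P_def)
          have "conj_subgroup G h ?C = C" using hc subgroup.subset[OF D'(4)] by (simp add: G.conj_comp G.conj_one)
          then have 1: "C = conj_subgroup G (h \<otimes>\<^bsub>G\<^esub> p) A" using p(2) G.conj_comp[OF hc pc(1) subgroup.subset[OF D(4)]] by simp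
          have "p \<in> cstab G (?ig <#\<^bsub>G\<^esub> H)" using p(1) st by (simp add: P_def)
          then have 2: "p <#\<^bsub>G\<^esub> (?ig <#\<^bsub>G\<^esub> H) = ?ig <#\<^bsub>G\<^esub> H" by (simp add: cstab_def)
          have "(h \<otimes>\<^bsub>G\<^esub> p) <#\<^bsub>G\<^esub> (?ig <#\<^bsub>G\<^esub> H) = h <#\<^bsub>G\<^esub> (?ig <#\<^bsub>G\<^esub> H)"
            using G.lcos_comp[OF hc pc(1) G.lcos_closed[OF ig subgroup.subset[OF D(1)]]] 2 by simp
          also have "\<dots> = inv\<^bsub>G\<^esub> g' <#\<^bsub>G\<^esub> H'" using h(4) G.lcos_comp[OF hc ig subgroup.subset[OF D(1)]] by simp
          finally show "mcls G i = mcls G k"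
            unfolding i' k' mcls_eq_iff[OF I L] using h(1) 1 subgroup.m_closed[OF D(2) h(3) pc(2)] by metis
        next
          assume "mcls G i = mcls G k"
          then obtain u where u: "u \<in> K" "C = conj_subgroup G u A" "inv\<^bsub>G\<^esub> g' <#\<^bsub>G\<^esub> H' = u <#\<^bsub>G\<^esub> (?ig <#\<^bsub>G\<^esub> H)"
            unfolding i' k' mcls_eq_iff[OF I L] by blast
          have uc: "u \<in> carrier G" using subgroup.mem_carrier[OF D(2) u(1)] .
          have ih: "inv\<^bsub>G\<^esub> h \<in> carrier G" using hc by simp
          note cs = G.lcos_closed[OF ig subgroup.subset[OF D(1)]]
          have "(inv\<^bsub>G\<^esub> h \<otimes>\<^bsub>G\<^esub> u) <#\<^bsub>G\<^esub> (?ig <#\<^bsub>G\<^esub> H) = inv\<^bsub>G\<^esub> h <#\<^bsub>G\<^esub> (h <#\<^bsub>G\<^esub> (?ig <#\<^bsub>G\<^esub> H))"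
            using G.lcos_comp[OF ih uc cs] u(3) h(4) G.lcos_comp[OF hc ig subgroup.subset[OF D(1)]] by simp
          also have "\<dots> = ?ig <#\<^bsub>G\<^esub> H" by (rule G.lcos_inv_cancel[OF hc cs])
          finally have "inv\<^bsub>G\<^esub> h \<otimes>\<^bsub>G\<^esub> u \<in> cstab G (?ig <#\<^bsub>G\<^esub> H)" using hc uc by (simp add: cstab_def)
          then have "inv\<^bsub>G\<^esub> h \<otimes>\<^bsub>G\<^esub> u \<in> P"
            unfolding P_def st using subgroup.m_closed[OF D(2) subgroup.m_inv_closed[OF D(2) h(3)] u(1)] by simp
          moreover have "?C = conj_subgroup G (inv\<^bsub>G\<^esub> h \<otimes>\<^bsub>G\<^esub> u) A"
            unfolding u(2) by (rule G.conj_comp[OF ih uc subgroup.subset[OF D(4)]])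
          ultimately show "\<exists>p\<in>P. ?C = conj_subgroup G p A" by blast
        qed
        finally show ?thesis .
      next
        case False
        have nl: "\<not> G.linked (K, H, ?ig, conj_subgroup G g B) (H', K', g', C) h" for B h
          using False unfolding G.linked_def by auto
        have tv: "tvalue G (q B) k = {#}" if "B \<in> subs G P" for B
          unfolding q_def k' by (rule G.tvalue_not_linked[OF q[OF that, unfolded q_def] L nl])
        have "(\<Oplus>\<^bsub>R\<^esub>B\<in>subs G P. n0 B \<otimes>\<^bsub>R\<^esub> msum R f (tvalue G (q B) k)) = \<zero>\<^bsub>R\<^esub>"
          by (rule R.add.finprod_one_eqI) (use tv n0(1) in \<open>auto simp: Pi_iff\<close>)
        moreover have "mcls G i \<noteq> mcls G k"
        proof
          assume "mcls G i = mcls G k"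
          then obtain u where u: "K = K'" "u \<in> K" "inv\<^bsub>G\<^esub> g' <#\<^bsub>G\<^esub> H' = u <#\<^bsub>G\<^esub> (?ig <#\<^bsub>G\<^esub> H)"
            unfolding i' k' mcls_eq_iff[OF I L] by blast
          have uc: "u \<in> carrier G" using subgroup.mem_carrier[OF D(2) u(2)] .
          have e: "inv\<^bsub>G\<^esub> g' <#\<^bsub>G\<^esub> H' = (u \<otimes>\<^bsub>G\<^esub> ?ig) <#\<^bsub>G\<^esub> H"
            using u(3) G.lcos_comp[OF uc ig subgroup.subset[OF D(1)]] by simp
          have ui: "u \<otimes>\<^bsub>G\<^esub> ?ig \<in> carrier G" using uc ig by simp
          have "H' = H"
            by (rule G.coset_type_unique[OF D'(1) D(1) G.cosetsI[OF ig']]) (use e G.cosetsI[OF ui] in simp)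
          then have "G.linked (K, H, ?ig, A) (H', K', g', C) u" unfolding G.linked_def using u e by simp
          then show False using False by blast
        qed
        ultimately show ?thesis by simp
      qed
      finally show ?thesis .
    qed
    then show "\<exists>n\<in>mindex G \<rightarrow> carrier R. \<forall>k\<in>mindex G.
      (\<Oplus>\<^bsub>R\<^esub>j\<in>mindex G. n j \<otimes>\<^bsub>R\<^esub> b (mel j) (mel k)) = (if mcls G i = mcls G k then \<one>\<^bsub>R\<^esub> else \<zero>\<^bsub>R\<^esub>)"
      using nc by blast
  qed
  moreover have "bilinear_form R MA' b"
    unfolding bilinear_form_def linear_maps_iff
    using b1 b2 by (simp add: linear_on_restrict[OF Q.module_axioms])
  moreover have "b x y = b y x" if "x \<in> carrier MA'" "y \<in> carrier MA'" for x y
    by (rule MB.symmetric_if_on_basis[OF b1 b2 sym]) (use that in auto)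
  moreover have "b (x \<cdot> y) z = b x (y \<cdot> z)" if "x \<in> carrier MA'" "y \<in> carrier MA'" "z \<in> carrier MA'" for x y z
    unfolding b_def using that by (simp add: Q.m_assoc)
  ultimately show ?thesis
    unfolding symmetric_algebra_def using MB.finitely_generated MB.projective by blast
qed

text \<open>The words t^P_C r^G_C pair nontrivially only with words from P to G, and there the value
  is an entry of the table over P. Representing the coordinate functional of t^P_A r^G_A by the form
  therefore solves the system for A.\<close>

lemma invertible_if_symmetric:
  assumes "symmetric_algebra R MA'"
  shows "\<exists>f. (\<forall>c. f c \<in> carrier R) \<and> invertible_tables R G f"
proof -
  obtain b where bf: "bilinear_form R MA' b" and nd: "nondegenerate R MA' b"
    and assoc: "\<And>x y z. x \<in> carrier MA' \<Longrightarrow> y \<in> carrier MA' \<Longrightarrow> z \<in> carrier MA' \<Longrightarrow> b (x \<cdot> y) z = b x (y \<cdot> z)"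
    and sym: "\<And>x y. x \<in> carrier MA' \<Longrightarrow> y \<in> carrier MA' \<Longrightarrow> b x y = b y x"
    using assms unfolding symmetric_algebra_def by blast
  have b1: "linear_on R MA' (regular_module R) (b x)" if "x \<in> carrier MA'" for x
    using bf that unfolding bilinear_form_def linear_maps_iff linear_on_restrict[OF Q.module_axioms] by simp
  have b2: "linear_on R MA' (regular_module R) (\<lambda>x. b x y)" if "y \<in> carrier MA'" for y
    using bf that unfolding bilinear_form_def linear_maps_iff linear_on_restrict[OF Q.module_axioms] by simp
  \<comment> \<open>Associativity gives b(x, y) = b(1, xy), so the form is determined by this
    trace.\<close>
  define \<tau> where "\<tau> = b \<one>\<^bsub>MA'\<^esub>"
  have \<tau>: "linear_on R MA' (regular_module R) \<tau>" unfolding \<tau>_def by (rule b1) simp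
  have b\<tau>: "b x y = \<tau> (x \<cdot> y)" if "x \<in> carrier MA'" "y \<in> carrier MA'" for x y
    using assoc[of "\<one>\<^bsub>MA'\<^esub>" x y] that by (simp add: \<tau>_def)
  \<comment> \<open>The values of \<tau> on standard words, as a function of classes; by
    \<open>mel_cong\<close> the choice of the index is immaterial.\<close>
  define F where "F c = (if \<exists>j\<in>mindex G. mcls G j = c then \<tau> (mel (SOME j. j \<in> mindex G \<and> mcls G j = c)) else \<zero>\<^bsub>R\<^esub>)" for c
  have \<tau>c: "\<tau> x \<in> carrier R" if "x \<in> carrier MA'" for x using linear_onD(1)[OF \<tau> that] by simp
  have F: "F c \<in> carrier R" for c
  proof (cases "\<exists>j\<in>mindex G. mcls G j = c")
    case True
    then have "(SOME j. j \<in> mindex G \<and> mcls G j = c) \<in> mindex G" using someI_ex[of "\<lambda>j. j \<in> mindex G \<and> mcls G j = c"] by blast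
    then show ?thesis unfolding F_def using True \<tau>c[OF mel_closed] by simp
  qed (simp add: F_def)
  have Fm: "F (mcls G j) = \<tau> (mel j)" if j: "j \<in> mindex G" for j
  proof -
    let ?k = "SOME k. k \<in> mindex G \<and> mcls G k = mcls G j"
    have "?k \<in> mindex G \<and> mcls G ?k = mcls G j" by (rule someI[of _ j]) (use j in simp)
    then have "mel ?k = mel j" using mel_cong[of ?k j] j by blast
    then show ?thesis unfolding F_def using j by auto
  qed
  obtain \<psi> where \<psi>: "linear_on R MA' (regular_module R) \<psi>" "\<And>w. w \<in> Wd \<Longrightarrow> \<psi> (cl w) = msum R F (coef G w)"
    using class_functional[of F, OF F] by blast
  \<comment> \<open>A functional is determined by its values on standard words, so \<tau> is the
    functional of F, and its values on arbitrary words can be computed by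
    \<open>coef\<close>.\<close>
  have \<tau>\<psi>: "\<tau> x = \<psi> x" if "x \<in> carrier MA'" for x
  proof (rule MB.linear_eqI[OF regular \<tau> \<psi>(1) _ that])
    fix j assume j: "j \<in> mindex G"
    show "\<tau> (mel j) = \<psi> (mel j)"
      using \<psi>(2)[OF mword_Wd[OF j]] Fm[OF j] G.coef_mword[OF j] R.msum_single[of F, OF F] by (simp add: mel_def)
  qed
  have val: "b (mel j) (mel k) = msum R F (coef G (mword G j @ mword G k))" if j: "j \<in> mindex G" and k: "k \<in> mindex G" for j k
  proof -
    have e: "mel j \<cdot> mel k = cl (mword G j @ mword G k)"
      unfolding mel_def by (rule cl_mult[OF mword_Wd[OF j] mword_Wd[OF k]])
    have w: "mword G j @ mword G k \<in> Wd" using mword_Wd[OF j] mword_Wd[OF k] by simp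
    show ?thesis
      unfolding b\<tau>[OF mel_closed[OF j] mel_closed[OF k]] e \<tau>\<psi>[OF cl_closed[OF w]] by (rule \<psi>(2)[OF w])
  qed
  let ?U = "carrier G"
  have U: "subgroup ?U G" by (rule G.subgroup_self)
  have kU: "k <#\<^bsub>G\<^esub> ?U = ?U" if "k \<in> ?U" for k using that G.cstab_self[OF U] by (auto simp: cstab_def)
  \<comment> \<open>The class used is that of t^G_A r^G_A, so f takes the value of the trace there,
    as a function of the conjugacy class of A. Conjugation by p does not change that class because
    pG = G.\<close>
  define f where "f c = (if \<exists>A. subgroup A G \<and> subconj G ?U A = c
      then F (state_class G ?U (SOME A. subgroup A G \<and> subconj G ?U A = c) ?U) else \<zero>\<^bsub>R\<^esub>)" for c
  have f: "f c \<in> carrier R" for c unfolding f_def using F by simp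
  have fF: "f (subconj G ?U A) = F (state_class G ?U A ?U)" if A: "subgroup A G" for A
  proof -
    let ?A = "SOME A'. subgroup A' G \<and> subconj G ?U A' = subconj G ?U A"
    have A': "subgroup ?A G \<and> subconj G ?U ?A = subconj G ?U A" by (rule someI[of _ A]) (use A in simp)
    have AU: "A \<subseteq> ?U" and A'U: "?A \<subseteq> ?U" using subgroup.subset A A' by blast+
    have "\<exists>p\<in>?U. A = conj_subgroup G p ?A" using G.subconj_eq_iff[OF U A'U AU] A' by simp
    then obtain p where p: "p \<in> ?U" "A = conj_subgroup G p ?A" by (rule bexE)
    have "\<exists>p\<in>?U. A = conj_subgroup G p ?A \<and> ?U = p <#\<^bsub>G\<^esub> ?U"
      by (rule bexI[OF _ p(1)]) (use p(2) kU[OF p(1)] in simp)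
    then have "state_class G ?U ?A ?U = state_class G ?U A ?U"
      using G.state_class_eq_iff[OF U A'U AU subset_refl subset_refl] by simp
    then show ?thesis unfolding f_def using A by auto
  qed
  have "invertible_tables R G f"
    unfolding invertible_tables_def
  proof (intro allI impI ballI)
    fix P A assume P: "subgroup P G" and A: "A \<in> subs G P"
    note Ps = subgroup.subset[OF P]
    have idx: "(P, ?U, \<one>\<^bsub>G\<^esub>, C) \<in> mindex G" if "C \<in> subs G P" for C
    proof -
      have C: "subgroup C G" "C \<subseteq> P" using that by (auto simp: subs_def)
      show ?thesis by (rule mindexI) (use P U C G.conj_one[OF subgroup.subset[OF C(1)]] subgroup.subset[OF C(1)] in auto)
    qed
    have st: "inv\<^bsub>G\<^esub> \<one>\<^bsub>G\<^esub> <#\<^bsub>G\<^esub> P = P" using G.lcos_one[OF Ps] by simp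
    have "\<exists>n\<in>mindex G \<rightarrow> carrier R. \<forall>k\<in>mindex G.
       (\<Oplus>\<^bsub>R\<^esub>j\<in>mindex G. n j \<otimes>\<^bsub>R\<^esub> b (mel j) (mel k)) =
       (if mcls G (P, ?U, \<one>\<^bsub>G\<^esub>, A) = mcls G k then \<one>\<^bsub>R\<^esub> else \<zero>\<^bsub>R\<^esub>)"
      using MB.nondegenerate_iff[OF b1 b2] sym mel_closed nd idx[OF A] by blast
    then obtain n where n: "n \<in> mindex G \<rightarrow> carrier R" "\<And>k. k \<in> mindex G \<Longrightarrow>
       (\<Oplus>\<^bsub>R\<^esub>j\<in>mindex G. n j \<otimes>\<^bsub>R\<^esub> b (mel j) (mel k)) =
       (if mcls G (P, ?U, \<one>\<^bsub>G\<^esub>, A) = mcls G k then \<one>\<^bsub>R\<^esub> else \<zero>\<^bsub>R\<^esub>)" by blast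
    \<comment> \<open>If K \<noteq> P, the product of the two words is zero as it stands. If K = P
      but H is not G, the product in the opposite order is zero, and the symmetry of the form is
      used.\<close>
    have val0: "b (mel (H, K, g, B)) (mel (P, ?U, \<one>\<^bsub>G\<^esub>, C)) = \<zero>\<^bsub>R\<^esub>"
      if j: "(H, K, g, B) \<in> mindex G" and C: "C \<in> subs G P" and ne: "H \<noteq> ?U \<or> K \<noteq> P" for H K g B C
    proof (cases "K = P")
      case True
      note D = G.mindexD[OF j]
      have ig: "inv\<^bsub>G\<^esub> g \<in> carrier G" using D by simp
      have "inv\<^bsub>G\<^esub> g <#\<^bsub>G\<^esub> H \<notin> cosets G ?U"
        using G.coset_type_unique[OF D(1) U G.cosetsI[OF ig]] ne True by blast
      then have "coef G (mword G (P, ?U, \<one>\<^bsub>G\<^esub>, C) @ mword G (H, K, g, B)) = {#}"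
        unfolding G.coef_pair[OF idx[OF C] j] by simp
      then show ?thesis
        using sym[OF mel_closed[OF j] mel_closed[OF idx[OF C]]] val[OF idx[OF C] j] by (simp del: mword.simps)
    next
      case False
      have "P \<notin> cosets G K" using G.coset_type_unique[OF P G.mindexD(2)[OF j] G.coset_self[OF P]] False by blast
      then have "coef G (mword G (H, K, g, B) @ mword G (P, ?U, \<one>\<^bsub>G\<^esub>, C)) = {#}"
        unfolding G.coef_pair[OF j idx[OF C]] st by simp
      then show ?thesis using val[OF j idx[OF C]] by (simp del: mword.simps)
    qed
    \<comment> \<open>The element g drops out of the value, since G is the only left coset of
      G.\<close>
    have val1: "b (mel (?U, P, g, B)) (mel (P, ?U, \<one>\<^bsub>G\<^esub>, C)) = msum R f (dtable G P C B)"
      if j: "(?U, P, g, B) \<in> mindex G" and C: "C \<in> subs G P" for g B C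
    proof -
      note D = G.mindexD[OF j] and D' = G.mindexD[OF idx[OF C]]
      have CP: "C \<subseteq> P" using C by (simp add: subs_def)
      note X = G.acts_kids[OF D'(4) D(4) G.subgroup_cstab_self[OF D'(4) CP P]]
      have "msum R F (osum C (lmult G) (kids G B P) (\<lambda>z. {#state_class G ?U (C \<inter> cstab G z) ((z #>\<^bsub>G\<^esub> inv\<^bsub>G\<^esub> g) <#>\<^bsub>G\<^esub> ?U)#}))
         = msum R f (dtable G P C B)"
        unfolding dtable_def
      proof (rule G.msum_osum_cong[OF cring_R F f X])
        fix z assume z: "z \<in> kids G B P"
        have zc: "(z #>\<^bsub>G\<^esub> inv\<^bsub>G\<^esub> g) <#>\<^bsub>G\<^esub> ?U \<in> cosets G ?U"
          by (rule G.up_in_cosets[OF D(7,1,6) G.rcos_in_cosets[OF D(3,4) G.kids_cosets[OF z]]])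
        then have "(z #>\<^bsub>G\<^esub> inv\<^bsub>G\<^esub> g) <#>\<^bsub>G\<^esub> ?U = ?U" using kU by (auto simp: cosets_def)
        moreover have "subgroup (C \<inter> cstab G z) G"
          by (rule G.subgroup_Int[OF D'(4) G.cstab_subgroup[OF G.cosets_subset[OF D(4) G.kids_cosets[OF z]]]])
        ultimately show "msum R F {#state_class G ?U (C \<inter> cstab G z) ((z #>\<^bsub>G\<^esub> inv\<^bsub>G\<^esub> g) <#>\<^bsub>G\<^esub> ?U)#} =
          msum R f {#subconj G ?U (C \<inter> cstab G z)#}"
          using fF R.msum_single[of F, OF F] R.msum_single[of f, OF f] by simp
      qed
      moreover have "P \<in> cosets G P" by (rule G.coset_self[OF P])
      ultimately show ?thesis using val[OF j idx[OF C]] unfolding G.coef_pair[OF j idx[OF C]] st by simp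
    qed
    define q :: "'g \<Rightarrow> 'g set \<Rightarrow> 'g mindex" where "q g B = (?U, P, g, B)" for g B
    have qi: "q g B \<in> mindex G" if "g \<in> ?U" "B \<in> subs G P" for g B
    proof -
      have B: "subgroup B G" "B \<subseteq> P" using that by (auto simp: subs_def)
      show ?thesis unfolding q_def
        by (rule mindexI[OF U P that(1) B G.conj_closed[OF that(1) subgroup.subset[OF B(1)]]])
    qed
    \<comment> \<open>The words \<open>q g B\<close> with the same B pair alike for all g, so their
      coefficients are added up.\<close>
    define n' where "n' B = (\<Oplus>\<^bsub>R\<^esub>g\<in>?U. n (q g B))" for B
    have nq: "n (q g B) \<in> carrier R" if "g \<in> ?U" "B \<in> subs G P" for g B using n(1) qi[OF that] by auto
    have n': "n' \<in> subs G P \<rightarrow> carrier R" unfolding n'_def using nq by (auto intro!: R.finsum_closed)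
    have "(\<Oplus>\<^bsub>R\<^esub>B\<in>subs G P. n' B \<otimes>\<^bsub>R\<^esub> msum R f (dtable G P C B)) =
      (if \<exists>p\<in>P. C = conj_subgroup G p A then \<one>\<^bsub>R\<^esub> else \<zero>\<^bsub>R\<^esub>)" if C: "C \<in> subs G P" for C
    proof -
      let ?k = "(P, ?U, \<one>\<^bsub>G\<^esub>, C)"
      let ?t = "\<lambda>j. n j \<otimes>\<^bsub>R\<^esub> b (mel j) (mel ?k)"
      have bc: "b (mel j) (mel ?k) \<in> carrier R" if "j \<in> mindex G" for j
        using linear_onD(1)[OF b1[OF mel_closed[OF that]] mel_closed[OF idx[OF C]]] by simp
      have tc: "?t j \<in> carrier R" if "j \<in> mindex G" for j using bc[OF that] n(1) that by auto
      have sub: "(\<Union>B\<in>subs G P. (\<lambda>g. q g B) ` ?U) \<subseteq> mindex G" using qi by auto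
      have "(\<Oplus>\<^bsub>R\<^esub>j\<in>mindex G. ?t j) = (\<Oplus>\<^bsub>R\<^esub>j\<in>(\<Union>B\<in>subs G P. (\<lambda>g. q g B) ` ?U). ?t j)"
      proof (rule R.add.finprod_mono_neutral_cong_right[OF G.finite_mindex sub])
        fix j assume j: "j \<in> mindex G - (\<Union>B\<in>subs G P. (\<lambda>g. q g B) ` ?U)"
        obtain H K g B where j': "j = (H, K, g, B)" by (cases j)
        have J: "(H, K, g, B) \<in> mindex G" using j j' by simp
        have ne: "H \<noteq> ?U \<or> K \<noteq> P"
        proof (rule ccontr)
          assume "\<not> (H \<noteq> ?U \<or> K \<noteq> P)"
          then have e: "H = ?U" "K = P" by auto
          then have "B \<in> subs G P" "j = q g B" "g \<in> ?U" using G.mindexD[OF J] j' by (auto simp: subs_def q_def)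
          then show False using j by blast
        qed
        show "?t j = \<zero>\<^bsub>R\<^esub>" 
          using funcset_mem[OF n(1) J] unfolding j' val0[OF J C ne] by (rule R.r_null)
      qed (use tc in auto)
      also have "\<dots> = (\<Oplus>\<^bsub>R\<^esub>B\<in>subs G P. (\<Oplus>\<^bsub>R\<^esub>j\<in>(\<lambda>g. q g B) ` ?U. ?t j))"
        by (rule R.add.finprod_UN_disjoint[OF finite_subs])
           (use G.finite_carrier qi tc in \<open>auto simp: q_def pairwise_def disjnt_def\<close>)
      also have "\<dots> = (\<Oplus>\<^bsub>R\<^esub>B\<in>subs G P. n' B \<otimes>\<^bsub>R\<^esub> msum R f (dtable G P C B))"
      proof (rule R.finsum_cong'[OF refl])
        show "(\<lambda>B. n' B \<otimes>\<^bsub>R\<^esub> msum R f (dtable G P C B)) \<in> subs G P \<rightarrow> carrier R"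
          using n' R.msum_closed[of f, OF f] by (auto simp: Pi_iff)
        fix B assume B: "B \<in> subs G P"
        have "(\<Oplus>\<^bsub>R\<^esub>j\<in>(\<lambda>g. q g B) ` ?U. ?t j) = (\<Oplus>\<^bsub>R\<^esub>g\<in>?U. ?t (q g B))"
          by (rule R.add.finprod_reindex) (use qi B tc in \<open>auto simp: inj_on_def q_def\<close>)
        also have "\<dots> = (\<Oplus>\<^bsub>R\<^esub>g\<in>?U. n (q g B) \<otimes>\<^bsub>R\<^esub> msum R f (dtable G P C B))"
          by (rule R.finsum_cong') (use val1[OF qi[unfolded q_def]] C B nq R.msum_closed[of f, OF f] in \<open>auto simp: q_def\<close>)
        also have "\<dots> = n' B \<otimes>\<^bsub>R\<^esub> msum R f (dtable G P C B)"
          unfolding n'_def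
          by (rule R.finsum_ldistr[symmetric]) (use G.finite_carrier nq B R.msum_closed[of f, OF f] in auto)
        finally show "(\<Oplus>\<^bsub>R\<^esub>j\<in>(\<lambda>g. q g B) ` ?U. ?t j) = n' B \<otimes>\<^bsub>R\<^esub> msum R f (dtable G P C B)" .
      qed
      finally have "(\<Oplus>\<^bsub>R\<^esub>B\<in>subs G P. n' B \<otimes>\<^bsub>R\<^esub> msum R f (dtable G P C B)) = (if mcls G (P, ?U, \<one>\<^bsub>G\<^esub>, A) = mcls G ?k then \<one>\<^bsub>R\<^esub> else \<zero>\<^bsub>R\<^esub>)"
        using n(2)[OF idx[OF C]] by simp
      also have "mcls G (P, ?U, \<one>\<^bsub>G\<^esub>, A) = mcls G ?k \<longleftrightarrow> (\<exists>p\<in>P. C = conj_subgroup G p A)"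
      proof -
        \<comment> \<open>An element fixes the coset P exactly if it lies in P; this turns equality
          of classes under all of G into conjugacy under P.\<close>
        have "(p \<in> ?U \<and> P = p <#\<^bsub>G\<^esub> P) \<longleftrightarrow> p \<in> P" for p
          using G.cstab_self[OF P] by (auto simp: cstab_def)
        then show ?thesis unfolding mcls_eq_iff[OF idx[OF A] idx[OF C]] st by blast
      qed
      finally show ?thesis .
    qed
    then show "\<exists>n\<in>subs G P \<rightarrow> carrier R. \<forall>C\<in>subs G P.
      (\<Oplus>\<^bsub>R\<^esub>B\<in>subs G P. n B \<otimes>\<^bsub>R\<^esub> msum R f (dtable G P C B)) =
      (if \<exists>p\<in>P. C = conj_subgroup G p A then \<one>\<^bsub>R\<^esub> else \<zero>\<^bsub>R\<^esub>)" using n' by blast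
  qed
  then show ?thesis using f by blast
qed

end

subsection \<open>Finite sets with a group action\<close>

context group
begin

text \<open>The only difference is extensionality: the bijections in \<open>BijGroup\<close> are
  undefined off the set. The bijections themselves come from inverses.\<close>

lemma group_action_iff:
  "group_action G X \<phi> \<longleftrightarrow> acts G (carrier G) \<phi> X \<and> (\<forall>g\<in>carrier G. \<phi> g \<in> extensional X)"
proof
  assume "group_action G X \<phi>"
  then interpret A: group_action G X \<phi> .
  have ext: "\<phi> g \<in> extensional X" if "g \<in> carrier G" for g
    using A.bij_prop0[OF that] by (simp add: Bij_def)
  have one: "\<phi> \<one> x = x" if "x \<in> X" for x using A.id_eq_one that by (metis restrict_apply')
  show "acts G (carrier G) \<phi> X \<and> (\<forall>g\<in>carrier G. \<phi> g \<in> extensional X)"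
    unfolding acts_def
    by (intro conjI ballI subgroup_self one ext A.composition_rule A.element_image[OF _ _ refl])
next
  assume a: "acts G (carrier G) \<phi> X \<and> (\<forall>g\<in>carrier G. \<phi> g \<in> extensional X)"
  then have cl: "\<phi> g x \<in> X" and one: "\<phi> \<one> x = x" and mul: "\<phi> (g \<otimes> h) x = \<phi> g (\<phi> h x)"
    if "g \<in> carrier G" "h \<in> carrier G" "x \<in> X" for g h x
    using that unfolding acts_def by auto
  have inv1: "\<phi> (inv g) (\<phi> g x) = x" "\<phi> g (\<phi> (inv g) x) = x" if "g \<in> carrier G" "x \<in> X" for g x
    using mul[of "inv g" g x] mul[of g "inv g" x] one[of \<one> \<one> x] that by auto
  have bij: "\<phi> g \<in> Bij X" if g: "g \<in> carrier G" for g
    unfolding Bij_def using a g cl[OF g g] cl[of "inv g" g] inv1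
    by (auto intro!: bij_betwI[where g = "\<phi> (inv g)"])
  have "\<phi> \<in> hom G (BijGroup X)"
  proof (rule homI)
    show "\<phi> g \<in> carrier (BijGroup X)" if "g \<in> carrier G" for g using bij[OF that] by (simp add: BijGroup_def)
    show "\<phi> (g \<otimes> h) = \<phi> g \<otimes>\<^bsub>BijGroup X\<^esub> \<phi> h" if gh: "g \<in> carrier G" "h \<in> carrier G" for g h
    proof
      fix x
      show "\<phi> (g \<otimes> h) x = (\<phi> g \<otimes>\<^bsub>BijGroup X\<^esub> \<phi> h) x"
      proof (cases "x \<in> X")
        case True
        then show ?thesis using bij gh mul by (simp add: BijGroup_def compose_def)
      next
        case False
        have "\<phi> (g \<otimes> h) \<in> extensional X" using a gh by auto
        then show ?thesis using False bij gh by (simp add: BijGroup_def compose_def extensional_def)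
      qed
    qed
  qed
  then show "group_action G X \<phi>"
    unfolding group_action_def group_hom_def group_hom_axioms_def
    using group_axioms group_BijGroup by auto
qed

lemma gset_acts: "finite_gset G X \<Longrightarrow> acts G (carrier G) (snd X) (fst X)"
  unfolding finite_gset_def group_action_iff by simp

lemma gset_finite: "finite_gset G X \<Longrightarrow> finite (fst X)"
  unfolding finite_gset_def by simp

lemma acts_restrict: "acts G A act X \<Longrightarrow> acts G A (\<lambda>g. restrict (act g) X) X"
  unfolding acts_def by (auto simp: subgroup.m_closed)

lemma finite_gsetI: "finite X \<Longrightarrow> acts G (carrier G) act X \<Longrightarrow> finite_gset G (X, \<lambda>g. restrict (act g) X)"
  unfolding finite_gset_def group_action_iff by (simp add: acts_restrict)

lemma acts_one: "acts G A act X \<Longrightarrow> x \<in> X \<Longrightarrow> act \<one> x = x"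
  unfolding acts_def by blast

lemma acts_mult: "acts G A act X \<Longrightarrow> a \<in> A \<Longrightarrow> b \<in> A \<Longrightarrow> x \<in> X \<Longrightarrow> act (a \<otimes> b) x = act a (act b x)"
  unfolding acts_def by blast

lemma acts_sub: "acts G A act X \<Longrightarrow> subgroup A G" unfolding acts_def by blast

lemma finite_gset_sum:
  assumes X: "finite_gset G X" and Y: "finite_gset G Y"
  shows "finite_gset G (gset_sum X Y)"
  unfolding gset_sum_def
  by (rule finite_gsetI)
     (use gset_finite[OF X] gset_finite[OF Y] gset_acts[OF X] gset_acts[OF Y] in
       \<open>auto simp: acts_def\<close>)

lemma finite_gset_prod:
  assumes X: "finite_gset G X" and Y: "finite_gset G Y"
  shows "finite_gset G (gset_prod X Y)"
  unfolding gset_prod_def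
  by (rule finite_gsetI)
     (use gset_finite[OF X] gset_finite[OF Y] gset_acts[OF X] gset_acts[OF Y] in
       \<open>auto simp: acts_def\<close>)

lemma finite_gset_point: "finite_gset G gset_point"
proof -
  have "finite_gset G ({0::nat}, \<lambda>g. restrict ((\<lambda>g x. x) g) {0})"
    by (rule finite_gsetI) (auto simp: acts_def subgroup_self)
  then show ?thesis by (simp add: gset_point_def)
qed

lemma gset_isoI:
  assumes "bij_betw f (fst X) (fst Y)" "\<And>g x. g \<in> carrier G \<Longrightarrow> x \<in> fst X \<Longrightarrow> f (snd X g x) = snd Y g (f x)"
  shows "gset_iso G X Y"
  using assms unfolding gset_iso_def by auto

lemma gset_iso_sym:
  assumes X: "finite_gset G X" and i: "gset_iso G X Y"
  shows "gset_iso G Y X"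
proof -
  obtain f where f: "bij_betw f (fst X) (fst Y)" "\<And>g x. g \<in> carrier G \<Longrightarrow> x \<in> fst X \<Longrightarrow> f (snd X g x) = snd Y g (f x)"
    using i unfolding gset_iso_def by auto
  show ?thesis
  proof (rule gset_isoI[OF bij_betw_inv_into[OF f(1)]])
    fix g y assume g: "g \<in> carrier G" and y: "y \<in> fst Y"
    obtain x where x: "x \<in> fst X" "y = f x" using f(1) y by (auto simp: bij_betw_def)
    have gx: "snd X g x \<in> fst X" by (rule acts_closed[OF gset_acts[OF X] g x(1)])
    show "inv_into (fst X) f (snd Y g y) = snd X g (inv_into (fst X) f y)"
      using x f(2)[OF g x(1)] bij_betw_inv_into_left[OF f(1) gx] bij_betw_inv_into_left[OF f(1) x(1)] by simp
  qed
qed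

lemma gset_iso_trans:
  assumes "gset_iso G X Y" "gset_iso G Y Z" shows "gset_iso G X Z"
proof -
  obtain f where f: "bij_betw f (fst X) (fst Y)" "\<And>g x. g \<in> carrier G \<Longrightarrow> x \<in> fst X \<Longrightarrow> f (snd X g x) = snd Y g (f x)"
    using assms(1) unfolding gset_iso_def by auto
  obtain f' where f': "bij_betw f' (fst Y) (fst Z)" "\<And>g x. g \<in> carrier G \<Longrightarrow> x \<in> fst Y \<Longrightarrow> f' (snd Y g x) = snd Z g (f' x)"
    using assms(2) unfolding gset_iso_def by auto
  have fy: "f x \<in> fst Y" if "x \<in> fst X" for x using f(1) that by (auto simp: bij_betw_def)
  show ?thesis
    by (rule gset_isoI[OF bij_betw_trans[OF f(1) f'(1)]]) (use f(2) f'(2) fy in simp)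
qed

lemma gset_class_cong:
  assumes X: "finite_gset G X" and i: "gset_iso G X Y"
  shows "gset_class G X = gset_class G Y"
  unfolding gset_class_def
  by (intro Collect_cong conj_cong refl iffI)
     (erule gset_iso_trans[OF gset_iso_sym[OF X i]], erule gset_iso_trans[OF i])

text \<open>Products, sums, coset spaces and induced sets leave the type \<open>nat\<close> on which
  the isomorphism classes are built; transport along an enumeration brings them back.\<close>

lemma gset_nat_copy:
  assumes X: "finite_gset G (X :: ('a, 'c) gset)"
  obtains Y :: "('a, nat) gset" where "finite_gset G Y" "gset_iso G X Y"
proof -
  note aX = gset_acts[OF X]
  obtain f :: "'c \<Rightarrow> nat" and n where f: "bij_betw f (fst X) {..<n}"
    using ex_bij_betw_finite_nat[OF gset_finite[OF X]] by (auto simp: atLeast0LessThan)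
  define u where "u = inv_into (fst X) f"
  have u: "u k \<in> fst X" "f (u k) = k" if "k < n" for k
    using bij_betw_inv_into[OF f] bij_betw_inv_into_right[OF f] that unfolding u_def bij_betw_def by auto
  have uf: "u (f x) = x" "f x < n" if "x \<in> fst X" for x
    using bij_betw_inv_into_left[OF f that] f that unfolding u_def bij_betw_def by auto
  let ?act = "\<lambda>g k. f (snd X g (u k))"
  have act: "acts G (carrier G) ?act {..<n}"
    unfolding acts_def
    using subgroup_self u uf acts_closed[OF aX] acts_one[OF aX] acts_mult[OF aX] by simp
  have "gset_iso G X ({..<n}, \<lambda>g. restrict (?act g) {..<n})"
    by (rule gset_isoI[of f]) (use f uf in auto)
  then show ?thesis using that finite_gsetI[OF _ act] by blast
qed

lemma gset_class_nonempty:
  assumes "finite_gset G X" shows "gset_class G X \<noteq> {}"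
  using gset_nat_copy[OF assms] unfolding gset_class_def by blast

lemma gset_class_memD:
  assumes "finite_gset G X" "Y \<in> gset_class G X"
  shows "finite_gset G Y" "gset_iso G X Y" "gset_class G Y = gset_class G X"
proof -
  show 1: "finite_gset G Y" "gset_iso G X Y" using assms(2) unfolding gset_class_def by auto
  show "gset_class G Y = gset_class G X" by (rule gset_class_cong[OF assms(1) 1(2), symmetric])
qed

lemma gset_class_carrier:
  assumes "finite_gset G X" shows "gset_class G X \<in> carrier (gset_monoid G)"
proof -
  obtain Y :: "('a, nat) gset" where "finite_gset G Y" "gset_iso G X Y" by (rule gset_nat_copy[OF assms])
  then have "gset_class G X = gset_class G Y" by (intro gset_class_cong[OF assms])
  then show ?thesis using \<open>finite_gset G Y\<close> by (cases Y) (auto simp: gset_monoid_def)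
qed

lemma gset_prod_cong:
  assumes "gset_iso G X X'" "gset_iso G Y Y'"
  shows "gset_iso G (gset_prod X Y) (gset_prod X' Y')"
proof -
  obtain f where f: "bij_betw f (fst X) (fst X')" "\<And>g x. g \<in> carrier G \<Longrightarrow> x \<in> fst X \<Longrightarrow> f (snd X g x) = snd X' g (f x)"
    using assms(1) unfolding gset_iso_def by auto
  obtain f' where f': "bij_betw f' (fst Y) (fst Y')" "\<And>g x. g \<in> carrier G \<Longrightarrow> x \<in> fst Y \<Longrightarrow> f' (snd Y g x) = snd Y' g (f' x)"
    using assms(2) unfolding gset_iso_def by auto
  show ?thesis
    by (rule gset_isoI[of "map_prod f f'"])
       (use f(2) f'(2) bij_betw_map_prod[OF f(1) f'(1)] bij_betwE[OF f(1)] bij_betwE[OF f'(1)]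
        in \<open>auto simp: gset_prod_def\<close>)
qed

lemma gset_prod_assoc: "gset_iso G (gset_prod (gset_prod X Y) Z) (gset_prod X (gset_prod Y Z))"
  if "finite_gset G X" "finite_gset G Y" "finite_gset G Z"
proof (rule gset_isoI[of "\<lambda>((x, y), z). (x, (y, z))"])
  show "bij_betw (\<lambda>((x, y), z). (x, (y, z))) (fst (gset_prod (gset_prod X Y) Z)) (fst (gset_prod X (gset_prod Y Z)))"
    by (rule bij_betwI[where g = "\<lambda>(x, (y, z)). ((x, y), z)"]) (auto simp: gset_prod_def)
qed (use that acts_closed[OF gset_acts] in \<open>auto simp: gset_prod_def\<close>)

lemma gset_prod_point: "gset_iso G (gset_prod gset_point X) X" "gset_iso G (gset_prod X gset_point) X"
  by (rule gset_isoI[of snd], auto simp: gset_prod_def gset_point_def bij_betw_def inj_on_def image_iff)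
     (rule gset_isoI[of fst], auto simp: gset_prod_def gset_point_def bij_betw_def inj_on_def image_iff)

text \<open>Distributivity on both sides at once is the form in which a defining relation is
  multiplied by basis elements from left and right.\<close>

lemma gset_sum_prod_distrib:
  assumes "finite_gset G P" "finite_gset G X" "finite_gset G Y" "finite_gset G Q"
  shows "gset_iso G (gset_prod (gset_prod P (gset_sum X Y)) Q)
    (gset_sum (gset_prod (gset_prod P X) Q) (gset_prod (gset_prod P Y) Q))"
proof (rule gset_isoI[of "\<lambda>((p, s), q). case s of Inl x \<Rightarrow> Inl ((p, x), q) | Inr y \<Rightarrow> Inr ((p, y), q)"])
  show "bij_betw (\<lambda>((p, s), q). case s of Inl x \<Rightarrow> Inl ((p, x), q) | Inr y \<Rightarrow> Inr ((p, y), q))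
     (fst (gset_prod (gset_prod P (gset_sum X Y)) Q)) (fst (gset_sum (gset_prod (gset_prod P X) Q) (gset_prod (gset_prod P Y) Q)))"
    by (rule bij_betwI[where g = "\<lambda>s. case s of Inl ((p, x), q) \<Rightarrow> ((p, Inl x), q) | Inr ((p, y), q) \<Rightarrow> ((p, Inr y), q)"])
       (auto simp: gset_prod_def gset_sum_def)
qed (use assms acts_closed[OF gset_acts] in \<open>auto simp: gset_prod_def gset_sum_def\<close>)

text \<open>The product in \<open>gset_monoid\<close> is a union over pairs of representatives; all
  members of the union are equal, and there is at least one.\<close>

lemma gset_monoid_mult:
  assumes X: "finite_gset G X" and Y: "finite_gset G Y"
  shows "gset_class G X \<otimes>\<^bsub>gset_monoid G\<^esub> gset_class G Y = gset_class G (gset_prod X Y)"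
proof -
  have "gset_class G (gset_prod X' Y') = gset_class G (gset_prod X Y)"
    if "X' \<in> gset_class G X" "Y' \<in> gset_class G Y" for X' Y'
    by (rule gset_class_cong[OF finite_gset_prod[OF X Y] gset_prod_cong[OF
          gset_class_memD(2)[OF X that(1)] gset_class_memD(2)[OF Y that(2)]], symmetric])
  then show ?thesis
    using gset_class_nonempty[OF X] gset_class_nonempty[OF Y] by (auto simp: gset_monoid_def)
qed

lemma gset_monoid_carrierE:
  assumes "c \<in> carrier (gset_monoid G)"
  obtains X :: "('a, nat) gset" where "finite_gset G X" "c = gset_class G X"
  using assms unfolding gset_monoid_def by auto

lemma gset_monoid_one: "\<one>\<^bsub>gset_monoid G\<^esub> = gset_class G gset_point"
  by (simp add: gset_monoid_def)

lemma gset_monoid_monoid: "monoid (gset_monoid G)"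
proof (rule monoidI)
  show "\<one>\<^bsub>gset_monoid G\<^esub> \<in> carrier (gset_monoid G)"
    unfolding gset_monoid_one by (rule gset_class_carrier[OF finite_gset_point])
  fix a assume "a \<in> carrier (gset_monoid G)"
  then obtain X :: "('a, nat) gset" where X: "finite_gset G X" "a = gset_class G X" by (rule gset_monoid_carrierE)
  show "\<one>\<^bsub>gset_monoid G\<^esub> \<otimes>\<^bsub>gset_monoid G\<^esub> a = a"
    unfolding gset_monoid_one X(2) gset_monoid_mult[OF finite_gset_point X(1)]
    by (rule gset_class_cong[OF finite_gset_prod[OF finite_gset_point X(1)] gset_prod_point(1)])
  show "a \<otimes>\<^bsub>gset_monoid G\<^esub> \<one>\<^bsub>gset_monoid G\<^esub> = a"
    unfolding gset_monoid_one X(2) gset_monoid_mult[OF X(1) finite_gset_point]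
    by (rule gset_class_cong[OF finite_gset_prod[OF X(1) finite_gset_point] gset_prod_point(2)])
  fix b assume "b \<in> carrier (gset_monoid G)"
  then obtain Y :: "('a, nat) gset" where Y: "finite_gset G Y" "b = gset_class G Y" by (rule gset_monoid_carrierE)
  note XY = finite_gset_prod[OF X(1) Y(1)]
  show "a \<otimes>\<^bsub>gset_monoid G\<^esub> b \<in> carrier (gset_monoid G)"
    unfolding X(2) Y(2) gset_monoid_mult[OF X(1) Y(1)] by (rule gset_class_carrier[OF XY])
  fix c assume "c \<in> carrier (gset_monoid G)"
  then obtain Z :: "('a, nat) gset" where Z: "finite_gset G Z" "c = gset_class G Z" by (rule gset_monoid_carrierE)
  note YZ = finite_gset_prod[OF Y(1) Z(1)]
  show "a \<otimes>\<^bsub>gset_monoid G\<^esub> b \<otimes>\<^bsub>gset_monoid G\<^esub> c = a \<otimes>\<^bsub>gset_monoid G\<^esub> (b \<otimes>\<^bsub>gset_monoid G\<^esub> c)"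
    unfolding X(2) Y(2) Z(2) gset_monoid_mult[OF X(1) Y(1)] gset_monoid_mult[OF Y(1) Z(1)]
      gset_monoid_mult[OF XY Z(1)] gset_monoid_mult[OF X(1) YZ]
    by (rule gset_class_cong[OF finite_gset_prod[OF XY Z(1)] gset_prod_assoc[OF X(1) Y(1) Z(1)]])
qed

end

subsection \<open>Orbit types of finite sets with a group action\<close>

text \<open>\<open>H\<close> acts, while stabilisers are recorded up to conjugation in
  \<open>P\<close>. With \<open>P = H\<close> the multiset determines the class in the Burnside ring
  of \<open>H\<close>; with \<open>P\<close> the whole group it carries what a form stable by
  induction can see.\<close>

definition orbit_types :: "('g, 'l) monoid_scheme \<Rightarrow> 'g set \<Rightarrow> 'g set \<Rightarrow> ('g, 'a) gset \<Rightarrow> 'g set set multiset"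
  where "orbit_types G P H X = osum H (snd X) (fst X) (\<lambda>x. {#subconj G P {h \<in> H. snd X h x = x}#})"

definition coset_gset :: "('g, 'l) monoid_scheme \<Rightarrow> 'g set \<Rightarrow> 'g set \<Rightarrow> ('g, 'g set) gset"
  where "coset_gset G H L = (kids G L H, \<lambda>h. restrict (lmult G h) (kids G L H))"

context fin_group
begin

lemma acts_carrier_iff:
  "subgroup H G \<Longrightarrow> acts (G\<lparr>carrier := H\<rparr>) H act X \<longleftrightarrow> acts G H act X"
  using group.subgroup_self[OF subgroup_imp_group, of H] by (auto simp: acts_def)

lemma sub_gset_acts:
  assumes H: "subgroup H G" and X: "finite_gset (G\<lparr>carrier := H\<rparr>) X"
  shows "acts G H (snd X) (fst X)"
  using group.gset_acts[OF subgroup_imp_group[OF H] X] by (simp add: acts_carrier_iff[OF H])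

lemma sub_finite_gsetI:
  assumes H: "subgroup H G" and "finite X" "acts G H act X"
  shows "finite_gset (G\<lparr>carrier := H\<rparr>) (X, \<lambda>g. restrict (act g) X)"
  by (rule group.finite_gsetI[OF subgroup_imp_group[OF H]]) (use assms in \<open>simp_all add: acts_carrier_iff[OF H]\<close>)

lemma stab_translate:
  assumes X: "acts G A act X" and a: "a \<in> A" and x: "x \<in> X"
  shows "{h \<in> A. act h (act a x) = act a x} = conj_subgroup G a {h \<in> A. act h x = x}"
proof -
  note A = acts_sub[OF X]
  have ac: "a \<in> carrier G" and ia: "inv a \<in> A"
    using subgroup.mem_carrier[OF A a] subgroup.m_inv_closed[OF A a] by auto
  have sub: "{h \<in> A. act h x = x} \<subseteq> carrier G" using subgroup.subset[OF A] by auto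
  note ax = acts_closed[OF X a x]
  show ?thesis
  proof (intro Set.set_eqI)
    fix h
    show "h \<in> {h \<in> A. act h (act a x) = act a x} \<longleftrightarrow> h \<in> conj_subgroup G a {h \<in> A. act h x = x}"
    proof (cases "h \<in> carrier G")
      case hc: True
      have AA: "inv a \<otimes> (h \<otimes> a) \<in> A \<longleftrightarrow> h \<in> A"
      proof
        assume *: "inv a \<otimes> (h \<otimes> a) \<in> A"
        have "a \<otimes> (inv a \<otimes> (h \<otimes> a)) \<otimes> inv a \<in> A"
          by (rule subgroup.m_closed[OF A subgroup.m_closed[OF A a *] ia])
        then show "h \<in> A" using ac hc by (simp add: m_assoc)
      next
        assume h: "h \<in> A"
        show "inv a \<otimes> (h \<otimes> a) \<in> A" by (rule subgroup.m_closed[OF A ia subgroup.m_closed[OF A h a]])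
      qed
      have "act (inv a \<otimes> (h \<otimes> a)) x = x \<longleftrightarrow> act h (act a x) = act a x" if h: "h \<in> A"
      proof -
        have e: "act (inv a \<otimes> (h \<otimes> a)) x = act (inv a) (act h (act a x))"
          using acts_mult[OF X ia subgroup.m_closed[OF A h a] x] acts_mult[OF X h a x] by simp
        have hax: "act h (act a x) \<in> X" by (rule acts_closed[OF X h ax])
        have 1: "act a (act (inv a) y) = y" "act (inv a) (act a y) = y" if "y \<in> X" for y
          using acts_mult[OF X a ia that] acts_mult[OF X ia a that] acts_one[OF X that] ac by simp_all
        show ?thesis unfolding e using 1(1)[OF hax] 1(2)[OF x] by metis
      qed
      then show ?thesis using conj_mem[OF ac sub, of h] AA hc by auto
    next
      case False
      then show ?thesis using subgroup.subset[OF A] conj_mem[OF ac sub, of h] by auto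
    qed
  qed
qed

lemma stab_subset: "acts G A act X \<Longrightarrow> {h \<in> A. act h x = x} \<subseteq> carrier G"
  using subgroup.subset[OF acts_sub] by blast

lemma stab_subgroup:
  assumes X: "acts G A act X" and x: "x \<in> X"
  shows "subgroup {h \<in> A. act h x = x} G"
proof -
  note A = acts_sub[OF X]
  have c: "a \<in> carrier G" if "a \<in> A" for a using subgroup.mem_carrier[OF A that] .
  show ?thesis
  proof (rule subgroupI)
    show "{h \<in> A. act h x = x} \<noteq> {}" using acts_one[OF X x] subgroup.one_closed[OF A] by blast
    show "inv a \<in> {h \<in> A. act h x = x}" if "a \<in> {h \<in> A. act h x = x}" for a
      using that acts_mult[OF X subgroup.m_inv_closed[OF A] _ x, of a a] acts_one[OF X x] subgroup.m_inv_closed[OF A] c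
      by auto
    show "a \<otimes> b \<in> {h \<in> A. act h x = x}" if "a \<in> {h \<in> A. act h x = x}" "b \<in> {h \<in> A. act h x = x}" for a b
      using that acts_mult[OF X _ _ x, of a b] subgroup.m_closed[OF A] by auto
  qed (use c in auto)
qed

lemma stab_invariant:
  assumes X: "acts G A act X" and P: "subgroup P G" "A \<subseteq> P"
  shows "invariant A act X (\<lambda>x. {#subconj G P {h \<in> A. act h x = x}#})"
  unfolding invariant_def
proof (intro ballI)
  fix a x assume a: "a \<in> A" and x: "x \<in> X"
  have "a \<in> P" using a P by auto
  then show "{#subconj G P {h \<in> A. act h (act a x) = act a x}#} = {#subconj G P {h \<in> A. act h x = x}#}"
    unfolding stab_translate[OF X a x] using subconj_conj[OF P(1) stab_subset[OF X]] by simp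
qed

lemma orbit_types_iso:
  assumes H: "subgroup H G" and P: "subgroup P G" "H \<subseteq> P"
    and X: "acts G H (snd X) (fst X)" and Y: "acts G H (snd Y) (fst Y)" and i: "gset_iso (G\<lparr>carrier := H\<rparr>) X Y"
  shows "orbit_types G P H X = orbit_types G P H Y"
proof -
  obtain f where f: "bij_betw f (fst X) (fst Y)" "\<And>g x. g \<in> H \<Longrightarrow> x \<in> fst X \<Longrightarrow> f (snd X g x) = snd Y g (f x)"
    using i unfolding gset_iso_def by auto
  show ?thesis unfolding orbit_types_def
  proof (rule osum_bij[OF X Y stab_invariant[OF X P] f(1)])
    fix x assume x: "x \<in> fst X"
    have "snd Y h (f x) = f x \<longleftrightarrow> snd X h x = x" if h: "h \<in> H" for h
      using f(2)[OF h x, symmetric] bij_betw_imp_inj_on[OF f(1)] acts_closed[OF X h x] x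
      by (simp add: inj_on_eq_iff)
    then have "{h \<in> H. snd X h x = x} = {h \<in> H. snd Y h (f x) = f x}" by blast
    then show "{#subconj G P {h \<in> H. snd X h x = x}#} = {#subconj G P {h \<in> H. snd Y h (f x) = f x}#}" by simp
  qed (rule f(2))
qed

lemma orbit_types_sum:
  assumes H: "subgroup H G" and P: "subgroup P G" "H \<subseteq> P" and fin: "finite (fst X)" "finite (fst Y)"
    and X: "acts G H (snd X) (fst X)" and Y: "acts G H (snd Y) (fst Y)"
  shows "orbit_types G P H (gset_sum X Y) = orbit_types G P H X + orbit_types G P H Y"
proof -
  let ?Z = "gset_sum X Y"
  let ?h = "\<lambda>z. {#subconj G P {h \<in> H. snd ?Z h z = z}#}"
  define W where "W b = (if b then Inl ` fst X else Inr ` fst Y)" for b :: bool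
  have Z: "acts G H (snd ?Z) (W b)" for b
    using X Y unfolding acts_def W_def gset_sum_def by auto
  have "fst ?Z = (\<Union>b\<in>UNIV. W b)" unfolding W_def gset_sum_def by (auto simp: UNIV_bool)
  then have "orbit_types G P H ?Z = (\<Sum>b\<in>UNIV. osum H (snd ?Z) (W b) ?h)"
    unfolding orbit_types_def by (simp only:) (rule osum_UN[OF Z], auto simp: W_def fin)
  also have "\<dots> = osum H (snd ?Z) (Inl ` fst X) ?h + osum H (snd ?Z) (Inr ` fst Y) ?h"
    by (simp add: UNIV_bool W_def add.commute)
  also have "osum H (snd ?Z) (Inl ` fst X) ?h = orbit_types G P H X"
    unfolding orbit_types_def
    by (rule osum_bij[OF X _ stab_invariant[OF X P], of _ _ Inl, symmetric])
       (use Z[of True] in \<open>auto simp: W_def gset_sum_def bij_betw_def InlI InrI\<close>)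
  also have "osum H (snd ?Z) (Inr ` fst Y) ?h = orbit_types G P H Y"
    unfolding orbit_types_def
    by (rule osum_bij[OF Y _ stab_invariant[OF Y P], of _ _ Inr, symmetric])
       (use Z[of False] in \<open>auto simp: W_def gset_sum_def bij_betw_def InlI InrI\<close>)
  finally show ?thesis .
qed

lemma coset_acts: "subgroup H G \<Longrightarrow> subgroup L G \<Longrightarrow> acts G H (lmult G) (kids G L H)"
  by (rule acts_kids) (simp_all add: cstab_self)

lemma coset_gset_finite:
  assumes H: "subgroup H G" and L: "subgroup L G"
  shows "finite_gset (G\<lparr>carrier := H\<rparr>) (coset_gset G H L)"
  unfolding coset_gset_def by (rule sub_finite_gsetI[OF H finite_kids coset_acts[OF H L]])

lemma kids_self_mem: "subgroup L G \<Longrightarrow> L \<subseteq> H \<Longrightarrow> L \<in> kids G L H"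
  by (simp add: kids_def coset_self)

text \<open>The inverse of the orbit map: a point y is sent to the set of elements that carry x to
  y, a left coset of the stabiliser of x.\<close>

lemma transitive_gset_iso:
  assumes H: "subgroup H G" and X: "acts G H (snd X) (fst X)" and x: "x \<in> fst X"
    and tr: "\<And>y. y \<in> fst X \<Longrightarrow> \<exists>h\<in>H. y = snd X h x" and L: "L = {h \<in> H. snd X h x = x}"
  shows "gset_iso (G\<lparr>carrier := H\<rparr>) X (coset_gset G H L)"
proof -
  note sL = stab_subgroup[OF X x, folded L]
  define f where "f y = {h \<in> H. snd X h x = y}" for y
  have hc: "h \<in> carrier G" if "h \<in> H" for h using subgroup.mem_carrier[OF H that] .
  have fu: "f (snd X u x) = u <# L" if u: "u \<in> H" for u
  proof (intro Set.set_eqI)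
    fix h
    show "h \<in> f (snd X u x) \<longleftrightarrow> h \<in> u <# L"
    proof (cases "h \<in> H")
      case h: True
      have iu: "inv u \<in> H" by (rule subgroup.m_inv_closed[OF H u])
      have iuh: "inv u \<otimes> h \<in> H" by (rule subgroup.m_closed[OF H iu h])
      have "h = u \<otimes> (inv u \<otimes> h)" using hc h u by simp
      then have 1: "snd X h x = snd X u (snd X (inv u \<otimes> h) x)" using acts_mult[OF X u iuh x] by simp
      have 2: "snd X (inv u \<otimes> h) x = snd X (inv u) (snd X h x)" by (rule acts_mult[OF X iu h x])
      have 3: "snd X (inv u) (snd X u x) = x" using acts_mult[OF X iu u x] acts_one[OF X x] hc[OF u] by simp
      have "snd X h x = snd X u x \<longleftrightarrow> snd X (inv u \<otimes> h) x = x" using 1 2 3 by metis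
      then show ?thesis using h iuh hc u lcos_mem[OF hc[OF u] subgroup.subset[OF sL]] by (simp add: f_def L)
    next
      case False
      have "h \<notin> u <# L"
      proof
        assume "h \<in> u <# L"
        then obtain l where "l \<in> L" "h = u \<otimes> l" by (auto simp: l_coset_def)
        then show False using False subgroup.m_closed[OF H u, of l] by (simp add: L)
      qed
      then show ?thesis using False by (simp add: f_def)
    qed
  qed
  have LH: "L \<subseteq> H" by (auto simp: L)
  show ?thesis
  proof (rule group.gset_isoI[OF subgroup_imp_group[OF H], of f])
    show "bij_betw f (fst X) (fst (coset_gset G H L))"
      unfolding bij_betw_def
    proof
      show "inj_on f (fst X)"
      proof (rule inj_onI)
        fix y z assume y: "y \<in> fst X" and "z \<in> fst X" and eq: "f y = f z"
        obtain h where h: "h \<in> H" "y = snd X h x" using tr[OF y] by auto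
        then have "h \<in> f z" using eq by (auto simp: f_def)
        then show "y = z" using h by (simp add: f_def)
      qed
      show "f ` fst X = fst (coset_gset G H L)"
      proof (intro equalityI subsetI)
        fix C assume "C \<in> f ` fst X"
        then obtain y where y: "y \<in> fst X" "C = f y" by auto
        obtain h where h: "h \<in> H" "y = snd X h x" using tr[OF y(1)] by auto
        have "C \<subseteq> H" using y by (auto simp: f_def)
        moreover have "C = h <# L" using y h fu by simp
        ultimately show "C \<in> fst (coset_gset G H L)" using cosetsI[OF hc[OF h(1)]] by (simp add: coset_gset_def kids_def)
      next
        fix C assume C: "C \<in> fst (coset_gset G H L)"
        then have Ck: "C \<in> kids G L H" by (simp add: coset_gset_def)
        obtain u where u: "u \<in> C" using cosets_nonempty[OF sL kids_cosets[OF Ck]] by auto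
        have U: "u \<in> H" "C = u <# L" using cosets_mem[OF sL kids_cosets[OF Ck] u] u Ck by (auto simp: kids_def)
        then show "C \<in> f ` fst X" using fu[OF U(1)] acts_closed[OF X U(1) x] by (metis image_eqI)
      qed
    qed
    fix g y assume "g \<in> carrier (G\<lparr>carrier := H\<rparr>)" and y: "y \<in> fst X"
    then have g: "g \<in> H" by simp
    obtain h where h: "h \<in> H" "y = snd X h x" using tr[OF y] by auto
    have "snd X g y = snd X (g \<otimes> h) x" using acts_mult[OF X g h(1) x] h by simp
    then have "f (snd X g y) = (g \<otimes> h) <# L" using fu[OF subgroup.m_closed[OF H g h(1)]] by simp
    also have "\<dots> = g <# f y" using fu[OF h(1)] h lcos_comp[OF hc[OF g] hc[OF h(1)] subgroup.subset[OF sL]] by simp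
    finally have e: "f (snd X g y) = g <# f y" .
    have "f y \<in> kids G L H" using fu[OF h(1)] h cosetsI[OF hc[OF h(1)], of L] by (auto simp: kids_def f_def)
    then show "f (snd X g y) = snd (coset_gset G H L) g (f y)" using e by (simp add: coset_gset_def)
  qed
qed

lemma coset_gset_acts: "subgroup H G \<Longrightarrow> subgroup L G \<Longrightarrow> acts G H (snd (coset_gset G H L)) (fst (coset_gset G H L))"
  using acts_restrict[OF coset_acts] by (simp add: coset_gset_def)

lemma coset_gset_transitive:
  assumes H: "subgroup H G" and L: "subgroup L G" "L \<subseteq> H" and y: "y \<in> fst (coset_gset G H L)"
  shows "\<exists>h\<in>H. y = snd (coset_gset G H L) h L"
proof -
  have yk: "y \<in> kids G L H" using y by (simp add: coset_gset_def)
  obtain u where u: "u \<in> y" using cosets_nonempty[OF L(1) kids_cosets[OF yk]] by auto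
  have "u \<in> H" "y = u <# L" using cosets_mem[OF L(1) kids_cosets[OF yk] u] u yk by (auto simp: kids_def)
  then show ?thesis using kids_self_mem[OF L] by (auto simp: coset_gset_def)
qed

lemma coset_gset_stab:
  assumes H: "subgroup H G" and L: "subgroup L G" "L \<subseteq> H"
  shows "L = {h \<in> H. snd (coset_gset G H L) h L = L}"
proof -
  have "{h \<in> H. h <# L = L} = H \<inter> cstab G L" using subgroup.subset[OF H] by (auto simp: cstab_def)
  also have "\<dots> = L" using cstab_self[OF L(1)] L(2) by auto
  finally show ?thesis using kids_self_mem[OF L] by (simp add: coset_gset_def)
qed

text \<open>In H/L the point pL has the conjugate of L by p as its stabiliser, so a change of base
  point gives the isomorphism.\<close>

lemma coset_gset_conj:
  assumes H: "subgroup H G" and L: "subgroup L G" "L \<subseteq> H" and p: "p \<in> H"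
  shows "gset_iso (G\<lparr>carrier := H\<rparr>) (coset_gset G H L) (coset_gset G H (conj_subgroup G p L))"
proof -
  let ?X = "coset_gset G H L"
  note X = coset_gset_acts[OF H L(1)]
  have Lm: "L \<in> fst ?X" using kids_self_mem[OF L] by (simp add: coset_gset_def)
  note pL = acts_closed[OF X p Lm]
  show ?thesis
  proof (rule transitive_gset_iso[OF H X pL])
    fix y assume y: "y \<in> fst ?X"
    obtain h where h: "h \<in> H" "y = snd ?X h L" using coset_gset_transitive[OF H L y] by auto
    have ip: "inv p \<in> H" by (rule subgroup.m_inv_closed[OF H p])
    have "snd ?X (h \<otimes> inv p) (snd ?X p L) = snd ?X (h \<otimes> inv p \<otimes> p) L"
      by (rule acts_mult[OF X subgroup.m_closed[OF H h(1) ip] p Lm, symmetric])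
    also have "h \<otimes> inv p \<otimes> p = h" using subgroup.mem_carrier[OF H] h(1) p by (simp add: m_assoc)
    finally show "\<exists>h\<in>H. y = snd ?X h (snd ?X p L)" using h subgroup.m_closed[OF H h(1) ip] by metis
  qed (use stab_translate[OF X p Lm] coset_gset_stab[OF H L] in simp)
qed

lemma orbit_types_transitive:
  assumes H: "subgroup H G" and P: "subgroup P G" "H \<subseteq> P" and X: "acts G H (snd X) (fst X)" and x: "x \<in> fst X"
    and tr: "\<And>y. y \<in> fst X \<Longrightarrow> \<exists>h\<in>H. y = snd X h x"
  shows "orbit_types G P H X = {#subconj G P {h \<in> H. snd X h x = x}#}"
  unfolding orbit_types_def by (rule osum_single[OF X x stab_invariant[OF X P] tr])

lemma orbit_types_coset:
  assumes H: "subgroup H G" and P: "subgroup P G" "H \<subseteq> P" and L: "subgroup L G" "L \<subseteq> H"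
  shows "orbit_types G P H (coset_gset G H L) = {#subconj G P L#}"
proof -
  have Lm: "L \<in> fst (coset_gset G H L)" using kids_self_mem[OF L] by (simp add: coset_gset_def)
  show ?thesis
    using orbit_types_transitive[OF H P coset_gset_acts[OF H L(1)] Lm coset_gset_transitive[OF H L]]
      coset_gset_stab[OF H L] by simp
qed

lemma osum_act_cong:
  assumes X: "acts G A act X" and eq: "\<And>a x. a \<in> A \<Longrightarrow> x \<in> X \<Longrightarrow> act' a x = act a x"
  shows "osum A act' X h = osum A act X h"
proof -
  have "orb A act' x = orb A act x" if "x \<in> X" for x using eq that unfolding orb_def by auto
  then have "orb A act' ` X = orb A act ` X" by auto
  then show ?thesis by (simp add: osum_def)
qed

text \<open>The stabiliser of a pair of cosets is the intersection of their stabilisers in H, so the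
  product of two basis elements of the Burnside algebra gives an entry of the table.\<close>

lemma orbit_types_product:
  assumes H: "subgroup H G" and B: "subgroup B G" "B \<subseteq> H" and C: "subgroup C G" "C \<subseteq> H"
  shows "orbit_types G (carrier G) H (gset_prod (coset_gset G H B) (coset_gset G H C)) = dtable G H B C"
proof -
  let ?Z = "gset_prod (coset_gset G H B) (coset_gset G H C)"
  let ?act = "\<lambda>p (y, z). (p <# y, p <# z)"
  let ?h = "\<lambda>q. {#subconj G (carrier G) {h \<in> H. snd ?Z h q = q}#}"
  note X = dtable_product(1)[OF H B C]
  have f: "fst ?Z = kids G B H \<times> kids G C H" by (simp add: gset_prod_def coset_gset_def)
  have e: "snd ?Z p q = ?act p q" if "p \<in> H" "q \<in> kids G B H \<times> kids G C H" for p q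
    using that by (auto simp: gset_prod_def coset_gset_def)
  have "orbit_types G (carrier G) H ?Z = osum H ?act (kids G B H \<times> kids G C H) ?h"
    unfolding orbit_types_def f by (rule osum_act_cong[OF X e])
  also have "\<dots> = osum H ?act (kids G B H \<times> kids G C H)
     (\<lambda>(y, z). {#subconj G (carrier G) (H \<inter> cstab G y \<inter> cstab G z)#})"
  proof (rule osum_cong[OF X])
    fix q assume q: "q \<in> kids G B H \<times> kids G C H"
    obtain y z where yz: "q = (y, z)" by (cases q)
    have "{h \<in> H. snd ?Z h q = q} = {h \<in> H. ?act h q = q}" using e q by auto
    also have "\<dots> = H \<inter> cstab G y \<inter> cstab G z" using subgroup.subset[OF H] by (auto simp: yz cstab_def)
    finally show "?h q = (case q of (y, z) \<Rightarrow> {#subconj G (carrier G) (H \<inter> cstab G y \<inter> cstab G z)#})"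
      using yz by simp
  qed
  finally show ?thesis using dtable_product(3)[OF H B C] by simp
qed

context
  fixes H and X :: "('a, 'c) gset"
  assumes H: "subgroup H G" and X: "finite_gset (G\<lparr>carrier := H\<rparr>) X"
begin

lemma ind_acts: "acts G H (snd X) (fst X)" by (rule sub_gset_acts[OF H X])

abbreviation (input) "qcl p \<equiv> ind_rel G H X `` {p}"

lemma ind_rel_iff:
  "((g, x), (g', x')) \<in> ind_rel G H X \<longleftrightarrow>
     g \<in> carrier G \<and> g' \<in> carrier G \<and> x \<in> fst X \<and> (\<exists>h\<in>H. g = g' \<otimes> h \<and> x' = snd X h x)"
  unfolding ind_rel_def using subgroup.mem_carrier[OF H] by auto

text \<open>\<open>ind_rel\<close> moves h from left to right only. It is an equivalence relation
  because H is a group: the inverse of h goes back, and two moves combine into one.\<close>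

lemma ind_equiv: "equiv (carrier G \<times> fst X) (ind_rel G H X)"
proof (rule equivI)
  note A = ind_acts
  have hc: "h \<in> carrier G" if "h \<in> H" for h using subgroup.mem_carrier[OF H that] .
  show "ind_rel G H X \<subseteq> (carrier G \<times> fst X) \<times> (carrier G \<times> fst X)"
    unfolding ind_rel_def using hc acts_closed[OF A] by auto
  show "refl_on (carrier G \<times> fst X) (ind_rel G H X)"
  proof (rule refl_onI)
    fix q assume "q \<in> carrier G \<times> fst X"
    then obtain g x where q: "q = (g, x)" "g \<in> carrier G" "x \<in> fst X" by auto
    have "g = g \<otimes> \<one> \<and> x = snd X \<one> x" using acts_one[OF A q(3)] q(2) by simp
    then show "(q, q) \<in> ind_rel G H X" unfolding q(1) ind_rel_iff using q subgroup.one_closed[OF H] by blast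
  qed
  show "sym (ind_rel G H X)"
  proof (rule symI)
    fix q r assume qr: "(q, r) \<in> ind_rel G H X"
    obtain g x g' x' where q: "q = (g, x)" "r = (g', x')" by (cases q, cases r)
    obtain h where h: "g \<in> carrier G" "g' \<in> carrier G" "x \<in> fst X" "h \<in> H" "g = g' \<otimes> h" "x' = snd X h x"
      using qr unfolding q ind_rel_iff by auto
    have ih: "inv h \<in> H" by (rule subgroup.m_inv_closed[OF H h(4)])
    have "snd X (inv h) x' = x" using acts_mult[OF A ih h(4,3)] acts_one[OF A h(3)] h(6) hc[OF h(4)] by simp
    moreover have "g' = g \<otimes> inv h" using h hc by (simp add: m_assoc)
    moreover have "x' \<in> fst X" using acts_closed[OF A h(4,3)] h(6) by simp
    ultimately show "(r, q) \<in> ind_rel G H X" unfolding q ind_rel_iff using h ih by metis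
  qed
  show "trans (ind_rel G H X)"
  proof (rule transI)
    fix q r s assume qr: "(q, r) \<in> ind_rel G H X" "(r, s) \<in> ind_rel G H X"
    obtain g x g' x' g'' x'' where q: "q = (g, x)" "r = (g', x')" "s = (g'', x'')" by (cases q, cases r, cases s)
    obtain h where h: "g \<in> carrier G" "g' \<in> carrier G" "x \<in> fst X" "h \<in> H" "g = g' \<otimes> h" "x' = snd X h x"
      using qr unfolding q ind_rel_iff by auto
    obtain k where k: "g'' \<in> carrier G" "k \<in> H" "g' = g'' \<otimes> k" "x'' = snd X k x'"
      using qr unfolding q ind_rel_iff by auto
    have "g = g'' \<otimes> (k \<otimes> h)" "x'' = snd X (k \<otimes> h) x"
      using h k hc acts_mult[OF A k(2) h(4,3)] by (simp_all add: m_assoc)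
    then show "(q, s) \<in> ind_rel G H X" unfolding q ind_rel_iff
      using h(1,3) k(1) subgroup.m_closed[OF H k(2) h(4)] by blast
  qed
qed

lemma qcl_eq_iff:
  assumes "g \<in> carrier G" "g' \<in> carrier G" "x \<in> fst X" "x' \<in> fst X"
  shows "qcl (g, x) = qcl (g', x') \<longleftrightarrow> (\<exists>h\<in>H. g = g' \<otimes> h \<and> x' = snd X h x)"
  using eq_equiv_class_iff[OF ind_equiv, of "(g, x)" "(g', x')"] assms ind_rel_iff by simp

lemma ind_fst: "fst (ind_gset G H X) = (\<lambda>p. qcl p) ` (carrier G \<times> fst X)"
  unfolding ind_gset_def quotient_def by auto

lemma ind_snd:
  assumes k: "k \<in> carrier G" and g: "g \<in> carrier G" and x: "x \<in> fst X"
  shows "snd (ind_gset G H X) k (qcl (g, x)) = qcl (k \<otimes> g, x)"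
proof -
  have m: "qcl (g, x) \<in> (carrier G \<times> fst X) // ind_rel G H X" using g x by (intro quotientI) auto
  have "(\<lambda>(g, x). (k \<otimes> g, x)) ` qcl (g, x) = qcl (k \<otimes> g, x)"
  proof (intro equalityI subsetI)
    fix q assume "q \<in> (\<lambda>(g, x). (k \<otimes> g, x)) ` qcl (g, x)"
    then obtain g' x' where q: "q = (k \<otimes> g', x')" "((g, x), (g', x')) \<in> ind_rel G H X" by auto
    then show "q \<in> qcl (k \<otimes> g, x)" using k subgroup.mem_carrier[OF H] by (auto simp: ind_rel_iff m_assoc)
  next
    fix q assume q: "q \<in> qcl (k \<otimes> g, x)"
    obtain g' x' where q': "q = (g', x')" by (cases q)
    have r: "((k \<otimes> g, x), (g', x')) \<in> ind_rel G H X" using q q' by simp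
    then obtain h where h: "g' \<in> carrier G" "h \<in> H" "k \<otimes> g = g' \<otimes> h" "x' = snd X h x" unfolding ind_rel_iff by auto
    have "g = inv k \<otimes> (k \<otimes> g)" using k g by simp
    also have "\<dots> = (inv k \<otimes> g') \<otimes> h" using h k subgroup.mem_carrier[OF H h(2)] by (simp add: m_assoc)
    finally have "((g, x), (inv k \<otimes> g', x')) \<in> ind_rel G H X" unfolding ind_rel_iff using h g x k by blast
    moreover have "q = (\<lambda>(g, x). (k \<otimes> g, x)) (inv k \<otimes> g', x')" using q' k h by simp
    ultimately show "q \<in> (\<lambda>(g, x). (k \<otimes> g, x)) ` qcl (g, x)" by (metis ImageI image_eqI singletonI)
  qed
  then show ?thesis unfolding ind_gset_def using m by simp
qed

lemma ind_gset_acts: "acts G (carrier G) (snd (ind_gset G H X)) (fst (ind_gset G H X))"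
  unfolding acts_def ind_fst by (auto simp: subgroup_self ind_snd m_assoc)

lemma ind_gset_finite: "finite_gset G (ind_gset G H X)"
proof -
  have ext: "snd (ind_gset G H X) g \<in> extensional (fst (ind_gset G H X))" for g
    unfolding ind_gset_def by simp
  have "finite (fst (ind_gset G H X))"
    unfolding ind_fst using finite_carrier X by (auto simp: finite_gset_def)
  then show ?thesis unfolding finite_gset_def group_action_iff using ind_gset_acts ext by simp
qed

lemma ind_stab:
  assumes x: "x \<in> fst X"
  shows "{g \<in> carrier G. snd (ind_gset G H X) g (qcl (\<one>, x)) = qcl (\<one>, x)} = {h \<in> H. snd X h x = x}"
proof -
  have "snd (ind_gset G H X) g (qcl (\<one>, x)) = qcl (\<one>, x) \<longleftrightarrow> g \<in> H \<and> snd X g x = x" if g: "g \<in> carrier G" for g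
  proof -
    have "snd (ind_gset G H X) g (qcl (\<one>, x)) = qcl (g, x)" using ind_snd[OF g one_closed x] g by simp
    then show ?thesis using qcl_eq_iff[OF g one_closed x x] subgroup.mem_carrier[OF H] by auto
  qed
  then show ?thesis using subgroup.mem_carrier[OF H] by blast
qed

text \<open>The map x \<mapsto> [1, x] matches the H-orbits on X with the G-orbits on the induced
  set and preserves stabilisers. This is the source of stability by induction.\<close>

lemma orbit_types_ind: "orbit_types G (carrier G) (carrier G) (ind_gset G H X) = orbit_types G (carrier G) H X"
  unfolding orbit_types_def
proof (rule osum_transfer[OF ind_acts ind_gset_acts, of _ _ "\<lambda>x. qcl (\<one>, x)", symmetric])
  show "invariant H (snd X) (fst X) (\<lambda>x. {#subconj G (carrier G) {h \<in> H. snd X h x = x}#})"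
    by (rule stab_invariant[OF ind_acts subgroup_self subgroup.subset[OF H]])
  show "invariant (carrier G) (snd (ind_gset G H X)) (fst (ind_gset G H X))
     (\<lambda>x. {#subconj G (carrier G) {h \<in> carrier G. snd (ind_gset G H X) h x = x}#})"
    by (rule stab_invariant[OF ind_gset_acts subgroup_self subset_refl])
  fix x assume x: "x \<in> fst X"
  show "qcl (\<one>, x) \<in> fst (ind_gset G H X)" unfolding ind_fst using x by auto
  show "{#subconj G (carrier G) {h \<in> H. snd X h x = x}#} =
     {#subconj G (carrier G) {h \<in> carrier G. snd (ind_gset G H X) h (qcl (\<one>, x)) = qcl (\<one>, x)}#}"
    unfolding ind_stab[OF x] ..
  show "\<exists>b\<in>carrier G. qcl (\<one>, snd X a x) = snd (ind_gset G H X) b (qcl (\<one>, x))" if a: "a \<in> H" for a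
  proof (rule bexI)
    have ac: "a \<in> carrier G" using subgroup.mem_carrier[OF H a] .
    show "a \<in> carrier G" by (rule ac)
    have "\<exists>h\<in>H. a = \<one> \<otimes> h \<and> snd X a x = snd X h x" by (rule bexI[of _ a]) (use a ac in simp_all)
    then have "qcl (a, x) = qcl (\<one>, snd X a x)"
      using qcl_eq_iff[OF ac one_closed x acts_closed[OF ind_acts a x]] by simp
    then show "qcl (\<one>, snd X a x) = snd (ind_gset G H X) a (qcl (\<one>, x))" using ind_snd[OF ac one_closed x] ac by simp
  qed
  show "\<exists>a\<in>H. x' = snd X a x" if "b \<in> carrier G" "x' \<in> fst X" "qcl (\<one>, x') = snd (ind_gset G H X) b (qcl (\<one>, x))" for b x'
  proof -
    have "qcl (b, x) = qcl (\<one>, x')" using that ind_snd[OF that(1) one_closed x] by simp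
    then show ?thesis using qcl_eq_iff[OF that(1) one_closed x that(2)] by blast
  qed
next
  fix y assume "y \<in> fst (ind_gset G H X)"
  then obtain g x where gx: "g \<in> carrier G" "x \<in> fst X" "y = qcl (g, x)" unfolding ind_fst by auto
  then show "\<exists>x\<in>fst X. \<exists>b\<in>carrier G. y = snd (ind_gset G H X) b (qcl (\<one>, x))"
    using ind_snd[OF gx(1) one_closed gx(2)] by (metis r_one)
qed

text \<open>Inducing H/L gives G/L: the class of (1, x) has stabiliser L in G, and its translates
  exhaust the induced set.\<close>

lemma ind_transitive_iso:
  assumes x: "x \<in> fst X" and tr: "\<And>y. y \<in> fst X \<Longrightarrow> \<exists>h\<in>H. y = snd X h x" and L: "L = {h \<in> H. snd X h x = x}"
  shows "gset_iso G (ind_gset G H X) (coset_gset G (carrier G) L)"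
proof -
  have m: "qcl (\<one>, x) \<in> fst (ind_gset G H X)" unfolding ind_fst using x by auto
  have "gset_iso (G\<lparr>carrier := carrier G\<rparr>) (ind_gset G H X) (coset_gset G (carrier G) L)"
  proof (rule transitive_gset_iso[OF subgroup_self ind_gset_acts m])
    show "L = {h \<in> carrier G. snd (ind_gset G H X) h (qcl (\<one>, x)) = qcl (\<one>, x)}" unfolding L ind_stab[OF x] ..
    fix y assume "y \<in> fst (ind_gset G H X)"
    then obtain g x' where gx: "g \<in> carrier G" "x' \<in> fst X" "y = qcl (g, x')" unfolding ind_fst by auto
    obtain h where h: "h \<in> H" "x' = snd X h x" using tr[OF gx(2)] by auto
    have hc: "h \<in> carrier G" using subgroup.mem_carrier[OF H h(1)] .
    have "\<exists>k\<in>H. g \<otimes> h = g \<otimes> k \<and> x' = snd X k x" using h by blast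
    then have "qcl (g \<otimes> h, x) = qcl (g, x')" using qcl_eq_iff[of "g \<otimes> h" g x x'] gx hc x by simp
    then have "y = snd (ind_gset G H X) (g \<otimes> h) (qcl (\<one>, x))"
      using ind_snd[of "g \<otimes> h" \<one> x] gx hc x by simp
    then show "\<exists>h\<in>carrier G. y = snd (ind_gset G H X) h (qcl (\<one>, x))" using gx hc by blast
  qed
  then show ?thesis by simp
qed

end

end

subsection \<open>Base change\<close>

text \<open>The additive group of \<open>R\<close> over the integers: the target for linear
  extensions from the free abelian groups that underlie the Burnside ring and the tensor
  product.\<close>

definition int_module :: "('r, 'k) ring_scheme \<Rightarrow> (int, 'r) module"
  where "int_module R = \<lparr>carrier = carrier R, monoid.mult = monoid.mult R, one = one R, zero = zero R, add = add R,
     smult = (\<lambda>k r. add_pow R (k :: int) r)\<rparr>"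

lemma int_module_simps [simp]:
  "carrier (int_module R) = carrier R" "add (int_module R) = add R" "zero (int_module R) = zero R"
  "smult (int_module R) = (\<lambda>k r. add_pow R k r)"
  by (simp_all add: int_module_def)

lemma int_ring_simps: "carrier \<Z> = UNIV" "add \<Z> = (+)" "monoid.mult \<Z> = (*)" "one \<Z> = 1" "zero \<Z> = 0"
  by (simp_all)

lemma int_module_module:
  assumes "ring R" shows "module \<Z> (int_module R)"
proof -
  interpret ring R by fact
  show ?thesis
  proof (rule moduleI[OF int_is_cring])
    show "abelian_group (int_module R)"
      by (rule abelian_groupI) (auto intro!: add.l_inv_ex simp: a_ac)
    fix k l :: int and x assume x: "x \<in> carrier (int_module R)"
    show "(k \<oplus>\<^bsub>\<Z>\<^esub> l) \<odot>\<^bsub>int_module R\<^esub> x = k \<odot>\<^bsub>int_module R\<^esub> x \<oplus>\<^bsub>int_module R\<^esub> l \<odot>\<^bsub>int_module R\<^esub> x"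
      using x by (simp add: int_ring_simps add.int_pow_mult)
    show "(k \<otimes>\<^bsub>\<Z>\<^esub> l) \<odot>\<^bsub>int_module R\<^esub> x = k \<odot>\<^bsub>int_module R\<^esub> (l \<odot>\<^bsub>int_module R\<^esub> x)"
      using x by (simp add: int_ring_simps add.int_pow_pow mult.commute)
  next
    fix k :: int and x y assume "x \<in> carrier (int_module R)" "y \<in> carrier (int_module R)"
    then show "k \<odot>\<^bsub>int_module R\<^esub> (x \<oplus>\<^bsub>int_module R\<^esub> y) = k \<odot>\<^bsub>int_module R\<^esub> x \<oplus>\<^bsub>int_module R\<^esub> k \<odot>\<^bsub>int_module R\<^esub> y"
      by (simp add: add.int_pow_distrib)
  qed (auto simp: int_ring_simps)
qed

lemma (in nc_algebra) quotient_map_linear: "ideal I A \<Longrightarrow> linear_on R A (quotient_algebra A I) (\<lambda>x. I +>\<^bsub>A\<^esub> x)"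
  by (rule linear_onI) (use quotient_ops(1)[OF _ _ _ R.one_closed] quotient_ops(3) quotient_carrier in auto)

lemma (in nc_algebra) quotient_class_eq:
  assumes S: "S \<subseteq> carrier A" and s: "u \<ominus>\<^bsub>A\<^esub> v \<in> S" and u: "u \<in> carrier A" and v: "v \<in> carrier A"
  shows "Idl\<^bsub>A\<^esub> S +>\<^bsub>A\<^esub> u = Idl\<^bsub>A\<^esub> S +>\<^bsub>A\<^esub> v"
  using quotient_eq_iff[OF genideal_ideal[OF S] u v] genideal_self[OF S] s by blast

lemma monoid_algebra_span:
  assumes R: "cring R" and x: "x \<in> carrier (monoid_algebra R M)"
  shows "x \<in> rspan R (monoid_algebra R M) (basis_vec R ` carrier M)"
  using R x[unfolded monoid_algebra_simps]
proof (induction rule: free_module_induct)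
  case zero
  have "(\<lambda>i. \<zero>\<^bsub>R\<^esub>) = \<zero>\<^bsub>monoid_algebra R M\<^esub>" by (simp add: monoid_algebra_simps free_module_simps)
  then show ?case using rspan.zero by metis
next
  case (add f g)
  show ?case using rspan.add[OF add(3,4)] by (simp add: monoid_algebra_simps)
next
  case (smult a i)
  show ?case using rspan.smult[OF smult(1) imageI[OF smult(2)], of "monoid_algebra R M" "basis_vec R"]
    by (simp add: monoid_algebra_simps)
qed

lemma quotient_span:
  assumes R: "cring R" and M: "monoid M" and I: "ideal I (monoid_algebra R M)"
    and X: "X \<in> carrier (quotient_algebra (monoid_algebra R M) I)"
  shows "X \<in> rspan R (quotient_algebra (monoid_algebra R M) I) ((\<lambda>w. I +>\<^bsub>monoid_algebra R M\<^esub> basis_vec R w) ` carrier M)"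
proof -
  let ?A = "monoid_algebra R M"
  interpret A: nc_algebra R ?A by (rule monoid_algebra_nc_algebra[OF R M])
  interpret Q: nc_algebra R "quotient_algebra ?A I" by (rule A.quotient_nc_algebra[OF I])
  have b: "basis_vec R ` carrier M \<subseteq> carrier ?A" using monoid_algebra_basis_closed[OF R M] by blast
  have T: "(\<lambda>w. I +>\<^bsub>?A\<^esub> basis_vec R w) ` carrier M \<subseteq> carrier (quotient_algebra ?A I)"
    unfolding A.quotient_carrier using b by blast
  obtain x where x: "x \<in> carrier ?A" "X = I +>\<^bsub>?A\<^esub> x" using X unfolding A.quotient_carrier by blast
  show ?thesis unfolding x(2)
  proof (rule linear_image_rspan[OF A.module_axioms Q.module_axioms b T A.quotient_map_linear[OF I] _ monoid_algebra_span[OF R x(1)]])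
    fix s assume "s \<in> basis_vec R ` carrier M"
    then obtain w where w: "w \<in> carrier M" "s = basis_vec R w" by blast
    show "I +>\<^bsub>?A\<^esub> s \<in> rspan R (quotient_algebra ?A I) ((\<lambda>w. I +>\<^bsub>?A\<^esub> basis_vec R w) ` carrier M)"
      unfolding w(2) by (rule rspan_base[OF Q.module_axioms T imageI[OF w(1)]])
  qed
qed

locale base_change_setup =
  fixes R :: "('r, 'k) ring_scheme" and B :: "('b, 'l) ring_scheme"
  assumes cR: "cring R" and rB: "ring B"
begin

sublocale R: cring R by (rule cR)
sublocale B: ring B by (rule rB)

abbreviation "TF \<equiv> tensor_free R B"
abbreviation "TI \<equiv> tensor_ideal R B"
abbreviation "BC \<equiv> base_change R B"
abbreviation "ten \<equiv> tensor_elem R B"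

lemma M: "monoid (R \<times>\<times> B)" by (rule DirProd_monoid) unfold_locales

lemma M_simps: "carrier (R \<times>\<times> B) = carrier R \<times> carrier B"
  "(r, x) \<otimes>\<^bsub>R \<times>\<times> B\<^esub> (s, y) = (r \<otimes>\<^bsub>R\<^esub> s, x \<otimes>\<^bsub>B\<^esub> y)" "\<one>\<^bsub>R \<times>\<times> B\<^esub> = (\<one>\<^bsub>R\<^esub>, \<one>\<^bsub>B\<^esub>)"
  by (simp_all add: DirProd_def)

sublocale F: nc_algebra \<Z> TF by (rule monoid_algebra_nc_algebra[OF int_is_cring M])

definition trels where "trels = ({basis_vec \<Z> (r \<oplus>\<^bsub>R\<^esub> s, x) \<ominus>\<^bsub>TF\<^esub>
        (basis_vec \<Z> (r, x) \<oplus>\<^bsub>TF\<^esub> basis_vec \<Z> (s, x))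
      |r s x. r \<in> carrier R \<and> s \<in> carrier R \<and> x \<in> carrier B} \<union>
     {basis_vec \<Z> (r, x \<oplus>\<^bsub>B\<^esub> y) \<ominus>\<^bsub>TF\<^esub>
        (basis_vec \<Z> (r, x) \<oplus>\<^bsub>TF\<^esub> basis_vec \<Z> (r, y))
      |r x y. r \<in> carrier R \<and> x \<in> carrier B \<and> y \<in> carrier B})"

lemma TI_alt: "TI = Idl\<^bsub>TF\<^esub> trels" by (simp add: tensor_ideal_def trels_def)

lemma bv_closed: "r \<in> carrier R \<Longrightarrow> x \<in> carrier B \<Longrightarrow> basis_vec \<Z> (r, x) \<in> carrier TF"
  using monoid_algebra_basis_closed[OF int_is_cring M] by (simp add: M_simps)

lemma trels_closed: "trels \<subseteq> carrier TF"
proof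
  fix u assume "u \<in> trels"
  then show "u \<in> carrier TF" unfolding trels_def
    by (elim UnE CollectE exE conjE) (simp_all add: bv_closed)
qed

lemma TI_ideal: "ideal TI TF" unfolding TI_alt by (rule F.genideal_ideal[OF trels_closed])

abbreviation "TQ \<equiv> quotient_algebra TF TI"

sublocale Q: nc_algebra \<Z> TQ by (rule F.quotient_nc_algebra[OF TI_ideal])

lemma BC_simps: "carrier BC = carrier TQ" "add BC = add TQ" "zero BC = zero TQ" "one BC = one TQ"
  "monoid.mult BC = monoid.mult TQ" "smult BC = (\<lambda>r X. ten r \<one>\<^bsub>B\<^esub> \<otimes>\<^bsub>TQ\<^esub> X)"
  by (simp_all add: base_change_def Let_def ring.extend_def module.fields_def quotient_algebra_simps FactRing_def)

lemma ten_alt: "ten r x = TI +>\<^bsub>TF\<^esub> basis_vec \<Z> (r, x)" by (simp add: tensor_elem_def)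

lemma ten_closed: "r \<in> carrier R \<Longrightarrow> x \<in> carrier B \<Longrightarrow> ten r x \<in> carrier TQ"
  unfolding ten_alt F.quotient_carrier using bv_closed by blast

lemma ten_mult:
  assumes "r \<in> carrier R" "x \<in> carrier B" "s \<in> carrier R" "y \<in> carrier B"
  shows "ten r x \<otimes>\<^bsub>TQ\<^esub> ten s y = ten (r \<otimes>\<^bsub>R\<^esub> s) (x \<otimes>\<^bsub>B\<^esub> y)"
  using F.quotient_ops(2)[OF TI_ideal bv_closed[OF assms(1,2)] bv_closed[OF assms(3,4)] UNIV_I]
    monoid_algebra_basis_mult[OF int_is_cring M, of "(r, x)" "(s, y)"] assms
  by (simp add: ten_alt M_simps)

lemma ten_add_l:
  assumes "r \<in> carrier R" "x \<in> carrier B" "s \<in> carrier R"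
  shows "ten (r \<oplus>\<^bsub>R\<^esub> s) x = ten r x \<oplus>\<^bsub>TQ\<^esub> ten s x"
proof -
  note b = bv_closed[OF assms(1,2)] bv_closed[OF assms(3,2)]
  have "basis_vec \<Z> (r \<oplus>\<^bsub>R\<^esub> s, x) \<ominus>\<^bsub>TF\<^esub> (basis_vec \<Z> (r, x) \<oplus>\<^bsub>TF\<^esub> basis_vec \<Z> (s, x)) \<in> trels"
    unfolding trels_def using assms by blast
  then have "ten (r \<oplus>\<^bsub>R\<^esub> s) x = TI +>\<^bsub>TF\<^esub> (basis_vec \<Z> (r, x) \<oplus>\<^bsub>TF\<^esub> basis_vec \<Z> (s, x))"
    unfolding ten_alt TI_alt using assms b bv_closed by (intro F.quotient_class_eq[OF trels_closed]) auto
  then show ?thesis using F.quotient_ops(1)[OF TI_ideal b UNIV_I] by (simp add: ten_alt)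
qed

lemma ten_add_r:
  assumes "r \<in> carrier R" "x \<in> carrier B" "y \<in> carrier B"
  shows "ten r (x \<oplus>\<^bsub>B\<^esub> y) = ten r x \<oplus>\<^bsub>TQ\<^esub> ten r y"
proof -
  note b = bv_closed[OF assms(1,2)] bv_closed[OF assms(1,3)]
  have "basis_vec \<Z> (r, x \<oplus>\<^bsub>B\<^esub> y) \<ominus>\<^bsub>TF\<^esub> (basis_vec \<Z> (r, x) \<oplus>\<^bsub>TF\<^esub> basis_vec \<Z> (r, y)) \<in> trels"
    unfolding trels_def using assms by blast
  then have "ten r (x \<oplus>\<^bsub>B\<^esub> y) = TI +>\<^bsub>TF\<^esub> (basis_vec \<Z> (r, x) \<oplus>\<^bsub>TF\<^esub> basis_vec \<Z> (r, y))"
    unfolding ten_alt TI_alt using assms b bv_closed by (intro F.quotient_class_eq[OF trels_closed]) auto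
  then show ?thesis using F.quotient_ops(1)[OF TI_ideal b UNIV_I] by (simp add: ten_alt)
qed

lemma ten_one: "\<one>\<^bsub>TQ\<^esub> = ten \<one>\<^bsub>R\<^esub> \<one>\<^bsub>B\<^esub>"
  by (simp add: quotient_algebra_simps monoid_algebra_simps M_simps ten_alt)

abbreviation "tens \<equiv> (\<lambda>w. ten (fst w) (snd w)) ` (carrier R \<times> carrier B)"

lemma tens_closed: "tens \<subseteq> carrier TQ" using ten_closed by auto

lemma ten_span: "X \<in> carrier TQ \<Longrightarrow> X \<in> rspan \<Z> TQ tens"
  using quotient_span[OF int_is_cring M TI_ideal, of X] by (simp add: M_simps ten_alt)

text \<open>The second factor is an arbitrary ring here. The elements r \<otimes> 1 are central
  nevertheless, because \<open>R\<close> is commutative, and this makes left multiplication by them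
  a scalar multiplication of an algebra.\<close>

lemma ten_scalar_central:
  assumes a: "a \<in> carrier R" and X: "X \<in> carrier TQ"
  shows "ten a \<one>\<^bsub>B\<^esub> \<otimes>\<^bsub>TQ\<^esub> X = X \<otimes>\<^bsub>TQ\<^esub> ten a \<one>\<^bsub>B\<^esub>"
proof -
  have ta: "ten a \<one>\<^bsub>B\<^esub> \<in> carrier TQ" by (rule ten_closed[OF a B.one_closed])
  have l: "linear_on \<Z> TQ TQ (\<lambda>X. ten a \<one>\<^bsub>B\<^esub> \<otimes>\<^bsub>TQ\<^esub> X)"
    by (rule linear_onI) (use ta in \<open>auto simp: Q.r_distr Q.smult_mult_r\<close>)
  have r: "linear_on \<Z> TQ TQ (\<lambda>X. X \<otimes>\<^bsub>TQ\<^esub> ten a \<one>\<^bsub>B\<^esub>)"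
    by (rule linear_onI) (use ta in \<open>auto simp: Q.l_distr Q.smult_mult_l\<close>)
  show ?thesis
  proof (rule linear_eq_on_rspan[OF Q.module_axioms Q.module_axioms tens_closed l r _ ten_span[OF X]])
    fix s assume "s \<in> tens"
    then obtain q x where qx: "q \<in> carrier R" "x \<in> carrier B" "s = ten q x" by auto
    show "ten a \<one>\<^bsub>B\<^esub> \<otimes>\<^bsub>TQ\<^esub> s = s \<otimes>\<^bsub>TQ\<^esub> ten a \<one>\<^bsub>B\<^esub>"
      unfolding qx(3) using ten_mult[OF a B.one_closed qx(1,2)] ten_mult[OF qx(1,2) a B.one_closed] a qx by (simp add: R.m_comm)
  qed
qed

lemma BC_nc_algebra: "nc_algebra R BC"
proof -
  have ta: "ten a \<one>\<^bsub>B\<^esub> \<in> carrier TQ" if "a \<in> carrier R" for a by (rule ten_closed[OF that B.one_closed])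
  have ring: "ring BC" by (rule ring_transfer[OF Q.ring_axioms]) (simp_all add: BC_simps)
  interpret BCr: ring BC by (rule ring)
  have mod: "module R BC"
  proof (rule moduleI[OF cR BCr.abelian_group_axioms], unfold BC_simps)
    fix a c X assume ac: "a \<in> carrier R" "c \<in> carrier R" and X: "X \<in> carrier TQ"
    show "ten (a \<oplus>\<^bsub>R\<^esub> c) \<one>\<^bsub>B\<^esub> \<otimes>\<^bsub>TQ\<^esub> X = ten a \<one>\<^bsub>B\<^esub> \<otimes>\<^bsub>TQ\<^esub> X \<oplus>\<^bsub>TQ\<^esub> ten c \<one>\<^bsub>B\<^esub> \<otimes>\<^bsub>TQ\<^esub> X"
      using ten_add_l[OF ac(1) B.one_closed ac(2)] Q.l_distr[OF ta[OF ac(1)] ta[OF ac(2)] X] by simp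
    show "ten (a \<otimes>\<^bsub>R\<^esub> c) \<one>\<^bsub>B\<^esub> \<otimes>\<^bsub>TQ\<^esub> X = ten a \<one>\<^bsub>B\<^esub> \<otimes>\<^bsub>TQ\<^esub> (ten c \<one>\<^bsub>B\<^esub> \<otimes>\<^bsub>TQ\<^esub> X)"
      using ten_mult[OF ac(1) B.one_closed ac(2) B.one_closed] Q.m_assoc[OF ta[OF ac(1)] ta[OF ac(2)] X] by simp
  next
    fix X assume X: "X \<in> carrier TQ"
    show "ten \<one>\<^bsub>R\<^esub> \<one>\<^bsub>B\<^esub> \<otimes>\<^bsub>TQ\<^esub> X = X" using X by (simp add: ten_one[symmetric])
  qed (use ta in \<open>simp_all add: Q.r_distr\<close>)
  show ?thesis
  proof (rule nc_algebra.intro[OF mod ring], rule nc_algebra_axioms.intro, unfold BC_simps)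
    fix a X Y assume a: "a \<in> carrier R" and X: "X \<in> carrier TQ" and Y: "Y \<in> carrier TQ"
    show "ten a \<one>\<^bsub>B\<^esub> \<otimes>\<^bsub>TQ\<^esub> X \<otimes>\<^bsub>TQ\<^esub> Y = ten a \<one>\<^bsub>B\<^esub> \<otimes>\<^bsub>TQ\<^esub> (X \<otimes>\<^bsub>TQ\<^esub> Y)"
      by (rule Q.m_assoc[OF ta[OF a] X Y])
    have "X \<otimes>\<^bsub>TQ\<^esub> (ten a \<one>\<^bsub>B\<^esub> \<otimes>\<^bsub>TQ\<^esub> Y) = X \<otimes>\<^bsub>TQ\<^esub> ten a \<one>\<^bsub>B\<^esub> \<otimes>\<^bsub>TQ\<^esub> Y"
      by (rule Q.m_assoc[OF X ta[OF a] Y, symmetric])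
    also have "\<dots> = ten a \<one>\<^bsub>B\<^esub> \<otimes>\<^bsub>TQ\<^esub> X \<otimes>\<^bsub>TQ\<^esub> Y" unfolding ten_scalar_central[OF a X] ..
    also have "\<dots> = ten a \<one>\<^bsub>B\<^esub> \<otimes>\<^bsub>TQ\<^esub> (X \<otimes>\<^bsub>TQ\<^esub> Y)" by (rule Q.m_assoc[OF ta[OF a] X Y])
    finally show "X \<otimes>\<^bsub>TQ\<^esub> (ten a \<one>\<^bsub>B\<^esub> \<otimes>\<^bsub>TQ\<^esub> Y) = ten a \<one>\<^bsub>B\<^esub> \<otimes>\<^bsub>TQ\<^esub> (X \<otimes>\<^bsub>TQ\<^esub> Y)" .
  qed
qed

lemma ten_scalar: "a \<in> carrier R \<Longrightarrow> r \<in> carrier R \<Longrightarrow> x \<in> carrier B \<Longrightarrow> a \<odot>\<^bsub>BC\<^esub> ten r x = ten (a \<otimes>\<^bsub>R\<^esub> r) x"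
  unfolding BC_simps using ten_mult[of a "\<one>\<^bsub>B\<^esub>" r x] by simp

text \<open>The universal property of base change: an additive map \<psi> from B to R extends to the
  R-linear map r \<otimes> x \<mapsto> r \<psi>(x).\<close>

lemma BC_functional:
  assumes \<psi>c: "\<And>x. x \<in> carrier B \<Longrightarrow> \<psi> x \<in> carrier R"
    and \<psi>a: "\<And>x y. x \<in> carrier B \<Longrightarrow> y \<in> carrier B \<Longrightarrow> \<psi> (x \<oplus>\<^bsub>B\<^esub> y) = \<psi> x \<oplus>\<^bsub>R\<^esub> \<psi> y"
  obtains \<phi> where "linear_on R BC (regular_module R) \<phi>"
    "\<And>r x. r \<in> carrier R \<Longrightarrow> x \<in> carrier B \<Longrightarrow> \<phi> (ten r x) = r \<otimes>\<^bsub>R\<^esub> \<psi> x"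
proof -
  let ?N = "int_module R"
  note N = int_module_module[OF R.ring_axioms]
  let ?g = "\<lambda>w. fst w \<otimes>\<^bsub>R\<^esub> \<psi> (snd w)"
  define L where "L = lin_ext \<Z> ?N ?g"
  have gc: "?g \<in> carrier (R \<times>\<times> B) \<rightarrow> carrier ?N" using \<psi>c by (auto simp: M_simps)
  have Llin: "linear_on \<Z> TF ?N L"
    using lin_ext_linear[OF N gc] unfolding L_def linear_on_def monoid_algebra_simps by simp
  have Lb: "L (basis_vec \<Z> (r, x)) = r \<otimes>\<^bsub>R\<^esub> \<psi> x" if "r \<in> carrier R" "x \<in> carrier B" for r x
    unfolding L_def using lin_ext_basis[OF N gc, of "(r, x)"] that by (simp add: M_simps)
  have Nm: "a \<ominus>\<^bsub>?N\<^esub> a = \<zero>\<^bsub>?N\<^esub>" if "a \<in> carrier R" for a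
  proof -
    interpret N: module \<Z> ?N by (rule N)
    show ?thesis using that N.M.r_neg[of a] by (simp add: a_minus_def)
  qed
  \<comment> \<open>The relations generate an ideal, so additivity is checked with arbitrary pairs p
    and q multiplied on either side; they are absorbed into the arguments.\<close>
  have Lz: "L x = \<zero>\<^bsub>?N\<^esub>" if x: "x \<in> TI" for x
  proof (rule genideal_linear_zero[OF int_is_cring M N Llin trels_closed _ x[unfolded TI_alt]])
    fix p q s assume p: "p \<in> carrier (R \<times>\<times> B)" and q: "q \<in> carrier (R \<times>\<times> B)" and s: "s \<in> trels"
    obtain p1 p2 where p': "p = (p1, p2)" "p1 \<in> carrier R" "p2 \<in> carrier B" using p by (auto simp: M_simps)
    obtain q1 q2 where q': "q = (q1, q2)" "q1 \<in> carrier R" "q2 \<in> carrier B" using q by (auto simp: M_simps)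
    note pc = bv_closed[OF p'(2,3)] and qc = bv_closed[OF q'(2,3)]
    have lin: "linear_on \<Z> TF ?N (\<lambda>s. L (basis_vec \<Z> p \<otimes>\<^bsub>TF\<^esub> s \<otimes>\<^bsub>TF\<^esub> basis_vec \<Z> q))"
      by (rule linear_on_comp[OF _ Llin], rule linear_onI)
         (use pc qc p' q' in \<open>auto simp: F.l_distr F.r_distr F.smult_mult_l F.smult_mult_r\<close>)
    have val: "L (basis_vec \<Z> p \<otimes>\<^bsub>TF\<^esub> basis_vec \<Z> (r, x) \<otimes>\<^bsub>TF\<^esub> basis_vec \<Z> q) = (p1 \<otimes>\<^bsub>R\<^esub> r \<otimes>\<^bsub>R\<^esub> q1) \<otimes>\<^bsub>R\<^esub> \<psi> (p2 \<otimes>\<^bsub>B\<^esub> x \<otimes>\<^bsub>B\<^esub> q2)"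
      if "r \<in> carrier R" "x \<in> carrier B" for r x
      using that p' q' Lb[of "p1 \<otimes>\<^bsub>R\<^esub> r \<otimes>\<^bsub>R\<^esub> q1" "p2 \<otimes>\<^bsub>B\<^esub> x \<otimes>\<^bsub>B\<^esub> q2"]
      by (simp add: monoid_algebra_basis_mult[OF int_is_cring M] M_simps)
    have split: "L (basis_vec \<Z> p \<otimes>\<^bsub>TF\<^esub> (u \<ominus>\<^bsub>TF\<^esub> (v \<oplus>\<^bsub>TF\<^esub> w)) \<otimes>\<^bsub>TF\<^esub> basis_vec \<Z> q) =
      L (basis_vec \<Z> p \<otimes>\<^bsub>TF\<^esub> u \<otimes>\<^bsub>TF\<^esub> basis_vec \<Z> q) \<ominus>\<^bsub>?N\<^esub>
        (L (basis_vec \<Z> p \<otimes>\<^bsub>TF\<^esub> v \<otimes>\<^bsub>TF\<^esub> basis_vec \<Z> q) \<oplus>\<^bsub>R\<^esub> L (basis_vec \<Z> p \<otimes>\<^bsub>TF\<^esub> w \<otimes>\<^bsub>TF\<^esub> basis_vec \<Z> q))"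
      if "u \<in> carrier TF" "v \<in> carrier TF" "w \<in> carrier TF" for u v w
      using linear_on_minus[OF F.module_axioms N lin that(1), of "v \<oplus>\<^bsub>TF\<^esub> w"] linear_onD(2)[OF lin that(2,3)] that by simp
    show "L (basis_vec \<Z> p \<otimes>\<^bsub>TF\<^esub> s \<otimes>\<^bsub>TF\<^esub> basis_vec \<Z> q) = \<zero>\<^bsub>?N\<^esub>"
      using s unfolding trels_def
    proof (elim UnE CollectE exE conjE)
      fix r s' x assume s: "s = basis_vec \<Z> (r \<oplus>\<^bsub>R\<^esub> s', x) \<ominus>\<^bsub>TF\<^esub> (basis_vec \<Z> (r, x) \<oplus>\<^bsub>TF\<^esub> basis_vec \<Z> (s', x))"
        and c: "r \<in> carrier R" "s' \<in> carrier R" "x \<in> carrier B"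
      have xc: "\<psi> (p2 \<otimes>\<^bsub>B\<^esub> x \<otimes>\<^bsub>B\<^esub> q2) \<in> carrier R" using \<psi>c c p' q' by simp
      have "(p1 \<otimes>\<^bsub>R\<^esub> (r \<oplus>\<^bsub>R\<^esub> s') \<otimes>\<^bsub>R\<^esub> q1) \<otimes>\<^bsub>R\<^esub> \<psi> (p2 \<otimes>\<^bsub>B\<^esub> x \<otimes>\<^bsub>B\<^esub> q2) =
        (p1 \<otimes>\<^bsub>R\<^esub> r \<otimes>\<^bsub>R\<^esub> q1) \<otimes>\<^bsub>R\<^esub> \<psi> (p2 \<otimes>\<^bsub>B\<^esub> x \<otimes>\<^bsub>B\<^esub> q2) \<oplus>\<^bsub>R\<^esub> (p1 \<otimes>\<^bsub>R\<^esub> s' \<otimes>\<^bsub>R\<^esub> q1) \<otimes>\<^bsub>R\<^esub> \<psi> (p2 \<otimes>\<^bsub>B\<^esub> x \<otimes>\<^bsub>B\<^esub> q2)"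
        using c p' q' xc by (simp add: R.l_distr R.r_distr)
      then show ?thesis
        unfolding s split[OF bv_closed[OF R.a_closed[OF c(1,2)] c(3)] bv_closed[OF c(1,3)] bv_closed[OF c(2,3)]]
          val[OF R.a_closed[OF c(1,2)] c(3)] val[OF c(1,3)] val[OF c(2,3)]
        using c p' q' xc by (simp add: Nm)
    next
      fix r x y assume s: "s = basis_vec \<Z> (r, x \<oplus>\<^bsub>B\<^esub> y) \<ominus>\<^bsub>TF\<^esub> (basis_vec \<Z> (r, x) \<oplus>\<^bsub>TF\<^esub> basis_vec \<Z> (r, y))"
        and c: "r \<in> carrier R" "x \<in> carrier B" "y \<in> carrier B"
      have xc: "\<psi> (p2 \<otimes>\<^bsub>B\<^esub> x \<otimes>\<^bsub>B\<^esub> q2) \<in> carrier R" "\<psi> (p2 \<otimes>\<^bsub>B\<^esub> y \<otimes>\<^bsub>B\<^esub> q2) \<in> carrier R" using \<psi>c c p' q' by simp_all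
      have "p2 \<otimes>\<^bsub>B\<^esub> (x \<oplus>\<^bsub>B\<^esub> y) \<otimes>\<^bsub>B\<^esub> q2 = p2 \<otimes>\<^bsub>B\<^esub> x \<otimes>\<^bsub>B\<^esub> q2 \<oplus>\<^bsub>B\<^esub> p2 \<otimes>\<^bsub>B\<^esub> y \<otimes>\<^bsub>B\<^esub> q2"
        using c p' q' by (simp add: B.l_distr B.r_distr)
      then have "(p1 \<otimes>\<^bsub>R\<^esub> r \<otimes>\<^bsub>R\<^esub> q1) \<otimes>\<^bsub>R\<^esub> \<psi> (p2 \<otimes>\<^bsub>B\<^esub> (x \<oplus>\<^bsub>B\<^esub> y) \<otimes>\<^bsub>B\<^esub> q2) =
        (p1 \<otimes>\<^bsub>R\<^esub> r \<otimes>\<^bsub>R\<^esub> q1) \<otimes>\<^bsub>R\<^esub> \<psi> (p2 \<otimes>\<^bsub>B\<^esub> x \<otimes>\<^bsub>B\<^esub> q2) \<oplus>\<^bsub>R\<^esub> (p1 \<otimes>\<^bsub>R\<^esub> r \<otimes>\<^bsub>R\<^esub> q1) \<otimes>\<^bsub>R\<^esub> \<psi> (p2 \<otimes>\<^bsub>B\<^esub> y \<otimes>\<^bsub>B\<^esub> q2)"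
        using c p' q' xc \<psi>a[of "p2 \<otimes>\<^bsub>B\<^esub> x \<otimes>\<^bsub>B\<^esub> q2" "p2 \<otimes>\<^bsub>B\<^esub> y \<otimes>\<^bsub>B\<^esub> q2"] by (simp add: R.r_distr)
      then show ?thesis
        unfolding s split[OF bv_closed[OF c(1) B.a_closed[OF c(2,3)]] bv_closed[OF c(1,2)] bv_closed[OF c(1,3)]]
          val[OF c(1) B.a_closed[OF c(2,3)]] val[OF c(1,2)] val[OF c(1,3)]
        using c p' q' xc by (simp add: Nm)
    qed
  qed
  show ?thesis
  proof (rule F.quotient_linear[OF TI_ideal N Llin Lz])
    fix \<phi> assume \<phi>: "linear_on \<Z> TQ ?N \<phi>" and e: "\<And>x. x \<in> carrier TF \<Longrightarrow> \<phi> (TI +>\<^bsub>TF\<^esub> x) = L x"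
    have \<phi>t: "\<phi> (ten r x) = r \<otimes>\<^bsub>R\<^esub> \<psi> x" if "r \<in> carrier R" "x \<in> carrier B" for r x
      unfolding ten_alt e[OF bv_closed[OF that]] by (rule Lb[OF that])
    \<comment> \<open>So far \<phi> is only additive. Compatibility with scalars of R is an identity
      of additive maps, so it suffices to check it on pure tensors.\<close>
    have hom: "\<phi> (ten a \<one>\<^bsub>B\<^esub> \<otimes>\<^bsub>TQ\<^esub> X) = a \<otimes>\<^bsub>R\<^esub> \<phi> X" if a: "a \<in> carrier R" and X: "X \<in> carrier TQ" for a X
    proof (rule linear_eq_on_rspan[OF Q.module_axioms N tens_closed _ _ _ ten_span[OF X]])
      have ta: "ten a \<one>\<^bsub>B\<^esub> \<in> carrier TQ" by (rule ten_closed[OF a B.one_closed])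
      show "linear_on \<Z> TQ ?N (\<lambda>X. \<phi> (ten a \<one>\<^bsub>B\<^esub> \<otimes>\<^bsub>TQ\<^esub> X))"
        by (rule linear_on_comp[OF _ \<phi>], rule linear_onI) (use ta in \<open>auto simp: Q.r_distr Q.smult_mult_r\<close>)
      show "linear_on \<Z> TQ ?N (\<lambda>X. a \<otimes>\<^bsub>R\<^esub> \<phi> X)"
        by (rule linear_on_comp[OF \<phi>], rule linear_onI) (use a in \<open>auto simp: R.r_distr R.add_pow_rdistr_int\<close>)
      fix s assume "s \<in> tens"
      then obtain q x where qx: "q \<in> carrier R" "x \<in> carrier B" "s = ten q x" by auto
      show "\<phi> (ten a \<one>\<^bsub>B\<^esub> \<otimes>\<^bsub>TQ\<^esub> s) = a \<otimes>\<^bsub>R\<^esub> \<phi> s"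
        unfolding qx(3) ten_mult[OF a B.one_closed qx(1,2)] B.l_one[OF qx(2)]
        using \<phi>t[OF R.m_closed[OF a qx(1)] qx(2)] \<phi>t[OF qx(1,2)] a qx \<psi>c by (simp add: R.m_assoc)
    qed
    have "linear_on R BC (regular_module R) \<phi>"
    proof (rule linear_onI, unfold BC_simps regular_module_simps)
      show "\<phi> x \<in> carrier R" if "x \<in> carrier TQ" for x using linear_onD(1)[OF \<phi> that] by simp
      show "\<phi> (x \<oplus>\<^bsub>TQ\<^esub> y) = \<phi> x \<oplus>\<^bsub>R\<^esub> \<phi> y" if "x \<in> carrier TQ" "y \<in> carrier TQ" for x y
        using linear_onD(2)[OF \<phi> that] by simp
    qed (rule hom)
    then show ?thesis using that \<phi>t by blast
  qed
qed

end

section \<open>The Burnside ring and its base change\<close>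

lemma (in group) gset_sum_cong:
  assumes "gset_iso G X X'" "gset_iso G Y Y'"
  shows "gset_iso G (gset_sum X Y) (gset_sum X' Y')"
proof -
  obtain f where f: "bij_betw f (fst X) (fst X')" "\<And>g x. g \<in> carrier G \<Longrightarrow> x \<in> fst X \<Longrightarrow> f (snd X g x) = snd X' g (f x)"
    using assms(1) unfolding gset_iso_def by auto
  obtain f' where f': "bij_betw f' (fst Y) (fst Y')" "\<And>g x. g \<in> carrier G \<Longrightarrow> x \<in> fst Y \<Longrightarrow> f' (snd Y g x) = snd Y' g (f' x)"
    using assms(2) unfolding gset_iso_def by auto
  have inj: "inj_on (map_sum f f') (Sum_Type.Plus (fst X) (fst Y))"
  proof (rule inj_onI)
    fix u v assume "u \<in> Sum_Type.Plus (fst X) (fst Y)" "v \<in> Sum_Type.Plus (fst X) (fst Y)" "map_sum f f' u = map_sum f f' v"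
    then show "u = v"
      using inj_onD[OF bij_betw_imp_inj_on[OF f(1)]] inj_onD[OF bij_betw_imp_inj_on[OF f'(1)]]
      by (cases u; cases v) auto
  qed
  have im: "map_sum f f' ` Sum_Type.Plus (fst X) (fst Y) = Sum_Type.Plus (f ` fst X) (f' ` fst Y)"
    unfolding Plus_def image_Un image_image by simp
  have bij: "bij_betw (map_sum f f') (fst (gset_sum X Y)) (fst (gset_sum X' Y'))"
    unfolding bij_betw_def gset_sum_def fst_conv im using inj bij_betw_imp_surj_on[OF f(1)] bij_betw_imp_surj_on[OF f'(1)] by simp
  have mem: "f x \<in> fst X'" if "x \<in> fst X" for x using f(1) that by (rule bij_betwE[rule_format])
  have mem': "f' x \<in> fst Y'" if "x \<in> fst Y" for x using f'(1) that by (rule bij_betwE[rule_format])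
  show ?thesis
  proof (rule gset_isoI[OF bij])
    fix g u assume g: "g \<in> carrier G" and u: "u \<in> fst (gset_sum X Y)"
    show "map_sum f f' (snd (gset_sum X Y) g u) = snd (gset_sum X' Y') g (map_sum f f' u)"
      using g u f(2) f'(2) mem mem' by (cases u) (simp_all add: gset_sum_def Plus_def image_iff)
  qed
qed

lemma (in abelian_group) idem_zero: "x \<in> carrier G \<Longrightarrow> x = x \<oplus> x \<Longrightarrow> x = \<zero>"
  using add.l_cancel_one[of x x] by simp

text \<open>A subset closed under sums and negatives is closed under integer multiples, by induction
  upwards and downwards from 0. It serves to compare spans over the integers with spans over
  \<open>R\<close>.\<close>

lemma int_smult_closed:
  assumes M: "module \<Z> M" and V: "V \<subseteq> carrier M" and z: "\<zero>\<^bsub>M\<^esub> \<in> V"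
    and a: "\<And>x y. x \<in> V \<Longrightarrow> y \<in> V \<Longrightarrow> x \<oplus>\<^bsub>M\<^esub> y \<in> V" and n: "\<And>x. x \<in> V \<Longrightarrow> \<ominus>\<^bsub>M\<^esub> x \<in> V" and x: "x \<in> V"
  shows "k \<odot>\<^bsub>M\<^esub> x \<in> V"
proof -
  interpret M: module \<Z> M by (rule M)
  have xc: "x \<in> carrier M" using V x by blast
  have e: "1 \<odot>\<^bsub>M\<^esub> x = x" "0 \<odot>\<^bsub>M\<^esub> x = \<zero>\<^bsub>M\<^esub>" "(- 1) \<odot>\<^bsub>M\<^esub> x = \<ominus>\<^bsub>M\<^esub> x"
    "\<And>k l. (k + l) \<odot>\<^bsub>M\<^esub> x = k \<odot>\<^bsub>M\<^esub> x \<oplus>\<^bsub>M\<^esub> l \<odot>\<^bsub>M\<^esub> x"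
    using M.smult_one[OF xc] M.smult_l_null[OF xc] M.smult_l_minus[OF _ xc, of 1] M.smult_l_distr[OF _ _ xc] by simp_all
  show ?thesis
  proof (induction k rule: int_induct[where k = 0])
    case base
    show ?case using z e(2) by simp
  next
    case (step1 i)
    show ?case using a[OF step1(2) x] e(1) e(4)[of i 1] by simp
  next
    case (step2 i)
    show ?case using a[OF step2(2) n[OF x]] e(3) e(4)[of i "- 1"] by simp
  qed
qed

locale burnside_setup =
  fixes R :: "('r, 'k) ring_scheme" and K :: "('g, 'l) monoid_scheme"
  assumes cR: "cring R" and gK: "group K"
begin

sublocale R: cring R by (rule cR)
sublocale K: group K by (rule gK)

abbreviation "BF \<equiv> burnside_free K"
abbreviation "BI \<equiv> burnside_ideal K"
abbreviation "BQ \<equiv> quotient_algebra BF BI"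
abbreviation "BA \<equiv> burnside_algebra R K"
abbreviation "el \<equiv> burnside_elem K"
abbreviation "cl \<equiv> burnside_class R K"

sublocale F: nc_algebra \<Z> BF by (rule monoid_algebra_nc_algebra[OF int_is_cring K.gset_monoid_monoid])

definition brels where "brels = {basis_vec \<Z> (gset_class K (gset_sum X Y)) \<ominus>\<^bsub>BF\<^esub>
       (basis_vec \<Z> (gset_class K X) \<oplus>\<^bsub>BF\<^esub> basis_vec \<Z> (gset_class K Y))
     |(X :: ('g, nat) gset) (Y :: ('g, nat) gset). finite_gset K X \<and> finite_gset K Y}"

lemma BI_alt: "BI = Idl\<^bsub>BF\<^esub> brels" by (simp add: burnside_ideal_def brels_def)

lemma bvec_closed: "finite_gset K X \<Longrightarrow> basis_vec \<Z> (gset_class K X) \<in> carrier BF"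
  by (rule monoid_algebra_basis_closed[OF int_is_cring K.gset_monoid_monoid K.gset_class_carrier])

lemma brels_closed: "brels \<subseteq> carrier BF"
proof
  fix u assume "u \<in> brels"
  then show "u \<in> carrier BF" unfolding brels_def
    by (elim CollectE exE conjE) (simp add: bvec_closed K.finite_gset_sum)
qed

lemma BI_ideal: "ideal BI BF" unfolding BI_alt by (rule F.genideal_ideal[OF brels_closed])

sublocale Q: nc_algebra \<Z> BQ by (rule F.quotient_nc_algebra[OF BI_ideal])

lemma BR_simps: "carrier (burnside_ring K) = carrier BQ" "add (burnside_ring K) = add BQ"
  "zero (burnside_ring K) = zero BQ" "one (burnside_ring K) = one BQ" "monoid.mult (burnside_ring K) = monoid.mult BQ"
  by (simp_all add: burnside_ring_def quotient_algebra_simps FactRing_def)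

lemma BR_ring: "ring (burnside_ring K)"
  by (rule ring_transfer[OF Q.ring_axioms]) (simp_all add: BR_simps)

sublocale T: base_change_setup R "burnside_ring K" by (rule base_change_setup.intro[OF cR BR_ring])

lemma BA_nc_algebra: "nc_algebra R BA" unfolding burnside_algebra_def by (rule T.BC_nc_algebra)

sublocale A: nc_algebra R BA by (rule BA_nc_algebra)

lemma el_alt: "el X = BI +>\<^bsub>BF\<^esub> basis_vec \<Z> (gset_class K X)" by (simp add: burnside_elem_def)

lemma el_closed: "finite_gset K X \<Longrightarrow> el X \<in> carrier (burnside_ring K)"
  unfolding BR_simps el_alt F.quotient_carrier by (rule imageI, rule bvec_closed)

lemma el_cong: "finite_gset K X \<Longrightarrow> gset_iso K X Y \<Longrightarrow> el X = el Y"
  unfolding el_alt by (simp add: K.gset_class_cong)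

text \<open>The defining relations concern sets on natural numbers only; copies there give
  additivity for sets of any type.\<close>

lemma el_sum:
  fixes X :: "('g, 'c) gset" and Y :: "('g, 'd) gset"
  assumes X: "finite_gset K X" and Y: "finite_gset K Y"
  shows "el (gset_sum X Y) = el X \<oplus>\<^bsub>burnside_ring K\<^esub> el Y"
proof -
  obtain X' :: "('g, nat) gset" where X': "finite_gset K X'" "gset_iso K X X'" by (rule K.gset_nat_copy[OF X])
  obtain Y' :: "('g, nat) gset" where Y': "finite_gset K Y'" "gset_iso K Y Y'" by (rule K.gset_nat_copy[OF Y])
  have "el (gset_sum X' Y') = BI +>\<^bsub>BF\<^esub> (basis_vec \<Z> (gset_class K X') \<oplus>\<^bsub>BF\<^esub> basis_vec \<Z> (gset_class K Y'))"
    unfolding el_alt BI_alt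
  proof (rule F.quotient_class_eq[OF brels_closed])
    show "basis_vec \<Z> (gset_class K (gset_sum X' Y')) \<ominus>\<^bsub>BF\<^esub>
       (basis_vec \<Z> (gset_class K X') \<oplus>\<^bsub>BF\<^esub> basis_vec \<Z> (gset_class K Y')) \<in> brels"
      unfolding brels_def using X'(1) Y'(1) by blast
  qed (simp_all add: bvec_closed X' Y' K.finite_gset_sum)
  also have "\<dots> = el X' \<oplus>\<^bsub>burnside_ring K\<^esub> el Y'"
    unfolding BR_simps el_alt
    by (rule F.quotient_ops(1)[OF BI_ideal bvec_closed[OF X'(1)] bvec_closed[OF Y'(1)] UNIV_I, symmetric])
  finally show ?thesis
    using el_cong[OF K.finite_gset_sum[OF X Y] K.gset_sum_cong[OF X'(2) Y'(2)]] el_cong[OF X X'(2)] el_cong[OF Y Y'(2)]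
    by simp
qed

lemma el_prod:
  assumes X: "finite_gset K X" and Y: "finite_gset K Y"
  shows "el X \<otimes>\<^bsub>burnside_ring K\<^esub> el Y = el (gset_prod X Y)"
  unfolding BR_simps el_alt F.quotient_ops(2)[OF BI_ideal bvec_closed[OF X] bvec_closed[OF Y] UNIV_I]
    monoid_algebra_basis_mult[OF int_is_cring K.gset_monoid_monoid K.gset_class_carrier[OF X] K.gset_class_carrier[OF Y]]
    K.gset_monoid_mult[OF X Y] ..

abbreviation "nat_gsets \<equiv> {X :: ('g, nat) gset. finite_gset K X}"

lemma el_span: 
  assumes "x \<in> carrier BQ" shows "x \<in> rspan \<Z> BQ (el ` nat_gsets)"
proof -
  have "(\<lambda>w. BI +>\<^bsub>BF\<^esub> basis_vec \<Z> w) ` carrier (gset_monoid K) = el ` nat_gsets"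
    unfolding el_alt by (auto simp: gset_monoid_def)
  then show ?thesis using quotient_span[OF int_is_cring K.gset_monoid_monoid BI_ideal assms] by simp
qed

lemma BA_simps: "carrier BA = carrier T.TQ" "add BA = add T.TQ" "zero BA = zero T.TQ" "monoid.mult BA = monoid.mult T.TQ"
  by (simp_all add: burnside_algebra_def T.BC_simps)

lemma cl_alt: "cl X = T.ten \<one>\<^bsub>R\<^esub> (el X)" by (simp add: burnside_class_def)

lemma cl_closed: "finite_gset K X \<Longrightarrow> cl X \<in> carrier BA"
  unfolding cl_alt BA_simps by (rule T.ten_closed[OF R.one_closed el_closed])

lemma cl_cong: "finite_gset K X \<Longrightarrow> gset_iso K X Y \<Longrightarrow> cl X = cl Y"
  unfolding cl_alt by (simp add: el_cong)

lemma cl_sum: "finite_gset K X \<Longrightarrow> finite_gset K Y \<Longrightarrow> cl (gset_sum X Y) = cl X \<oplus>\<^bsub>BA\<^esub> cl Y"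
  unfolding cl_alt BA_simps by (simp add: el_sum T.ten_add_r el_closed)

lemma cl_prod: "finite_gset K X \<Longrightarrow> finite_gset K Y \<Longrightarrow> cl X \<otimes>\<^bsub>BA\<^esub> cl Y = cl (gset_prod X Y)"
  unfolding cl_alt BA_simps by (simp add: T.ten_mult el_closed el_prod)

text \<open>The disjoint union of an empty set with itself is again that set, so its class is equal
  to its own double.\<close>

lemma cl_empty:
  assumes X: "finite_gset K X" and e: "fst X = {}" shows "cl X = \<zero>\<^bsub>BA\<^esub>"
proof -
  \<comment> \<open>Any map will do, since both sets are empty.\<close>
  have "gset_iso K (gset_sum X X) X"
    by (rule K.gset_isoI[of undefined]) (simp_all add: gset_sum_def e bij_betw_def Plus_def)
  then have "cl X = cl X \<oplus>\<^bsub>BA\<^esub> cl X" using cl_cong[OF K.finite_gset_sum[OF X X]] cl_sum[OF X X] by metis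
  then show ?thesis by (rule abelian_group.idem_zero[OF A.abelian_group_axioms cl_closed[OF X]])
qed

text \<open>Elements are built in two layers of integral combinations, of tensors and of classes of
  sets. A scalar from R is pulled out of each tensor, and integral multiples are absorbed because
  the R-span is an additive subgroup.\<close>

lemma cl_span:
  assumes x: "x \<in> carrier BA" shows "x \<in> rspan R BA (cl ` nat_gsets)"
proof -
  let ?S = "cl ` nat_gsets"
  let ?V = "rspan R BA ?S"
  have S: "?S \<subseteq> carrier BA" using cl_closed by blast
  have sm: "a \<odot>\<^bsub>BA\<^esub> v \<in> ?V" if "a \<in> carrier R" "v \<in> ?V" for a v
    by (rule rspan_smult_closed[OF A.module_axioms S that(2,1)])
  have Vc: "?V \<subseteq> carrier BA" using rspan_closed[OF A.module_axioms S] by blast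
  have neg: "\<ominus>\<^bsub>BA\<^esub> v \<in> ?V" if v: "v \<in> ?V" for v
  proof -
    have "(\<ominus>\<^bsub>R\<^esub> \<one>\<^bsub>R\<^esub>) \<odot>\<^bsub>BA\<^esub> v = \<ominus>\<^bsub>BA\<^esub> v"
      using A.smult_l_minus[OF R.one_closed subsetD[OF Vc v]] A.smult_one[OF subsetD[OF Vc v]] by simp
    then show ?thesis using sm[OF _ v, of "\<ominus>\<^bsub>R\<^esub> \<one>\<^bsub>R\<^esub>"] by simp
  qed
  have ai: "a_inv BA = a_inv T.TQ" by (intro ext) (simp add: a_inv_def m_inv_def BA_simps)
  have aiB: "a_inv (burnside_ring K) = a_inv BQ" by (intro ext) (simp add: a_inv_def m_inv_def BR_simps)
  have tz: "T.ten \<one>\<^bsub>R\<^esub> \<zero>\<^bsub>BQ\<^esub> = \<zero>\<^bsub>BA\<^esub>"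
  proof -
    have c: "T.ten \<one>\<^bsub>R\<^esub> \<zero>\<^bsub>burnside_ring K\<^esub> \<in> carrier BA"
      unfolding BA_simps by (rule T.ten_closed[OF R.one_closed T.B.zero_closed])
    have "T.ten \<one>\<^bsub>R\<^esub> \<zero>\<^bsub>burnside_ring K\<^esub> = T.ten \<one>\<^bsub>R\<^esub> \<zero>\<^bsub>burnside_ring K\<^esub> \<oplus>\<^bsub>BA\<^esub> T.ten \<one>\<^bsub>R\<^esub> \<zero>\<^bsub>burnside_ring K\<^esub>"
      unfolding BA_simps using T.ten_add_r[OF R.one_closed T.B.zero_closed T.B.zero_closed] by simp
    then have "T.ten \<one>\<^bsub>R\<^esub> \<zero>\<^bsub>burnside_ring K\<^esub> = \<zero>\<^bsub>BA\<^esub>"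
      by (rule abelian_group.idem_zero[OF A.abelian_group_axioms c])
    then show ?thesis by (simp add: BR_simps)
  qed
  \<comment> \<open>An additive subgroup of the Burnside ring that contains all classes of sets,
    hence everything.\<close>
  define W where "W = {b \<in> carrier BQ. T.ten \<one>\<^bsub>R\<^esub> b \<in> ?V}"
  have Wadd: "b \<oplus>\<^bsub>BQ\<^esub> c \<in> W" if "b \<in> W" "c \<in> W" for b c
  proof -
    have bc: "b \<in> carrier BQ" "c \<in> carrier BQ" "T.ten \<one>\<^bsub>R\<^esub> b \<in> ?V" "T.ten \<one>\<^bsub>R\<^esub> c \<in> ?V" using that by (auto simp: W_def)
    have "T.ten \<one>\<^bsub>R\<^esub> (b \<oplus>\<^bsub>BQ\<^esub> c) = T.ten \<one>\<^bsub>R\<^esub> b \<oplus>\<^bsub>BA\<^esub> T.ten \<one>\<^bsub>R\<^esub> c"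
      using T.ten_add_r[OF R.one_closed, of b c] bc(1,2) by (simp add: BR_simps BA_simps)
    then show ?thesis unfolding W_def using rspan.add[OF bc(3,4)] bc(1,2) by simp
  qed
  have Wzero: "\<zero>\<^bsub>BQ\<^esub> \<in> W" unfolding W_def using tz rspan.zero[of BA R ?S] by simp
  have Wneg: "\<ominus>\<^bsub>BQ\<^esub> b \<in> W" if "b \<in> W" for b
  proof -
    have b: "b \<in> carrier BQ" "T.ten \<one>\<^bsub>R\<^esub> b \<in> ?V" using that by (auto simp: W_def)
    have c: "T.ten \<one>\<^bsub>R\<^esub> b \<in> carrier BA" "T.ten \<one>\<^bsub>R\<^esub> (\<ominus>\<^bsub>BQ\<^esub> b) \<in> carrier BA"
      unfolding BA_simps by (rule T.ten_closed[OF R.one_closed], simp add: BR_simps b)+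
    have "T.ten \<one>\<^bsub>R\<^esub> (\<ominus>\<^bsub>BQ\<^esub> b) \<oplus>\<^bsub>BA\<^esub> T.ten \<one>\<^bsub>R\<^esub> b = \<zero>\<^bsub>BA\<^esub>"
      using T.ten_add_r[OF R.one_closed, of "\<ominus>\<^bsub>BQ\<^esub> b" b] b(1) tz by (simp add: BR_simps BA_simps Q.l_neg)
    then have "T.ten \<one>\<^bsub>R\<^esub> (\<ominus>\<^bsub>BQ\<^esub> b) = \<ominus>\<^bsub>BA\<^esub> (T.ten \<one>\<^bsub>R\<^esub> b)" by (rule A.minus_equality[OF _ c, symmetric])
    then show ?thesis unfolding W_def using neg[OF b(2)] b(1) by simp
  qed
  have base: "el X \<in> W" if "X \<in> nat_gsets" for X :: "('g, nat) gset"
    unfolding W_def using that el_closed[of X] rspan_base[OF A.module_axioms S imageI[OF that]] by (simp add: BR_simps cl_alt)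
  have W: "b \<in> W" if "b \<in> carrier BQ" for b
    using el_span[OF that]
  proof induction
    case zero
    show ?case by (rule Wzero)
  next
    case (add x y)
    show ?case by (rule Wadd[OF add(3,4)])
  next
    case (smult a s)
    have "s \<in> W" using smult(2) base by blast
    show ?case by (rule int_smult_closed[OF Q.module_axioms _ Wzero Wadd Wneg \<open>s \<in> W\<close>]) (simp_all add: W_def subset_iff)
  qed
  have tens: "s \<in> ?V" if s: "s \<in> T.tens" for s
  proof -
    obtain w where w: "s = T.ten (fst w) (snd w)" "w \<in> carrier R \<times> carrier (burnside_ring K)" using s by (rule imageE)
    define r b where "r = fst w" and "b = snd w"
    have rb: "r \<in> carrier R" "b \<in> carrier BQ" "s = T.ten r b" using w unfolding r_def b_def BR_simps mem_Times_iff by simp_all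
    have "s = r \<odot>\<^bsub>BA\<^esub> T.ten \<one>\<^bsub>R\<^esub> b"
      using T.ten_scalar[OF rb(1) R.one_closed, of b] rb by (simp add: BR_simps burnside_algebra_def)
    moreover have "T.ten \<one>\<^bsub>R\<^esub> b \<in> ?V" using W[OF rb(2)] by (simp add: W_def)
    ultimately show ?thesis using sm[OF rb(1)] by simp
  qed
  show ?thesis
    using T.ten_span[OF x[unfolded BA_simps]]
  proof induction
    case zero
    show ?case using rspan.zero[of BA R ?S] by (simp add: BA_simps)
  next
    case (add x y)
    show ?case using rspan.add[OF add(3,4)] by (simp add: BA_simps)
  next
    case (smult a s)
    show ?case
    proof (rule int_smult_closed[OF T.Q.module_axioms _ _ _ _ tens[OF smult(2)]])
      show "?V \<subseteq> carrier T.TQ" using Vc by (simp add: BA_simps)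
      show "\<zero>\<^bsub>T.TQ\<^esub> \<in> ?V" using rspan.zero[of BA R ?S] by (simp add: BA_simps)
      show "x \<oplus>\<^bsub>T.TQ\<^esub> y \<in> ?V" if "x \<in> ?V" "y \<in> ?V" for x y using rspan.add[OF that] by (simp add: BA_simps)
      show "\<ominus>\<^bsub>T.TQ\<^esub> x \<in> ?V" if "x \<in> ?V" for x using neg[OF that] by (simp add: ai)
    qed
  qed
qed

text \<open>Additivity on disjoint unions is enough, although the relations generate an ideal:
  multiplied by sets on both sides, a relation becomes by distributivity a relation of the same kind
  for the products.\<close>

lemma burnside_functional:
  fixes h :: "('g, nat) gset set \<Rightarrow> 'r"
  assumes hc: "\<And>c. h c \<in> carrier R"
    and hs: "\<And>(X :: ('g, nat) gset) (Y :: ('g, nat) gset). finite_gset K X \<Longrightarrow> finite_gset K Y \<Longrightarrow>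
      h (gset_class K (gset_sum X Y)) = h (gset_class K X) \<oplus>\<^bsub>R\<^esub> h (gset_class K Y)"
  obtains \<phi> where "linear_on R BA (regular_module R) \<phi>"
    "\<And>c. c \<in> carrier (gset_monoid K) \<Longrightarrow> \<phi> (T.ten \<one>\<^bsub>R\<^esub> (BI +>\<^bsub>BF\<^esub> basis_vec \<Z> c)) = h c"
proof -
  let ?N = "int_module R"
  note N = int_module_module[OF R.ring_axioms]
  note M = K.gset_monoid_monoid
  define L where "L = lin_ext \<Z> ?N h"
  have gc: "h \<in> carrier (gset_monoid K) \<rightarrow> carrier ?N" using hc by simp
  have Llin: "linear_on \<Z> BF ?N L"
    using lin_ext_linear[OF N gc] unfolding L_def linear_on_def monoid_algebra_simps by simp
  have Lb: "L (basis_vec \<Z> c) = h c" if "c \<in> carrier (gset_monoid K)" for c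
    unfolding L_def by (rule lin_ext_basis[OF N gc that])
  have Nm: "a \<ominus>\<^bsub>?N\<^esub> a = \<zero>\<^bsub>?N\<^esub>" if "a \<in> carrier R" for a
  proof -
    interpret N: module \<Z> ?N by (rule N)
    show ?thesis using that N.M.r_neg[of a] by (simp add: a_minus_def)
  qed
  \<comment> \<open>The products of three sets live on a product type, so additivity is needed there
    too; it is inherited through copies on the natural numbers.\<close>
  have hsum: "h (gset_class K (gset_sum X Y)) = h (gset_class K X) \<oplus>\<^bsub>R\<^esub> h (gset_class K Y)"
    if X: "finite_gset K X" and Y: "finite_gset K Y" for X Y :: "('g, (nat \<times> nat) \<times> nat) gset"
  proof -
    obtain X' :: "('g, nat) gset" where X': "finite_gset K X'" "gset_iso K X X'" by (rule K.gset_nat_copy[OF X])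
    obtain Y' :: "('g, nat) gset" where Y': "finite_gset K Y'" "gset_iso K Y Y'" by (rule K.gset_nat_copy[OF Y])
    show ?thesis using hs[OF X'(1) Y'(1)] K.gset_class_cong[OF X X'(2)] K.gset_class_cong[OF Y Y'(2)]
      K.gset_class_cong[OF K.finite_gset_sum[OF X Y] K.gset_sum_cong[OF X'(2) Y'(2)]] by simp
  qed
  have Lz: "L x = \<zero>\<^bsub>?N\<^esub>" if x: "x \<in> BI" for x
  proof (rule genideal_linear_zero[OF int_is_cring M N Llin brels_closed _ x[unfolded BI_alt]])
    fix p q s assume p: "p \<in> carrier (gset_monoid K)" and q: "q \<in> carrier (gset_monoid K)" and s: "s \<in> brels"
    obtain P :: "('g, nat) gset" where P: "finite_gset K P" "p = gset_class K P" by (rule K.gset_monoid_carrierE[OF p])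
    obtain U :: "('g, nat) gset" where U: "finite_gset K U" "q = gset_class K U" by (rule K.gset_monoid_carrierE[OF q])
    obtain X Y :: "('g, nat) gset" where XY: "finite_gset K X" "finite_gset K Y"
      and s': "s = basis_vec \<Z> (gset_class K (gset_sum X Y)) \<ominus>\<^bsub>BF\<^esub> (basis_vec \<Z> (gset_class K X) \<oplus>\<^bsub>BF\<^esub> basis_vec \<Z> (gset_class K Y))"
      using s unfolding brels_def by blast
    note pc = bvec_closed[OF P(1)] and qc = bvec_closed[OF U(1)]
    have lin: "linear_on \<Z> BF ?N (\<lambda>s. L (basis_vec \<Z> p \<otimes>\<^bsub>BF\<^esub> s \<otimes>\<^bsub>BF\<^esub> basis_vec \<Z> q))"
      unfolding P(2) U(2)
      by (rule linear_on_comp[OF _ Llin], rule linear_onI)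
         (use pc qc in \<open>auto simp: F.l_distr F.r_distr F.smult_mult_l F.smult_mult_r\<close>)
    have val: "L (basis_vec \<Z> p \<otimes>\<^bsub>BF\<^esub> basis_vec \<Z> (gset_class K Z) \<otimes>\<^bsub>BF\<^esub> basis_vec \<Z> q) = h (gset_class K (gset_prod (gset_prod P Z) U))"
      if Z: "finite_gset K Z" for Z :: "('g, 'z) gset"
      unfolding P(2) U(2) 
        monoid_algebra_basis_mult[OF int_is_cring M K.gset_class_carrier[OF P(1)] K.gset_class_carrier[OF Z]]
        K.gset_monoid_mult[OF P(1) Z]
        monoid_algebra_basis_mult[OF int_is_cring M K.gset_class_carrier[OF K.finite_gset_prod[OF P(1) Z]] K.gset_class_carrier[OF U(1)]]
        K.gset_monoid_mult[OF K.finite_gset_prod[OF P(1) Z] U(1)]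
      by (rule Lb[OF K.gset_class_carrier[OF K.finite_gset_prod[OF K.finite_gset_prod[OF P(1) Z] U(1)]]])
    have valS: "L (basis_vec \<Z> p \<otimes>\<^bsub>BF\<^esub> basis_vec \<Z> (gset_class K (gset_sum X Y)) \<otimes>\<^bsub>BF\<^esub> basis_vec \<Z> q) = h (gset_class K (gset_prod (gset_prod P (gset_sum X Y)) U))"
      unfolding P(2) U(2) 
        monoid_algebra_basis_mult[OF int_is_cring M K.gset_class_carrier[OF P(1)] K.gset_class_carrier[OF K.finite_gset_sum[OF XY]]]
        K.gset_monoid_mult[OF P(1) K.finite_gset_sum[OF XY]]
        monoid_algebra_basis_mult[OF int_is_cring M K.gset_class_carrier[OF K.finite_gset_prod[OF P(1) K.finite_gset_sum[OF XY]]] K.gset_class_carrier[OF U(1)]]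
        K.gset_monoid_mult[OF K.finite_gset_prod[OF P(1) K.finite_gset_sum[OF XY]] U(1)]
      by (rule Lb[OF K.gset_class_carrier[OF K.finite_gset_prod[OF K.finite_gset_prod[OF P(1) K.finite_gset_sum[OF XY]] U(1)]]])
    have fP: "finite_gset K (gset_prod (gset_prod P X) U)" "finite_gset K (gset_prod (gset_prod P Y) U)"
      using K.finite_gset_prod[OF K.finite_gset_prod[OF P(1) XY(1)] U(1)] K.finite_gset_prod[OF K.finite_gset_prod[OF P(1) XY(2)] U(1)] by auto
    have "h (gset_class K (gset_prod (gset_prod P (gset_sum X Y)) U)) =
      h (gset_class K (gset_sum (gset_prod (gset_prod P X) U) (gset_prod (gset_prod P Y) U)))"
      using K.gset_class_cong[OF K.finite_gset_prod[OF K.finite_gset_prod[OF P(1) K.finite_gset_sum[OF XY]] U(1)]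
        K.gset_sum_prod_distrib[OF P(1) XY U(1)]] by simp
    also note hsum[OF fP]
    finally show "L (basis_vec \<Z> p \<otimes>\<^bsub>BF\<^esub> s \<otimes>\<^bsub>BF\<^esub> basis_vec \<Z> q) = \<zero>\<^bsub>?N\<^esub>"
      unfolding s' using linear_on_minus[OF F.module_axioms N lin bvec_closed[OF K.finite_gset_sum[OF XY]]
          F.a_closed[OF bvec_closed[OF XY(1)] bvec_closed[OF XY(2)]]]
        linear_onD(2)[OF lin bvec_closed[OF XY(1)] bvec_closed[OF XY(2)]] valS val[OF XY(1)] val[OF XY(2)]
      by (simp add: Nm hc)
  qed
  show ?thesis
  proof (rule F.quotient_linear[OF BI_ideal N Llin Lz])
    fix \<psi> assume \<psi>: "linear_on \<Z> BQ ?N \<psi>" and e: "\<And>x. x \<in> carrier BF \<Longrightarrow> \<psi> (BI +>\<^bsub>BF\<^esub> x) = L x"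
    show ?thesis
    proof (rule T.BC_functional[of \<psi>])
      show "\<psi> x \<in> carrier R" if "x \<in> carrier (burnside_ring K)" for x
        using linear_onD(1)[OF \<psi>, of x] that by (simp add: BR_simps)
      show "\<psi> (x \<oplus>\<^bsub>burnside_ring K\<^esub> y) = \<psi> x \<oplus>\<^bsub>R\<^esub> \<psi> y" if "x \<in> carrier (burnside_ring K)" "y \<in> carrier (burnside_ring K)" for x y
        using linear_onD(2)[OF \<psi>, of x y] that by (simp add: BR_simps)
      fix \<phi> assume \<phi>: "linear_on R T.BC (regular_module R) \<phi>"
        and \<phi>t: "\<And>r x. r \<in> carrier R \<Longrightarrow> x \<in> carrier (burnside_ring K) \<Longrightarrow> \<phi> (T.ten r x) = r \<otimes>\<^bsub>R\<^esub> \<psi> x"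
      have "\<phi> (T.ten \<one>\<^bsub>R\<^esub> (BI +>\<^bsub>BF\<^esub> basis_vec \<Z> c)) = h c" if c: "c \<in> carrier (gset_monoid K)" for c
      proof -
        note bc = monoid_algebra_basis_closed[OF int_is_cring M c]
        have "BI +>\<^bsub>BF\<^esub> basis_vec \<Z> c \<in> carrier (burnside_ring K)"
          unfolding BR_simps F.quotient_carrier by (rule imageI[OF bc])
        then show ?thesis using \<phi>t[OF R.one_closed] e[OF bc] Lb[OF c] hc by simp
      qed
      then show thesis using that[of \<phi>] \<phi> by (simp add: burnside_algebra_def)
    qed
  qed
qed

end

section \<open>Bases and stable linear forms of the Burnside algebras\<close>

context mackey_setup
begin

abbreviation "GH H \<equiv> G\<lparr>carrier := H\<rparr>"

abbreviation "BAH H \<equiv> burnside_algebra R (GH H)"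
abbreviation "bcls H \<equiv> burnside_class R (GH H)"

lemma burnside_setup: "subgroup H G \<Longrightarrow> burnside_setup R (GH H)"
  by (rule burnside_setup.intro[OF cring_R G.subgroup_imp_group])

text \<open>One construction with two uses: \<open>P = H\<close> and an indicator function give the
  coordinate functionals, \<open>P = carrier G\<close> gives the members of a family stable by
  induction.\<close>

definition burnside_form where
  "burnside_form P H f = (SOME \<phi>. linear_on R (BAH H) (regular_module R) \<phi> \<and>
    (\<forall>X :: ('g, nat) gset. finite_gset (GH H) X \<longrightarrow>
       \<phi> (bcls H X) = msum R f (orbit_types G P H X)))"

context
  fixes H P and f :: "'g set set \<Rightarrow> 'r"
  assumes H: "subgroup H G" and P: "subgroup P G" "H \<subseteq> P" and f: "\<And>c. f c \<in> carrier R"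
begin

interpretation S: burnside_setup R "GH H" by (rule burnside_setup[OF H])

lemma orbit_types_gset_iso:
  assumes X: "finite_gset (GH H) X" and Y: "finite_gset (GH H) Y" and i: "gset_iso (GH H) X Y"
  shows "orbit_types G P H X = orbit_types G P H Y"
  by (rule G.orbit_types_iso[OF H P G.sub_gset_acts[OF H X] G.sub_gset_acts[OF H Y] i])

lemma burnside_form_exists:
  "\<exists>\<phi>. linear_on R (BAH H) (regular_module R) \<phi> \<and>
    (\<forall>X :: ('g, nat) gset. finite_gset (GH H) X \<longrightarrow>
       \<phi> (bcls H X) = msum R f (orbit_types G P H X))"
proof -
  define h :: "('g, nat) gset set \<Rightarrow> 'r" where "h c = msum R f (orbit_types G P H (SOME X. X \<in> c))" for c
  have h: "h (gset_class (GH H) X) = msum R f (orbit_types G P H X)" if X: "finite_gset (GH H) X" for X :: "('g, 'x) gset"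
  proof -
    have m: "(SOME Y. Y \<in> gset_class (GH H) X) \<in> gset_class (GH H) X"
      using S.K.gset_class_nonempty[OF X] by (simp add: some_in_eq)
    show ?thesis unfolding h_def
      using orbit_types_gset_iso[OF X S.K.gset_class_memD(1)[OF X m] S.K.gset_class_memD(2)[OF X m]] by simp
  qed
  show ?thesis
  proof (rule S.burnside_functional[of h])
    show "h c \<in> carrier R" for c unfolding h_def by (rule R.msum_closed[of f, OF f])
    fix X Y :: "('g, nat) gset" assume X: "finite_gset (GH H) X" and Y: "finite_gset (GH H) Y"
    show "h (gset_class (GH H) (gset_sum X Y)) = h (gset_class (GH H) X) \<oplus>\<^bsub>R\<^esub> h (gset_class (GH H) Y)"
      unfolding h[OF X] h[OF Y] h[OF S.K.finite_gset_sum[OF X Y]]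
        G.orbit_types_sum[OF H P S.K.gset_finite[OF X] S.K.gset_finite[OF Y] G.sub_gset_acts[OF H X] G.sub_gset_acts[OF H Y]]
      by (rule R.msum_add[of f, OF f])
  next
    fix \<phi> assume \<phi>: "linear_on R (BAH H) (regular_module R) \<phi>"
      and v: "\<And>c. c \<in> carrier (gset_monoid (GH H)) \<Longrightarrow>
        \<phi> (S.T.ten \<one>\<^bsub>R\<^esub> (burnside_ideal (GH H) +>\<^bsub>burnside_free (GH H)\<^esub> basis_vec \<Z> c)) = h c"
    have "\<phi> (bcls H X) = msum R f (orbit_types G P H X)" if X: "finite_gset (GH H) X" for X :: "('g, nat) gset"
      unfolding S.cl_alt S.el_alt v[OF S.K.gset_class_carrier[OF X]] by (rule h[OF X])
    then show ?thesis using \<phi> by blast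
  qed
qed

lemma burnside_form_linear: "linear_on R (BAH H) (regular_module R) (burnside_form P H f)"
  using someI_ex[OF burnside_form_exists] unfolding burnside_form_def by blast

text \<open>The defining property covers sets on natural numbers; both sides are invariant under
  isomorphism, so it extends to sets of any type.\<close>

lemma burnside_form_class:
  assumes X: "finite_gset (GH H) X"
  shows "burnside_form P H f (bcls H X) = msum R f (orbit_types G P H X)"
proof -
  obtain Y :: "('g, nat) gset" where Y: "finite_gset (GH H) Y" "gset_iso (GH H) X Y" by (rule S.K.gset_nat_copy[OF X])
  have "burnside_form P H f (bcls H Y) = msum R f (orbit_types G P H Y)"
    using someI_ex[OF burnside_form_exists] Y(1) unfolding burnside_form_def by blast
  then show ?thesis unfolding S.cl_cong[OF X Y(2)] orbit_types_gset_iso[OF X Y] .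
qed

end

text \<open>Induction on the number of points: one orbit is split off, it is isomorphic to a coset
  space of the stabiliser of a point, and the rest is smaller.\<close>

lemma coset_span:
  fixes X :: "('g, 'c) gset"
  assumes H: "subgroup H G" and X: "finite_gset (GH H) X"
  shows "bcls H X \<in> rspan R (BAH H) ((\<lambda>L. bcls H (coset_gset G H L)) ` subs G H)"
  using X
proof (induction "card (fst X)" arbitrary: X rule: less_induct)
  case less
  interpret S: burnside_setup R "GH H" by (rule burnside_setup[OF H])
  let ?T = "(\<lambda>L. bcls H (coset_gset G H L)) ` subs G H"
  have T: "?T \<subseteq> carrier (BAH H)"
    using S.cl_closed[OF G.coset_gset_finite[OF H]] by (auto simp: subs_def)
  show ?case
  proof (cases "fst X = {}")
    case True
    show ?thesis unfolding S.cl_empty[OF less.prems True] by (rule rspan.zero)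
  next
    case False
    then obtain x where x: "x \<in> fst X" by blast
    note a = G.sub_gset_acts[OF H less.prems] and fin = S.K.gset_finite[OF less.prems]
    define O1 where "O1 = orb H (snd X) x"
    have sub: "O1 \<subseteq> fst X" unfolding O1_def by (rule G.orb_subset[OF a x])
    have xO: "x \<in> O1" unfolding O1_def by (rule G.orb_self[OF a x])
    have memO: "y \<in> O1 \<longleftrightarrow> orb H (snd X) x = orb H (snd X) y" if y: "y \<in> fst X" for y
      unfolding G.orb_eq_iff[OF a x y] unfolding O1_def orb_def by blast
    have inv: "orb H (snd X) (snd X g y) = orb H (snd X) y" if "g \<in> H" "y \<in> fst X" for g y
      using G.orb_eq_iff[OF a that(2) acts_closed[OF a that]] that(1) by blast
    have aO: "acts G H (snd X) O1"
    proof (rule G.acts_subset[OF a sub])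
      fix g y assume g: "g \<in> H" and y: "y \<in> O1"
      then have y': "y \<in> fst X" using sub by blast
      show "snd X g y \<in> O1" using memO[OF acts_closed[OF a g y']] memO[OF y'] y inv[OF g y'] by simp
    qed
    have aR: "acts G H (snd X) (fst X - O1)"
    proof (rule G.acts_subset[OF a Diff_subset])
      fix g y assume g: "g \<in> H" and y: "y \<in> fst X - O1"
      then have y': "y \<in> fst X" by blast
      show "snd X g y \<in> fst X - O1"
        using memO[OF acts_closed[OF a g y']] memO[OF y'] y inv[OF g y'] acts_closed[OF a g y'] by simp
    qed
    define XO XR where "XO = (O1, \<lambda>g. restrict (snd X g) O1)" and "XR = (fst X - O1, \<lambda>g. restrict (snd X g) (fst X - O1))"
    have fO: "finite_gset (GH H) XO" unfolding XO_def by (rule G.sub_finite_gsetI[OF H finite_subset[OF sub fin] aO])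
    have fR: "finite_gset (GH H) XR" unfolding XR_def by (rule G.sub_finite_gsetI[OF H finite_subset[OF Diff_subset fin] aR])
    have iso: "gset_iso (GH H) (gset_sum XO XR) X"
    proof (rule S.K.gset_isoI[of "case_sum (\<lambda>y. y) (\<lambda>y. y)"])
      show "bij_betw (case_sum (\<lambda>y. y) (\<lambda>y. y)) (fst (gset_sum XO XR)) (fst X)"
        unfolding bij_betw_def inj_on_def gset_sum_def XO_def XR_def Plus_def using sub by (auto simp: image_Un image_image)
    qed (auto simp: gset_sum_def XO_def XR_def)
    define L where "L = {h \<in> H. snd XO h x = x}"
    have aXO: "acts G H (snd XO) (fst XO)" by (rule G.sub_gset_acts[OF H fO])
    have xm: "x \<in> fst XO" unfolding XO_def using xO by simp
    have isoL: "gset_iso (GH H) XO (coset_gset G H L)"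
    proof (rule G.transitive_gset_iso[OF H aXO xm _ L_def])
      fix y assume "y \<in> fst XO"
      then show "\<exists>h\<in>H. y = snd XO h x" using xO unfolding XO_def O1_def orb_def by auto
    qed
    have L: "L \<in> subs G H" unfolding subs_def L_def using G.stab_subgroup[OF aXO xm] by blast
    have "card (fst XR) < card (fst X)" unfolding XR_def fst_conv by (rule psubset_card_mono[OF fin]) (use x xO in blast)
    then have r: "bcls H XR \<in> rspan R (BAH H) ?T" by (rule less.hyps[OF _ fR])
    have o: "bcls H XO \<in> rspan R (BAH H) ?T"
      unfolding S.cl_cong[OF fO isoL] by (rule rspan_base[OF S.A.module_axioms T imageI[OF L]])
    show ?thesis
      unfolding S.cl_cong[OF S.K.finite_gset_sum[OF fO fR] iso, symmetric] S.cl_sum[OF fO fR] by (rule rspan.add[OF o r])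
  qed
qed

lemma burnside_basis:
  assumes H: "subgroup H G"
  shows "class_basis R (BAH H) (subs G H) (\<lambda>L. bcls H (coset_gset G H L)) (subconj G H)"
proof -
  interpret S: burnside_setup R "GH H" by (rule burnside_setup[OF H])
  have Hc: "H \<subseteq> carrier G" by (rule subgroup.subset[OF H])
  have sub: "subgroup L G" "L \<subseteq> H" "L \<subseteq> carrier G" if "L \<in> subs G H" for L
    using that Hc by (auto simp: subs_def)
  have T: "(\<lambda>L. bcls H (coset_gset G H L)) ` subs G H \<subseteq> carrier (BAH H)"
    using S.cl_closed[OF G.coset_gset_finite[OF H]] by (auto simp: subs_def)
  have N: "S.cl ` S.nat_gsets \<subseteq> carrier (BAH H)" using S.cl_closed by blast
  show ?thesis
  proof (rule class_basis.intro[OF S.A.module_axioms class_basis_axioms.intro])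
    show "finite (subs G H)" by (rule finite_subs)
    show "bcls H (coset_gset G H j) \<in> carrier (BAH H)" if "j \<in> subs G H" for j
      using T that by blast
    show "bcls H (coset_gset G H i) = bcls H (coset_gset G H j)"
      if i: "i \<in> subs G H" and j: "j \<in> subs G H" and e: "subconj G H i = subconj G H j" for i j
    proof -
      obtain p where p: "p \<in> H" "j = conj_subgroup G p i" using e unfolding G.subconj_eq_iff[OF H sub(3)[OF i] sub(3)[OF j]] by blast
      show ?thesis unfolding p(2)
        by (rule S.cl_cong[OF G.coset_gset_finite[OF H sub(1)[OF i]] G.coset_gset_conj[OF H sub(1,2)[OF i] p(1)]])
    qed
    show "x \<in> rspan R (BAH H) ((\<lambda>L. bcls H (coset_gset G H L)) ` subs G H)"
      if x: "x \<in> carrier (BAH H)" for x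
    proof (rule linear_image_rspan[OF S.A.module_axioms S.A.module_axioms N T _ _ S.cl_span[OF x]])
      show "linear_on R (BAH H) (BAH H) (\<lambda>x. x)" by (rule linear_onI) simp_all
      fix s assume "s \<in> S.cl ` S.nat_gsets"
      then obtain X :: "('g, nat) gset" where X: "finite_gset (GH H) X" "s = S.cl X" by blast
      show "s \<in> rspan R (BAH H) ((\<lambda>L. bcls H (coset_gset G H L)) ` subs G H)"
        unfolding X(2) by (rule coset_span[OF H X(1)])
    qed
    show "\<exists>\<phi>. linear_on R (BAH H) (regular_module R) \<phi> \<and>
      (\<forall>j\<in>subs G H. \<phi> (bcls H (coset_gset G H j)) = (if subconj G H i = subconj G H j then \<one>\<^bsub>R\<^esub> else \<zero>\<^bsub>R\<^esub>))"
      for i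
    proof -
      \<comment> \<open>With this weight the form counts the orbits whose stabilisers are conjugate
        to i in H, the coordinate functional of H/i.\<close>
      define f where "f c = (if subconj G H i = c then \<one>\<^bsub>R\<^esub> else \<zero>\<^bsub>R\<^esub>)" for c
      have f: "f c \<in> carrier R" for c by (simp add: f_def)
      have v: "burnside_form H H f (bcls H (coset_gset G H j)) = f (subconj G H j)" if j: "j \<in> subs G H" for j
        unfolding burnside_form_class[OF H H subset_refl f G.coset_gset_finite[OF H sub(1)[OF j]]]
          G.orbit_types_coset[OF H H subset_refl sub(1,2)[OF j]]
        by (rule R.msum_single[of f, OF f])
      show ?thesis
        by (intro exI[of _ "burnside_form H H f"] conjI ballI, rule burnside_form_linear[OF H H subset_refl f])
           (simp only: v f_def)
    qed
  qed
qed

text \<open>The products of coset spaces decompose according to the table, so the Gram matrix of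
  \<phi> on the basis is the table of H evaluated by f; the criterion of \<open>class_basis\<close>
  then reads as the condition on tables.\<close>

lemma nondegenerate_iff_table:
  assumes H: "subgroup H G" and f: "\<And>c. f c \<in> carrier R"
    and \<phi>: "linear_on R (BAH H) (regular_module R) \<phi>"
    and \<phi>f: "\<And>L. L \<in> subs G H \<Longrightarrow> \<phi> (bcls H (coset_gset G H L)) = f (subconj G (carrier G) L)"
  shows "nondegenerate R (BAH H) (\<lambda>X Y. \<phi> (X \<otimes>\<^bsub>BAH H\<^esub> Y)) \<longleftrightarrow>
    (\<forall>A\<in>subs G H. \<exists>n\<in>subs G H \<rightarrow> carrier R. \<forall>C\<in>subs G H.
      (\<Oplus>\<^bsub>R\<^esub>B\<in>subs G H. n B \<otimes>\<^bsub>R\<^esub> msum R f (dtable G H C B)) =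
      (if \<exists>p\<in>H. C = conj_subgroup G p A then \<one>\<^bsub>R\<^esub> else \<zero>\<^bsub>R\<^esub>))"
proof -
  interpret S: burnside_setup R "GH H" by (rule burnside_setup[OF H])
  interpret E: class_basis R "BAH H" "subs G H" "\<lambda>L. bcls H (coset_gset G H L)" "subconj G H"
    by (rule burnside_basis[OF H])
  let ?e = "\<lambda>L. bcls H (coset_gset G H L)"
  let ?b = "\<lambda>X Y. \<phi> (X \<otimes>\<^bsub>BAH H\<^esub> Y)"
  have Hc: "H \<subseteq> carrier G" by (rule subgroup.subset[OF H])
  note G1 = G.subgroup_self
  have sub: "subgroup L G" "L \<subseteq> H" "L \<subseteq> carrier G" if "L \<in> subs G H" for L
    using that Hc by (auto simp: subs_def)
  \<comment> \<open>\<phi> is known on coset spaces only. As these span, it agrees with the form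
    that sums f over orbit types, and so its values on products of coset spaces are known as
    well.\<close>
  have eq: "\<phi> x = burnside_form (carrier G) H f x" if "x \<in> carrier (BAH H)" for x
  proof (rule E.linear_eqI[OF regular_module_module[OF cring_R] \<phi> burnside_form_linear[OF H G1 Hc f] _ that])
    fix L assume L: "L \<in> subs G H"
    show "\<phi> (?e L) = burnside_form (carrier G) H f (?e L)"
      unfolding \<phi>f[OF L] burnside_form_class[OF H G1 Hc f G.coset_gset_finite[OF H sub(1)[OF L]]]
        G.orbit_types_coset[OF H G1 Hc sub(1,2)[OF L]]
      by (rule R.msum_single[of f, OF f, symmetric])
  qed
  have val: "?b (?e B) (?e C) = msum R f (dtable G H B C)" if B: "B \<in> subs G H" and C: "C \<in> subs G H" for B C
  proof -
    note fB = G.coset_gset_finite[OF H sub(1)[OF B]] and fC = G.coset_gset_finite[OF H sub(1)[OF C]]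
    show ?thesis
      unfolding S.cl_prod[OF fB fC] eq[OF S.cl_closed[OF S.K.finite_gset_prod[OF fB fC]]]
        burnside_form_class[OF H G1 Hc f S.K.finite_gset_prod[OF fB fC]]
        G.orbit_types_product[OF H sub(1,2)[OF B] sub(1,2)[OF C]] ..
  qed
  have sym: "?b (?e B) (?e C) = ?b (?e C) (?e B)" if B: "B \<in> subs G H" and C: "C \<in> subs G H" for B C
    unfolding val[OF B C] val[OF C B] G.dtable_sym[OF H sub(1,2)[OF B] sub(1,2)[OF C]] ..
  have b1: "linear_on R (BAH H) (regular_module R) (?b x)" if x: "x \<in> carrier (BAH H)" for x
    by (rule linear_on_comp[OF _ \<phi>], rule linear_onI) (use x in \<open>simp_all add: S.A.r_distr S.A.smult_mult_r\<close>)
  have b2: "linear_on R (BAH H) (regular_module R) (\<lambda>x. ?b x y)" if y: "y \<in> carrier (BAH H)" for y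
    by (rule linear_on_comp[OF _ \<phi>], rule linear_onI) (use y in \<open>simp_all add: S.A.l_distr S.A.smult_mult_l\<close>)
  have tab: "(\<Oplus>\<^bsub>R\<^esub>B\<in>subs G H. n B \<otimes>\<^bsub>R\<^esub> ?b (?e B) (?e C)) = (\<Oplus>\<^bsub>R\<^esub>B\<in>subs G H. n B \<otimes>\<^bsub>R\<^esub> msum R f (dtable G H C B))"
    if n: "n \<in> subs G H \<rightarrow> carrier R" and C: "C \<in> subs G H" for n C
  proof (rule R.finsum_cong'[OF refl])
    show "(\<lambda>B. n B \<otimes>\<^bsub>R\<^esub> msum R f (dtable G H C B)) \<in> subs G H \<rightarrow> carrier R"
      using n R.msum_closed[of f, OF f] by auto
    show "n B \<otimes>\<^bsub>R\<^esub> ?b (?e B) (?e C) = n B \<otimes>\<^bsub>R\<^esub> msum R f (dtable G H C B)" if B: "B \<in> subs G H" for B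
      unfolding val[OF B C] G.dtable_sym[OF H sub(1,2)[OF B] sub(1,2)[OF C]] ..
  qed
  have nd: "nondegenerate R (BAH H) ?b \<longleftrightarrow> (\<forall>A\<in>subs G H. \<exists>n\<in>subs G H \<rightarrow> carrier R. \<forall>C\<in>subs G H.
     (\<Oplus>\<^bsub>R\<^esub>B\<in>subs G H. n B \<otimes>\<^bsub>R\<^esub> ?b (?e B) (?e C)) = (if subconj G H A = subconj G H C then \<one>\<^bsub>R\<^esub> else \<zero>\<^bsub>R\<^esub>))"
    by (rule E.nondegenerate_iff[OF b1 b2 sym])
  show ?thesis unfolding nd
  proof (rule ball_cong[OF refl], rule bex_cong[OF refl], rule ball_cong[OF refl])
    fix A n C assume A: "A \<in> subs G H" and n: "n \<in> subs G H \<rightarrow> carrier R" and C: "C \<in> subs G H"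
    show "(\<Oplus>\<^bsub>R\<^esub>B\<in>subs G H. n B \<otimes>\<^bsub>R\<^esub> ?b (?e B) (?e C)) = (if subconj G H A = subconj G H C then \<one>\<^bsub>R\<^esub> else \<zero>\<^bsub>R\<^esub>) \<longleftrightarrow>
      (\<Oplus>\<^bsub>R\<^esub>B\<in>subs G H. n B \<otimes>\<^bsub>R\<^esub> msum R f (dtable G H C B)) = (if \<exists>p\<in>H. C = conj_subgroup G p A then \<one>\<^bsub>R\<^esub> else \<zero>\<^bsub>R\<^esub>)"
      unfolding tab[OF n C] G.subconj_eq_iff[OF H sub(3)[OF A] sub(3)[OF C]] ..
  qed
qed

text \<open>Each form sums f over stabilisers taken up to conjugation in the whole of G. Induction
  preserves this multiset by \<open>orbit_types_ind\<close>, so the forms are stable for any f;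
  invertibility of the tables gives non-degeneracy.\<close>

lemma stable_family_if_invertible:
  assumes f: "\<And>c. f c \<in> carrier R" and inv: "invertible_tables R G f"
  shows "stable_symmetric_burnside_family R G"
proof -
  define \<phi> where "\<phi> H = restrict (burnside_form (carrier G) H f) (carrier (BAH H))" for H
  note G1 = G.subgroup_self
  show ?thesis unfolding stable_symmetric_burnside_family_def
  proof (intro exI[of _ \<phi>] conjI allI impI)
    fix H assume H: "subgroup H G"
    interpret S: burnside_setup R "GH H" by (rule burnside_setup[OF H])
    note Hc = subgroup.subset[OF H]
    note lin = burnside_form_linear[OF H G1 Hc f]
    have \<phi>l: "linear_on R (BAH H) (regular_module R) (\<phi> H)"
      unfolding \<phi>_def linear_on_restrict[OF S.A.module_axioms] by (rule lin)
    then show "\<phi> H \<in> linear_maps R (BAH H) (regular_module R)"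
      unfolding linear_maps_iff by (simp add: \<phi>_def)
    have v: "\<phi> H (bcls H (coset_gset G H L)) = f (subconj G (carrier G) L)" if "L \<in> subs G H" for L
    proof -
      have L: "subgroup L G" "L \<subseteq> H" using that by (auto simp: subs_def)
      note fL = G.coset_gset_finite[OF H L(1)]
      show ?thesis using S.cl_closed[OF fL] burnside_form_class[OF H G1 Hc f fL] G.orbit_types_coset[OF H G1 Hc L]
        R.msum_single[of f, OF f] by (simp add: \<phi>_def)
    qed
    show "nondegenerate R (BAH H) (\<lambda>X Y. \<phi> H (X \<otimes>\<^bsub>BAH H\<^esub> Y))"
      by (rule iffD2[OF nondegenerate_iff_table[of H f "\<phi> H", OF H f \<phi>l v]
        inv[unfolded invertible_tables_def, THEN spec, THEN mp, OF H]])
  next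
    show "stable_by_induction R G \<phi>" unfolding stable_by_induction_def
    proof (intro allI impI)
      fix H and X :: "('g, nat) gset" assume H: "subgroup H G" and X: "finite_gset (GH H) X"
      interpret S: burnside_setup R "GH H" by (rule burnside_setup[OF H])
      interpret SG: burnside_setup R "GH (carrier G)" by (rule burnside_setup[OF G1])
      have fI: "finite_gset (GH (carrier G)) (ind_gset G H X)" using G.ind_gset_finite[OF H X] by simp
      have "\<phi> (carrier G) (bcls (carrier G) (ind_gset G H X)) = \<phi> H (bcls H X)"
        using SG.cl_closed[OF fI] S.cl_closed[OF X] burnside_form_class[OF G1 G1 subset_refl f fI]
          burnside_form_class[OF H G1 subgroup.subset[OF H] f X] G.orbit_types_ind[OF H X]
        unfolding \<phi>_def by simp
      then show "\<phi> (carrier G) (burnside_class R G (ind_gset G H X)) = \<phi> H (bcls H X)" by simp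
    qed
  qed
qed

text \<open>Since inducing H/L gives G/L, stability forces the form of H to take on H/L the value
  that the form of G takes on G/L. That value depends only on the conjugacy class of L in G and
  defines f.\<close>

lemma invertible_if_stable_family:
  assumes "stable_symmetric_burnside_family R G"
  shows "\<exists>f. (\<forall>c. f c \<in> carrier R) \<and> invertible_tables R G f"
proof -
  obtain \<phi> where \<phi>: "\<And>H. subgroup H G \<Longrightarrow> \<phi> H \<in> linear_maps R (BAH H) (regular_module R)"
    and st: "stable_by_induction R G \<phi>"
    and nd: "\<And>H. subgroup H G \<Longrightarrow> nondegenerate R (BAH H) (\<lambda>X Y. \<phi> H (X \<otimes>\<^bsub>BAH H\<^esub> Y))"
    using assms unfolding stable_symmetric_burnside_family_def by blast
  note G1 = G.subgroup_self
  interpret SG: burnside_setup R "GH (carrier G)" by (rule burnside_setup[OF G1])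
  have lin: "linear_on R (BAH H) (regular_module R) (\<phi> H)" if "subgroup H G" for H
    using \<phi>[OF that] unfolding linear_maps_iff by blast
  define v where "v A = \<phi> (carrier G) (burnside_class R G (coset_gset G (carrier G) A))" for A
  have vc: "v A \<in> carrier R" if "subgroup A G" for A
    using linear_onD(1)[OF lin[OF G1] SG.cl_closed[OF G.coset_gset_finite[OF G1 that]]] by (simp add: v_def)
  have vcong: "v A = v B" if A: "subgroup A G" and B: "subgroup B G" and e: "subconj G (carrier G) A = subconj G (carrier G) B" for A B
  proof -
    note Ac = subgroup.subset[OF A] and Bc = subgroup.subset[OF B]
    obtain p where p: "p \<in> carrier G" "B = conj_subgroup G p A" using e unfolding G.subconj_eq_iff[OF G1 Ac Bc] by blast
    have "bcls (carrier G) (coset_gset G (carrier G) A) = bcls (carrier G) (coset_gset G (carrier G) B)"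
      unfolding p(2) by (rule SG.cl_cong[OF G.coset_gset_finite[OF G1 A] G.coset_gset_conj[OF G1 A Ac p(1)]])
    then show ?thesis by (simp add: v_def)
  qed
  define f where "f c = (if \<exists>A. subgroup A G \<and> subconj G (carrier G) A = c
    then v (SOME A. subgroup A G \<and> subconj G (carrier G) A = c) else \<zero>\<^bsub>R\<^esub>)" for c
  have fv: "f (subconj G (carrier G) A) = v A" if A: "subgroup A G" for A
  proof -
    have "\<exists>A'. subgroup A' G \<and> subconj G (carrier G) A' = subconj G (carrier G) A" using A by blast
    then show ?thesis unfolding f_def using someI_ex[of "\<lambda>A'. subgroup A' G \<and> subconj G (carrier G) A' = subconj G (carrier G) A"] vcong[OF _ A] by simp
  qed
  have fc: "f c \<in> carrier R" for c
    unfolding f_def using vc someI_ex[of "\<lambda>A. subgroup A G \<and> subconj G (carrier G) A = c"] by simp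
  have val: "\<phi> H (bcls H (coset_gset G H L)) = f (subconj G (carrier G) L)" if H: "subgroup H G" and "L \<in> subs G H" for H L
  proof -
    have L: "subgroup L G" "L \<subseteq> H" using that(2) by (auto simp: subs_def)
    interpret S: burnside_setup R "GH H" by (rule burnside_setup[OF H])
    note fL = G.coset_gset_finite[OF H L(1)]
    let ?C = "coset_gset G H L"
    \<comment> \<open>\<open>stable_by_induction\<close> speaks of sets on natural numbers, so H/L
      is replaced by a copy there; a base point with stabiliser L is carried along to identify the
      induced set.\<close>
    obtain X :: "('g, nat) gset" where X: "finite_gset (GH H) X" "gset_iso (GH H) ?C X" by (rule S.K.gset_nat_copy[OF fL])
    obtain F where F: "bij_betw F (fst ?C) (fst X)" "\<And>g x. g \<in> H \<Longrightarrow> x \<in> fst ?C \<Longrightarrow> F (snd ?C g x) = snd X g (F x)"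
      using X(2) unfolding gset_iso_def by auto
    have Lm: "L \<in> fst ?C" using G.kids_self_mem[OF L] by (simp add: coset_gset_def)
    note aC = G.coset_gset_acts[OF H L(1)]
    have x: "F L \<in> fst X" by (rule bij_betwE[OF F(1), rule_format, OF Lm])
    have tr: "\<exists>h\<in>H. y = snd X h (F L)" if y: "y \<in> fst X" for y
    proof -
      obtain z where z: "z \<in> fst ?C" "y = F z" using y bij_betw_imp_surj_on[OF F(1)] by blast
      obtain h where h: "h \<in> H" "z = snd ?C h L" using G.coset_gset_transitive[OF H L z(1)] by blast
      show ?thesis using F(2)[OF h(1) Lm] h z(2) by blast
    qed
    have "snd X h (F L) = F L \<longleftrightarrow> snd ?C h L = L" if h: "h \<in> H" for h
      unfolding F(2)[OF h Lm, symmetric]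
      by (rule inj_on_eq_iff[OF bij_betw_imp_inj_on[OF F(1)] acts_closed[OF aC h Lm] Lm])
    then have "{h \<in> H. snd ?C h L = L} = {h \<in> H. snd X h (F L) = F L}" by blast
    then have Lst: "L = {h \<in> H. snd X h (F L) = F L}" by (rule trans[OF G.coset_gset_stab[OF H L]])
    have "\<phi> H (bcls H ?C) = \<phi> H (bcls H X)" using S.cl_cong[OF fL X(2)] by simp
    also have "\<dots> = \<phi> (carrier G) (burnside_class R G (ind_gset G H X))"
      using st H X(1) unfolding stable_by_induction_def by metis
    also have "burnside_class R G (ind_gset G H X) = burnside_class R G (coset_gset G (carrier G) L)"
      using SG.cl_cong[of "ind_gset G H X" "coset_gset G (carrier G) L"] G.ind_gset_finite[OF H X(1)]
        G.ind_transitive_iso[OF H X(1) x tr Lst] by simp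
    finally show ?thesis using fv[OF L(1)] by (simp add: v_def)
  qed
  have "invertible_tables R G f" unfolding invertible_tables_def
  proof (intro allI impI)
    fix P assume P: "subgroup P G"
    show "\<forall>A\<in>subs G P. \<exists>n\<in>subs G P \<rightarrow> carrier R. \<forall>C\<in>subs G P.
      (\<Oplus>\<^bsub>R\<^esub>B\<in>subs G P. n B \<otimes>\<^bsub>R\<^esub> msum R f (dtable G P C B)) =
      (if \<exists>p\<in>P. C = conj_subgroup G p A then \<one>\<^bsub>R\<^esub> else \<zero>\<^bsub>R\<^esub>)"
      by (rule iffD1[OF nondegenerate_iff_table[of P f "\<phi> P", OF P fc lin[OF P] val[OF P]] nd[OF P]])
  qed
  then show ?thesis using fc by blast
qed

end

theorem theoremB:
  fixes R :: "('r, 'k) ring_scheme" and G :: "('g, 'l) monoid_scheme"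
  assumes "cring R" and "group G" and "finite (carrier G)"
  shows "symmetric_algebra R (mackey_algebra R G) \<longleftrightarrow> stable_symmetric_burnside_family R G"
proof -
  interpret mackey_setup R G
    using assms by (intro mackey_setup.intro fin_group.intro fin_group_axioms.intro)
  show ?thesis
    using symmetric_if_invertible invertible_if_symmetric stable_family_if_invertible invertible_if_stable_family
    by metis
qed

end
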